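(* Let $k$ be an algebraically closed field, let $n\ge 3$ be an integer, and let the multiplicative group $\mathbb{G}_m$ over $k$ act on $\mathbf{P}^n_k$ by $$t\cdot[a_0:a_1:\cdots:a_n]=[a_0:ta_1:\cdots:ta_n].$$ If $\mathcal{E}$ is a $\mathbb{G}_m$-equivariant vector bundle of rank $2$ on $\mathbf{P}^n_k$ (with respect to this action), then $\mathcal{E}$ splits as a direct sum of line bundles, i.e. there are line bundles $\mathcal{L}_1,\mathcal{L}_2$ on $\mathbf{P}^n_k$ with $\mathcal{E}\cong\mathcal{L}_1\oplus\mathcal{L}_2$ as vector bundles on $\mathbf{P}^n_k$.
   Context: A $\mathbb{G}_m$-equivariant vector bundle on $\mathbf{P}^n_k$ (for a given algebraic action of $\mathbb{G}_m$ on $\mathbf{P}^n_k$) is a vector bundle $\mathcal{E}$ whose total space $\mathbb{E}$ is equipped with an algebraic $\mathbb{G}_m$-action that is compatible with the action on $\mathbf{P}^n_k$: the projection $\mathbb{E}\to\mathbf{P}^n_k$ is $\mathbb{G}_m$-equivariant, and the action is linear on fibers (i.e. $\mathcal{E}$ is equipped with a $\mathbb{G}_m$-linearization in the usual sense). *)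

theory Defs
  imports "HOL-Computational_Algebra.Polynomial" "HOL-Library.Poly_Mapping"
begin

text \<open>
  The ground field is algebraically closed, so varieties are treated classically, through their
  sets of closed points: a morphism is a map that is given locally by regular functions.
  Vectors are functions on the natural numbers that vanish outside the relevant index range.
\<close>

section \<open>The varieties $\mathbf{P}^n \times \mathbf{A}^m$ and their regular functions\<close>

definition affine_space :: "nat \<Rightarrow> (nat \<Rightarrow> 'k::field) set" where
  "affine_space m = {v. \<forall>i\<ge>m. v i = 0}"

definition homog_coords :: "nat \<Rightarrow> (nat \<Rightarrow> 'k::field) set" where
  "homog_coords n = affine_space (Suc n) - {\<lambda>_. 0}"

text \<open>The point $[a_0 : \dots : a_n]$ is the set of all its homogeneous coordinate vectors.\<close>

definition proj_point :: "(nat \<Rightarrow> 'k::field) \<Rightarrow> (nat \<Rightarrow> 'k) set" where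
  "proj_point a = {\<lambda>i. c * a i |c. c \<noteq> 0}"

definition proj_space :: "nat \<Rightarrow> (nat \<Rightarrow> 'k::field) set set" where
  "proj_space n = proj_point ` homog_coords n"

text \<open>
  Polynomials in homogeneous coordinates (variables \<open>Inl i\<close>) and affine coordinates
  (variables \<open>Inr j\<close>).
\<close>

type_synonym 'k mpol = "((nat + nat) \<Rightarrow>\<^sub>0 nat) \<Rightarrow>\<^sub>0 'k"

definition mpol_eval :: "'k::field mpol \<Rightarrow> (nat \<Rightarrow> 'k) \<Rightarrow> (nat \<Rightarrow> 'k) \<Rightarrow> 'k" where
  "mpol_eval p a v =
     (\<Sum>m\<in>Poly_Mapping.keys p. Poly_Mapping.lookup p m *
        (\<Prod>x\<in>Poly_Mapping.keys m. case_sum a v x ^ Poly_Mapping.lookup m x))"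

text \<open>Homogeneous of degree \<open>d\<close> in the projective variables, arbitrary in the affine ones.\<close>

definition homog_mpols :: "nat \<Rightarrow> nat \<Rightarrow> nat \<Rightarrow> 'k::field mpol set" where
  "homog_mpols n m d =
     {p. \<forall>mon\<in>Poly_Mapping.keys p.
           Poly_Mapping.keys mon \<subseteq> Inl ` {..n} \<union> Inr ` {..<m} \<and>
           (\<Sum>i\<le>n. Poly_Mapping.lookup mon (Inl i)) = d}"

definition zariski_open ::
    "nat \<Rightarrow> nat \<Rightarrow> ((nat \<Rightarrow> 'k::field) set \<times> (nat \<Rightarrow> 'k)) set \<Rightarrow> bool" where
  "zariski_open n m W \<longleftrightarrow>
     (\<exists>S \<subseteq> (\<Union>d. homog_mpols n m d).
        W = {(proj_point a, v) |a v. a \<in> homog_coords n \<and> v \<in> affine_space m \<and>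
               (\<exists>p\<in>S. mpol_eval p a v \<noteq> 0)})"

text \<open>
  Any set on which some function is regular in this sense is automatically open.
\<close>

definition regular_on ::
    "nat \<Rightarrow> nat \<Rightarrow> ((nat \<Rightarrow> 'k::field) set \<times> (nat \<Rightarrow> 'k)) set \<Rightarrow>
     ((nat \<Rightarrow> 'k) set \<times> (nat \<Rightarrow> 'k) \<Rightarrow> 'k) \<Rightarrow> bool" where
  "regular_on n m W f \<longleftrightarrow>
     (\<forall>w\<in>W. \<exists>W' d F G. zariski_open n m W' \<and> w \<in> W' \<and> W' \<subseteq> W \<and>
        F \<in> homog_mpols n m d \<and> G \<in> homog_mpols n m d \<and>
        (\<forall>a\<in>homog_coords n. \<forall>v. (proj_point a, v) \<in> W' \<longrightarrow>
           mpol_eval G a v \<noteq> 0 \<and> f (proj_point a, v) = mpol_eval F a v / mpol_eval G a v))"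

definition proj_open :: "nat \<Rightarrow> (nat \<Rightarrow> 'k::field) set set \<Rightarrow> bool" where
  "proj_open n U \<longleftrightarrow> zariski_open n 0 (U \<times> affine_space 0)"


section \<open>Vector bundles on projective space\<close>

text \<open>
  A bundle is given by its total space, projection, fibrewise vector space operations and an atlas.
  A chart \<open>(U, \<phi>)\<close> stands for the trivialisation $e \mapsto (\pi(e), \varphi(e))$ of the bundle over
  \<open>U\<close>, with values in $U \times \mathbf{A}^r$; the atlas determines the structure of variety on the
  total space.
\<close>

record ('e, 'k) vbundle =
  total_space :: "'e set"
  bproj :: "'e \<Rightarrow> (nat \<Rightarrow> 'k) set"
  fadd :: "'e \<Rightarrow> 'e \<Rightarrow> 'e"
  fscale :: "'k \<Rightarrow> 'e \<Rightarrow> 'e"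
  charts :: "((nat \<Rightarrow> 'k) set set \<times> ('e \<Rightarrow> nat \<Rightarrow> 'k)) set"

definition fibre :: "('e, 'k) vbundle \<Rightarrow> (nat \<Rightarrow> 'k) set \<Rightarrow> 'e set" where
  "fibre E x = {e \<in> total_space E. bproj E e = x}"

text \<open>
  The vector space axioms for the fibres need not be listed: they are transported from
  $k^r$ along any chart.
\<close>

definition local_trivialisation ::
    "nat \<Rightarrow> nat \<Rightarrow> ('e, 'k::field) vbundle \<Rightarrow> (nat \<Rightarrow> 'k) set set \<Rightarrow> ('e \<Rightarrow> nat \<Rightarrow> 'k) \<Rightarrow> bool" where
  "local_trivialisation n r E U \<phi> \<longleftrightarrow>
     proj_open n U \<and>
     (\<forall>x\<in>U. bij_betw \<phi> (fibre E x) (affine_space r) \<and>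
        (\<forall>d\<in>fibre E x. \<forall>e\<in>fibre E x. \<phi> (fadd E d e) = (\<lambda>i. \<phi> d i + \<phi> e i)) \<and>
        (\<forall>c. \<forall>e\<in>fibre E x. \<phi> (fscale E c e) = (\<lambda>i. c * \<phi> e i)))"

definition chart_inv ::
    "('e, 'k) vbundle \<Rightarrow> ('e \<Rightarrow> nat \<Rightarrow> 'k) \<Rightarrow> (nat \<Rightarrow> 'k) set \<Rightarrow> (nat \<Rightarrow> 'k) \<Rightarrow> 'e" where
  "chart_inv E \<phi> x v = inv_into (fibre E x) \<phi> v"

definition vector_bundle :: "nat \<Rightarrow> nat \<Rightarrow> ('e, 'k::field) vbundle \<Rightarrow> bool" where
  "vector_bundle n r E \<longleftrightarrow>
     bproj E ` total_space E \<subseteq> proj_space n \<and>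
     (\<forall>x\<in>proj_space n. \<forall>d\<in>fibre E x. \<forall>e\<in>fibre E x. fadd E d e \<in> fibre E x) \<and>
     (\<forall>x\<in>proj_space n. \<forall>c. \<forall>e\<in>fibre E x. fscale E c e \<in> fibre E x) \<and>
     (\<Union>(U, \<phi>)\<in>charts E. U) = proj_space n \<and>
     (\<forall>(U, \<phi>)\<in>charts E. local_trivialisation n r E U \<phi>) \<and>
     (\<forall>(U, \<phi>)\<in>charts E. \<forall>(V, \<psi>)\<in>charts E. \<forall>i<r.
        regular_on n r ((U \<inter> V) \<times> affine_space r) (\<lambda>(x, v). \<psi> (chart_inv E \<phi> x v) i))"

abbreviation line_bundle :: "nat \<Rightarrow> ('e, 'k::field) vbundle \<Rightarrow> bool" where
  "line_bundle n L \<equiv> vector_bundle n 1 L"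

text \<open>Morphisms over $\mathbf{P}^n$ from a bundle of rank \<open>r\<close> to a bundle of rank \<open>s\<close>.\<close>

definition bundle_hom ::
    "nat \<Rightarrow> nat \<Rightarrow> nat \<Rightarrow> ('e, 'k::field) vbundle \<Rightarrow> ('f, 'k) vbundle \<Rightarrow> ('e \<Rightarrow> 'f) \<Rightarrow> bool" where
  "bundle_hom n r s E F h \<longleftrightarrow>
     (\<forall>x\<in>proj_space n.
        h ` fibre E x \<subseteq> fibre F x \<and>
        (\<forall>d\<in>fibre E x. \<forall>e\<in>fibre E x. h (fadd E d e) = fadd F (h d) (h e)) \<and>
        (\<forall>c. \<forall>e\<in>fibre E x. h (fscale E c e) = fscale F c (h e))) \<and>
     (\<forall>(U, \<phi>)\<in>charts E. \<forall>(V, \<psi>)\<in>charts F. \<forall>i<s.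
        regular_on n r ((U \<inter> V) \<times> affine_space r) (\<lambda>(x, v). \<psi> (h (chart_inv E \<phi> x v)) i))"

definition bundle_isomorphic ::
    "nat \<Rightarrow> nat \<Rightarrow> ('e, 'k::field) vbundle \<Rightarrow> ('f, 'k) vbundle \<Rightarrow> bool" where
  "bundle_isomorphic n r E F \<longleftrightarrow>
     (\<exists>h g. bundle_hom n r r E F h \<and> bundle_hom n r r F E g \<and>
        (\<forall>e\<in>total_space E. g (h e) = e) \<and> (\<forall>e\<in>total_space F. h (g e) = e))"

text \<open>The direct sum of a bundle of rank \<open>r\<close> with another bundle.\<close>

definition direct_sum ::
    "nat \<Rightarrow> ('e, 'k) vbundle \<Rightarrow> ('f, 'k) vbundle \<Rightarrow> ('e \<times> 'f, 'k) vbundle" where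
  "direct_sum r E F =
     \<lparr> total_space = {(d, e). d \<in> total_space E \<and> e \<in> total_space F \<and> bproj E d = bproj F e},
       bproj = (\<lambda>(d, e). bproj E d),
       fadd = (\<lambda>(d, e) (d', e'). (fadd E d d', fadd F e e')),
       fscale = (\<lambda>c (d, e). (fscale E c d, fscale F c e)),
       charts = {(U \<inter> V, \<lambda>(d, e) i. if i < r then \<phi> d i else \<psi> e (i - r)) |U \<phi> V \<psi>.
                   (U, \<phi>) \<in> charts E \<and> (V, \<psi>) \<in> charts F} \<rparr>"


section \<open>The action of the multiplicative group and equivariant bundles\<close>

definition gm_act :: "'k::field \<Rightarrow> (nat \<Rightarrow> 'k) set \<Rightarrow> (nat \<Rightarrow> 'k) set" where
  "gm_act t x = (\<lambda>a i. if i = 0 then a i else t * a i) ` x"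

lemma gm_act_proj_point:
  "gm_act t (proj_point a) = proj_point (\<lambda>i. if i = 0 then a i else t * a i)"
  unfolding gm_act_def proj_point_def image_def by (auto simp: fun_eq_iff algebra_simps)

text \<open>
  A linearisation is an algebraic action of the group on the total space that covers the action on
  $\mathbf{P}^n$ and is linear on the fibres. Algebraicity is that of the map
  $\mathbf{G}_m \times E \to E$, expressed in charts \<open>(U, \<phi>)\<close> of the source and \<open>(V, \<psi>)\<close> of the target:
  the open set of all $(t, x, v)$ in $\mathbf{G}_m \times U \times \mathbf{A}^r$ with $t \cdot x \in V$ is
  regarded as a subset of $\mathbf{P}^n \times \mathbf{A}^{r+1}$, with \<open>t\<close> as affine coordinate \<open>0\<close>.
  The component of the map in $\mathbf{P}^n$ is the given action there, so only the component in
  $\mathbf{A}^r$ is constrained.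
\<close>

definition gm_linearisation ::
    "nat \<Rightarrow> nat \<Rightarrow> ('e, 'k::field) vbundle \<Rightarrow> ('k \<Rightarrow> 'e \<Rightarrow> 'e) \<Rightarrow> bool" where
  "gm_linearisation n r E \<sigma> \<longleftrightarrow>
     (\<forall>e\<in>total_space E. \<sigma> 1 e = e) \<and>
     (\<forall>s t. s \<noteq> 0 \<longrightarrow> t \<noteq> 0 \<longrightarrow> (\<forall>e\<in>total_space E. \<sigma> (s * t) e = \<sigma> s (\<sigma> t e))) \<and>
     (\<forall>t. t \<noteq> 0 \<longrightarrow> (\<forall>x\<in>proj_space n.
        \<sigma> t ` fibre E x \<subseteq> fibre E (gm_act t x) \<and>
        (\<forall>d\<in>fibre E x. \<forall>e\<in>fibre E x. \<sigma> t (fadd E d e) = fadd E (\<sigma> t d) (\<sigma> t e)) \<and>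
        (\<forall>c. \<forall>e\<in>fibre E x. \<sigma> t (fscale E c e) = fscale E c (\<sigma> t e)))) \<and>
     (\<forall>(U, \<phi>)\<in>charts E. \<forall>(V, \<psi>)\<in>charts E. \<forall>i<r.
        regular_on n (Suc r)
          {(x, case_nat t v) |x t v. t \<noteq> 0 \<and> x \<in> U \<and> gm_act t x \<in> V \<and> v \<in> affine_space r}
          (\<lambda>(x, w). \<psi> (\<sigma> (w 0) (chart_inv E \<phi> x (\<lambda>j. w (Suc j)))) i))"

end

theory Submission
  imports Defs "HOL-Computational_Algebra.Polynomial_FPS"
    "Berlekamp_Zassenhaus.Unique_Factorization_Poly" "Subresultants.Subresultant_Gcd"
begin

text \<open>
  Work with sections over the affine cone. The action contracts the affine space \<open>a\<^sub>0 \<noteq> 0\<close> to a fixed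
  point, and its inverse contracts the complement of that point to the fixed hyperplane \<open>a\<^sub>0 = 0\<close>. The
  coefficients of Laurent expansions along orbits are semi-invariant sections, and they give a
  semi-invariant frame \<open>e\<^sub>1, e\<^sub>2\<close> on the affine space and local semi-invariant frames along the hyperplane,
  the latter with weights \<open>b\<^sub>1 \<ge> b\<^sub>2\<close> that do not depend on the point. If \<open>b\<^sub>1 = b\<^sub>2\<close>, then suitable
  powers of \<open>a\<^sub>0\<close> times \<open>e\<^sub>1\<close> and \<open>e\<^sub>2\<close> extend to a frame along the hyperplane. If \<open>b\<^sub>1 > b\<^sub>2\<close>, then the
  sections of weight \<open>b\<^sub>2\<close> span a well-defined line, whose direction with respect to \<open>e\<^sub>1, e\<^sub>2\<close> is a
  map from the hyperplane to the projective line, up to a twist. As the hyperplane has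
  dimension at least \<open>2\<close>, the map misses \<open>e\<^sub>1\<close> or \<open>e\<^sub>2\<close> (otherwise two forms in three variables would have no
  common zero), hence is given by a polynomial, and after adding a multiple of one of \<open>e\<^sub>1, e\<^sub>2\<close>
  to the other the two sections span complementary line subbundles everywhere.
\<close>

hide_const (open) module.smult

text \<open>What makes the frames rigid is the limit point of an orbit: a regular function on an
  orbit with its limit that scales by a negative power of the parameter is zero. If b1 > b2, this
  kills the \<open>f1\<close>-component of every other second frame section along the hyperplane, so
  the line spanned by \<open>f2\<close> is canonical, whereas \<open>f1\<close> can be changed by
  multiples of \<open>f2\<close>. A complement therefore has to come from the frame on the affine
  space.

  A coefficient on the affine space is continued across the hyperplane by removing its power of a_0.
  For equal weights one power serves both components of a section; for unequal weights it does not,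
  and this is the obstacle behind the second case.

  The dimension enters where the hyperplane must contain three independent vectors. With n = 2 the
  argument has to fail: the tangent bundle of the projective plane is equivariant and does not
  split. That the direction map is a polynomial and not merely a rational function is extension
  across the vertex of the cone over the hyperplane.\<close>

lemma infinite_UNIV_alg_closed: "infinite (UNIV :: 'k::alg_closed_field set)"
proof
  assume fin: "finite (UNIV :: 'k set)"
  define p :: "'k poly" where "p = (\<Prod>a\<in>UNIV. [:-a, 1:]) + 1"
  have "degree (\<Prod>a\<in>(UNIV::'k set). [:-a, 1:]) = card (UNIV :: 'k set)"
    by (subst degree_prod_eq_sum_degree) auto
  moreover have "card (UNIV :: 'k set) > 0" using fin by (simp add: card_gt_0_iff)
  ultimately have "degree p > 0" unfolding p_def by (subst degree_add_eq_left) auto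
  then obtain x where x: "poly p x = 0" using alg_closed_imp_poly_has_root by blast
  have "poly (\<Prod>a\<in>(UNIV::'k set). [:-a, 1:]) x = 0"
    using fin by (auto simp: poly_prod)
  with x show False by (simp add: p_def)
qed

lemma poly_nonzero_ex:
  fixes p :: "'k::alg_closed_field poly"
  assumes "p \<noteq> 0" "finite B"
  shows "\<exists>x. x \<notin> B \<and> poly p x \<noteq> 0"
proof -
  have "finite (B \<union> {x. poly p x = 0})" using assms poly_roots_finite by blast
  then obtain x where "x \<notin> B \<union> {x. poly p x = 0}"
    using infinite_UNIV_alg_closed ex_new_if_finite by blast
  then show ?thesis by auto
qed

lemma poly_eqI_cofinite:
  fixes p q :: "'k::alg_closed_field poly"
  assumes "finite B" "\<And>x. x \<notin> B \<Longrightarrow> poly p x = poly q x"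
  shows "p = q"
proof (rule ccontr)
  assume "p \<noteq> q"
  then obtain x where "x \<notin> B" "poly (p - q) x \<noteq> 0" using poly_nonzero_ex[of "p - q" B] assms(1) by auto
  with assms(2) show False by simp
qed

section \<open>Polynomial functions\<close>

text \<open>Generating polynomial functions by rules makes substitution a composition and every
  closure property an induction. The index type stays free: vectors, pairs over
  \<open>nat + nat\<close>, and vectors with an extra parameter over \<open>nat option\<close> all
  occur.\<close>

inductive_set polyfun :: "(('i \<Rightarrow> 'k::comm_ring_1) \<Rightarrow> 'k) set" where
  const: "(\<lambda>_. c) \<in> polyfun"
| coord: "(\<lambda>x. x i) \<in> polyfun"
| add: "f \<in> polyfun \<Longrightarrow> g \<in> polyfun \<Longrightarrow> (\<lambda>x. f x + g x) \<in> polyfun"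
| mult: "f \<in> polyfun \<Longrightarrow> g \<in> polyfun \<Longrightarrow> (\<lambda>x. f x * g x) \<in> polyfun"

lemma polyfun_uminus: "f \<in> polyfun \<Longrightarrow> (\<lambda>x. - f x) \<in> polyfun"
  using polyfun.mult[OF polyfun.const[of "-1"], of f] by simp

lemma polyfun_diff: "f \<in> polyfun \<Longrightarrow> g \<in> polyfun \<Longrightarrow> (\<lambda>x. f x - g x) \<in> polyfun"
  using polyfun.add[OF _ polyfun_uminus, of f g] by simp

lemma polyfun_power: "f \<in> polyfun \<Longrightarrow> (\<lambda>x. f x ^ m) \<in> polyfun"
  by (induction m) (auto intro: polyfun.intros)

lemma polyfun_sum: "(\<And>i. i \<in> I \<Longrightarrow> f i \<in> polyfun) \<Longrightarrow> (\<lambda>x. \<Sum>i\<in>I. f i x) \<in> polyfun"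
  by (induction I rule: infinite_finite_induct) (auto intro: polyfun.intros)

lemma polyfun_prod: "(\<And>i. i \<in> I \<Longrightarrow> f i \<in> polyfun) \<Longrightarrow> (\<lambda>x. \<Prod>i\<in>I. f i x) \<in> polyfun"
  by (induction I rule: infinite_finite_induct) (auto intro: polyfun.intros)

lemma polyfun_if: "f \<in> polyfun \<Longrightarrow> g \<in> polyfun \<Longrightarrow> (\<lambda>x. if c then f x else g x) \<in> polyfun"
  by (cases c) auto

lemmas polyfun_intros = polyfun.intros polyfun_uminus polyfun_diff polyfun_power polyfun_sum polyfun_prod polyfun_if

lemma polyfun_subst:
  assumes "f \<in> polyfun" "\<And>i. (\<lambda>y. \<rho> y i) \<in> polyfun"
  shows "(\<lambda>y. f (\<rho> y)) \<in> polyfun"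
  using assms(1) by induction (auto intro: polyfun_intros assms(2))

text \<open>This stands in for a polynomial in the coordinates of \<open>y\<close> and one further
  variable. The degree bound is uniform in \<open>y\<close>, so that a value can be written as a
  finite sum whose number of terms does not depend on \<open>y\<close>.\<close>

definition pfam :: "(('i \<Rightarrow> 'k::comm_ring_1) \<Rightarrow> 'k poly) \<Rightarrow> bool" where
  "pfam P \<longleftrightarrow> (\<forall>j. (\<lambda>y. coeff (P y) j) \<in> polyfun) \<and> (\<exists>D. \<forall>y. degree (P y) \<le> D)"

lemma pfam_const: "pfam (\<lambda>_. p)"
  by (auto simp: pfam_def intro: polyfun_intros)

lemma pfam_pCons: assumes "f \<in> polyfun" "pfam P" shows "pfam (\<lambda>y. pCons (f y) (P y))"
proof -
  obtain D where "\<And>y. degree (P y) \<le> D" using assms by (auto simp: pfam_def)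
  then have "degree (pCons (f y) (P y)) \<le> Suc D" for y
    by (metis Suc_le_mono degree_pCons_le order_trans)
  moreover have "(\<lambda>y. coeff (pCons (f y) (P y)) j) \<in> polyfun" for j
    using assms by (cases j) (auto simp: pfam_def)
  ultimately show ?thesis unfolding pfam_def by blast
qed

lemma pfam_add: assumes "pfam P" "pfam Q" shows "pfam (\<lambda>y. P y + Q y)"
proof -
  obtain D D' where "\<And>y. degree (P y) \<le> D" "\<And>y. degree (Q y) \<le> D'"
    using assms by (auto simp: pfam_def)
  then have "degree (P y + Q y) \<le> max D D'" for y
    by (meson degree_add_le max.coboundedI1 max.coboundedI2)
  then have "\<exists>D. \<forall>y. degree (P y + Q y) \<le> D" by blast
  moreover have "(\<lambda>y. coeff (P y + Q y) j) \<in> polyfun" for j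
    using assms by (auto simp: pfam_def intro: polyfun_intros)
  ultimately show ?thesis unfolding pfam_def by blast
qed

lemma pfam_mult: assumes "pfam P" "pfam Q" shows "pfam (\<lambda>y. P y * Q y)"
proof -
  obtain D D' where "\<And>y. degree (P y) \<le> D" "\<And>y. degree (Q y) \<le> D'"
    using assms by (auto simp: pfam_def)
  then have "degree (P y * Q y) \<le> D + D'" for y
    by (meson add_mono degree_mult_le order_trans)
  then have "\<exists>D. \<forall>y. degree (P y * Q y) \<le> D" by blast
  moreover have "(\<lambda>y. coeff (P y * Q y) j) \<in> polyfun" for j
    using assms unfolding coeff_mult by (intro polyfun_intros) (auto simp: pfam_def)
  ultimately show ?thesis unfolding pfam_def by blast
qed

lemma pfam_power: assumes "pfam P" shows "pfam (\<lambda>y. P y ^ m)"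
  by (induction m) (auto intro: pfam_mult pfam_const assms)

lemma pfam_smult: assumes "f \<in> polyfun" "pfam P" shows "pfam (\<lambda>y. smult (f y) (P y))"
  using pfam_mult[OF pfam_pCons[OF assms(1) pfam_const[of 0]] assms(2)] by simp

lemma pfam_subst:
  assumes "f \<in> polyfun" "\<And>i. pfam (X i)"
  shows "\<exists>P. pfam P \<and> (\<forall>y s. poly (P y) s = f (\<lambda>i. poly (X i y) s))"
  using assms(1)
proof induction
  case (const c)
  show ?case by (rule exI[of _ "\<lambda>_. [:c:]"]) (simp add: pfam_const)
next
  case (coord i)
  show ?case by (rule exI[of _ "X i"]) (simp add: assms(2))
next
  case (add f g)
  then obtain P Q where "pfam P \<and> (\<forall>y s. poly (P y) s = f (\<lambda>i. poly (X i y) s))"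
    "pfam Q \<and> (\<forall>y s. poly (Q y) s = g (\<lambda>i. poly (X i y) s))" by blast
  then show ?case by (intro exI[of _ "\<lambda>y. P y + Q y"]) (simp add: pfam_add)
next
  case (mult f g)
  then obtain P Q where "pfam P \<and> (\<forall>y s. poly (P y) s = f (\<lambda>i. poly (X i y) s))"
    "pfam Q \<and> (\<forall>y s. poly (Q y) s = g (\<lambda>i. poly (X i y) s))" by blast
  then show ?case by (intro exI[of _ "\<lambda>y. P y * Q y"]) (simp add: pfam_mult)
qed

lemma polyfun_line:
  fixes f :: "('i \<Rightarrow> 'k::comm_ring_1) \<Rightarrow> 'k"
  assumes "f \<in> polyfun"
  shows "\<exists>p. \<forall>s. poly p s = f (\<lambda>i. a i + s * b i)"
proof -
  have "pfam (\<lambda>_::unit \<Rightarrow> 'k. [:a i, b i:])" for i by (rule pfam_const)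
  from pfam_subst[OF assms, of "\<lambda>i _. [:a i, b i:]", OF this]
  obtain P :: "(unit \<Rightarrow> 'k) \<Rightarrow> 'k poly" where "\<forall>y s. poly (P y) s = f (\<lambda>i. poly [:a i, b i:] s)" by blast
  \<comment> \<open>The parameter of the family is a dummy here, so any value of it will do.\<close>
  then show ?thesis by (intro exI[of _ "P undefined"]) (simp)
qed

text \<open>The coefficients of a quotient of two families, up to powers of the constant coefficient of
  the denominator.\<close>

lemma pfam_quot_coeff:
  fixes P Q :: "('i \<Rightarrow> 'k::field) \<Rightarrow> 'k poly"
  assumes "pfam P" "pfam Q"
  shows "\<exists>C\<in>polyfun. \<forall>y. coeff (Q y) 0 \<noteq> 0 \<longrightarrow>
     fps_nth (fps_of_poly (P y) / fps_of_poly (Q y)) j * coeff (Q y) 0 ^ Suc j = C y"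
proof (induction j rule: less_induct)
  case (less j)
  let ?c = "\<lambda>y i. fps_nth (fps_of_poly (P y) / fps_of_poly (Q y)) i"
  let ?q = "\<lambda>y. coeff (Q y) 0"
  from less obtain C where C: "\<And>i. i < j \<Longrightarrow> C i \<in> polyfun"
     "\<And>i y. i < j \<Longrightarrow> ?q y \<noteq> 0 \<Longrightarrow> ?c y i * ?q y ^ Suc i = C i y" by metis
  \<comment> \<open>The recursion c_j q_0 = p_j - (sum over i < j of c_i q_(j-i)) for the
    coefficients of the quotient, multiplied by q_0^j. In each summand q_0^(i+1) is spent on turning
    c_i into \<open>C i\<close>.\<close>
  define D where "D = (\<lambda>y. coeff (P y) j * ?q y ^ j - (\<Sum>i<j. C i y * coeff (Q y) (j - i) * ?q y ^ (j - Suc i)))"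
  have "D \<in> polyfun" unfolding D_def using assms C(1)
    by (intro polyfun_intros) (auto simp: pfam_def)
  moreover have "?c y j * ?q y ^ Suc j = D y" if q: "?q y \<noteq> 0" for y
  proof -
    have "fps_of_poly (P y) = fps_of_poly (P y) / fps_of_poly (Q y) * fps_of_poly (Q y)"
      using q by (simp add: fps_divide_unit mult.assoc inverse_mult_eq_1)
    then have "coeff (P y) j = (\<Sum>i=0..j. ?c y i * coeff (Q y) (j - i))"
      by (metis (mono_tags, lifting) fps_mult_nth fps_of_poly_nth sum.cong)
    also have "{0..j} = insert j {..<j}" by auto
    finally have "coeff (P y) j = ?c y j * ?q y + (\<Sum>i<j. ?c y i * coeff (Q y) (j - i))" by simp
    then have "?c y j * ?q y ^ Suc j = coeff (P y) j * ?q y ^ j - (\<Sum>i<j. ?c y i * coeff (Q y) (j - i)) * ?q y ^ j"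
      by (simp add: algebra_simps)
    also have "(\<Sum>i<j. ?c y i * coeff (Q y) (j - i)) * ?q y ^ j = (\<Sum>i<j. C i y * coeff (Q y) (j - i) * ?q y ^ (j - Suc i))"
      unfolding sum_distrib_right
    proof (rule sum.cong)
      fix i assume "i \<in> {..<j}"
      then have i: "i < j" by simp
      have "?q y ^ j = ?q y ^ Suc i * ?q y ^ (j - Suc i)"
        using i by (simp flip: power_add power_Suc)
      then show "?c y i * coeff (Q y) (j - i) * ?q y ^ j = C i y * coeff (Q y) (j - i) * ?q y ^ (j - Suc i)"
        using C(2)[OF i q] by (simp add: algebra_simps)
    qed simp
    finally show ?thesis by (simp add: D_def)
  qed
  ultimately show ?case by blast
qed

section \<open>Regular functions and Zariski open sets\<close>

text \<open>Locally a fraction with the denominator cleared. \<open>A\<close> may be any set; the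
  neighbourhood of \<open>a\<close> is the part of \<open>A\<close> on which \<open>G\<close> does
  not vanish.\<close>

definition regf :: "('i \<Rightarrow> 'k::field) set \<Rightarrow> (('i \<Rightarrow> 'k) \<Rightarrow> 'k) \<Rightarrow> bool" where
  "regf A f \<longleftrightarrow> (\<forall>a\<in>A. \<exists>F\<in>polyfun. \<exists>G\<in>polyfun. G a \<noteq> 0 \<and> (\<forall>b\<in>A. G b \<noteq> 0 \<longrightarrow> f b * G b = F b))"

lemma regfE:
  assumes "regf A f" "a \<in> A"
  obtains F G where "F \<in> polyfun" "G \<in> polyfun" "G a \<noteq> 0" "\<And>b. b \<in> A \<Longrightarrow> G b \<noteq> 0 \<Longrightarrow> f b * G b = F b"
  using assms unfolding regf_def by blast

lemma regf_subset: assumes "regf A f" "B \<subseteq> A" shows "regf B f"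
  unfolding regf_def
proof
  fix a assume "a \<in> B"
  with assms(2) have "a \<in> A" by blast
  then obtain F G where "F \<in> polyfun" "G \<in> polyfun" "G a \<noteq> 0" "\<And>b. b \<in> A \<Longrightarrow> G b \<noteq> 0 \<Longrightarrow> f b * G b = F b"
    by (rule regfE[OF assms(1)]) blast
  then show "\<exists>F\<in>polyfun. \<exists>G\<in>polyfun. G a \<noteq> 0 \<and> (\<forall>b\<in>B. G b \<noteq> 0 \<longrightarrow> f b * G b = F b)"
    using assms(2) by blast
qed

lemma regf_cong: "(\<And>a. a \<in> A \<Longrightarrow> f a = g a) \<Longrightarrow> regf A f \<longleftrightarrow> regf A g"
  unfolding regf_def by simp

lemma regf_polyfun: "f \<in> polyfun \<Longrightarrow> regf A f"
  unfolding regf_def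
proof (intro ballI)
  fix a assume "f \<in> polyfun"
  then show "\<exists>F\<in>polyfun. \<exists>G\<in>polyfun. G a \<noteq> 0 \<and> (\<forall>b\<in>A. G b \<noteq> 0 \<longrightarrow> f b * G b = F b)"
    by (intro bexI[of _ f] bexI[of _ "\<lambda>_. 1"]) (auto intro: polyfun_intros)
qed

lemma regf_local:
  assumes "\<And>a. a \<in> A \<Longrightarrow> \<exists>p g. regf A p \<and> regf A g \<and> g a \<noteq> 0 \<and> (\<forall>b\<in>A. g b \<noteq> 0 \<longrightarrow> f b * g b = p b)"
  shows "regf A f"
  unfolding regf_def
proof
  fix a assume a: "a \<in> A"
  from assms[OF a] obtain p g where *: "regf A p" "regf A g" "g a \<noteq> 0" "\<And>b. b\<in>A \<Longrightarrow> g b \<noteq> 0 \<Longrightarrow> f b * g b = p b"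
    by blast
  from *(1) a obtain F1 G1 where 1: "F1 \<in> polyfun" "G1 \<in> polyfun" "G1 a \<noteq> 0" "\<And>b. b\<in>A \<Longrightarrow> G1 b \<noteq> 0 \<Longrightarrow> p b * G1 b = F1 b"
    unfolding regf_def by blast
  from *(2) a obtain F2 G2 where 2: "F2 \<in> polyfun" "G2 \<in> polyfun" "G2 a \<noteq> 0" "\<And>b. b\<in>A \<Longrightarrow> G2 b \<noteq> 0 \<Longrightarrow> g b * G2 b = F2 b"
    unfolding regf_def by blast
  \<comment> \<open>The quotient of the fractions F1/G1 and F2/G2. The extra factor
    \<open>G2\<close> ensures that both \<open>G1\<close> and \<open>G2\<close> are nonzero wherever
    \<open>?G\<close> is.\<close>
  let ?F = "\<lambda>x. F1 x * G2 x * G2 x" and ?G = "\<lambda>x. F2 x * G1 x * G2 x"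
  have "?G a \<noteq> 0" using * 1 2 a by (metis no_zero_divisors)
  moreover have "f b * ?G b = ?F b" if "b \<in> A" "?G b \<noteq> 0" for b
  proof -
    have n: "G1 b \<noteq> 0" "G2 b \<noteq> 0" "g b \<noteq> 0" using that 2(4)[of b] by auto
    have "f b * ?G b = (f b * g b) * (G1 b * G2 b * G2 b)"
      unfolding 2(4)[OF that(1) n(2), symmetric] by (simp only: mult_ac)
    also have "\<dots> = ?F b"
      unfolding *(4)[OF that(1) n(3)] 1(4)[OF that(1) n(1), symmetric] by (simp only: mult_ac)
    finally show ?thesis .
  qed
  ultimately show "\<exists>F\<in>polyfun. \<exists>G\<in>polyfun. G a \<noteq> 0 \<and> (\<forall>b\<in>A. G b \<noteq> 0 \<longrightarrow> f b * G b = F b)"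
    using 1 2 by (intro bexI[of _ ?F] bexI[of _ ?G]) (auto intro!: polyfun_intros)
qed

lemma regf_const: "regf A (\<lambda>_. c)"
  by (rule regf_polyfun[OF polyfun.const])

lemma regf_coord: "regf A (\<lambda>x. x i)"
  by (rule regf_polyfun[OF polyfun.coord])

lemma regf_add: assumes "regf A f" "regf A g" shows "regf A (\<lambda>x. f x + g x)"
  unfolding regf_def
proof
  fix a assume a: "a \<in> A"
  from assms(1) a obtain F1 G1 where 1: "F1 \<in> polyfun" "G1 \<in> polyfun" "G1 a \<noteq> 0" "\<And>b. b\<in>A \<Longrightarrow> G1 b \<noteq> 0 \<Longrightarrow> f b * G1 b = F1 b"
    unfolding regf_def by blast
  from assms(2) a obtain F2 G2 where 2: "F2 \<in> polyfun" "G2 \<in> polyfun" "G2 a \<noteq> 0" "\<And>b. b\<in>A \<Longrightarrow> G2 b \<noteq> 0 \<Longrightarrow> g b * G2 b = F2 b"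
    unfolding regf_def by blast
  show "\<exists>F\<in>polyfun. \<exists>G\<in>polyfun. G a \<noteq> 0 \<and> (\<forall>b\<in>A. G b \<noteq> 0 \<longrightarrow> (f b + g b) * G b = F b)"
    using 1 2 by (intro bexI[of _ "\<lambda>x. F1 x * G2 x + F2 x * G1 x"] bexI[of _ "\<lambda>x. G1 x * G2 x"])
      (auto intro!: polyfun_intros simp: ring_distribs simp flip: 1(4) 2(4))
qed

lemma regf_mult: assumes "regf A f" "regf A g" shows "regf A (\<lambda>x. f x * g x)"
  unfolding regf_def
proof
  fix a assume a: "a \<in> A"
  from assms(1) a obtain F1 G1 where 1: "F1 \<in> polyfun" "G1 \<in> polyfun" "G1 a \<noteq> 0" "\<And>b. b\<in>A \<Longrightarrow> G1 b \<noteq> 0 \<Longrightarrow> f b * G1 b = F1 b"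
    unfolding regf_def by blast
  from assms(2) a obtain F2 G2 where 2: "F2 \<in> polyfun" "G2 \<in> polyfun" "G2 a \<noteq> 0" "\<And>b. b\<in>A \<Longrightarrow> G2 b \<noteq> 0 \<Longrightarrow> g b * G2 b = F2 b"
    unfolding regf_def by blast
  show "\<exists>F\<in>polyfun. \<exists>G\<in>polyfun. G a \<noteq> 0 \<and> (\<forall>b\<in>A. G b \<noteq> 0 \<longrightarrow> (f b * g b) * G b = F b)"
    using 1 2 by (intro bexI[of _ "\<lambda>x. F1 x * F2 x"] bexI[of _ "\<lambda>x. G1 x * G2 x"])
      (auto intro!: polyfun_intros simp flip: 1(4) 2(4))
qed

lemma regf_divide:
  assumes "regf A f" "regf A g" "\<And>a. a \<in> A \<Longrightarrow> g a \<noteq> 0"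
  shows "regf A (\<lambda>x. f x / g x)"
  using assms by (intro regf_local) force

lemma regf_inverse:
  assumes "regf A g" "\<And>a. a \<in> A \<Longrightarrow> g a \<noteq> 0"
  shows "regf A (\<lambda>x. inverse (g x))"
  using regf_divide[OF regf_const[of _ 1] assms] by (simp add: divide_inverse)

lemma regf_uminus: "regf A f \<Longrightarrow> regf A (\<lambda>x. - f x)"
  using regf_mult[OF regf_const[of A "-1"], of f] by simp

lemma regf_diff: "regf A f \<Longrightarrow> regf A g \<Longrightarrow> regf A (\<lambda>x. f x - g x)"
  using regf_add[OF _ regf_uminus, of A f g] by simp

lemma regf_power: "regf A f \<Longrightarrow> regf A (\<lambda>x. f x ^ m)"
  by (induction m) (auto intro: regf_const regf_mult)

lemma regf_sum: "(\<And>i. i \<in> I \<Longrightarrow> regf A (f i)) \<Longrightarrow> regf A (\<lambda>x. \<Sum>i\<in>I. f i x)"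
  by (induction I rule: infinite_finite_induct) (auto intro: regf_const regf_add)

lemmas regf_intros = regf_const regf_coord regf_add regf_mult regf_uminus regf_diff regf_power regf_sum

lemma regf_polyfun_subst:
  assumes "F \<in> polyfun" "\<And>i. regf A (\<lambda>a. \<rho> a i)"
  shows "regf A (\<lambda>a. F (\<rho> a))"
  using assms(1) by induction (auto intro: regf_intros assms(2))

lemma regf_comp:
  assumes "regf B f" "\<And>a. a \<in> A \<Longrightarrow> \<rho> a \<in> B" "\<And>i. regf A (\<lambda>a. \<rho> a i)"
  shows "regf A (\<lambda>a. f (\<rho> a))"
proof (rule regf_local)
  fix a assume a: "a \<in> A"
  obtain F G where *: "F \<in> polyfun" "G \<in> polyfun" "G (\<rho> a) \<noteq> 0" "\<And>b. b\<in>B \<Longrightarrow> G b \<noteq> 0 \<Longrightarrow> f b * G b = F b"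
    by (rule regfE[OF assms(1) assms(2)[OF a]]) blast
  show "\<exists>p g. regf A p \<and> regf A g \<and> g a \<noteq> 0 \<and> (\<forall>b\<in>A. g b \<noteq> 0 \<longrightarrow> f (\<rho> b) * g b = p b)"
    using * assms by (intro exI[of _ "\<lambda>a. F (\<rho> a)"] exI[of _ "\<lambda>a. G (\<rho> a)"]) (auto intro: regf_polyfun_subst)
qed

definition zopen :: "('i \<Rightarrow> 'k::field) set \<Rightarrow> ('i \<Rightarrow> 'k) set \<Rightarrow> bool" where
  "zopen X A \<longleftrightarrow> A \<subseteq> X \<and> (\<forall>a\<in>A. \<exists>G\<in>polyfun. G a \<noteq> 0 \<and> (\<forall>b\<in>X. G b \<noteq> 0 \<longrightarrow> b \<in> A))"

lemma zopE:
  assumes "zopen X A" "a \<in> A"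
  obtains G where "G \<in> polyfun" "G a \<noteq> 0" "\<And>b. b \<in> X \<Longrightarrow> G b \<noteq> 0 \<Longrightarrow> b \<in> A"
  using assms unfolding zopen_def by blast

lemma zopen_subset: "zopen X A \<Longrightarrow> A \<subseteq> X" by (simp add: zopen_def)

lemma zopen_self: "zopen X X"
  unfolding zopen_def by (auto intro!: bexI[of _ "\<lambda>_. 1"] polyfun_intros)

lemma zopen_Int: assumes "zopen X A" "zopen X B" shows "zopen X (A \<inter> B)"
  unfolding zopen_def
proof (intro conjI ballI)
  show "A \<inter> B \<subseteq> X" using assms by (auto simp: zopen_def)
  fix a assume a: "a \<in> A \<inter> B"
  then obtain G H where "G \<in> polyfun" "H \<in> polyfun" "G a \<noteq> 0" "H a \<noteq> 0"
    "\<forall>b\<in>X. G b \<noteq> 0 \<longrightarrow> b \<in> A" "\<forall>b\<in>X. H b \<noteq> 0 \<longrightarrow> b \<in> B"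
    using assms unfolding zopen_def by blast
  then show "\<exists>G\<in>polyfun. G a \<noteq> 0 \<and> (\<forall>b\<in>X. G b \<noteq> 0 \<longrightarrow> b \<in> A \<inter> B)"
    by (intro bexI[of _ "\<lambda>x. G x * H x"]) (auto intro: polyfun_intros)
qed

lemma zopen_nonvanishing: assumes "zopen X A" "regf A f" shows "zopen X {a\<in>A. f a \<noteq> 0}"
  unfolding zopen_def
proof (intro conjI ballI)
  show "{a\<in>A. f a \<noteq> 0} \<subseteq> X" using assms by (auto simp: zopen_def)
  fix a assume a: "a \<in> {a\<in>A. f a \<noteq> 0}"
  from assms(2) a obtain F G where 1: "F \<in> polyfun" "G \<in> polyfun" "G a \<noteq> 0" "\<And>b. b\<in>A \<Longrightarrow> G b \<noteq> 0 \<Longrightarrow> f b * G b = F b"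
    unfolding regf_def by blast
  from assms(1) a obtain H where 2: "H \<in> polyfun" "H a \<noteq> 0" "\<And>b. b\<in>X \<Longrightarrow> H b \<noteq> 0 \<Longrightarrow> b \<in> A"
    unfolding zopen_def by blast
  have "F a \<noteq> 0" using 1 a by (metis (mono_tags) mem_Collect_eq no_zero_divisors)
  then show "\<exists>G\<in>polyfun. G a \<noteq> 0 \<and> (\<forall>b\<in>X. G b \<noteq> 0 \<longrightarrow> b \<in> {a\<in>A. f a \<noteq> 0})"
    using 1 2 by (intro bexI[of _ "\<lambda>x. F x * G x * H x"]) (auto intro!: polyfun_intros simp flip: 1(4))
qed

lemma zopen_nonvanishing_polyfun: "f \<in> polyfun \<Longrightarrow> zopen X {a\<in>X. f a \<noteq> 0}"
  by (rule zopen_nonvanishing[OF zopen_self regf_polyfun])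

lemma zopen_preimage:
  assumes "zopen X A" "zopen X' B" "\<And>b. b \<in> B \<Longrightarrow> \<rho> b \<in> X" "\<And>i. regf B (\<lambda>b. \<rho> b i)"
  shows "zopen X' {b\<in>B. \<rho> b \<in> A}"
  unfolding zopen_def
proof (intro conjI ballI)
  show "{b\<in>B. \<rho> b \<in> A} \<subseteq> X'" using assms by (auto simp: zopen_def)
  fix a assume a: "a \<in> {b\<in>B. \<rho> b \<in> A}"
  then obtain G where G: "G \<in> polyfun" "G (\<rho> a) \<noteq> 0" "\<And>b. b\<in>X \<Longrightarrow> G b \<noteq> 0 \<Longrightarrow> b \<in> A"
    using assms(1) unfolding zopen_def by blast
  have "regf B (\<lambda>b. G (\<rho> b))" by (rule regf_polyfun_subst[OF G(1) assms(4)])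
  from zopen_nonvanishing[OF assms(2) this] have z: "zopen X' {b\<in>B. G (\<rho> b) \<noteq> 0}" .
  have "a \<in> {b\<in>B. G (\<rho> b) \<noteq> 0}" using a G by auto
  then obtain H where
    "H \<in> polyfun" "H a \<noteq> 0" "\<And>b. b\<in>X' \<Longrightarrow> H b \<noteq> 0 \<Longrightarrow> b \<in> {b\<in>B. G (\<rho> b) \<noteq> 0}"
    by (rule zopE[OF z]) blast
  then show "\<exists>H\<in>polyfun. H a \<noteq> 0 \<and> (\<forall>b\<in>X'. H b \<noteq> 0 \<longrightarrow> b \<in> {b\<in>B. \<rho> b \<in> A})"
    using G(3) assms(3) by blast
qed

lemma regf_glue:
  assumes "A \<subseteq> X" "\<And>a. a \<in> A \<Longrightarrow> \<exists>B. zopen X B \<and> a \<in> B \<and> regf (A \<inter> B) f"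
  shows "regf A f"
  unfolding regf_def
proof
  fix a assume a: "a \<in> A"
  from assms(2)[OF a] obtain B where B: "zopen X B" "a \<in> B" "regf (A \<inter> B) f" by blast
  from B(3) a B(2) obtain F G where 1: "F \<in> polyfun" "G \<in> polyfun" "G a \<noteq> 0" "\<And>b. b\<in>A\<inter>B \<Longrightarrow> G b \<noteq> 0 \<Longrightarrow> f b * G b = F b"
    unfolding regf_def by blast
  from B obtain H where 2: "H \<in> polyfun" "H a \<noteq> 0" "\<And>b. b\<in>X \<Longrightarrow> H b \<noteq> 0 \<Longrightarrow> b \<in> B"
    unfolding zopen_def by blast
  show "\<exists>F\<in>polyfun. \<exists>G\<in>polyfun. G a \<noteq> 0 \<and> (\<forall>b\<in>A. G b \<noteq> 0 \<longrightarrow> f b * G b = F b)"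
    using 1 2 assms(1) by (intro bexI[of _ "\<lambda>x. F x * H x"] bexI[of _ "\<lambda>x. G x * H x"])
      (auto intro!: polyfun_intros simp flip: 1(4))
qed

lemma zopen_glue:
  assumes "A \<subseteq> X" "\<And>a. a \<in> A \<Longrightarrow> \<exists>B. zopen X B \<and> a \<in> B \<and> B \<subseteq> A"
  shows "zopen X A"
  unfolding zopen_def
proof (intro conjI ballI)
  fix a assume "a \<in> A"
  with assms(2) obtain B where B: "zopen X B" "a \<in> B" "B \<subseteq> A" by blast
  obtain G where "G \<in> polyfun" "G a \<noteq> 0" "\<And>b. b\<in>X \<Longrightarrow> G b \<noteq> 0 \<Longrightarrow> b \<in> B"
    by (rule zopE[OF B(1,2)]) blast
  then show "\<exists>G\<in>polyfun. G a \<noteq> 0 \<and> (\<forall>b\<in>X. G b \<noteq> 0 \<longrightarrow> b \<in> A)"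
    using B(3) by blast
qed (rule assms(1))

section \<open>Irreducible sets and density\<close>

definition irreducible_set :: "('i \<Rightarrow> 'k::field) set \<Rightarrow> bool" where
  "irreducible_set X \<longleftrightarrow> (\<forall>F\<in>polyfun. \<forall>G\<in>polyfun. (\<exists>a\<in>X. F a \<noteq> 0) \<longrightarrow> (\<exists>a\<in>X. G a \<noteq> 0) \<longrightarrow> (\<exists>a\<in>X. F a \<noteq> 0 \<and> G a \<noteq> 0))"

lemma irreducible_set_zopen_meet:
  assumes "irreducible_set X" "zopen X A" "zopen X B" "A \<noteq> {}" "B \<noteq> {}"
  shows "A \<inter> B \<noteq> {}"
proof -
  obtain a b where ab: "a \<in> A" "b \<in> B" using assms by auto
  obtain G where G: "G \<in> polyfun" "G a \<noteq> 0" "\<And>b. b\<in>X \<Longrightarrow> G b \<noteq> 0 \<Longrightarrow> b \<in> A"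
    by (rule zopE[OF assms(2) ab(1)]) blast
  obtain H where H: "H \<in> polyfun" "H b \<noteq> 0" "\<And>b. b\<in>X \<Longrightarrow> H b \<noteq> 0 \<Longrightarrow> b \<in> B"
    by (rule zopE[OF assms(3) ab(2)]) blast
  have "a \<in> X" "b \<in> X" using ab assms(2,3) by (auto simp: zopen_def)
  then obtain c where "c \<in> X" "G c \<noteq> 0" "H c \<noteq> 0"
    using assms(1) G(1,2) H(1,2) unfolding irreducible_set_def by blast
  then show ?thesis using G(3) H(3) by blast
qed

text \<open>The locus in \<open>A\<close> where \<open>f\<close> and \<open>g\<close> differ is open
  in \<open>X\<close>; if it were nonempty, it would meet \<open>B\<close>.\<close>

lemma regf_eq_dense:
  assumes "irreducible_set X" "zopen X A" "regf A f" "regf A g" "zopen X B" "B \<noteq> {}" "\<And>a. a \<in> A \<inter> B \<Longrightarrow> f a = g a" "a \<in> A"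
  shows "f a = g a"
proof (rule ccontr)
  assume "f a \<noteq> g a"
  then have ne: "{a\<in>A. f a - g a \<noteq> 0} \<noteq> {}" using assms(8) by auto
  have "zopen X {a\<in>A. f a - g a \<noteq> 0}"
    by (rule zopen_nonvanishing[OF assms(2) regf_diff[OF assms(3,4)]])
  from irreducible_set_zopen_meet[OF assms(1) this assms(5) ne assms(6)] assms(7) show False by auto
qed

text \<open>On the line joining a point where \<open>F\<close> is nonzero to one where
  \<open>G\<close> is nonzero, \<open>F\<close>, \<open>G\<close> and some coordinate restrict to
  nonzero polynomials in one variable, and the field is infinite. The coordinate keeps the point
  found away from the origin.\<close>

lemma irreducible_set_nonzero_vectors:
  fixes V :: "('i \<Rightarrow> 'k::alg_closed_field) set"
  assumes "\<And>a b s. a \<in> V \<Longrightarrow> b \<in> V \<Longrightarrow> (\<lambda>i. a i + s * (b i - a i)) \<in> V"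
  shows "irreducible_set (V - {\<lambda>_. 0})"
  unfolding irreducible_set_def
proof (intro ballI impI)
  fix F G :: "('i \<Rightarrow> 'k) \<Rightarrow> 'k" assume FG: "F \<in> polyfun" "G \<in> polyfun"
  assume "\<exists>a\<in>V - {\<lambda>_. 0}. F a \<noteq> 0" "\<exists>b\<in>V - {\<lambda>_. 0}. G b \<noteq> 0"
  then obtain a b where ab: "a \<in> V" "a \<noteq> (\<lambda>_. 0)" "F a \<noteq> 0" "b \<in> V" "b \<noteq> (\<lambda>_. 0)" "G b \<noteq> 0" by auto
  obtain i where i: "a i \<noteq> 0" using ab by auto
  let ?l = "\<lambda>s i. a i + s * (b i - a i)"
  obtain p q where p: "\<And>s. poly p s = F (?l s)" and q: "\<And>s. poly q s = G (?l s)"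
    using polyfun_line[OF FG(1), of a "\<lambda>i. b i - a i"] polyfun_line[OF FG(2), of a "\<lambda>i. b i - a i"] by auto
  have "p \<noteq> 0" using p[of 0] ab by auto
  moreover have "q \<noteq> 0" using q[of 1] ab by auto
  moreover have "[:a i, b i - a i:] \<noteq> 0" using i by auto
  ultimately have "p * q * [:a i, b i - a i:] \<noteq> 0" by (simp only: no_zero_divisors not_False_eq_True)
  from poly_nonzero_ex[OF this, of "{}"] obtain s where
    "poly (p * q * [:a i, b i - a i:]) s \<noteq> 0" by auto
  then have "poly p s \<noteq> 0" "poly q s \<noteq> 0" "poly [:a i, b i - a i:] s \<noteq> 0"
    by (simp_all only: poly_mult mult_eq_0_iff not_False_eq_True de_Morgan_disj)
  then have "F (?l s) \<noteq> 0" "G (?l s) \<noteq> 0" "?l s i \<noteq> 0" by (auto simp: p q)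
  then show "\<exists>a\<in>V - {\<lambda>_. 0}. F a \<noteq> 0 \<and> G a \<noteq> 0"
    using assms[OF ab(1,4)] by (intro bexI[of _ "?l s"]) (auto dest: fun_cong)
qed

section \<open>Regular functions on principal open sets\<close>

text \<open>The roots of \<open>G\<close> are removed one at a time. If \<open>g\<close> vanishes at
  the root, a factor of \<open>g\<close> absorbs it; otherwise the local fraction shows that
  \<open>F\<close> vanishes there as well, and the linear factor cancels. Each root costs at most
  one factor \<open>g\<close>, whence the exponent.\<close>

lemma poly_dvd_locally:
  fixes F G g :: "'k::alg_closed_field poly"
  assumes "G \<noteq> 0"
    "\<And>\<rho>. poly G \<rho> = 0 \<Longrightarrow> poly g \<rho> \<noteq> 0 \<Longrightarrow> \<exists>F' G'. poly G' \<rho> \<noteq> 0 \<and> F * G' = F' * G"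
  shows "G dvd F * g ^ degree G"
  using assms
proof (induction "degree G" arbitrary: F G)
  case 0
  then show ?case by (metis is_unit_iff_degree dvd_trans one_dvd)
next
  case (Suc m)
  then obtain \<rho> where \<rho>: "poly G \<rho> = 0" using alg_closed_imp_poly_has_root by (metis zero_less_Suc)
  then obtain H where H: "G = [:-\<rho>, 1:] * H" by (metis dvdE poly_eq_0_iff_dvd)
  with Suc.prems have H0: "H \<noteq> 0" by auto
  have degH: "m = degree H" using Suc.hyps(2) H0 unfolding H by (subst (asm) degree_mult_eq) auto
  have deg: "degree G = Suc (degree H)" using degH Suc.hyps(2) by simp
  show ?case
  proof (cases "poly g \<rho> = 0")
    case True
    then obtain g1 where g1: "g = [:-\<rho>, 1:] * g1" by (metis dvdE poly_eq_0_iff_dvd)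
    have "H dvd F * g ^ degree H"
    proof (rule Suc.hyps(1)[OF degH H0])
      fix \<tau> assume "poly H \<tau> = 0" "poly g \<tau> \<noteq> 0"
      then have "poly G \<tau> = 0" "poly g \<tau> \<noteq> 0" by (simp_all add: H)
      from Suc.prems(2)[OF this] obtain F' G' where *: "poly G' \<tau> \<noteq> 0" "F * G' = F' * G" by blast
      have "F * G' = F' * [:-\<rho>, 1:] * H" unfolding *(2) H by (simp only: mult_ac)
      with *(1) show "\<exists>F' G'. poly G' \<tau> \<noteq> 0 \<and> F * G' = F' * H" by blast
    qed
    moreover have "[:-\<rho>, 1:] dvd g" unfolding g1 by (rule dvd_triv_left)
    ultimately have "[:-\<rho>, 1:] * H dvd g * (F * g ^ degree H)" by (intro mult_dvd_mono)
    moreover have "g * (F * g ^ degree H) = F * g ^ degree G" unfolding deg by (simp add: mult_ac)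
    ultimately show ?thesis unfolding H[symmetric] by simp
  next
    case False
    from Suc.prems(2)[OF \<rho> this] obtain F' G' where FG: "poly G' \<rho> \<noteq> 0" "F * G' = F' * G" by blast
    have "poly (F * G') \<rho> = 0" unfolding FG by (simp add: \<rho>)
    with FG(1) have "poly F \<rho> = 0" by simp
    then obtain F1 where F1: "F = [:-\<rho>, 1:] * F1" by (metis dvdE poly_eq_0_iff_dvd)
    have "H dvd F1 * g ^ degree H"
    proof (rule Suc.hyps(1)[OF degH H0])
      fix \<tau> assume "poly H \<tau> = 0" "poly g \<tau> \<noteq> 0"
      then have "poly G \<tau> = 0" "poly g \<tau> \<noteq> 0" by (simp_all add: H)
      from Suc.prems(2)[OF this] obtain F' G' where *: "poly G' \<tau> \<noteq> 0" "F * G' = F' * G" by blast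
      have "[:-\<rho>, 1:] * (F1 * G') = [:-\<rho>, 1:] * (F' * H)" using *(2) unfolding F1 H by (simp only: mult_ac)
      then have "F1 * G' = F' * H" by (subst (asm) mult_cancel_left) auto
      then show "\<exists>F' G'. poly G' \<tau> \<noteq> 0 \<and> F1 * G' = F' * H" using *(1) by blast
    qed
    then have "[:-\<rho>, 1:] * H dvd [:-\<rho>, 1:] * (F1 * g ^ degree H)" by (intro mult_dvd_mono) auto
    also have "[:-\<rho>, 1:] * (F1 * g ^ degree H) = F * g ^ degree H" unfolding F1 by (simp only: mult_ac)
    also have "\<dots> dvd F * g ^ degree G" unfolding deg by (intro mult_dvd_mono le_imp_power_dvd) auto
    finally show ?thesis unfolding H[symmetric] .
  qed
qed

text \<open>The proof restricts the function to the lines through a fixed point. On such a line the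
  statement is one about polynomials in one variable, all degrees are bounded uniformly, and the
  coefficients of the resulting polynomial are power series coefficients of a fixed fraction.\<close>

lemma regf_principal:
  fixes f g :: "('i \<Rightarrow> 'k::alg_closed_field) \<Rightarrow> 'k"
  assumes g: "g \<in> polyfun" and f: "regf {w. g w \<noteq> 0} f"
  shows "\<exists>\<Phi>\<in>polyfun. \<exists>M. \<forall>w. g w \<noteq> 0 \<longrightarrow> f w * g w ^ M = \<Phi> w"
proof (cases "\<exists>w. g w \<noteq> 0")
  case False
  then show ?thesis by (intro bexI[of _ "\<lambda>_. 0"]) (auto intro: polyfun_intros)
next
  case True
  then obtain w0 where w0: "g w0 \<noteq> 0" by blast
  then have w0': "w0 \<in> {w. g w \<noteq> 0}" by simp
  obtain F G where FG: "F \<in> polyfun" "G \<in> polyfun" "G w0 \<noteq> 0"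
      "\<And>b. b \<in> {w. g w \<noteq> 0} \<Longrightarrow> G b \<noteq> 0 \<Longrightarrow> f b * G b = F b"
    by (rule regfE[OF f w0']) blast
  let ?l = "\<lambda>y s i. w0 i + s * y i"
  have X: "pfam (\<lambda>y. [:w0 i, y i:])" for i :: 'i
    by (intro pfam_pCons polyfun_intros pfam_const)
  have fam: "\<exists>P. pfam P \<and> (\<forall>y s. poly (P y) s = h (?l y s))" if "h \<in> polyfun" for h
    using pfam_subst[OF that X] by simp
  obtain Pg where Pg: "pfam Pg" "\<And>y s. poly (Pg y) s = g (?l y s)" using fam[OF g] by blast
  obtain PF where PF: "pfam PF" "\<And>y s. poly (PF y) s = F (?l y s)" using fam[OF FG(1)] by blast
  obtain PG where PG: "pfam PG" "\<And>y s. poly (PG y) s = G (?l y s)" using fam[OF FG(2)] by blast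
  obtain d where d: "\<And>y. degree (PG y) \<le> d" using PG(1) by (auto simp: pfam_def)
  have PG0: "coeff (PG y) 0 = G w0" for y using PG(2)[of y 0] by (simp add: poly_0_coeff_0)
  have Pgn: "Pg y \<noteq> 0" for y using Pg(2)[of y 0] w0 by auto
  have PGn: "PG y \<noteq> 0" for y using PG0[of y] FG(3) by auto
  have loc: "\<exists>F' G'. poly G' s \<noteq> 0 \<and> PF y * G' = F' * PG y \<and> f (?l y s) * poly G' s = poly F' s"
    if s: "poly (Pg y) s \<noteq> 0" for y s
  proof -
    have "?l y s \<in> {w. g w \<noteq> 0}" using s by (simp add: Pg)
    then obtain F' G' where FG': "F' \<in> polyfun" "G' \<in> polyfun" "G' (?l y s) \<noteq> 0"
      "\<And>b. b \<in> {w. g w \<noteq> 0} \<Longrightarrow> G' b \<noteq> 0 \<Longrightarrow> f b * G' b = F' b"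
      by (rule regfE[OF f]) blast
    obtain PF' where PF': "\<And>t. poly PF' t = F' (?l y t)" using polyfun_line[OF FG'(1), of w0 y] by blast
    obtain PG' where PG': "\<And>t. poly PG' t = G' (?l y t)" using polyfun_line[OF FG'(2), of w0 y] by blast
    have PG'n: "PG' \<noteq> 0" using FG'(3) PG'[of s] by auto
    \<comment> \<open>Where \<open>g\<close>, \<open>G\<close> and \<open>G'\<close> are all
      nonzero, both fractions equal \<open>f\<close>. The extra factor makes the identity true at
      every \<open>t\<close>; it is a nonzero polynomial and cancels afterwards.\<close>
    have "(PF y * PG' - PF' * PG y) * (Pg y * (PG y * PG')) = 0"
    proof (rule poly_eqI_cofinite[of "{}"])
      fix t
      show "poly ((PF y * PG' - PF' * PG y) * (Pg y * (PG y * PG'))) t = poly 0 t"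
      proof (cases "g (?l y t) = 0 \<or> G (?l y t) = 0 \<or> G' (?l y t) = 0")
        case True then show ?thesis by (auto simp: Pg PG PG')
      next
        case False
        then have "F (?l y t) = f (?l y t) * G (?l y t)" "F' (?l y t) = f (?l y t) * G' (?l y t)"
          using FG(4) FG'(4) by auto
        then have "F (?l y t) * G' (?l y t) = F' (?l y t) * G (?l y t)" by (simp only: mult_ac)
        then show ?thesis by (simp add: PF PG PF' PG')
      qed
    qed simp
    then have "PF y * PG' = PF' * PG y" using Pgn[of y] PGn[of y] PG'n by (simp only: mult_eq_0_iff) simp
    moreover have "f (?l y s) * poly PG' s = poly PF' s" unfolding PF' PG'
      using FG'(3,4) s by (simp add: Pg)
    ultimately show ?thesis using FG'(3) by (intro exI[of _ PF'] exI[of _ PG']) (simp add: PG')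
  qed
  \<comment> \<open>The exponent from \<open>poly_dvd_locally\<close> is the degree of
    \<open>PG y\<close> and varies with the line; the bound \<open>d\<close> replaces it by a
    uniform one.\<close>
  have "\<exists>A. PF y * Pg y ^ d = PG y * A" for y
  proof -
    have "PG y dvd PF y * Pg y ^ degree (PG y)"
      by (rule poly_dvd_locally[OF PGn]) (use loc in blast)
    also have "\<dots> dvd PF y * Pg y ^ d" using d by (intro mult_dvd_mono le_imp_power_dvd) auto
    finally show ?thesis by (auto simp: dvd_def)
  qed
  then obtain A where A: "\<And>y. PF y * Pg y ^ d = PG y * A y" by metis
  have fA: "f (?l y s) * g (?l y s) ^ d = poly (A y) s" if s: "g (?l y s) \<noteq> 0" for y s
  proof -
    from loc[of y s] s obtain F' G' where FG': "poly G' s \<noteq> 0" "PF y * G' = F' * PG y" "f (?l y s) * poly G' s = poly F' s"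
      by (auto simp: Pg)
    have "PG y * (A y * G') = (PG y * A y) * G'" by (simp only: mult_ac)
    also have "\<dots> = (PF y * G') * Pg y ^ d" unfolding A[symmetric] by (simp only: mult_ac)
    also have "\<dots> = PG y * (F' * Pg y ^ d)" unfolding FG'(2) by (simp only: mult_ac)
    finally have "PG y * (A y * G') = PG y * (F' * Pg y ^ d)" .
    then have "A y * G' = F' * Pg y ^ d" using PGn by simp
    then have "poly (A y) s * poly G' s = poly F' s * g (?l y s) ^ d" by (metis Pg(2) poly_mult poly_power)
    then have "poly (A y) s * poly G' s = f (?l y s) * g (?l y s) ^ d * poly G' s" using FG'(3) by (simp add: mult_ac)
    with FG'(1) show ?thesis by simp
  qed
  have fam2: "pfam (\<lambda>y. PF y * Pg y ^ d)" by (intro pfam_mult pfam_power PF Pg)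
  then obtain K where K: "\<And>y. degree (PF y * Pg y ^ d) \<le> K" by (auto simp: pfam_def)
  have degA: "degree (A y) \<le> K" for y
    using K[of y] PGn[of y] unfolding A by (cases "A y = 0") (auto simp: degree_mult_eq)
  have "\<exists>C\<in>polyfun. \<forall>y. coeff (A y) j * G w0 ^ Suc j = C y" for j
  proof -
    have "fps_of_poly (PF y * Pg y ^ d) / fps_of_poly (PG y) = fps_of_poly (A y)" for y
      using PGn[of y] unfolding A fps_of_poly_mult by simp
    then show ?thesis using pfam_quot_coeff[OF fam2 PG(1), of j] FG(3) by (simp add: PG0)
  qed
  then obtain C where C: "\<And>j. C j \<in> polyfun" "\<And>j y. coeff (A y) j * G w0 ^ Suc j = C j y" by metis
  \<comment> \<open>All lines pass through \<open>w0\<close> at s = 0, so the denominator has the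
    constant coefficient \<open>G w0\<close> for every direction, and dividing by its powers keeps a
    polynomial. The point w is reached at s = 1 in the direction w - w0.\<close>
  define \<Phi> where "\<Phi> = (\<lambda>w. \<Sum>j\<le>K. C j (\<lambda>i. w i - w0 i) * inverse (G w0 ^ Suc j))"
  have "\<Phi> \<in> polyfun" unfolding \<Phi>_def
    by (intro polyfun_intros polyfun_subst[OF C(1)])
  moreover have "f w * g w ^ d = \<Phi> w" if "g w \<noteq> 0" for w
  proof -
    let ?y = "\<lambda>i. w i - w0 i"
    have "f w * g w ^ d = poly (A ?y) 1" using fA[where y = ?y and s = 1] that by simp
    also have "\<dots> = (\<Sum>j\<le>degree (A ?y). coeff (A ?y) j)" by (simp add: poly_altdef)
    also have "\<dots> = (\<Sum>j\<le>K. coeff (A ?y) j)"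
      using degA[of ?y] by (intro sum.mono_neutral_left) (auto simp: coeff_eq_0)
    also have "\<dots> = \<Phi> w" unfolding \<Phi>_def
    proof (rule sum.cong)
      fix j show "coeff (A ?y) j = C j ?y * inverse (G w0 ^ Suc j)"
        unfolding C(2)[symmetric] using FG(3) by (simp add: field_simps)
    qed simp
    finally show ?thesis .
  qed
  ultimately show ?thesis by blast
qed

lemma regf_principal_ge:
  fixes f g :: "('i \<Rightarrow> 'k::alg_closed_field) \<Rightarrow> 'k"
  assumes g: "g \<in> polyfun" and f: "regf {w. g w \<noteq> 0} f"
  shows "\<exists>M0. \<forall>M\<ge>M0. \<exists>\<Phi>\<in>polyfun. \<forall>w. g w \<noteq> 0 \<longrightarrow> f w * g w ^ M = \<Phi> w"
proof -
  from regf_principal[OF assms] obtain \<Phi> M0 where \<Phi>: "\<Phi> \<in> polyfun" "\<And>w. g w \<noteq> 0 \<Longrightarrow> f w * g w ^ M0 = \<Phi> w"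
    by blast
  have "f w * g w ^ M = \<Phi> w * g w ^ (M - M0)" if "M \<ge> M0" "g w \<noteq> 0" for M w
    using that by (simp add: mult.assoc flip: \<Phi>(2) power_add)
  moreover have "(\<lambda>w. \<Phi> w * g w ^ (M - M0)) \<in> polyfun" for M by (intro polyfun_intros \<Phi> g)
  ultimately show ?thesis
    by (intro exI[of _ M0] allI impI bexI[of _ "\<lambda>w. \<Phi> w * g w ^ (_ - M0)"]) auto
qed

text \<open>Exponents may be raised, so the sum of the individual ones serves the whole
  family.\<close>

lemma regf_principal_finite:
  fixes f :: "'j \<Rightarrow> ('i \<Rightarrow> 'k::alg_closed_field) \<Rightarrow> 'k"
  assumes "g \<in> polyfun" "finite J" "\<And>j. j \<in> J \<Longrightarrow> regf {w. g w \<noteq> 0} (f j)"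
  shows "\<exists>M0. \<forall>j\<in>J. \<exists>\<Phi>\<in>polyfun. \<forall>w. g w \<noteq> 0 \<longrightarrow> f j w * g w ^ M0 = \<Phi> w"
proof -
  have "\<forall>j\<in>J. \<exists>M0. \<forall>M\<ge>M0. \<exists>\<Phi>\<in>polyfun. \<forall>w. g w \<noteq> 0 \<longrightarrow> f j w * g w ^ M = \<Phi> w"
    using regf_principal_ge[OF assms(1)] assms(3) by blast
  from bchoice[OF this] obtain M0 where
    M0: "\<forall>j\<in>J. \<forall>M\<ge>M0 j. \<exists>\<Phi>\<in>polyfun. \<forall>w. g w \<noteq> 0 \<longrightarrow> f j w * g w ^ M = \<Phi> w" ..
  have "M0 j \<le> (\<Sum>j\<in>J. M0 j)" if "j \<in> J" for j using assms(2) that by (simp add: member_le_sum)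
  then show ?thesis using M0 by blast
qed

section \<open>Passing to the affine cone\<close>

definition mon_eval :: "((nat + nat) \<Rightarrow>\<^sub>0 nat) \<Rightarrow> (nat + nat \<Rightarrow> 'k::field) \<Rightarrow> 'k" where
  "mon_eval m w = (\<Prod>x\<in>Poly_Mapping.keys m. w x ^ Poly_Mapping.lookup m x)"

lemma mpol_eval_mon: "mpol_eval p a v = (\<Sum>m\<in>Poly_Mapping.keys p. Poly_Mapping.lookup p m * mon_eval m (case_sum a v))"
  unfolding mpol_eval_def mon_eval_def ..

lemma mon_eval_superset:
  assumes "finite S" "Poly_Mapping.keys m \<subseteq> S"
  shows "mon_eval m w = (\<Prod>x\<in>S. w x ^ Poly_Mapping.lookup m x)"
  unfolding mon_eval_def by (rule prod.mono_neutral_left) (use assms in \<open>auto simp: in_keys_iff\<close>)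

lemma mon_eval_add: "mon_eval (m + m') w = mon_eval m w * mon_eval m' w"
proof -
  let ?S = "Poly_Mapping.keys m \<union> Poly_Mapping.keys m'"
  have "mon_eval (m + m') w = (\<Prod>x\<in>?S. w x ^ Poly_Mapping.lookup (m + m') x)"
    by (rule mon_eval_superset) (use Poly_Mapping.keys_add[of m m'] in auto)
  moreover have "mon_eval m w = (\<Prod>x\<in>?S. w x ^ Poly_Mapping.lookup m x)" by (rule mon_eval_superset) auto
  moreover have "mon_eval m' w = (\<Prod>x\<in>?S. w x ^ Poly_Mapping.lookup m' x)" by (rule mon_eval_superset) auto
  ultimately show ?thesis by (simp add: lookup_add power_add prod.distrib)
qed

lemma mpol_eval_zero [simp]: "mpol_eval 0 a v = 0"
  by (simp add: mpol_eval_def)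

lemma mpol_eval_single: "mpol_eval (Poly_Mapping.single m c) a v = c * mon_eval m (case_sum a v)"
  by (cases "c = 0") (auto simp: mpol_eval_mon)

lemma mpol_eval_add: "mpol_eval (p + q) a v = mpol_eval p a v + mpol_eval q a v"
  unfolding mpol_eval_mon by (rule setsum_keys_plus_distrib) (auto simp: ring_distribs)

lemma mpol_induct:
  assumes "P 0" "\<And>m c. P (Poly_Mapping.single m c)" "\<And>p q. P p \<Longrightarrow> P q \<Longrightarrow> P (p + q)"
  shows "P (p :: 'a \<Rightarrow>\<^sub>0 'b::monoid_add)"
proof (induction p rule: update_induct)
  case const show ?case by (rule assms)
next
  case (update f a b)
  have "Poly_Mapping.update a b f = Poly_Mapping.single a b + f"
    by (rule poly_mapping_eqI) (use update(1) in \<open>auto simp: lookup_update lookup_add lookup_single in_keys_iff when_def\<close>)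
  with assms update show ?case by simp
qed

lemma mpol_eval_mult: "mpol_eval (p * q) a v = mpol_eval p a v * mpol_eval q a v"
proof (induction p rule: mpol_induct)
  case (2 m c)
  show ?case
  proof (induction q rule: mpol_induct)
    case (2 m' c')
    show ?case by (simp add: mult_single mpol_eval_single mon_eval_add mult_ac)
  qed (auto simp: ring_distribs mpol_eval_add)
qed (auto simp: ring_distribs mpol_eval_add)

lemma mpol_eval_sum: "mpol_eval (\<Sum>i\<in>I. p i) a v = (\<Sum>i\<in>I. mpol_eval (p i) a v)"
  by (induction I rule: infinite_finite_induct) (auto simp: mpol_eval_add)

lemma mpol_eval_polyfun: "(\<lambda>w. mpol_eval p (\<lambda>i. w (Inl i)) (\<lambda>j. w (Inr j))) \<in> polyfun"
proof -
  have "case_sum (\<lambda>i. w (Inl i)) (\<lambda>j. w (Inr j)) = w" for w :: "nat + nat \<Rightarrow> 'a"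
    by (auto split: sum.split)
  then show ?thesis unfolding mpol_eval_mon mon_eval_def
    by (intro polyfun_intros) (simp_all add: polyfun.coord)
qed

lemma homog_mpols_zero: "0 \<in> homog_mpols n m d" by (simp add: homog_mpols_def)

lemma homog_mpols_add: "p \<in> homog_mpols n m d \<Longrightarrow> q \<in> homog_mpols n m d \<Longrightarrow> p + q \<in> homog_mpols n m d"
  using Poly_Mapping.keys_add[of p q] unfolding homog_mpols_def by blast

lemma homog_mpols_sum: "(\<And>i. i \<in> I \<Longrightarrow> p i \<in> homog_mpols n m d) \<Longrightarrow> (\<Sum>i\<in>I. p i) \<in> homog_mpols n m d"
  by (induction I rule: infinite_finite_induct) (auto intro: homog_mpols_zero homog_mpols_add)

lemma homog_mpols_mult:
  assumes "p \<in> homog_mpols n m d" "q \<in> homog_mpols n m e"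
  shows "p * q \<in> homog_mpols n m (d + e)"
  unfolding homog_mpols_def
proof (intro CollectI ballI)
  fix mo assume "mo \<in> Poly_Mapping.keys (p * q)"
  then obtain x y where xy: "mo = x + y" "x \<in> Poly_Mapping.keys p" "y \<in> Poly_Mapping.keys q"
    using Poly_Mapping.keys_mult[of p q] by blast
  from xy(2) assms(1) have x: "Poly_Mapping.keys x \<subseteq> Inl ` {..n} \<union> Inr ` {..<m}"
    "(\<Sum>i\<le>n. Poly_Mapping.lookup x (Inl i)) = d" unfolding homog_mpols_def by auto
  from xy(3) assms(2) have y: "Poly_Mapping.keys y \<subseteq> Inl ` {..n} \<union> Inr ` {..<m}"
    "(\<Sum>i\<le>n. Poly_Mapping.lookup y (Inl i)) = e" unfolding homog_mpols_def by auto
  have "Poly_Mapping.keys mo \<subseteq> Inl ` {..n} \<union> Inr ` {..<m}"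
    using Poly_Mapping.keys_add[of x y] x(1) y(1) unfolding xy(1) by (meson Un_least order_trans)
  moreover have "(\<Sum>i\<le>n. Poly_Mapping.lookup mo (Inl i)) = d + e"
    unfolding xy(1) x(2)[symmetric] y(2)[symmetric] by (simp add: lookup_add sum.distrib)
  ultimately show "Poly_Mapping.keys mo \<subseteq> Inl ` {..n} \<union> Inr ` {..<m} \<and>
           (\<Sum>i\<le>n. Poly_Mapping.lookup mo (Inl i)) = d + e" ..
qed

lemma homog_mpols_single:
  assumes "Poly_Mapping.keys mo \<subseteq> Inl ` {..n} \<union> Inr ` {..<m}" "(\<Sum>i\<le>n. Poly_Mapping.lookup mo (Inl i)) = d"
  shows "Poly_Mapping.single mo c \<in> homog_mpols n m d"
  using assms unfolding homog_mpols_def by auto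

lemma mpol_eval_scale:
  assumes "p \<in> homog_mpols n m d"
  shows "mpol_eval p (\<lambda>i. c * a i) v = c ^ d * mpol_eval p a v"
  unfolding mpol_eval_mon sum_distrib_left
proof (rule sum.cong)
  fix mo assume "mo \<in> Poly_Mapping.keys p"
  with assms have mo: "Poly_Mapping.keys mo \<subseteq> Inl ` {..n} \<union> Inr ` {..<m}" "(\<Sum>i\<le>n. Poly_Mapping.lookup mo (Inl i)) = d"
    by (auto simp: homog_mpols_def)
  have "mon_eval mo w = (\<Prod>i\<le>n. w (Inl i) ^ Poly_Mapping.lookup mo (Inl i)) *
     (\<Prod>j<m. w (Inr j) ^ Poly_Mapping.lookup mo (Inr j))" for w :: "nat + nat \<Rightarrow> 'a"
    by (subst mon_eval_superset[OF _ mo(1)], simp, subst prod.union_disjoint) (auto simp: prod.reindex)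
  then show "Poly_Mapping.lookup p mo * mon_eval mo (case_sum (\<lambda>i. c * a i) v) =
    c ^ d * (Poly_Mapping.lookup p mo * mon_eval mo (case_sum a v))"
    by (simp add: power_mult_distrib prod.distrib mult_ac flip: mo(2) power_sum)
qed simp

text \<open>The homogeneous components in the projective variables are found as coefficients of the
  polynomial that sends c to the value of \<open>f\<close> at (c a, v). That \<open>p\<close> is a
  polynomial also records that only finitely many components matter at a point.\<close>

lemma polyfun_homog:
  fixes f :: "(nat + nat \<Rightarrow> 'k::field) \<Rightarrow> 'k"
  assumes "f \<in> polyfun"
  shows "\<exists>H. (\<forall>d. H d \<in> homog_mpols n m d) \<and> (\<forall>a\<in>affine_space (Suc n). \<forall>v\<in>affine_space m.
     \<exists>p. (\<forall>d. coeff p d = mpol_eval (H d) a v) \<and> (\<forall>c. poly p c = f (case_sum (\<lambda>i. c * a i) v)))"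
  using assms
proof induction
  case (const c)
  show ?case
    by (intro exI[of _ "\<lambda>d. if d = 0 then Poly_Mapping.single 0 c else 0"] conjI allI ballI exI[of _ "[:c:]"])
      (auto simp: homog_mpols_zero mpol_eval_single mon_eval_def coeff_pCons split: nat.split intro!: homog_mpols_single)
next
  case (coord x)
  show ?case
  proof (cases x)
    case (Inl i)
    \<comment> \<open>A coordinate beyond \<open>n\<close> vanishes on the points considered, so all
      its components are taken to be zero.\<close>
    let ?H = "\<lambda>d::nat. if d = 1 \<and> i \<le> n then Poly_Mapping.single (Poly_Mapping.single (Inl i) 1) (1::'k) else 0"
    have "(\<Sum>k\<le>n. Poly_Mapping.lookup (Poly_Mapping.single (Inl i) (1::nat)) (Inl k :: nat + nat)) = 1" if "i \<le> n"
      using that by (simp add: lookup_single when_def)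
    then have "?H d \<in> homog_mpols n m d" for d
      by (auto simp: homog_mpols_zero intro!: homog_mpols_single)
    moreover have "\<exists>p. (\<forall>d. coeff p d = mpol_eval (?H d) a v) \<and> (\<forall>c. poly p c = case_sum (\<lambda>i. c * a i) v x)"
      if "a \<in> affine_space (Suc n)" for a :: "nat \<Rightarrow> 'k" and v
      using that Inl
      by (intro exI[of _ "[:0, a i:]"])
        (auto simp: mpol_eval_single mon_eval_def coeff_pCons affine_space_def split: nat.split)
    ultimately show ?thesis by (intro exI[of _ ?H]) blast
  next
    case (Inr j)
    let ?H = "\<lambda>d::nat. if d = 0 \<and> j < m then Poly_Mapping.single (Poly_Mapping.single (Inr j) 1) (1::'k) else 0"
    have "(\<Sum>k\<le>n. Poly_Mapping.lookup (Poly_Mapping.single (Inr j) (1::nat)) (Inl k :: nat + nat)) = 0"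
      by (simp add: lookup_single when_def)
    then have "?H d \<in> homog_mpols n m d" for d
      by (auto simp: homog_mpols_zero intro!: homog_mpols_single)
    moreover have "\<exists>p. (\<forall>d. coeff p d = mpol_eval (?H d) a v) \<and> (\<forall>c. poly p c = case_sum (\<lambda>i. c * a i) v x)"
      if "v \<in> affine_space m" for a v :: "nat \<Rightarrow> 'k"
      using that Inr
      by (intro exI[of _ "[:v j:]"])
        (auto simp: mpol_eval_single mon_eval_def coeff_pCons affine_space_def split: nat.split)
    ultimately show ?thesis by (intro exI[of _ ?H]) blast
  qed
next
  case (add f g)
  from add.IH(1) obtain H where H: "\<And>d. H d \<in> homog_mpols n m d"
    "\<And>a v. a\<in>affine_space (Suc n) \<Longrightarrow> v\<in>affine_space m \<Longrightarrow>
     \<exists>p. (\<forall>d. coeff p d = mpol_eval (H d) a v) \<and> (\<forall>c. poly p c = f (case_sum (\<lambda>i. c * a i) v))"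
    by blast
  from add.IH(2) obtain H' where H': "\<And>d. H' d \<in> homog_mpols n m d"
    "\<And>a v. a\<in>affine_space (Suc n) \<Longrightarrow> v\<in>affine_space m \<Longrightarrow>
     \<exists>p. (\<forall>d. coeff p d = mpol_eval (H' d) a v) \<and> (\<forall>c. poly p c = g (case_sum (\<lambda>i. c * a i) v))"
    by blast
  show ?case
  proof (intro exI[of _ "\<lambda>d. H d + H' d"] conjI allI ballI homog_mpols_add H(1) H'(1))
    fix a v :: "nat \<Rightarrow> 'k" assume av: "a \<in> affine_space (Suc n)" "v \<in> affine_space m"
    from H(2)[OF av] H'(2)[OF av] obtain p q where
      "(\<forall>d. coeff p d = mpol_eval (H d) a v) \<and> (\<forall>c. poly p c = f (case_sum (\<lambda>i. c * a i) v))"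
      "(\<forall>d. coeff q d = mpol_eval (H' d) a v) \<and> (\<forall>c. poly q c = g (case_sum (\<lambda>i. c * a i) v))" by blast
    then show "\<exists>p. (\<forall>d. coeff p d = mpol_eval (H d + H' d) a v) \<and>
      (\<forall>c. poly p c = f (case_sum (\<lambda>i. c * a i) v) + g (case_sum (\<lambda>i. c * a i) v))"
      by (intro exI[of _ "p + q"]) (simp add: mpol_eval_add)
  qed
next
  case (mult f g)
  from mult.IH(1) obtain H where H: "\<And>d. H d \<in> homog_mpols n m d"
    "\<And>a v. a\<in>affine_space (Suc n) \<Longrightarrow> v\<in>affine_space m \<Longrightarrow>
     \<exists>p. (\<forall>d. coeff p d = mpol_eval (H d) a v) \<and> (\<forall>c. poly p c = f (case_sum (\<lambda>i. c * a i) v))"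
    by blast
  from mult.IH(2) obtain H' where H': "\<And>d. H' d \<in> homog_mpols n m d"
    "\<And>a v. a\<in>affine_space (Suc n) \<Longrightarrow> v\<in>affine_space m \<Longrightarrow>
     \<exists>p. (\<forall>d. coeff p d = mpol_eval (H' d) a v) \<and> (\<forall>c. poly p c = g (case_sum (\<lambda>i. c * a i) v))"
    by blast
  show ?case
  proof (intro exI[of _ "\<lambda>d. \<Sum>i\<le>d. H i * H' (d - i)"] conjI allI ballI homog_mpols_sum)
    fix d i :: nat assume "i \<in> {..d}"
    then show "H i * H' (d - i) \<in> homog_mpols n m d"
      using homog_mpols_mult[OF H(1)[of i] H'(1)[of "d - i"]] by simp
  next
    fix a v :: "nat \<Rightarrow> 'k" assume av: "a \<in> affine_space (Suc n)" "v \<in> affine_space m"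
    from H(2)[OF av] H'(2)[OF av] obtain p q where
      "(\<forall>d. coeff p d = mpol_eval (H d) a v) \<and> (\<forall>c. poly p c = f (case_sum (\<lambda>i. c * a i) v))"
      "(\<forall>d. coeff q d = mpol_eval (H' d) a v) \<and> (\<forall>c. poly q c = g (case_sum (\<lambda>i. c * a i) v))" by blast
    then show "\<exists>p. (\<forall>d. coeff p d = mpol_eval (\<Sum>i\<le>d. H i * H' (d - i)) a v) \<and>
      (\<forall>c. poly p c = f (case_sum (\<lambda>i. c * a i) v) * g (case_sum (\<lambda>i. c * a i) v))"
      by (intro exI[of _ "p * q"]) (simp add: mpol_eval_sum mpol_eval_mult coeff_mult)
  qed
qed

definition prodpts :: "nat \<Rightarrow> nat \<Rightarrow> (nat + nat \<Rightarrow> 'k::field) set" where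
  "prodpts n m = {case_sum a v |a v. a \<in> homog_coords n \<and> v \<in> affine_space m}"

text \<open>The preimage of \<open>W\<close> in the product of the punctured vector space and the
  affine space, with both vectors packed into one function on \<open>nat + nat\<close>. On it,
  openness and regularity can be tested with arbitrary polynomial functions instead of homogeneous
  ones.\<close>

definition cone :: "nat \<Rightarrow> nat \<Rightarrow> ((nat \<Rightarrow> 'k::field) set \<times> (nat \<Rightarrow> 'k)) set \<Rightarrow> (nat + nat \<Rightarrow> 'k) set" where
  "cone n m W = {case_sum a v |a v. a \<in> homog_coords n \<and> v \<in> affine_space m \<and> (proj_point a, v) \<in> W}"

lemma case_sum_eq_iff: "case_sum a v = case_sum b w \<longleftrightarrow> a = b \<and> v = w"
  by (metis case_sum_o_inj(1) case_sum_o_inj(2))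

lemma cone_iff: "case_sum a v \<in> cone n m W \<longleftrightarrow> a \<in> homog_coords n \<and> v \<in> affine_space m \<and> (proj_point a, v) \<in> W"
  by (auto simp: cone_def case_sum_eq_iff)

lemma prodpts_iff: "case_sum a v \<in> prodpts n m \<longleftrightarrow> a \<in> homog_coords n \<and> v \<in> affine_space m"
  by (auto simp: prodpts_def case_sum_eq_iff)

lemma cone_subset: "cone n m W \<subseteq> prodpts n m"
  by (auto simp: cone_def prodpts_def)

lemma proj_point_scale:
  fixes a :: "nat \<Rightarrow> 'k::field"
  shows "c \<noteq> 0 \<Longrightarrow> proj_point (\<lambda>i. c * a i) = proj_point a"
  unfolding proj_point_def
proof (intro equalityI subsetI; clarsimp)
  fix d :: 'k assume "c \<noteq> 0" "d \<noteq> 0"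
  then show "\<exists>e. (\<lambda>i. d * (c * a i)) = (\<lambda>i. e * a i) \<and> e \<noteq> 0" by (intro exI[of _ "d * c"]) auto
next
  fix d :: 'k assume "c \<noteq> 0" "d \<noteq> 0"
  then show "\<exists>e. (\<lambda>i. d * a i) = (\<lambda>i. e * (c * a i)) \<and> e \<noteq> 0" by (intro exI[of _ "d / c"]) auto
qed

lemma proj_point_eqD:
  assumes "proj_point a = proj_point b"
  obtains c where "c \<noteq> 0" "a = (\<lambda>i. c * b i)"
proof -
  have "a \<in> proj_point a" unfolding proj_point_def by (auto intro!: exI[of _ 1])
  with assms that show ?thesis unfolding proj_point_def by auto
qed

lemma homog_coords_scale: "a \<in> homog_coords n \<Longrightarrow> c \<noteq> 0 \<Longrightarrow> (\<lambda>i. c * a i) \<in> homog_coords n"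
  by (auto simp: homog_coords_def affine_space_def fun_eq_iff)

lemma homog_coords_affine: "a \<in> homog_coords n \<Longrightarrow> a \<in> affine_space (Suc n)"
  by (simp add: homog_coords_def)

lemma zariski_open_imp_zopen:
  assumes "zariski_open n m W"
  shows "zopen (prodpts n m) (cone n m W)"
  unfolding zopen_def
proof (intro conjI ballI cone_subset)
  obtain S where S: "S \<subseteq> (\<Union>d. homog_mpols n m d)"
    "W = {(proj_point a, v) |a v. a \<in> homog_coords n \<and> v \<in> affine_space m \<and> (\<exists>p\<in>S. mpol_eval p a v \<noteq> 0)}"
    using assms unfolding zariski_open_def by blast
  have W: "(proj_point a, v) \<in> W \<longleftrightarrow> (\<exists>p\<in>S. mpol_eval p a v \<noteq> 0)" if "a \<in> homog_coords n" "v \<in> affine_space m" for a v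
  proof
    assume "(proj_point a, v) \<in> W"
    then obtain b p where b: "proj_point a = proj_point b" "p \<in> S" "mpol_eval p b v \<noteq> 0" unfolding S(2) by blast
    from b(1) obtain c where c: "c \<noteq> 0" "a = (\<lambda>i. c * b i)" by (rule proj_point_eqD)
    obtain d where "p \<in> homog_mpols n m d" using b(2) S(1) by blast
    from mpol_eval_scale[OF this, of c b v] c b show "\<exists>p\<in>S. mpol_eval p a v \<noteq> 0" by (intro bexI[of _ p]) auto
  qed (use that in \<open>auto simp: S(2)\<close>)
  fix w assume "w \<in> cone n m W"
  then obtain a v where w: "w = case_sum a v" "a \<in> homog_coords n" "v \<in> affine_space m" "(proj_point a, v) \<in> W"
    by (auto simp: cone_def)
  then obtain p where p: "p \<in> S" "mpol_eval p a v \<noteq> 0" using W by blast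
  show "\<exists>G\<in>polyfun. G w \<noteq> 0 \<and> (\<forall>b\<in>prodpts n m. G b \<noteq> 0 \<longrightarrow> b \<in> cone n m W)"
    by (rule bexI[OF _ mpol_eval_polyfun[of p]]) (use p w W in \<open>auto simp: prodpts_def cone_iff\<close>)
qed

text \<open>If \<open>G\<close> witnesses openness at a point, some homogeneous component of
  \<open>G\<close> is nonzero there. Conversely, where a component is nonzero, \<open>G\<close>
  itself is nonzero at some multiple of the vector, and this multiple represents the same projective
  point.\<close>

lemma zopen_imp_zariski_open:
  fixes W :: "((nat \<Rightarrow> 'k::alg_closed_field) set \<times> (nat \<Rightarrow> 'k)) set"
  assumes "zopen (prodpts n m) (cone n m W)" "W \<subseteq> proj_space n \<times> affine_space m"
  shows "zariski_open n m W"
proof -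
  define S where "S = {p. (\<exists>d. p \<in> homog_mpols n m d) \<and>
     (\<forall>a\<in>homog_coords n. \<forall>v\<in>affine_space m. mpol_eval p a v \<noteq> 0 \<longrightarrow> (proj_point a, v) \<in> W)}"
  have "\<exists>p\<in>S. mpol_eval p a v \<noteq> 0"
    if a: "a \<in> homog_coords n" and v: "v \<in> affine_space m" and W: "(proj_point a, v) \<in> W" for a v
  proof -
    have "case_sum a v \<in> cone n m W" using that by (simp add: cone_iff)
    then obtain G where G: "G \<in> polyfun" "G (case_sum a v) \<noteq> 0" "\<And>b. b \<in> prodpts n m \<Longrightarrow> G b \<noteq> 0 \<Longrightarrow> b \<in> cone n m W"
      by (rule zopE[OF assms(1)]) blast
    from polyfun_homog[OF G(1), where n = n and m = m] obtain H where H: "\<And>d. H d \<in> homog_mpols n m d"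
      "\<And>a v. a\<in>affine_space (Suc n) \<Longrightarrow> v\<in>affine_space m \<Longrightarrow>
        \<exists>p. (\<forall>d. coeff p d = mpol_eval (H d) a v) \<and> (\<forall>c. poly p c = G (case_sum (\<lambda>i. c * a i) v))"
      by blast
    from H(2)[OF homog_coords_affine[OF a] v] obtain p where p: "\<And>d. coeff p d = mpol_eval (H d) a v"
      "\<And>c. poly p c = G (case_sum (\<lambda>i. c * a i) v)" by blast
    have "p \<noteq> 0" using p(2)[of 1] G(2) by auto
    then obtain d where d: "mpol_eval (H d) a v \<noteq> 0" using p(1) by (metis leading_coeff_0_iff)
    moreover have "H d \<in> S" unfolding S_def
    proof (intro CollectI conjI exI[of _ d] H(1) ballI impI)
      fix b u assume b: "b \<in> homog_coords n" and u: "u \<in> affine_space m" and e: "mpol_eval (H d) b u \<noteq> 0"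
      from H(2)[OF homog_coords_affine[OF b] u] obtain q where q: "\<And>d. coeff q d = mpol_eval (H d) b u"
        "\<And>c. poly q c = G (case_sum (\<lambda>i. c * b i) u)" by blast
      have "q \<noteq> 0" using q(1)[of d] e by auto
      from poly_nonzero_ex[OF this, of "{0}"] obtain c where c: "c \<noteq> 0" "poly q c \<noteq> 0" by auto
      then have "case_sum (\<lambda>i. c * b i) u \<in> cone n m W"
        using G(3)[of "case_sum (\<lambda>i. c * b i) u"] b u by (simp add: q(2) prodpts_iff homog_coords_scale)
      then show "(proj_point b, u) \<in> W" using c by (simp add: cone_iff proj_point_scale)
    qed
    ultimately show ?thesis by blast
  qed
  moreover have "\<exists>a v. w = (proj_point a, v) \<and> a \<in> homog_coords n \<and> v \<in> affine_space m" if "w \<in> W" for w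
    using that assms(2) unfolding proj_space_def by (cases w) blast
  ultimately have 1: "\<exists>a v. w = (proj_point a, v) \<and> a \<in> homog_coords n \<and> v \<in> affine_space m \<and> (\<exists>p\<in>S. mpol_eval p a v \<noteq> 0)"
    if "w \<in> W" for w
    using that by metis
  have "W = {(proj_point a, v) |a v. a \<in> homog_coords n \<and> v \<in> affine_space m \<and> (\<exists>p\<in>S. mpol_eval p a v \<noteq> 0)}"
    (is "_ = ?R")
  proof (intro equalityI subsetI)
    fix w assume "w \<in> W" from 1[OF this] show "w \<in> ?R" by simp
  next
    fix w assume "w \<in> ?R" then show "w \<in> W" unfolding S_def by auto
  qed
  then show ?thesis unfolding zariski_open_def by (intro exI[of _ S]) (auto simp: S_def)
qed

lemma regular_on_imp_regf:
  assumes "regular_on n m W f"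
  shows "regf (cone n m W) (\<lambda>w. f (proj_point (\<lambda>i. w (Inl i)), \<lambda>j. w (Inr j)))"
proof (rule regf_glue[OF cone_subset])
  fix w assume "w \<in> cone n m W"
  then obtain a v where w: "w = case_sum a v" "a \<in> homog_coords n" "v \<in> affine_space m" "(proj_point a, v) \<in> W"
    by (auto simp: cone_def)
  from assms w(4) obtain W' d F G where W': "zariski_open n m W'" "(proj_point a, v) \<in> W'" "W' \<subseteq> W"
    and FG: "\<And>a v. a\<in>homog_coords n \<Longrightarrow> (proj_point a, v) \<in> W' \<Longrightarrow>
           mpol_eval G a v \<noteq> 0 \<and> f (proj_point a, v) = mpol_eval F a v / mpol_eval G a v"
    unfolding regular_on_def by metis
  have "regf (cone n m W') (\<lambda>w. mpol_eval F (\<lambda>i. w (Inl i)) (\<lambda>j. w (Inr j)) / mpol_eval G (\<lambda>i. w (Inl i)) (\<lambda>j. w (Inr j)))"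
    using FG by (intro regf_divide regf_polyfun mpol_eval_polyfun) (auto simp: cone_def)
  then have "regf (cone n m W') (\<lambda>w. f (proj_point (\<lambda>i. w (Inl i)), \<lambda>j. w (Inr j)))"
    by (subst regf_cong) (use FG in \<open>auto simp: cone_def\<close>)
  then have "regf (cone n m W \<inter> cone n m W') (\<lambda>w. f (proj_point (\<lambda>i. w (Inl i)), \<lambda>j. w (Inr j)))"
    by (rule regf_subset) auto
  then show "\<exists>B. zopen (prodpts n m) B \<and> w \<in> B \<and> regf (cone n m W \<inter> B) (\<lambda>w. f (proj_point (\<lambda>i. w (Inl i)), \<lambda>j. w (Inr j)))"
    using zariski_open_imp_zopen[OF W'(1)] W'(2) w by (intro exI[of _ "cone n m W'"]) (auto simp: cone_iff)
qed

text \<open>Since \<open>f\<close> does not change under scaling, the relation f G = F on the cone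
  splits into f G_d = F_d for the components of each degree d. A degree with G_d nonzero at the
  given point provides the homogeneous fraction.\<close>

lemma regf_imp_regular_on:
  fixes W :: "((nat \<Rightarrow> 'k::alg_closed_field) set \<times> (nat \<Rightarrow> 'k)) set"
  assumes "zopen (prodpts n m) (cone n m W)" "W \<subseteq> proj_space n \<times> affine_space m"
    "regf (cone n m W) (\<lambda>w. f (proj_point (\<lambda>i. w (Inl i)), \<lambda>j. w (Inr j)))"
  shows "regular_on n m W f"
  unfolding regular_on_def
proof
  fix w assume w: "w \<in> W"
  then obtain a v where av: "w = (proj_point a, v)" "a \<in> homog_coords n" "v \<in> affine_space m"
    using assms(2) unfolding proj_space_def by (cases w) blast
  then have "case_sum a v \<in> cone n m W" using w by (simp add: cone_iff)
  then obtain F G where FG: "F \<in> polyfun" "G \<in> polyfun" "G (case_sum a v) \<noteq> 0"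
      "\<And>b. b \<in> cone n m W \<Longrightarrow> G b \<noteq> 0 \<Longrightarrow> f (proj_point (\<lambda>i. b (Inl i)), \<lambda>j. b (Inr j)) * G b = F b"
    by (rule regfE[OF assms(3)]) blast
  from polyfun_homog[OF FG(1), where n = n and m = m] obtain HF where HF: "\<And>d. HF d \<in> homog_mpols n m d"
      "\<And>a v. a\<in>affine_space (Suc n) \<Longrightarrow> v\<in>affine_space m \<Longrightarrow>
        \<exists>p. (\<forall>d. coeff p d = mpol_eval (HF d) a v) \<and> (\<forall>c. poly p c = F (case_sum (\<lambda>i. c * a i) v))" by blast
  from polyfun_homog[OF FG(2), where n = n and m = m] obtain HG where HG: "\<And>d. HG d \<in> homog_mpols n m d"
      "\<And>a v. a\<in>affine_space (Suc n) \<Longrightarrow> v\<in>affine_space m \<Longrightarrow>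
        \<exists>p. (\<forall>d. coeff p d = mpol_eval (HG d) a v) \<and> (\<forall>c. poly p c = G (case_sum (\<lambda>i. c * a i) v))" by blast
  from HG(2)[OF homog_coords_affine[OF av(2)] av(3)] obtain p where p: "\<And>d. coeff p d = mpol_eval (HG d) a v"
      "\<And>c. poly p c = G (case_sum (\<lambda>i. c * a i) v)" by blast
  have "p \<noteq> 0" using p(2)[of 1] FG(3) by auto
  then obtain d where d: "mpol_eval (HG d) a v \<noteq> 0" using p(1) by (metis leading_coeff_0_iff)
  define W' where "W' = {(proj_point b, u) |b u. b \<in> homog_coords n \<and> u \<in> affine_space m \<and> (proj_point b, u) \<in> W \<and> mpol_eval (HG d) b u \<noteq> 0}"
  have W'iff: "(proj_point b, u) \<in> W' \<longleftrightarrow> u \<in> affine_space m \<and> (proj_point b, u) \<in> W \<and> mpol_eval (HG d) b u \<noteq> 0" if b: "b \<in> homog_coords n" for b u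
  proof
    assume "(proj_point b, u) \<in> W'"
    then obtain b' where b': "proj_point b = proj_point b'" "u \<in> affine_space m" "(proj_point b', u) \<in> W" "mpol_eval (HG d) b' u \<noteq> 0"
      unfolding W'_def by blast
    from b'(1) obtain c where c: "c \<noteq> 0" "b = (\<lambda>i. c * b' i)" by (rule proj_point_eqD)
    with mpol_eval_scale[OF HG(1), of d c b' u] b' show "u \<in> affine_space m \<and> (proj_point b, u) \<in> W \<and> mpol_eval (HG d) b u \<noteq> 0" by auto
  qed (use b in \<open>auto simp: W'_def\<close>)
  have "W' \<subseteq> W" by (auto simp: W'_def)
  have cone': "cone n m W' = {w\<in>cone n m W. mpol_eval (HG d) (\<lambda>i. w (Inl i)) (\<lambda>j. w (Inr j)) \<noteq> 0}"
    unfolding cone_def using W'iff by (auto simp: case_sum_eq_iff)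
  have "zariski_open n m W'"
  proof (rule zopen_imp_zariski_open)
    show "zopen (prodpts n m) (cone n m W')" unfolding cone'
      by (rule zopen_nonvanishing[OF assms(1) regf_polyfun[OF mpol_eval_polyfun]])
  qed (use \<open>W' \<subseteq> W\<close> assms(2) in blast)
  moreover have "w \<in> W'" using w av d by (simp add: W'iff)
  moreover have "mpol_eval (HG d) b u \<noteq> 0 \<and> f (proj_point b, u) = mpol_eval (HF d) b u / mpol_eval (HG d) b u"
    if b: "b \<in> homog_coords n" and u: "(proj_point b, u) \<in> W'" for b u
  proof -
    from u b have u': "u \<in> affine_space m" "(proj_point b, u) \<in> W" "mpol_eval (HG d) b u \<noteq> 0" by (auto simp: W'iff)
    from HF(2)[OF homog_coords_affine[OF b] u'(1)] obtain q where q: "\<And>d. coeff q d = mpol_eval (HF d) b u"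
        "\<And>c. poly q c = F (case_sum (\<lambda>i. c * b i) u)" by blast
    from HG(2)[OF homog_coords_affine[OF b] u'(1)] obtain r where r: "\<And>d. coeff r d = mpol_eval (HG d) b u"
        "\<And>c. poly r c = G (case_sum (\<lambda>i. c * b i) u)" by blast
    have "r \<noteq> 0" using r(1)[of d] u' by auto
    then have fin: "finite ({0} \<union> {c. poly r c = 0})" using poly_roots_finite by blast
    have "smult (f (proj_point b, u)) r = q"
    proof (rule poly_eqI_cofinite[OF fin])
      fix c assume c: "c \<notin> {0} \<union> {c. poly r c = 0}"
      then have "case_sum (\<lambda>i. c * b i) u \<in> cone n m W"
        using b u' by (simp add: cone_iff homog_coords_scale proj_point_scale)
      from FG(4)[OF this] c show "poly (smult (f (proj_point b, u)) r) c = poly q c"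
        by (simp add: q r proj_point_scale)
    qed
    then have "f (proj_point b, u) * mpol_eval (HG d) b u = mpol_eval (HF d) b u"
      by (metis coeff_smult q(1) r(1))
    then show ?thesis using u'(3) by (simp add: field_simps)
  qed
  ultimately show "\<exists>W' d F G. zariski_open n m W' \<and> w \<in> W' \<and> W' \<subseteq> W \<and> F \<in> homog_mpols n m d \<and> G \<in> homog_mpols n m d \<and>
     (\<forall>a\<in>homog_coords n. \<forall>v. (proj_point a, v) \<in> W' \<longrightarrow> mpol_eval G a v \<noteq> 0 \<and> f (proj_point a, v) = mpol_eval F a v / mpol_eval G a v)"
    using \<open>W' \<subseteq> W\<close> HF(1)[of d] HG(1)[of d] by blast
qed

lemma affine_space_0: "affine_space 0 = {\<lambda>_. 0}"
  by (auto simp: affine_space_def)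

lemma proj_open_imp_zopen:
  assumes "proj_open n U"
  shows "zopen (homog_coords n) {a\<in>homog_coords n. proj_point a \<in> U}"
proof -
  have "zopen (homog_coords n) {b \<in> homog_coords n. case_sum b (\<lambda>_. 0) \<in> cone n 0 (U \<times> affine_space 0)}"
  proof (rule zopen_preimage[OF zariski_open_imp_zopen[OF assms[unfolded proj_open_def]] zopen_self])
    show "regf (homog_coords n) (\<lambda>b. case_sum b (\<lambda>_. 0) i)" for i
      by (cases i) (auto intro: regf_intros)
  qed (simp add: prodpts_iff affine_space_0)
  also have "{b \<in> homog_coords n. case_sum b (\<lambda>_. 0) \<in> cone n 0 (U \<times> affine_space 0)} = {a\<in>homog_coords n. proj_point a \<in> U}"
    by (auto simp: cone_iff affine_space_0)
  finally show ?thesis .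
qed

lemma zopen_cone_times:
  assumes "zopen (homog_coords n) {a\<in>homog_coords n. proj_point a \<in> U}"
  shows "zopen (prodpts n m) (cone n m (U \<times> affine_space m))"
proof -
  have "zopen (prodpts n m) {w \<in> prodpts n m. (\<lambda>i. w (Inl i)) \<in> {a\<in>homog_coords n. proj_point a \<in> U}}"
    by (rule zopen_preimage[OF assms zopen_self]) (auto simp: prodpts_def intro: regf_intros)
  also have "{w \<in> prodpts n m. (\<lambda>i. w (Inl i)) \<in> {a\<in>homog_coords n. proj_point a \<in> U}} = cone n m (U \<times> affine_space m)"
    by (auto simp: cone_def prodpts_def case_sum_eq_iff)
  finally show ?thesis .
qed

lemma zopen_imp_proj_open:
  fixes U :: "(nat \<Rightarrow> 'k::alg_closed_field) set set"
  assumes "zopen (homog_coords n) {a\<in>homog_coords n. proj_point a \<in> U}" "U \<subseteq> proj_space n"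
  shows "proj_open n U"
  unfolding proj_open_def
  by (rule zopen_imp_zariski_open[OF zopen_cone_times[OF assms(1)]]) (use assms(2) in auto)

section \<open>Sections of an equivariant bundle over the cone\<close>

definition vec2 :: "'k \<Rightarrow> 'k \<Rightarrow> nat \<Rightarrow> 'k::zero" where
  "vec2 x y = (\<lambda>i. if i = 0 then x else if i = 1 then y else 0)"

lemma vec2_simps [simp]: "vec2 x y 0 = x" "vec2 x y (Suc 0) = y" "vec2 x y 1 = y"
  by (auto simp: vec2_def)

lemma vec2_affine: "vec2 x y \<in> affine_space 2"
  by (auto simp: vec2_def affine_space_def)

lemma regf_vec2: "regf A x \<Longrightarrow> regf A y \<Longrightarrow> regf A (\<lambda>p. vec2 (x p) (y p) i)"
  unfolding vec2_def by (cases "i = 0"; cases "i = 1") (auto intro: regf_const)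

lemma affine2_vec: "v \<in> affine_space 2 \<Longrightarrow> vec2 (v 0) (v 1) = v"
  by (auto simp: vec2_def affine_space_def fun_eq_iff)

text \<open>\<open>lam b\<close> scales the coordinate \<open>0\<close> or all the others, according to \<open>b\<close>. On projective space
  the two actions are inverse to each other; on the cone each of them extends to \<open>u = 0\<close>.\<close>

definition lam :: "bool \<Rightarrow> 'k::field \<Rightarrow> (nat \<Rightarrow> 'k) \<Rightarrow> nat \<Rightarrow> 'k" where
  "lam b u a = (\<lambda>i. if (i = 0) = b then u * a i else a i)"

lemma lam_lam: "lam b u (lam b v a) = lam b (u * v) a"
  by (auto simp: lam_def)

lemma lam_1 [simp]: "lam b 1 a = a"
  by (auto simp: lam_def)

lemma lam_homog_coords: "u \<noteq> 0 \<Longrightarrow> a \<in> homog_coords n \<Longrightarrow> lam b u a \<in> homog_coords n"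
  by (auto simp: lam_def homog_coords_def affine_space_def fun_eq_iff)

lemma lam_scale: "lam b u (\<lambda>i. c * a i) = (\<lambda>i. c * lam b u a i)"
  by (auto simp: lam_def)

lemma proj_point_lam:
  fixes a :: "nat \<Rightarrow> 'k::field"
  assumes "u \<noteq> 0"
  shows "proj_point (lam b u a) = gm_act (if b then inverse u else u) (proj_point a)"
proof (cases b)
  case True
  have "lam b u a = (\<lambda>i. u * (if i = 0 then a i else inverse u * a i))"
    using True assms by (auto simp: lam_def)
  then show ?thesis using True assms proj_point_scale[OF assms, of "\<lambda>i. if i = 0 then a i else inverse u * a i"]
    by (simp add: gm_act_proj_point)
next
  case False
  have "lam b u a = (\<lambda>i. if i = 0 then a i else u * a i)"
    using False by (auto simp: lam_def)
  then show ?thesis using False by (simp add: gm_act_proj_point)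
qed

lemma regf_lam: "regf A u \<Longrightarrow> (\<And>i. regf A (\<lambda>p. \<alpha> p i)) \<Longrightarrow> regf A (\<lambda>p. lam b (u p) (\<alpha> p) i)"
  unfolding lam_def by (cases "(i = 0) = b") (auto intro: regf_intros)

locale equivariant_bundle =
  fixes n :: nat
    and E :: "('e, 'k::alg_closed_field) vbundle"
    and \<sigma> :: "'k \<Rightarrow> 'e \<Rightarrow> 'e"
  assumes n3: "n \<ge> 3"
    and vb: "vector_bundle n 2 E"
    and lin: "gm_linearisation n 2 E \<sigma>"
begin

abbreviation Y :: "(nat \<Rightarrow> 'k) set" where "Y \<equiv> homog_coords n"

definition fib :: "(nat \<Rightarrow> 'k) \<Rightarrow> 'e set" where "fib a = fibre E (proj_point a)"

definition cU :: "(nat \<Rightarrow> 'k) set set \<Rightarrow> (nat \<Rightarrow> 'k) set" where "cU U = {a\<in>Y. proj_point a \<in> U}"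

definition tr :: "('e \<Rightarrow> nat \<Rightarrow> 'k) \<Rightarrow> (nat \<Rightarrow> 'k) \<Rightarrow> 'k \<Rightarrow> 'k \<Rightarrow> 'e" where
  "tr \<phi> a x y = chart_inv E \<phi> (proj_point a) (vec2 x y)"

definition lc :: "'k \<Rightarrow> 'k \<Rightarrow> 'e \<Rightarrow> 'e \<Rightarrow> 'e" where
  "lc c1 c2 d e = fadd E (fscale E c1 d) (fscale E c2 e)"

lemma Y_proj: "a \<in> Y \<Longrightarrow> proj_point a \<in> proj_space n"
  by (simp add: proj_space_def)

lemma cU_Y: "a \<in> cU U \<Longrightarrow> a \<in> Y" by (simp add: cU_def)

lemma bundle_axioms:
  shows fibre_add: "\<forall>x\<in>proj_space n. \<forall>d\<in>fibre E x. \<forall>e\<in>fibre E x. fadd E d e \<in> fibre E x"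
    and fibre_scale: "\<forall>x\<in>proj_space n. \<forall>c. \<forall>e\<in>fibre E x. fscale E c e \<in> fibre E x"
    and charts_cover: "(\<Union>(U, \<phi>)\<in>charts E. U) = proj_space n"
    and charts_trivial: "\<forall>(U, \<phi>)\<in>charts E. local_trivialisation n 2 E U \<phi>"
    and charts_transition: "\<forall>(U, \<phi>)\<in>charts E. \<forall>(V, \<psi>)\<in>charts E. \<forall>i<2.
        regular_on n 2 ((U \<inter> V) \<times> affine_space 2) (\<lambda>(x, v). \<psi> (chart_inv E \<phi> x v) i)"
    and bproj_proj_space: "bproj E ` total_space E \<subseteq> proj_space n"
  by (insert vb[unfolded vector_bundle_def]; elim conjE; assumption)+

lemma fib_add: "a \<in> Y \<Longrightarrow> d \<in> fib a \<Longrightarrow> e \<in> fib a \<Longrightarrow> fadd E d e \<in> fib a"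
  using fibre_add Y_proj unfolding fib_def by blast

lemma fib_scale: "a \<in> Y \<Longrightarrow> d \<in> fib a \<Longrightarrow> fscale E c d \<in> fib a"
  using fibre_scale Y_proj unfolding fib_def by blast

lemma fib_lc: "a \<in> Y \<Longrightarrow> d \<in> fib a \<Longrightarrow> e \<in> fib a \<Longrightarrow> lc c1 c2 d e \<in> fib a"
  by (simp add: lc_def fib_add fib_scale)

lemma chart_loc: "(U, \<phi>) \<in> charts E \<Longrightarrow> local_trivialisation n 2 E U \<phi>"
  using charts_trivial by blast

lemma chart_ex: assumes "a \<in> Y" obtains U \<phi> where "(U, \<phi>) \<in> charts E" "a \<in> cU U"
proof -
  have "proj_point a \<in> (\<Union>(U, \<phi>)\<in>charts E. U)"
    using charts_cover Y_proj[OF assms] by simp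
  then show ?thesis using assms that unfolding cU_def by auto
qed

lemma zopen_cU: assumes "(U, \<phi>) \<in> charts E" shows "zopen Y (cU U)"
  using proj_open_imp_zopen chart_loc[OF assms] unfolding local_trivialisation_def cU_def by blast

context
  fixes U \<phi> a
  assumes ch: "(U, \<phi>) \<in> charts E" "a \<in> cU U"
begin

lemma ch_bij: "bij_betw \<phi> (fib a) (affine_space 2)"
  using chart_loc[OF ch(1)] ch(2) unfolding local_trivialisation_def fib_def cU_def by blast

lemma ch_add: assumes "d \<in> fib a" "e \<in> fib a" shows "\<phi> (fadd E d e) i = \<phi> d i + \<phi> e i"
proof -
  have "\<phi> (fadd E d e) = (\<lambda>i. \<phi> d i + \<phi> e i)"
    using assms chart_loc[OF ch(1)] ch(2) unfolding local_trivialisation_def fib_def cU_def by blast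
  then show ?thesis by simp
qed

lemma ch_scale: assumes "d \<in> fib a" shows "\<phi> (fscale E c d) i = c * \<phi> d i"
proof -
  have "\<phi> (fscale E c d) = (\<lambda>i. c * \<phi> d i)"
    using assms chart_loc[OF ch(1)] ch(2) unfolding local_trivialisation_def fib_def cU_def by blast
  then show ?thesis by simp
qed

lemma ch_lc: "d \<in> fib a \<Longrightarrow> e \<in> fib a \<Longrightarrow> \<phi> (lc c1 c2 d e) i = c1 * \<phi> d i + c2 * \<phi> e i"
  using fib_scale cU_Y[OF ch(2)] by (simp add: lc_def ch_add ch_scale)

lemma tr_fib: "tr \<phi> a x y \<in> fib a"
  using ch_bij vec2_affine unfolding tr_def chart_inv_def fib_def bij_betw_def
  by (metis inv_into_into)

lemma ch_tr: "\<phi> (tr \<phi> a x y) = vec2 x y"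
  using ch_bij vec2_affine unfolding tr_def chart_inv_def fib_def bij_betw_def
  by (metis f_inv_into_f)

lemma tr_ch: "d \<in> fib a \<Longrightarrow> tr \<phi> a (\<phi> d 0) (\<phi> d 1) = d"
proof -
  assume d: "d \<in> fib a"
  then have "vec2 (\<phi> d 0) (\<phi> d 1) = \<phi> d" using ch_bij by (intro affine2_vec) (auto simp: bij_betw_def)
  then show ?thesis using d ch_bij unfolding tr_def chart_inv_def fib_def bij_betw_def
    by (simp add: inv_into_f_f)
qed

lemma ch_eqI: "d \<in> fib a \<Longrightarrow> e \<in> fib a \<Longrightarrow> \<phi> d 0 = \<phi> e 0 \<Longrightarrow> \<phi> d 1 = \<phi> e 1 \<Longrightarrow> d = e"
  using tr_ch by metis

end

text \<open>Transition functions in the form in which they get composed: base point and vector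
  depend regularly on a parameter \<open>p\<close>.\<close>

lemma trans_reg:
  fixes \<alpha> :: "('i \<Rightarrow> 'k) \<Rightarrow> nat \<Rightarrow> 'k"
  assumes "(U, \<phi>) \<in> charts E" "(V, \<psi>) \<in> charts E" "j < 2"
    "\<And>p. p \<in> A \<Longrightarrow> \<alpha> p \<in> cU U" "\<And>p. p \<in> A \<Longrightarrow> \<alpha> p \<in> cU V"
    "\<And>i. regf A (\<lambda>p. \<alpha> p i)" "regf A x" "regf A y"
  shows "regf A (\<lambda>p. \<psi> (tr \<phi> (\<alpha> p) (x p) (y p)) j)"
proof -
  from charts_transition assms(1,2,3) have "regular_on n 2 ((U \<inter> V) \<times> affine_space 2) (\<lambda>(x, v). \<psi> (chart_inv E \<phi> x v) j)"
    by blast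
  note reg = regular_on_imp_regf[OF this]
  have "regf A (\<lambda>p. (\<lambda>w. (\<lambda>(x, v). \<psi> (chart_inv E \<phi> x v) j) (proj_point (\<lambda>i. w (Inl i)), \<lambda>j. w (Inr j)))
     (case_sum (\<alpha> p) (vec2 (x p) (y p))))"
  proof (rule regf_comp[OF reg])
    fix p assume "p \<in> A"
    then show "case_sum (\<alpha> p) (vec2 (x p) (y p)) \<in> cone n 2 ((U \<inter> V) \<times> affine_space 2)"
      using assms(4,5) by (auto simp: cone_iff cU_def vec2_affine)
  next
    fix i show "regf A (\<lambda>p. case_sum (\<alpha> p) (vec2 (x p) (y p)) i)"
      using assms(6-8) by (cases i) (auto intro: regf_vec2)
  qed
  then show ?thesis by (simp add: tr_def)
qed

text \<open>A section of the pullback of the bundle to the cone: the values at \<open>a\<close> and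
  at a multiple of \<open>a\<close> lie in the same fibre but need not agree. Sections of all twists
  of the bundle are thereby included, without twisting sheaves.\<close>

definition sect :: "(nat \<Rightarrow> 'k) set \<Rightarrow> ((nat \<Rightarrow> 'k) \<Rightarrow> 'e) \<Rightarrow> bool" where
  "sect A s \<longleftrightarrow> A \<subseteq> Y \<and> (\<forall>a\<in>A. s a \<in> fib a) \<and>
     (\<forall>(U, \<phi>)\<in>charts E. \<forall>j<2. regf (A \<inter> cU U) (\<lambda>a. \<phi> (s a) j))"

lemma sect_fib: "sect A s \<Longrightarrow> a \<in> A \<Longrightarrow> s a \<in> fib a"
  by (simp add: sect_def)

lemma sect_Y: "sect A s \<Longrightarrow> a \<in> A \<Longrightarrow> a \<in> Y"
  by (auto simp: sect_def)

lemma sect_chart: "sect A s \<Longrightarrow> (U, \<phi>) \<in> charts E \<Longrightarrow> j < 2 \<Longrightarrow> regf (A \<inter> cU U) (\<lambda>a. \<phi> (s a) j)"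
  unfolding sect_def by blast

lemma sect_subset: assumes "sect A s" "B \<subseteq> A" shows "sect B s"
proof -
  have "regf (B \<inter> cU U) (\<lambda>a. \<phi> (s a) j)" if "(U, \<phi>) \<in> charts E" "j < 2" for U \<phi> j
    by (rule regf_subset[OF sect_chart[OF assms(1) that]]) (use assms(2) in auto)
  then show ?thesis using assms unfolding sect_def by blast
qed

text \<open>One chart near each point suffices: \<open>s\<close> is recovered from its coordinates
  in that chart, and the transition functions carry it to any other.\<close>

lemma sect_local:
  assumes AY: "A \<subseteq> Y" and s: "\<And>a. a \<in> A \<Longrightarrow> s a \<in> fib a"
    and loc: "\<And>a. a \<in> A \<Longrightarrow> \<exists>B U \<phi>. zopen Y B \<and> a \<in> B \<and> (U, \<phi>) \<in> charts E \<and> a \<in> cU U \<and>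
       (\<forall>j<2. regf (A \<inter> B \<inter> cU U) (\<lambda>a. \<phi> (s a) j))"
  shows "sect A s"
proof -
  have "regf (A \<inter> cU V) (\<lambda>a. \<psi> (s a) j)" if V: "(V, \<psi>) \<in> charts E" and j: "j < 2" for V \<psi> j
  proof (rule regf_glue[where X = Y])
    fix a assume a: "a \<in> A \<inter> cU V"
    with loc obtain B U \<phi> where *: "zopen Y B" "a \<in> B" "(U, \<phi>) \<in> charts E" "a \<in> cU U"
      "\<And>j. j < 2 \<Longrightarrow> regf (A \<inter> B \<inter> cU U) (\<lambda>a. \<phi> (s a) j)" by blast
    let ?C = "A \<inter> cU V \<inter> (B \<inter> cU U)"
    have r: "regf ?C (\<lambda>a. \<phi> (s a) j)" if "j < 2" for j
      by (rule regf_subset[OF *(5)[OF that]]) auto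
    have "regf ?C (\<lambda>a. \<psi> (tr \<phi> a (\<phi> (s a) 0) (\<phi> (s a) 1)) j)"
      by (rule trans_reg[OF *(3) V j]) (auto intro: regf_intros r)
    then have "regf ?C (\<lambda>a. \<psi> (s a) j)"
      by (subst regf_cong) (use tr_ch[OF *(3)] s in auto)
    then show "\<exists>B. zopen Y B \<and> a \<in> B \<and> regf (A \<inter> cU V \<inter> B) (\<lambda>a. \<psi> (s a) j)"
      using *(1,2,4) zopen_cU[OF *(3)] by (intro exI[of _ "B \<inter> cU U"]) (auto intro: zopen_Int)
  qed (use AY in auto)
  then show ?thesis using AY s unfolding sect_def by blast
qed

lemma sect_glue:
  assumes "A \<subseteq> Y" "\<And>a. a \<in> A \<Longrightarrow> \<exists>B. zopen Y B \<and> a \<in> B \<and> sect (A \<inter> B) s"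
  shows "sect A s"
proof (rule sect_local[OF assms(1)])
  fix a assume a: "a \<in> A"
  from assms(2)[OF a] obtain B where B: "zopen Y B" "a \<in> B" "sect (A \<inter> B) s" by blast
  then show "s a \<in> fib a" using a sect_fib by auto
  have "a \<in> Y" using a assms(1) by auto
  then obtain U \<phi> where U: "(U, \<phi>) \<in> charts E" "a \<in> cU U" by (rule chart_ex)
  then show "\<exists>B U \<phi>. zopen Y B \<and> a \<in> B \<and> (U, \<phi>) \<in> charts E \<and> a \<in> cU U \<and>
       (\<forall>j<2. regf (A \<inter> B \<inter> cU U) (\<lambda>a. \<phi> (s a) j))"
    using B sect_chart[OF B(3) U(1)] by blast
qed

lemma sect_lc:
  assumes "sect A s" "sect A t" "regf A f" "regf A g"
  shows "sect A (\<lambda>a. lc (f a) (g a) (s a) (t a))"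
proof -
  have "regf (A \<inter> cU U) (\<lambda>a. \<phi> (lc (f a) (g a) (s a) (t a)) j)"
    if U: "(U, \<phi>) \<in> charts E" and j: "j < 2" for U \<phi> j
  proof -
    have "regf (A \<inter> cU U) (\<lambda>a. f a * \<phi> (s a) j + g a * \<phi> (t a) j)"
      using assms(3,4) by (intro regf_add regf_mult sect_chart[OF assms(1) U j] sect_chart[OF assms(2) U j]) (auto intro: regf_subset)
    then show ?thesis
      by (subst regf_cong) (use ch_lc[OF U] sect_fib[OF assms(1)] sect_fib[OF assms(2)] in auto)
  qed
  then show ?thesis using assms(1,2) fib_lc unfolding sect_def by blast
qed

lemma sect_fscale:
  assumes "sect A s" "regf A f"
  shows "sect A (\<lambda>a. fscale E (f a) (s a))"
proof -
  have "regf (A \<inter> cU U) (\<lambda>a. \<phi> (fscale E (f a) (s a)) j)"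
    if U: "(U, \<phi>) \<in> charts E" and j: "j < 2" for U \<phi> j
  proof -
    have "regf (A \<inter> cU U) (\<lambda>a. f a * \<phi> (s a) j)"
      using assms(2) by (intro regf_mult sect_chart[OF assms(1) U j]) (auto intro: regf_subset)
    then show ?thesis
      by (subst regf_cong) (use ch_scale[OF U] sect_fib[OF assms(1)] in auto)
  qed
  then show ?thesis using assms(1) fib_scale unfolding sect_def by blast
qed

lemma sect_comp:
  assumes "sect A s" "B \<subseteq> Y" "\<And>b. b \<in> B \<Longrightarrow> \<rho> b \<in> A" "\<And>i. regf B (\<lambda>b. \<rho> b i)"
    "\<And>b. b \<in> B \<Longrightarrow> proj_point (\<rho> b) = proj_point b"
  shows "sect B (\<lambda>b. s (\<rho> b))"
proof -
  have "regf (B \<inter> cU U) (\<lambda>b. \<phi> (s (\<rho> b)) j)" if U: "(U, \<phi>) \<in> charts E" and j: "j < 2" for U \<phi> j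
  proof (rule regf_comp[OF sect_chart[OF assms(1) U j], of _ \<rho>])
    fix b assume b: "b \<in> B \<inter> cU U"
    then show "\<rho> b \<in> A \<inter> cU U" using assms(3,5)[of b] sect_Y[OF assms(1)] by (auto simp: cU_def)
  qed (use assms(4) in \<open>auto intro: regf_subset\<close>)
  moreover have "s (\<rho> b) \<in> fib b" if "b \<in> B" for b
    using sect_fib[OF assms(1) assms(3)[OF that]] assms(5)[OF that] by (simp add: fib_def)
  ultimately show ?thesis using assms(2) unfolding sect_def by blast
qed

lemma sect_tr:
  assumes "(U, \<phi>) \<in> charts E" "A \<subseteq> cU U" "regf A f" "regf A g"
  shows "sect A (\<lambda>a. tr \<phi> a (f a) (g a))"
proof -
  have "regf (A \<inter> cU V) (\<lambda>a. \<psi> (tr \<phi> a (f a) (g a)) j)" if V: "(V, \<psi>) \<in> charts E" "j < 2" for V \<psi> j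
    by (rule trans_reg[OF assms(1) V]) (use assms(2-4) in \<open>auto intro: regf_subset regf_intros\<close>)
  then show ?thesis using assms(2) tr_fib[OF assms(1)] cU_Y unfolding sect_def by blast
qed

section \<open>Bases of the fibres\<close>

definition chart_det :: "('e \<Rightarrow> nat \<Rightarrow> 'k) \<Rightarrow> 'e \<Rightarrow> 'e \<Rightarrow> 'k" where
  "chart_det \<phi> d e = \<phi> d 0 * \<phi> e 1 - \<phi> d 1 * \<phi> e 0"

text \<open>One chart decides; by \<open>basis_at_chart\<close> every other chart around the point
  gives the same answer.\<close>

definition basis_at :: "(nat \<Rightarrow> 'k) \<Rightarrow> 'e \<Rightarrow> 'e \<Rightarrow> bool" where
  "basis_at a d e \<longleftrightarrow> a \<in> Y \<and> d \<in> fib a \<and> e \<in> fib a \<and> (\<exists>(U, \<phi>)\<in>charts E. a \<in> cU U \<and> chart_det \<phi> d e \<noteq> 0)"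

lemma basis_at_swap: "basis_at a d e \<Longrightarrow> basis_at a e d"
proof -
  have "chart_det \<phi> e d = - chart_det \<phi> d e" for \<phi> by (simp add: chart_det_def)
  then show "basis_at a d e \<Longrightarrow> basis_at a e d" unfolding basis_at_def by auto
qed

lemma chart_det_lc:
  assumes "(U, \<phi>) \<in> charts E" "a \<in> cU U" "d \<in> fib a" "e \<in> fib a"
  shows "chart_det \<phi> (lc p q d e) (lc r s d e) = (p * s - q * r) * chart_det \<phi> d e"
  using assms by (simp add: chart_det_def ch_lc[OF assms(1,2)] algebra_simps)

lemma basis_at_uniq:
  assumes "basis_at a d e" "lc c1 c2 d e = lc c1' c2' d e"
  shows "c1 = c1' \<and> c2 = c2'"
proof -
  obtain U \<phi> where U: "(U, \<phi>) \<in> charts E" "a \<in> cU U" "d \<in> fib a" "e \<in> fib a" and D: "chart_det \<phi> d e \<noteq> 0"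
    using assms(1) unfolding basis_at_def by blast
  have 0: "c1 * \<phi> d i + c2 * \<phi> e i = c1' * \<phi> d i + c2' * \<phi> e i" for i
    using ch_lc[OF U(1,2,3,4)] assms(2) by metis
  have "(c1 - c1') * chart_det \<phi> d e = (c1 * \<phi> d 0 + c2 * \<phi> e 0 - (c1' * \<phi> d 0 + c2' * \<phi> e 0)) * \<phi> e 1
     - (c1 * \<phi> d 1 + c2 * \<phi> e 1 - (c1' * \<phi> d 1 + c2' * \<phi> e 1)) * \<phi> e 0"
    by (simp add: chart_det_def algebra_simps)
  then have "(c1 - c1') * chart_det \<phi> d e = 0" using 0 by simp
  moreover have "(c2 - c2') * chart_det \<phi> d e = (c1 * \<phi> d 1 + c2 * \<phi> e 1 - (c1' * \<phi> d 1 + c2' * \<phi> e 1)) * \<phi> d 0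
     - (c1 * \<phi> d 0 + c2 * \<phi> e 0 - (c1' * \<phi> d 0 + c2' * \<phi> e 0)) * \<phi> d 1"
    by (simp add: chart_det_def algebra_simps)
  then have "(c2 - c2') * chart_det \<phi> d e = 0" using 0 by simp
  ultimately show ?thesis using D by auto
qed

text \<open>A vanishing determinant yields a nontrivial linear relation in the fibre. Such a
  relation does not depend on the chart, and \<open>basis_at_uniq\<close> excludes it.\<close>

lemma basis_at_chart:
  assumes "basis_at a d e" and V: "(V, \<psi>) \<in> charts E" "a \<in> cU V"
  shows "chart_det \<psi> d e \<noteq> 0"
proof
  assume D: "chart_det \<psi> d e = 0"
  have de: "d \<in> fib a" "e \<in> fib a" "a \<in> Y" using assms(1) by (auto simp: basis_at_def)
  have "\<exists>c1 c2. (c1 \<noteq> 0 \<or> c2 \<noteq> 0) \<and> c1 * \<psi> d 0 + c2 * \<psi> e 0 = 0 \<and> c1 * \<psi> d 1 + c2 * \<psi> e 1 = 0"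
  proof (cases "\<psi> e 0 \<noteq> 0 \<or> \<psi> d 0 \<noteq> 0")
    case True
    then show ?thesis using D by (intro exI[of _ "\<psi> e 0"] exI[of _ "- \<psi> d 0"]) (auto simp: chart_det_def algebra_simps)
  next
    case False
    show ?thesis
    proof (cases "\<psi> e 1 \<noteq> 0 \<or> \<psi> d 1 \<noteq> 0")
      case True
      then show ?thesis using False by (intro exI[of _ "\<psi> e 1"] exI[of _ "- \<psi> d 1"]) (auto simp: algebra_simps)
    qed (use False in \<open>auto intro!: exI[of _ 1]\<close>)
  qed
  then obtain c1 c2 where c: "c1 \<noteq> 0 \<or> c2 \<noteq> 0" "c1 * \<psi> d 0 + c2 * \<psi> e 0 = 0" "c1 * \<psi> d 1 + c2 * \<psi> e 1 = 0" by blast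
  have "lc c1 c2 d e = lc 0 0 d e"
    using c(2,3) de by (intro ch_eqI[OF V]) (simp_all add: fib_lc ch_lc[OF V])
  from basis_at_uniq[OF assms(1) this] c(1) show False by auto
qed

lemma basI: "(U, \<phi>) \<in> charts E \<Longrightarrow> a \<in> cU U \<Longrightarrow> d \<in> fib a \<Longrightarrow> e \<in> fib a \<Longrightarrow> chart_det \<phi> d e \<noteq> 0 \<Longrightarrow> basis_at a d e"
  unfolding basis_at_def using cU_Y by blast

lemma basis_at_cramer:
  assumes "(U, \<phi>) \<in> charts E" "a \<in> cU U" "d \<in> fib a" "e \<in> fib a" "chart_det \<phi> d e \<noteq> 0" "x \<in> fib a"
  shows "x = lc (chart_det \<phi> x e / chart_det \<phi> d e) (chart_det \<phi> d x / chart_det \<phi> d e) d e"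
proof (rule ch_eqI[OF assms(1,2)])
  have "\<phi> x i = chart_det \<phi> x e / chart_det \<phi> d e * \<phi> d i + chart_det \<phi> d x / chart_det \<phi> d e * \<phi> e i" if "i = 0 \<or> i = 1" for i
  proof -
    have "chart_det \<phi> x e * \<phi> d i + chart_det \<phi> d x * \<phi> e i = \<phi> x i * chart_det \<phi> d e"
      using that by (auto simp: chart_det_def algebra_simps)
    then show ?thesis using assms(5) by (simp add: field_simps)
  qed
  then show "\<phi> x 0 = \<phi> (lc (chart_det \<phi> x e / chart_det \<phi> d e) (chart_det \<phi> d x / chart_det \<phi> d e) d e) 0"
    "\<phi> x 1 = \<phi> (lc (chart_det \<phi> x e / chart_det \<phi> d e) (chart_det \<phi> d x / chart_det \<phi> d e) d e) 1"
    by (simp_all add: ch_lc[OF assms(1,2)] assms(3,4))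
qed (use assms cU_Y fib_lc in auto)

lemma basis_at_ex: assumes "basis_at a d e" "x \<in> fib a" obtains c1 c2 where "x = lc c1 c2 d e"
  using assms basis_at_cramer unfolding basis_at_def by blast

lemma basis_at_lc_iff:
  assumes "basis_at a d e"
  shows "basis_at a (lc p q d e) (lc r s d e) \<longleftrightarrow> p * s - q * r \<noteq> 0"
proof -
  obtain U \<phi> where U: "(U, \<phi>) \<in> charts E" "a \<in> cU U" "d \<in> fib a" "e \<in> fib a" "a \<in> Y" and D: "chart_det \<phi> d e \<noteq> 0"
    using assms(1) unfolding basis_at_def by blast
  show ?thesis
  proof
    assume "basis_at a (lc p q d e) (lc r s d e)"
    from basis_at_chart[OF this U(1,2)] show "p * s - q * r \<noteq> 0" using chart_det_lc[OF U(1-4)] by auto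
  next
    assume "p * s - q * r \<noteq> 0"
    then show "basis_at a (lc p q d e) (lc r s d e)"
      using D by (intro basI[OF U(1,2)]) (auto simp: fib_lc U chart_det_lc[OF U(1-4)])
  qed
qed

lemma sect_chart_det:
  assumes "sect A s" "sect A t" "(U, \<phi>) \<in> charts E"
  shows "regf (A \<inter> cU U) (\<lambda>a. chart_det \<phi> (s a) (t a))"
  unfolding chart_det_def by (intro regf_intros sect_chart[OF assms(1,3)] sect_chart[OF assms(2,3)]) auto

text \<open>In a chart the coefficients are quotients of determinants by Cramer's rule. Uniqueness
  identifies these local formulas with the coefficients chosen pointwise.\<close>

lemma sect_cof:
  assumes "sect A s" "sect A t" "sect A x" "\<And>a. a \<in> A \<Longrightarrow> basis_at a (s a) (t a)"
  obtains f g where "regf A f" "regf A g" "\<And>a. a \<in> A \<Longrightarrow> x a = lc (f a) (g a) (s a) (t a)"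
proof -
  have "\<exists>p. x a = lc (fst p) (snd p) (s a) (t a)" if "a \<in> A" for a
    using basis_at_ex[OF assms(4)[OF that] sect_fib[OF assms(3) that]] by (metis fst_conv snd_conv)
  then obtain P where P: "\<And>a. a \<in> A \<Longrightarrow> x a = lc (fst (P a)) (snd (P a)) (s a) (t a)" by metis
  have "regf A (\<lambda>a. fst (P a)) \<and> regf A (\<lambda>a. snd (P a))"
  proof -
    have "\<exists>B. zopen Y B \<and> a \<in> B \<and> regf (A \<inter> B) (\<lambda>a. fst (P a)) \<and> regf (A \<inter> B) (\<lambda>a. snd (P a))" if a: "a \<in> A" for a
    proof -
      obtain U \<phi> where U: "(U, \<phi>) \<in> charts E" "a \<in> cU U" by (rule chart_ex[OF sect_Y[OF assms(1) a]])
      have nz: "chart_det \<phi> (s b) (t b) \<noteq> 0" if "b \<in> A \<inter> cU U" for b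
        using basis_at_chart[OF assms(4) U(1)] that by auto
      have eq: "fst (P b) = chart_det \<phi> (x b) (t b) / chart_det \<phi> (s b) (t b) \<and> snd (P b) = chart_det \<phi> (s b) (x b) / chart_det \<phi> (s b) (t b)"
        if b: "b \<in> A \<inter> cU U" for b
      proof (rule basis_at_uniq[OF assms(4)])
        show "lc (fst (P b)) (snd (P b)) (s b) (t b) = lc (chart_det \<phi> (x b) (t b) / chart_det \<phi> (s b) (t b)) (chart_det \<phi> (s b) (x b) / chart_det \<phi> (s b) (t b)) (s b) (t b)"
          using basis_at_cramer[OF U(1) _ _ _ nz[OF b], of b "x b"] P[of b] b sect_fib assms by force
      qed (use b in auto)
      have "regf (A \<inter> cU U) (\<lambda>b. chart_det \<phi> (x b) (t b) / chart_det \<phi> (s b) (t b))"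
        "regf (A \<inter> cU U) (\<lambda>b. chart_det \<phi> (s b) (x b) / chart_det \<phi> (s b) (t b))"
        using nz by (intro regf_divide sect_chart_det[OF _ _ U(1)] assms; simp)+
      then have "regf (A \<inter> cU U) (\<lambda>a. fst (P a))" "regf (A \<inter> cU U) (\<lambda>a. snd (P a))"
        by (subst regf_cong; use eq in force)+
      then show ?thesis using zopen_cU[OF U(1)] U(2) by blast
    qed
    then show ?thesis using assms(1) sect_def
      by (intro conjI regf_glue[where X = Y]) blast+
  qed
  then show ?thesis using that P by blast
qed

lemma zopen_basis_at:
  assumes "sect A s" "sect A t" "zopen Y A"
  shows "zopen Y {a\<in>A. basis_at a (s a) (t a)}"
proof (rule zopen_glue)
  fix a assume a: "a \<in> {a\<in>A. basis_at a (s a) (t a)}"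
  then obtain U \<phi> where U: "(U, \<phi>) \<in> charts E" "a \<in> cU U" using chart_ex sect_Y[OF assms(1)] by blast
  have "zopen Y {b\<in>A \<inter> cU U. chart_det \<phi> (s b) (t b) \<noteq> 0}"
    by (intro zopen_nonvanishing zopen_Int assms zopen_cU[OF U(1)] sect_chart_det[OF _ _ U(1)])
  moreover have "{b\<in>A \<inter> cU U. chart_det \<phi> (s b) (t b) \<noteq> 0} \<subseteq> {a\<in>A. basis_at a (s a) (t a)}"
    using basI[OF U(1)] sect_fib assms by blast
  ultimately show "\<exists>B. zopen Y B \<and> a \<in> B \<and> B \<subseteq> {a\<in>A. basis_at a (s a) (t a)}"
    using a U basis_at_chart by blast
qed (use assms(3) zopen_subset in blast)

section \<open>The action on sections\<close>

text \<open>For \<open>b = True\<close> the parameter is inverted, because scaling a_0 by u amounts,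
  up to a common factor, to scaling the other coordinates by the inverse of u. In this way
  \<open>act b u\<close> covers \<open>lam b u\<close>.\<close>

definition act :: "bool \<Rightarrow> 'k \<Rightarrow> 'e \<Rightarrow> 'e" where
  "act b u = \<sigma> (if b then inverse u else u)"

lemma linearisation_axioms:
  shows sigma_1: "\<forall>e\<in>total_space E. \<sigma> 1 e = e"
    and sigma_sigma: "\<forall>s t. s \<noteq> 0 \<longrightarrow> t \<noteq> 0 \<longrightarrow> (\<forall>e\<in>total_space E. \<sigma> (s * t) e = \<sigma> s (\<sigma> t e))"
    and sigma_linear: "\<forall>t. t \<noteq> 0 \<longrightarrow> (\<forall>x\<in>proj_space n.
        \<sigma> t ` fibre E x \<subseteq> fibre E (gm_act t x) \<and>
        (\<forall>d\<in>fibre E x. \<forall>e\<in>fibre E x. \<sigma> t (fadd E d e) = fadd E (\<sigma> t d) (\<sigma> t e)) \<and>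
        (\<forall>c. \<forall>e\<in>fibre E x. \<sigma> t (fscale E c e) = fscale E c (\<sigma> t e)))"
    and sigma_regular: "\<forall>(U, \<phi>)\<in>charts E. \<forall>(V, \<psi>)\<in>charts E. \<forall>i<2.
        regular_on n (Suc 2)
          {(x, case_nat t v) |x t v. t \<noteq> 0 \<and> x \<in> U \<and> gm_act t x \<in> V \<and> v \<in> affine_space 2}
          (\<lambda>(x, w). \<psi> (\<sigma> (w 0) (chart_inv E \<phi> x (\<lambda>j. w (Suc j)))) i)"
  by (insert lin[unfolded gm_linearisation_def]; elim conjE; assumption)+

lemma fib_total: "d \<in> fib a \<Longrightarrow> d \<in> total_space E"
  by (simp add: fib_def fibre_def)

lemma act_1: "d \<in> fib a \<Longrightarrow> act b 1 d = d"
  using sigma_1 fib_total unfolding act_def by simp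

lemma act_act: "d \<in> fib a \<Longrightarrow> u \<noteq> 0 \<Longrightarrow> v \<noteq> 0 \<Longrightarrow> act b u (act b v d) = act b (u * v) d"
proof -
  assume *: "d \<in> fib a" "u \<noteq> 0" "v \<noteq> 0"
  have "\<sigma> (s * t) d = \<sigma> s (\<sigma> t d)" if "s \<noteq> 0" "t \<noteq> 0" for s t
    using sigma_sigma fib_total[OF *(1)] that by blast
  then show ?thesis using * by (cases b) (simp_all add: act_def)
qed

lemma act_lin:
  assumes "a \<in> Y" "u \<noteq> 0"
  shows act_fib: "d \<in> fib a \<Longrightarrow> act b u d \<in> fib (lam b u a)"
    and act_add: "d \<in> fib a \<Longrightarrow> e \<in> fib a \<Longrightarrow> act b u (fadd E d e) = fadd E (act b u d) (act b u e)"
    and act_fscale: "d \<in> fib a \<Longrightarrow> act b u (fscale E c d) = fscale E c (act b u d)"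
proof -
  let ?t = "if b then inverse u else u"
  have t: "?t \<noteq> 0" using assms by simp
  from sigma_linear t Y_proj[OF assms(1)] have "\<sigma> ?t ` fib a \<subseteq> fibre E (gm_act ?t (proj_point a)) \<and>
        (\<forall>d\<in>fib a. \<forall>e\<in>fib a. \<sigma> ?t (fadd E d e) = fadd E (\<sigma> ?t d) (\<sigma> ?t e)) \<and>
        (\<forall>c. \<forall>e\<in>fib a. \<sigma> ?t (fscale E c e) = fscale E c (\<sigma> ?t e))"
    unfolding fib_def by blast
  then show "d \<in> fib a \<Longrightarrow> act b u d \<in> fib (lam b u a)"
    "d \<in> fib a \<Longrightarrow> e \<in> fib a \<Longrightarrow> act b u (fadd E d e) = fadd E (act b u d) (act b u e)"
    "d \<in> fib a \<Longrightarrow> act b u (fscale E c d) = fscale E c (act b u d)"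
    using proj_point_lam[OF assms(2), of b a] unfolding act_def fib_def by auto
qed

lemma act_lc:
  assumes "a \<in> Y" "u \<noteq> 0" "d \<in> fib a" "e \<in> fib a"
  shows "act b u (lc p q d e) = lc p q (act b u d) (act b u e)"
  using assms by (simp add: lc_def act_add[of a] act_fscale[of a] fib_scale)

lemma act_reg:
  fixes \<alpha> :: "('i \<Rightarrow> 'k) \<Rightarrow> nat \<Rightarrow> 'k"
  assumes "(U, \<phi>) \<in> charts E" "(V, \<psi>) \<in> charts E" "j < 2"
    "\<And>p. p \<in> A \<Longrightarrow> \<alpha> p \<in> cU U" "\<And>p. p \<in> A \<Longrightarrow> u p \<noteq> 0" "\<And>p. p \<in> A \<Longrightarrow> lam b (u p) (\<alpha> p) \<in> cU V"
    "\<And>i. regf A (\<lambda>p. \<alpha> p i)" "regf A u" "regf A x" "regf A y"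
  shows "regf A (\<lambda>p. \<psi> (act b (u p) (tr \<phi> (\<alpha> p) (x p) (y p))) j)"
proof -
  let ?W = "{(x, case_nat t v) |x t v. t \<noteq> 0 \<and> x \<in> U \<and> gm_act t x \<in> V \<and> v \<in> affine_space 2}"
  let ?t = "\<lambda>p. if b then inverse (u p) else u p"
  let ?\<rho> = "\<lambda>p. case_sum (\<alpha> p) (case_nat (?t p) (vec2 (x p) (y p)))"
  from sigma_regular assms(1,2,3) have "regular_on n (Suc 2) ?W (\<lambda>(x, w). \<psi> (\<sigma> (w 0) (chart_inv E \<phi> x (\<lambda>j. w (Suc j)))) j)"
    by blast
  note reg = regular_on_imp_regf[OF this]
  have "regf A (\<lambda>p. (\<lambda>w. (\<lambda>(x, w). \<psi> (\<sigma> (w 0) (chart_inv E \<phi> x (\<lambda>j. w (Suc j)))) j)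
     (proj_point (\<lambda>i. w (Inl i)), \<lambda>j. w (Inr j))) (?\<rho> p))"
  proof (rule regf_comp[OF reg])
    fix p assume p: "p \<in> A"
    have "case_nat (?t p) (vec2 (x p) (y p)) \<in> affine_space (Suc 2)"
      by (auto simp: affine_space_def vec2_def split: nat.split)
    moreover have "?t p \<noteq> 0" using assms(5)[OF p] by simp
    moreover have "gm_act (?t p) (proj_point (\<alpha> p)) \<in> V"
      using assms(6)[OF p] proj_point_lam[OF assms(5)[OF p], of b "\<alpha> p"] by (simp add: cU_def)
    ultimately show "?\<rho> p \<in> cone n (Suc 2) ?W"
      using assms(4)[OF p] vec2_affine[of "x p" "y p"] unfolding cone_iff cU_def by blast
  next
    fix i show "regf A (\<lambda>p. ?\<rho> p i)"
    proof (cases i)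
      case (Inr k)
      then show ?thesis using assms(5,8-10)
        by (cases k; cases b) (auto intro: regf_vec2 regf_inverse)
    qed (use assms(7) in auto)
  qed
  then show ?thesis by (simp add: tr_def act_def)
qed

lemma zopen_lam: assumes "zopen Y A" "u \<noteq> 0" shows "zopen Y {a\<in>Y. lam b u a \<in> A}"
  by (rule zopen_preimage[OF assms(1) zopen_self]) (use assms(2) in \<open>auto intro: lam_homog_coords regf_lam regf_intros\<close>)

text \<open>The translate of a section by one group element: go to \<open>lam b u a\<close>,
  evaluate, come back. Regularity combines a chart near \<open>a\<close> with one near the moved
  point.\<close>

lemma sect_pull:
  assumes s: "sect A s" and u: "u \<noteq> 0"
  shows "sect {a\<in>Y. lam b u a \<in> A} (\<lambda>a. act b (inverse u) (s (lam b u a)))"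
proof (rule sect_local)
  have ll: "lam b (inverse u) (lam b u a) = a" for a using u by (simp add: lam_lam)
  fix a assume a: "a \<in> {a\<in>Y. lam b u a \<in> A}"
  then show "act b (inverse u) (s (lam b u a)) \<in> fib a"
    using act_fib[of "lam b u a" "inverse u" "s (lam b u a)" b] u s ll by (auto simp: sect_fib lam_homog_coords)
  from a obtain U \<phi> where U: "(U, \<phi>) \<in> charts E" "a \<in> cU U" using chart_ex by blast
  have "lam b u a \<in> Y" using a u lam_homog_coords by blast
  then obtain V \<psi> where V: "(V, \<psi>) \<in> charts E" "lam b u a \<in> cU V" using chart_ex by blast
  let ?B = "{a\<in>Y. lam b u a \<in> cU V}"
  let ?C = "{a\<in>Y. lam b u a \<in> A} \<inter> ?B \<inter> cU U"
  have "regf ?C (\<lambda>a. \<phi> (act b (inverse u) (s (lam b u a))) j)" if j: "j < 2" for j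
  proof -
    have r: "regf ?C (\<lambda>a. \<psi> (s (lam b u a)) j)" if "j < 2" for j
      by (rule regf_comp[OF sect_chart[OF s V(1) that]]) (auto intro: regf_lam regf_intros)
    have "regf ?C (\<lambda>a. \<phi> (act b (inverse u) (tr \<psi> (lam b u a) (\<psi> (s (lam b u a)) 0) (\<psi> (s (lam b u a)) 1))) j)"
      by (rule act_reg[OF V(1) U(1) j]) (use u in \<open>auto simp: ll intro: regf_lam regf_intros r\<close>)
    then show ?thesis by (subst regf_cong) (use tr_ch[OF V(1)] sect_fib[OF s] in auto)
  qed
  moreover have "zopen Y ?B" by (rule zopen_lam[OF zopen_cU[OF V(1)] u])
  ultimately show "\<exists>B U \<phi>. zopen Y B \<and> a \<in> B \<and> (U, \<phi>) \<in> charts E \<and> a \<in> cU U \<and>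
       (\<forall>j<2. regf ({a \<in> Y. lam b u a \<in> A} \<inter> B \<inter> cU U) (\<lambda>a. \<phi> (act b (inverse u) (s (lam b u a))) j))"
    using a U V by (intro exI[of _ ?B] exI[of _ U] exI[of _ \<phi>]) auto
qed auto

end

lemma pcompose_scale_nth:
  fixes p :: "'k::field poly"
  shows "fps_of_poly (pcompose p [:0, v:]) = fps_compose (fps_of_poly p) (fps_const v * fps_X)"
proof -
  have *: "fps_of_poly [:0, v:] = fps_const v * fps_X"
    by (simp add: fps_of_poly_pCons fps_of_poly_const)
  show ?thesis unfolding *[symmetric] by (rule fps_of_poly_pcompose) simp
qed

lemma ex_sum_nonzero: "(\<Sum>i\<in>I. f i) \<noteq> 0 \<Longrightarrow> \<exists>i\<in>I. f i \<noteq> (0::'a::comm_monoid_add)"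
  by (meson sum.neutral)

context equivariant_bundle
begin

lemma fs_fs: "a \<in> Y \<Longrightarrow> d \<in> fib a \<Longrightarrow> fscale E c (fscale E c' d) = fscale E (c * c') d"
proof -
  assume a: "a \<in> Y" "d \<in> fib a"
  obtain U \<phi> where U: "(U, \<phi>) \<in> charts E" "a \<in> cU U" by (rule chart_ex[OF a(1)])
  show ?thesis by (rule ch_eqI[OF U]) (simp_all add: fib_scale a ch_scale[OF U])
qed

lemma fs_1: "a \<in> Y \<Longrightarrow> d \<in> fib a \<Longrightarrow> fscale E 1 d = d"
proof -
  assume a: "a \<in> Y" "d \<in> fib a"
  obtain U \<phi> where U: "(U, \<phi>) \<in> charts E" "a \<in> cU U" by (rule chart_ex[OF a(1)])
  show ?thesis by (rule ch_eqI[OF U]) (simp_all add: fib_scale a ch_scale[OF U])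
qed

lemma lc_fs: "a \<in> Y \<Longrightarrow> d \<in> fib a \<Longrightarrow> e \<in> fib a \<Longrightarrow> lc p q (fscale E x d) (fscale E y e) = lc (p * x) (q * y) d e"
  by (simp add: lc_def fs_fs)

lemma fs_lc:
  assumes a: "a \<in> Y" "d \<in> fib a" "e \<in> fib a"
  shows "fscale E c (lc p q d e) = lc (c * p) (c * q) d e"
proof -
  obtain U \<phi> where U: "(U, \<phi>) \<in> charts E" "a \<in> cU U" by (rule chart_ex[OF a(1)])
  show ?thesis
    by (rule ch_eqI[OF U]) (simp_all add: fib_scale fib_lc a ch_scale[OF U] ch_lc[OF U] algebra_simps)
qed

lemma lc_lc:
  assumes a: "a \<in> Y" "d \<in> fib a" "e \<in> fib a"
  shows "lc x y (lc p q d e) (lc r s d e) = lc (x * p + y * r) (x * q + y * s) d e"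
proof -
  obtain U \<phi> where U: "(U, \<phi>) \<in> charts E" "a \<in> cU U" by (rule chart_ex[OF a(1)])
  show ?thesis
    by (rule ch_eqI[OF U]) (simp_all add: fib_lc a ch_lc[OF U] algebra_simps)
qed

lemma lc_10:
  assumes a: "a \<in> Y" "d \<in> fib a" "e \<in> fib a"
  shows lc_x0: "lc x 0 d e = fscale E x d" and lc_0x: "lc 0 x d e = fscale E x e"
proof -
  obtain U \<phi> where U: "(U, \<phi>) \<in> charts E" "a \<in> cU U" by (rule chart_ex[OF a(1)])
  show "lc x 0 d e = fscale E x d"
    by (rule ch_eqI[OF U]) (simp_all add: fib_lc fib_scale a ch_scale[OF U] ch_lc[OF U])
  show "lc 0 x d e = fscale E x e"
    by (rule ch_eqI[OF U]) (simp_all add: fib_lc fib_scale a ch_scale[OF U] ch_lc[OF U])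
qed

lemma basis_at_fs:
  assumes "basis_at a d e" "x \<noteq> 0" "y \<noteq> 0"
  shows "basis_at a (fscale E x d) (fscale E y e)"
proof -
  have "a \<in> Y" "d \<in> fib a" "e \<in> fib a" using assms(1) by (auto simp: basis_at_def)
  then have "fscale E x d = lc x 0 d e" "fscale E y e = lc 0 y d e" by (simp_all add: lc_10)
  then show ?thesis using basis_at_lc_iff[OF assms(1), of x 0 0 y] assms by simp
qed

lemma chart_det_zero_dep:
  assumes V: "(V, \<psi>) \<in> charts E" "a \<in> cU V" and de: "d \<in> fib a" "e \<in> fib a" and D: "chart_det \<psi> d e = 0"
  shows "\<exists>c1 c2. (c1 \<noteq> 0 \<or> c2 \<noteq> 0) \<and> lc c1 c2 d e = lc 0 0 d e"
proof -
  have a: "a \<in> Y" using cU_Y[OF V(2)] .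
  have "\<exists>c1 c2. (c1 \<noteq> 0 \<or> c2 \<noteq> 0) \<and> c1 * \<psi> d 0 + c2 * \<psi> e 0 = 0 \<and> c1 * \<psi> d 1 + c2 * \<psi> e 1 = 0"
  proof (cases "\<psi> e 0 \<noteq> 0 \<or> \<psi> d 0 \<noteq> 0")
    case True
    then show ?thesis using D by (intro exI[of _ "\<psi> e 0"] exI[of _ "- \<psi> d 0"]) (auto simp: chart_det_def algebra_simps)
  next
    case False
    show ?thesis
    proof (cases "\<psi> e 1 \<noteq> 0 \<or> \<psi> d 1 \<noteq> 0")
      case True
      then show ?thesis using False by (intro exI[of _ "\<psi> e 1"] exI[of _ "- \<psi> d 1"]) (auto simp: algebra_simps)
    qed (use False in \<open>auto intro!: exI[of _ 1]\<close>)
  qed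
  then obtain c1 c2 where c: "c1 \<noteq> 0 \<or> c2 \<noteq> 0" "c1 * \<psi> d 0 + c2 * \<psi> e 0 = 0" "c1 * \<psi> d 1 + c2 * \<psi> e 1 = 0" by blast
  have "lc c1 c2 d e = lc 0 0 d e"
    using c(2,3) de a by (intro ch_eqI[OF V]) (simp_all add: fib_lc ch_lc[OF V])
  with c(1) show ?thesis by blast
qed

lemma basis_at_act:
  assumes "basis_at a d e" "u \<noteq> 0"
  shows "basis_at (lam b u a) (act b u d) (act b u e)"
proof -
  have a: "a \<in> Y" "d \<in> fib a" "e \<in> fib a" using assms(1) by (auto simp: basis_at_def)
  have a': "lam b u a \<in> Y" "act b u d \<in> fib (lam b u a)" "act b u e \<in> fib (lam b u a)"
    using a assms(2) by (auto intro: lam_homog_coords act_fib)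
  obtain U \<phi> where U: "(U, \<phi>) \<in> charts E" "lam b u a \<in> cU U" by (rule chart_ex[OF a'(1)])
  have act_inv: "act b (inverse u) (act b u x) = x" if "x \<in> fib a" for x
    using act_act[OF that, of "inverse u" u b] act_1[OF that, of b] assms(2) by simp
  have "chart_det \<phi> (act b u d) (act b u e) \<noteq> 0"
  proof
    assume "chart_det \<phi> (act b u d) (act b u e) = 0"
    from chart_det_zero_dep[OF U a'(2,3) this] obtain c1 c2 where c: "c1 \<noteq> 0 \<or> c2 \<noteq> 0"
      "lc c1 c2 (act b u d) (act b u e) = lc 0 0 (act b u d) (act b u e)" by blast
    then have "act b u (lc c1 c2 d e) = act b u (lc 0 0 d e)" by (simp add: act_lc[OF a(1) assms(2) a(2,3)])
    then have "lc c1 c2 d e = lc 0 0 d e" using act_inv fib_lc[OF a] by metis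
    from basis_at_uniq[OF assms(1) this] c(1) show False by auto
  qed
  then show ?thesis by (rule basI[OF U a'(2,3)])
qed

lemma sect_eq: assumes "sect A s" "\<And>a. a \<in> A \<Longrightarrow> s a = t a" shows "sect A t"
proof -
  have "regf (A \<inter> cU U) (\<lambda>a. \<phi> (t a) j)" if "(U, \<phi>) \<in> charts E" "j < 2" for U \<phi> j
  proof -
    have "regf (A \<inter> cU U) (\<lambda>a. \<phi> (s a) j) \<longleftrightarrow> regf (A \<inter> cU U) (\<lambda>a. \<phi> (t a) j)"
      by (rule regf_cong) (use assms(2) in auto)
    then show ?thesis using sect_chart[OF assms(1) that] by simp
  qed
  moreover have "A \<subseteq> Y" using assms(1) by (simp add: sect_def)
  moreover have "t a \<in> fib a" if "a \<in> A" for a using sect_fib[OF assms(1) that] assms(2)[OF that] by simp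
  ultimately show ?thesis unfolding sect_def by blast
qed

section \<open>Homogeneous frames near the fixed points\<close>

text \<open>Transporting a constant vector of a chart along an orbit gives a rational function of the
  parameter \<open>u\<close>, whose Laurent coefficients at \<open>u = 0\<close> are homogeneous sections. At the fixed point
  the coefficients add up to the vector itself, so that two of them are linearly independent.\<close>

lemma ex_local_homogeneous_frame:
  assumes z: "z \<in> Y" "lam b 0 z = z"
  shows "\<exists>A s1 s2 m1 m2. zopen Y A \<and> z \<in> A \<and> sect A s1 \<and> sect A s2 \<and> (\<forall>a\<in>A. basis_at a (s1 a) (s2 a)) \<and>
    (\<forall>a\<in>A. \<forall>u. u \<noteq> 0 \<longrightarrow> lam b u a \<in> A \<longrightarrow>
      s1 (lam b u a) = fscale E (u powi m1) (act b u (s1 a)) \<and>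
      s2 (lam b u a) = fscale E (u powi m2) (act b u (s2 a)))"
proof -
  obtain U \<phi> where U: "(U, \<phi>) \<in> charts E" "z \<in> cU U" by (rule chart_ex[OF z(1)])
  obtain g where g: "g \<in> polyfun" "g z \<noteq> 0" "\<And>x. x \<in> Y \<Longrightarrow> g x \<noteq> 0 \<Longrightarrow> x \<in> cU U"
    by (rule zopE[OF zopen_cU[OF U(1)] U(2)]) blast
  obtain i0 where i0: "z i0 \<noteq> 0" using z(1) by (auto simp: homog_coords_def fun_eq_iff)
  \<comment> \<open>\<open>regf_principal_finite\<close> concerns functions on all vectors.
    Truncation extends the data from \<open>Y\<close>, where it is the identity.\<close>
  define trunc where "trunc = (\<lambda>(a::nat \<Rightarrow> 'k) i. if i \<le> n then a i else 0)"
  have trunc_Y: "trunc a = a" if "a \<in> Y" for a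
    using that by (auto simp: trunc_def homog_coords_def affine_space_def fun_eq_iff)
  have trunc_lam: "lam b u (trunc a) = trunc (lam b u a)" for u a
    by (auto simp: trunc_def lam_def)
  \<comment> \<open>The factor \<open>trunc a i0\<close> keeps the truncated vector nonzero, so that
    \<open>h a \<noteq> 0\<close> puts it into \<open>Y\<close> and into the domain of the
    chart.\<close>
  define h where "h = (\<lambda>a. g (trunc a) * trunc a i0)"
  have h: "h \<in> polyfun" unfolding h_def trunc_def
    by (intro polyfun_intros polyfun_subst[OF g(1)])
  have hz: "h z \<noteq> 0" using g(2) i0 by (simp add: h_def trunc_Y[OF z(1)])
  have hY: "trunc a \<in> Y" "trunc a \<in> cU U" if "h a \<noteq> 0" for a
  proof -
    have "trunc a i0 \<noteq> 0" using that by (simp add: h_def)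
    then have "trunc a \<noteq> (\<lambda>_. 0)" by auto
    then show "trunc a \<in> Y" by (auto simp: homog_coords_def affine_space_def trunc_def)
    then show "trunc a \<in> cU U" using g(3) that by (auto simp: h_def)
  qed
  define sm where "sm = (\<lambda>(w::nat option \<Rightarrow> 'k) i. w (Some i))"
  \<comment> \<open>The coordinate \<open>None\<close> is the group parameter u. Where
    \<open>q\<close> is nonzero, u is invertible and both the truncated point and its translate lie
    in the chart.\<close>
  define q where "q = (\<lambda>w. w None * (h (sm w) * h (lam b (w None) (sm w))))"
  have q: "q \<in> polyfun" unfolding q_def lam_def sm_def
    by (intro polyfun_intros polyfun_subst[OF h])
  define ex ey where "ex = (\<lambda>l. if l then 1 else 0 :: 'k)" and "ey = (\<lambda>l. if l then 0 else 1 :: 'k)"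
  \<comment> \<open>Coordinate \<open>i\<close> of the vector at \<open>a\<close> that arises when
    the standard vector selected by \<open>l\<close>, taken in the chart at
    \<open>lam b u a\<close>, is carried back to \<open>a\<close>.\<close>
  define F where "F = (\<lambda>(l, i::nat) a u. \<phi> (act b (inverse u) (tr \<phi> (lam b u a) (ex l) (ey l))) i)"
  let ?J = "(UNIV :: bool set) \<times> {0, 1 :: nat}"
  have regF: "regf {w. q w \<noteq> 0} (\<lambda>w. F j (trunc (sm w)) (w None))" if "j \<in> ?J" for j
  proof -
    obtain l i where j: "j = (l, i)" by (cases j)
    have "regf {w. q w \<noteq> 0} (\<lambda>w. \<phi> (act b (inverse (w None)) (tr \<phi> (lam b (w None) (trunc (sm w))) (ex l) (ey l))) i)"
    proof (rule act_reg[OF U(1) U(1)])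
      show "regf {w. q w \<noteq> 0} (\<lambda>w. lam b (w None) (trunc (sm w)) k)" for k
        by (intro regf_lam regf_intros regf_polyfun) (auto simp: trunc_def sm_def intro: polyfun_intros)
      show "regf {w. q w \<noteq> 0} (\<lambda>w. inverse (w None))"
        by (intro regf_inverse regf_intros) (auto simp: q_def)
    qed (use that j hY in \<open>auto simp: q_def trunc_lam lam_lam intro: regf_const\<close>)
    then show ?thesis by (simp add: F_def j)
  qed
  have "finite ?J" by simp
  from regf_principal_finite[OF q this regF] obtain M where
    "\<forall>j\<in>?J. \<exists>\<Phi>\<in>polyfun. \<forall>w. q w \<noteq> 0 \<longrightarrow> F j (trunc (sm w)) (w None) * q w ^ M = \<Phi> w" ..
  from bchoice[OF this[unfolded Bex_def]] obtain \<Phi> where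
    "\<forall>j\<in>?J. \<Phi> j \<in> polyfun \<and> (\<forall>w. q w \<noteq> 0 \<longrightarrow> F j (trunc (sm w)) (w None) * q w ^ M = \<Phi> j w)" ..
  then have \<Phi>: "\<And>j. j \<in> ?J \<Longrightarrow> \<Phi> j \<in> polyfun"
    "\<And>j w. j \<in> ?J \<Longrightarrow> q w \<noteq> 0 \<Longrightarrow> F j (trunc (sm w)) (w None) * q w ^ M = \<Phi> j w" by blast+
  define X where "X = (\<lambda>(oi::nat option) (a::nat \<Rightarrow> 'k). case oi of None \<Rightarrow> [:0, 1:] | Some i \<Rightarrow> [:a i:])"
  have X: "pfam (X oi)" for oi
    by (cases oi) (auto simp: X_def intro!: pfam_const pfam_pCons polyfun_intros)
  have X': "(\<lambda>oi. poly (X oi a) u) = case_option u a" for a u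
    by (auto simp: X_def split: option.split)
  have "\<forall>j\<in>?J. \<exists>P. pfam P \<and> (\<forall>a u. poly (P a) u = \<Phi> j (case_option u a))"
  proof
    fix j assume "j \<in> ?J"
    from pfam_subst[where X = X, OF \<Phi>(1)[OF this] X] show "\<exists>P. pfam P \<and> (\<forall>a u. poly (P a) u = \<Phi> j (case_option u a))"
      by (simp only: X')
  qed
  from bchoice[OF this] obtain P where
    "\<forall>j\<in>?J. pfam (P j) \<and> (\<forall>a u. poly (P j a) u = \<Phi> j (case_option u a))" ..
  then have P: "\<And>j. j \<in> ?J \<Longrightarrow> pfam (P j)"
    "\<And>j a u. j \<in> ?J \<Longrightarrow> poly (P j a) u = \<Phi> j (case_option u a)" by blast+
  define X2 where "X2 = (\<lambda>i (a::nat \<Rightarrow> 'k). if (i = 0) = b then [:0, a i:] else [:a i:])"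
  have X2: "pfam (X2 i)" for i
    unfolding X2_def by (cases "(i = 0) = b") (auto intro!: pfam_const pfam_pCons polyfun_intros)
  have X2': "(\<lambda>i. poly (X2 i a) u) = lam b u a" for a u
    by (auto simp: X2_def lam_def)
  from pfam_subst[where X = X2, OF h X2] obtain Hh where Hh: "pfam Hh" "\<And>a u. poly (Hh a) u = h (lam b u a)"
    unfolding X2' by blast
  \<comment> \<open>In \<open>q ^ M\<close> the factor u^M is set apart, so that F = u^(-M) P / Q.
    The constant coefficient of \<open>Q\<close> is nonzero as long as \<open>h\<close> does not
    vanish at \<open>a\<close> and at the limit \<open>lam b 0 a\<close>; the Laurent expansion at u
    = 0 then starts at u^(-M) or later.\<close>
  define Q where "Q = (\<lambda>a. smult (h a ^ M) (Hh a ^ M))"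
  have Q: "pfam Q" unfolding Q_def by (intro pfam_smult pfam_power Hh polyfun_intros h)
  have Q0: "coeff (Q a) 0 = h a ^ M * h (lam b 0 a) ^ M" for a
    by (simp add: Q_def Hh(2) flip: poly_0_coeff_0)
  have key1: "u ^ M * poly (Q a) u * F j a u = poly (P j a) u"
    if "j \<in> ?J" "a \<in> Y" "u \<noteq> 0" "h a \<noteq> 0" "h (lam b u a) \<noteq> 0" for j a u
  proof -
    have sm: "sm (case_option u a) = a" by (auto simp: sm_def)
    have "q (case_option u a) \<noteq> 0" using that by (simp add: q_def sm)
    from \<Phi>(2)[OF that(1) this] show ?thesis using that
      by (simp add: P(2) sm trunc_Y q_def power_mult_distrib Q_def Hh(2) mult_ac)
  qed
  define A0 where "A0 = {a\<in>Y. h a * h (lam b 0 a) \<noteq> 0}"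
  have A0: "zopen Y A0" unfolding A0_def
    by (rule zopen_nonvanishing_polyfun) (auto simp: lam_def intro!: polyfun_intros h polyfun_subst[OF h])
  have A0U: "A0 \<subseteq> cU U"
  proof
    fix a assume "a \<in> A0"
    then have "a \<in> Y" "h a \<noteq> 0" by (auto simp: A0_def)
    then show "a \<in> cU U" using hY(2)[of a] trunc_Y by simp
  qed
  have A0Q: "coeff (Q a) 0 \<noteq> 0" if "a \<in> A0" for a
    using that by (simp add: Q0 A0_def)
  define cs where "cs = (\<lambda>j a. fps_of_poly (P j a) / fps_of_poly (Q a))"
  have cs: "fps_of_poly (P j a) = cs j a * fps_of_poly (Q a)" if "a \<in> A0" for j a
    using A0Q[OF that] unfolding cs_def by (simp add: fps_divide_unit mult.assoc inverse_mult_eq_1)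
  have cs_reg: "regf A0 (\<lambda>a. fps_nth (cs j a) k)" if "j \<in> ?J" for j k
  proof -
    from pfam_quot_coeff[OF P(1)[OF that] Q, of k] obtain C where C: "C \<in> polyfun"
      "\<And>a. coeff (Q a) 0 \<noteq> 0 \<Longrightarrow> fps_nth (cs j a) k * coeff (Q a) 0 ^ Suc k = C a"
      unfolding cs_def by blast
    have "regf A0 (\<lambda>a. C a / coeff (Q a) 0 ^ Suc k)"
    proof (rule regf_divide)
      show "regf A0 (\<lambda>a. coeff (Q a) 0 ^ Suc k)"
        using Q by (intro regf_power regf_polyfun) (simp add: pfam_def)
    qed (use A0Q in \<open>auto intro: regf_polyfun C\<close>)
    moreover have "fps_nth (cs j a) k = C a / coeff (Q a) 0 ^ Suc k" if "a \<in> A0" for a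
      using C(2)[OF A0Q[OF that]] A0Q[OF that] by (simp add: field_simps)
    ultimately show ?thesis by (subst regf_cong) auto
  qed
  \<comment> \<open>The vector of the coefficients of u^(k - M) in the Laurent expansion.\<close>
  define S where "S = (\<lambda>l k a. tr \<phi> a (fps_nth (cs (l, 0) a) k) (fps_nth (cs (l, 1) a) k))"
  have S_sect: "sect A0 (S l k)" for l k
    unfolding S_def by (rule sect_tr[OF U(1) A0U]) (auto intro: cs_reg)
  have S_ch: "\<phi> (S l k a) = vec2 (fps_nth (cs (l, 0) a) k) (fps_nth (cs (l, 1) a) k)" if "a \<in> A0" for l k a
    unfolding S_def using ch_tr[OF U(1)] A0U that by blast
  \<comment> \<open>The vector carried to \<open>lam b v a\<close> with parameter u is the image
    under v of the one carried to \<open>a\<close> with parameter u v. Comparing the coefficients of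
    u^(k - M) produces the factor v^(k - M).\<close>
  have S_hom: "S l k (lam b v a) = fscale E (v powi (int k - int M)) (act b v (S l k a))"
    if a: "a \<in> A0" and v: "v \<noteq> 0" and a': "lam b v a \<in> A0" for l k a v
  proof -
    let ?a' = "lam b v a"
    have Ua: "a \<in> cU U" "?a' \<in> cU U" using a a' A0U by auto
    have Ya: "a \<in> Y" "?a' \<in> Y" using a a' by (auto simp: A0_def)
    define T0 T1 where "T0 = \<phi> (act b v (tr \<phi> a 1 0))" and "T1 = \<phi> (act b v (tr \<phi> a 0 1))"
    have T: "\<phi> (act b v x) i = \<phi> x 0 * T0 i + \<phi> x 1 * T1 i" if x: "x \<in> fib a" for x i
    proof -
      have "x = lc (\<phi> x 0) (\<phi> x 1) (tr \<phi> a 1 0) (tr \<phi> a 0 1)"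
        by (rule ch_eqI[OF U(1) Ua(1)]) (simp_all add: x fib_lc Ya tr_fib[OF U(1) Ua(1)] ch_lc[OF U(1) Ua(1)] ch_tr[OF U(1) Ua(1)])
      then have "\<phi> (act b v x) i = \<phi> (lc (\<phi> x 0) (\<phi> x 1) (act b v (tr \<phi> a 1 0)) (act b v (tr \<phi> a 0 1))) i"
        using act_lc[OF Ya(1) v tr_fib[OF U(1) Ua(1)] tr_fib[OF U(1) Ua(1)]] by metis
      then show ?thesis
        by (simp add: ch_lc[OF U(1) Ua(2)] act_fib[OF Ya(1) v tr_fib[OF U(1) Ua(1)]] T0_def T1_def)
    qed
    have key2: "F (l, i) ?a' u = F (l, 0) a (u * v) * T0 i + F (l, 1) a (u * v) * T1 i"
      if u: "u \<noteq> 0" "h (lam b u ?a') \<noteq> 0" for u i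
    proof -
      let ?c = "lam b (u * v) a"
      have c: "lam b u ?a' = ?c" by (simp add: lam_lam)
      have cY: "?c \<in> Y" using Ya u v by (intro lam_homog_coords) auto
      then have cU': "?c \<in> cU U" using hY(2)[OF u(2)] trunc_Y[OF cY] by (simp add: c)
      let ?x = "tr \<phi> ?c (ex l) (ey l)"
      have x: "?x \<in> fib ?c" by (rule tr_fib[OF U(1) cU'])
      have uv: "inverse (u * v) \<noteq> 0" using u v by simp
      have D: "act b (inverse (u * v)) ?x \<in> fib a"
        using act_fib[OF cY uv x, of b] u v by (simp add: lam_lam mult_ac)
      have "act b (inverse u) ?x = act b v (act b (inverse (u * v)) ?x)"
        unfolding act_act[OF x v uv] using u v by (simp add: field_simps)
      then show ?thesis using T[OF D, of i] by (simp add: F_def c)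
    qed
    let ?v = "[:0, v:]"
    have polyid: "smult (v ^ M) (P (l, i) ?a' * pcompose (Q a) ?v) =
        Q ?a' * (smult (T0 i) (pcompose (P (l, 0) a) ?v) + smult (T1 i) (pcompose (P (l, 1) a) ?v))"
      if i: "i \<in> {0, 1}" for i
    proof -
      have "poly (Hh ?a') 0 \<noteq> 0" using a' by (simp add: Hh(2) A0_def)
      then have "Hh ?a' \<noteq> 0" by auto
      then have fin: "finite ({0} \<union> {u. poly (Hh ?a') u = 0})" using poly_roots_finite by blast
      show ?thesis
      proof (rule poly_eqI_cofinite[OF fin])
        fix u assume "u \<notin> {0} \<union> {u. poly (Hh ?a') u = 0}"
        then have u: "u \<noteq> 0" "h (lam b u ?a') \<noteq> 0" by (auto simp: Hh(2))
        then have u': "u * v \<noteq> 0" "h (lam b (u * v) a) \<noteq> 0" using v by (auto simp: lam_lam)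
        have ha: "h a \<noteq> 0" "h ?a' \<noteq> 0" using a a' by (auto simp: A0_def)
        have 1: "poly (P (l, i) ?a') u = u ^ M * poly (Q ?a') u * F (l, i) ?a' u"
          using i u ha Ya by (intro key1[symmetric]) auto
        have 2: "poly (P (l, j) a) (u * v) = (u * v) ^ M * poly (Q a) (u * v) * F (l, j) a (u * v)" if "j \<in> {0,1}" for j
          using that u' ha Ya by (intro key1[symmetric]) auto
        show "poly (smult (v ^ M) (P (l, i) ?a' * pcompose (Q a) ?v)) u =
          poly (Q ?a' * (smult (T0 i) (pcompose (P (l, 0) a) ?v) + smult (T1 i) (pcompose (P (l, 1) a) ?v))) u"
          by (simp add: poly_pcompose 1 2 key2[OF u] power_mult_distrib algebra_simps)
      qed
    qed
    have coeffs: "v ^ M * fps_nth (cs (l, i) ?a') k = v ^ k * \<phi> (act b v (S l k a)) i" if i: "i \<in> {0, 1}" for i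
    proof -
      let ?o = "\<lambda>f. fps_compose f (fps_const v * fps_X)"
      let ?q = "fps_of_poly (Q a)" and ?q' = "fps_of_poly (Q ?a')"
      have X0: "fps_nth (fps_const v * fps_X) 0 = 0" by simp
      have nz: "?q' \<noteq> 0" "?o ?q \<noteq> 0"
      proof -
        show "?q' \<noteq> 0" using A0Q[OF a'] by (metis coeff_0 fps_of_poly_eq_iff fps_of_poly_0)
        have "fps_nth (?o ?q) 0 \<noteq> 0" using A0Q[OF a] by simp
        then show "?o ?q \<noteq> 0" by (metis fps_zero_nth)
      qed
      have "fps_const (v ^ M) * (fps_of_poly (P (l, i) ?a') * ?o ?q) =
         ?q' * (fps_const (T0 i) * ?o (fps_of_poly (P (l, 0) a)) + fps_const (T1 i) * ?o (fps_of_poly (P (l, 1) a)))"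
        using arg_cong[OF polyid[OF i], of fps_of_poly]
        by (simp only: fps_of_poly_smult fps_of_poly_mult fps_of_poly_add pcompose_scale_nth)
      also have "?o (fps_of_poly (P (l, 0) a)) = ?o (cs (l, 0) a) * ?o ?q"
        unfolding cs[OF a] by (rule fps_compose_mult_distrib[OF X0])
      also have "?o (fps_of_poly (P (l, 1) a)) = ?o (cs (l, 1) a) * ?o ?q"
        unfolding cs[OF a] by (rule fps_compose_mult_distrib[OF X0])
      also have "fps_of_poly (P (l, i) ?a') = cs (l, i) ?a' * ?q'" by (rule cs[OF a'])
      finally have "(?q' * ?o ?q) * (fps_const (v ^ M) * cs (l, i) ?a') =
        (?q' * ?o ?q) * (fps_const (T0 i) * ?o (cs (l, 0) a) + fps_const (T1 i) * ?o (cs (l, 1) a))"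
        by (simp only: algebra_simps)
      then have "fps_const (v ^ M) * cs (l, i) ?a' = fps_const (T0 i) * ?o (cs (l, 0) a) + fps_const (T1 i) * ?o (cs (l, 1) a)"
        using nz by simp
      then have "fps_nth (fps_const (v ^ M) * cs (l, i) ?a') k =
          fps_nth (fps_const (T0 i) * ?o (cs (l, 0) a) + fps_const (T1 i) * ?o (cs (l, 1) a)) k" by simp
      then have "v ^ M * fps_nth (cs (l, i) ?a') k = T0 i * (v ^ k * fps_nth (cs (l, 0) a) k) + T1 i * (v ^ k * fps_nth (cs (l, 1) a) k)"
        by simp
      then show ?thesis using T[OF sect_fib[OF S_sect a], of l k i] by (simp add: S_ch[OF a] algebra_simps)
    qed
    have pw: "v powi (int k - int M) = v ^ k / v ^ M" using v by (simp add: power_int_diff)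
    have Sf: "S l k ?a' \<in> fib ?a'" "act b v (S l k a) \<in> fib ?a'"
      using sect_fib[OF S_sect a'] act_fib[OF Ya(1) v sect_fib[OF S_sect a]] by auto
    show ?thesis
    proof (rule ch_eqI[OF U(1) Ua(2) Sf(1)])
      show "fscale E (v powi (int k - int M)) (act b v (S l k a)) \<in> fib ?a'" by (rule fib_scale[OF Ya(2) Sf(2)])
      show "\<phi> (S l k ?a') 0 = \<phi> (fscale E (v powi (int k - int M)) (act b v (S l k a))) 0"
        using coeffs[of 0] v by (simp add: ch_scale[OF U(1) Ua(2) Sf(2)] S_ch[OF a'] pw field_simps)
      show "\<phi> (S l k ?a') 1 = \<phi> (fscale E (v powi (int k - int M)) (act b v (S l k a))) 1"
        using coeffs[of 1] v by (simp add: ch_scale[OF U(1) Ua(2) Sf(2)] S_ch[OF a'] pw field_simps)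
    qed
  qed
  have zA0: "z \<in> A0" using z hz by (simp add: A0_def)
  \<comment> \<open>The hypothesis on \<open>z\<close> says that the coordinates scaled by
    \<open>lam b\<close> are zero, so every \<open>lam b u\<close> fixes \<open>z\<close>.\<close>
  have lamz: "lam b u z = z" for u
  proof
    fix i show "lam b u z i = z i" using fun_cong[OF z(2), of i] by (auto simp: lam_def)
  qed
  define \<kappa> where "\<kappa> = h z ^ M * h z ^ M"
  have \<kappa>: "\<kappa> \<noteq> 0" using hz by (simp add: \<kappa>_def)
  have Qz: "Q z = [:\<kappa>:]"
    by (rule poly_eqI_cofinite[of "{}"]) (simp_all add: Q_def Hh(2) lamz \<kappa>_def)
  have csz: "fps_nth (cs j z) k = coeff (P j z) k / \<kappa>" for j k
    using \<kappa> by (simp add: cs_def Qz fps_of_poly_const fps_divide_unit fps_const_inverse divide_inverse)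
  have Fz: "F (l, i) z 1 = vec2 (ex l) (ey l) i" for l i
    by (simp add: F_def lamz act_1[OF tr_fib[OF U]] ch_tr[OF U])
  define K where "K = (\<Sum>j\<in>?J. degree (P j z))"
  \<comment> \<open>At u = 1 the transport over the fixed point is the identity. Since
    \<open>Q z\<close> is constant, the expansion is a finite sum there, and \<open>K\<close> bounds
    the degrees of all numerators.\<close>
  have sumz: "(\<Sum>k\<le>K. fps_nth (cs (l, i) z) k) = vec2 (ex l) (ey l) i" if "i \<in> {0, 1}" for l i
  proof -
    have "degree (P (l, i) z) \<le> K" unfolding K_def
      by (rule member_le_sum) (use that in auto)
    then have "poly (P (l, i) z) 1 = (\<Sum>k\<le>K. coeff (P (l, i) z) k)"
      unfolding poly_altdef by (simp, intro sum.mono_neutral_left) (auto simp: coeff_eq_0)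
    moreover have "poly (P (l, i) z) 1 = \<kappa> * vec2 (ex l) (ey l) i"
      using key1[of "(l, i)" z 1] that z hz by (simp add: lamz Qz Fz)
    ultimately show ?thesis using \<kappa> by (simp add: csz field_simps flip: sum_divide_distrib)
  qed
  \<comment> \<open>Bilinear expansion of the determinant of the two standard vectors. Its value is
    1, so some pair of coefficient vectors is independent.\<close>
  have "(\<Sum>k\<le>K. \<Sum>k'\<le>K. fps_nth (cs (True, 0) z) k * fps_nth (cs (False, 1) z) k' -
      fps_nth (cs (True, 1) z) k * fps_nth (cs (False, 0) z) k') =
    (\<Sum>k\<le>K. fps_nth (cs (True, 0) z) k) * (\<Sum>k\<le>K. fps_nth (cs (False, 1) z) k) -
      (\<Sum>k\<le>K. fps_nth (cs (True, 1) z) k) * (\<Sum>k\<le>K. fps_nth (cs (False, 0) z) k)"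
    by (simp add: sum_product sum_subtractf)
  also have "\<dots> = 1" by (simp add: sumz ex_def ey_def)
  finally obtain k k' where kk: "fps_nth (cs (True, 0) z) k * fps_nth (cs (False, 1) z) k' -
      fps_nth (cs (True, 1) z) k * fps_nth (cs (False, 0) z) k' \<noteq> 0"
    using ex_sum_nonzero by (metis (mono_tags, lifting) zero_neq_one)
  have "basis_at z (S True k z) (S False k' z)"
    using kk by (intro basI[OF U] sect_fib[OF S_sect zA0]) (simp add: chart_det_def S_ch[OF zA0])
  moreover have "zopen Y {a\<in>A0. basis_at a (S True k a) (S False k' a)}"
    by (rule zopen_basis_at[OF S_sect S_sect A0])
  ultimately show ?thesis using zA0 S_hom
    by (intro exI[of _ "{a\<in>A0. basis_at a (S True k a) (S False k' a)}"] exI[of _ "S True k"] exI[of _ "S False k'"]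
      exI[of _ "int k - int M"] exI[of _ "int k' - int M"]) (auto intro: sect_subset[OF S_sect])
qed

text \<open>The set \<open>A\<close> consists of entire attracting orbits: \<open>lam b 0\<close> projects to the fixed points, the
  hyperplane at infinity for \<open>b = True\<close> and the point \<open>[1:0:\<dots>:0]\<close> for \<open>b = False\<close>.\<close>

definition hframe :: "bool \<Rightarrow> (nat \<Rightarrow> 'k) set \<Rightarrow> ((nat \<Rightarrow> 'k) \<Rightarrow> 'e) \<Rightarrow> ((nat \<Rightarrow> 'k) \<Rightarrow> 'e) \<Rightarrow> int \<Rightarrow> int \<Rightarrow> bool" where
  "hframe b A s1 s2 m1 m2 \<longleftrightarrow> zopen Y A \<and> (\<forall>a\<in>A. lam b 0 a \<in> A) \<and> (\<forall>a\<in>Y. lam b 0 a \<in> A \<longrightarrow> a \<in> A) \<and>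
     sect A s1 \<and> sect A s2 \<and> (\<forall>a\<in>A. basis_at a (s1 a) (s2 a)) \<and>
     (\<forall>a\<in>A. \<forall>u. u \<noteq> 0 \<longrightarrow>
        s1 (lam b u a) = fscale E (u powi m1) (act b u (s1 a)) \<and>
        s2 (lam b u a) = fscale E (u powi m2) (act b u (s2 a)))"

text \<open>Each point of \<open>A'\<close> is moved into \<open>A\<close> by some u, evaluated
  there, moved back, and rescaled by u^(-m). Homogeneity of \<open>s\<close> makes the result
  independent of u, so locally one fixed u may be used and regularity follows from
  \<open>sect_pull\<close>.\<close>

lemma extend_homogeneous_section:
  assumes A: "zopen Y A" "sect A s"
    and hom: "\<And>a u. a \<in> A \<Longrightarrow> u \<noteq> 0 \<Longrightarrow> lam b u a \<in> A \<Longrightarrow> s (lam b u a) = fscale E (u powi m) (act b u (s a))"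
    and A': "A' \<subseteq> Y" "\<And>a. a \<in> A' \<Longrightarrow> \<exists>u. u \<noteq> 0 \<and> lam b u a \<in> A" "\<And>a u. a \<in> A' \<Longrightarrow> u \<noteq> 0 \<Longrightarrow> lam b u a \<in> A'"
  shows "\<exists>t. sect A' t \<and> (\<forall>a\<in>A'. \<forall>u. u \<noteq> 0 \<longrightarrow> t (lam b u a) = fscale E (u powi m) (act b u (t a))) \<and>
    (\<forall>a\<in>A'. \<forall>u. u \<noteq> 0 \<longrightarrow> lam b u a \<in> A \<longrightarrow> t a = fscale E (u powi (-m)) (act b (inverse u) (s (lam b u a))))"
proof -
  define w where "w = (\<lambda>a. SOME u. u \<noteq> 0 \<and> lam b u a \<in> A)"
  have w: "w a \<noteq> 0" "lam b (w a) a \<in> A" if "a \<in> A'" for a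
    using someI_ex[OF A'(2)[OF that]] unfolding w_def by auto
  define t where "t = (\<lambda>a. fscale E (w a powi (-m)) (act b (inverse (w a)) (s (lam b (w a) a))))"
  have t: "t a = fscale E (u powi (-m)) (act b (inverse u) (s (lam b u a)))"
    if a: "a \<in> A'" and u: "u \<noteq> 0" "lam b u a \<in> A" for a u
  proof -
    let ?v = "w a"
    note v = w[OF a]
    let ?x = "s (lam b u a)"
    have uY: "lam b u a \<in> Y" using u(2) A(1) zopen_subset by blast
    have x: "?x \<in> fib (lam b u a)" using sect_fib[OF A(2) u(2)] .
    have q: "?v / u \<noteq> 0" using u v by simp
    have vY: "lam b ?v a \<in> Y" using v A(1) zopen_subset by blast
    have l: "lam b (?v / u) (lam b u a) = lam b ?v a" using u by (simp add: lam_lam)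
    have "s (lam b ?v a) = fscale E ((?v / u) powi m) (act b (?v / u) ?x)"
      using hom[OF u(2) q] v by (simp add: l)
    moreover have x': "act b (?v / u) ?x \<in> fib (lam b ?v a)" using act_fib[OF uY q x, of b] by (simp add: l)
    ultimately have "act b (inverse ?v) (s (lam b ?v a)) = fscale E ((?v / u) powi m) (act b (inverse ?v) (act b (?v / u) ?x))"
      using act_fscale[OF vY _ x', of "inverse ?v" b] v by simp
    also have "act b (inverse ?v) (act b (?v / u) ?x) = act b (inverse u) ?x"
      using act_act[OF x _ q, of "inverse ?v"] v u by (simp add: field_simps)
    finally have "t a = fscale E (?v powi (-m)) (fscale E ((?v / u) powi m) (act b (inverse u) ?x))"
      by (simp add: t_def)
    also have "\<dots> = fscale E (?v powi (-m) * (?v / u) powi m) (act b (inverse u) ?x)"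
      using act_fib[OF uY _ x, of "inverse u" b] u by (intro fs_fs[of "lam b (inverse u) (lam b u a)"]) (auto intro: lam_homog_coords uY)
    also have "?v powi (-m) * (?v / u) powi m = u powi (-m)"
      using u v by (simp add: power_int_divide_distrib power_int_minus field_simps)
    finally show ?thesis .
  qed
  have "sect A' t"
  proof (rule sect_glue[OF A'(1)])
    fix a assume a: "a \<in> A'"
    let ?u = "w a"
    let ?B = "{x\<in>Y. lam b ?u x \<in> A}"
    have "sect ?B (\<lambda>x. fscale E (?u powi (-m)) (act b (inverse ?u) (s (lam b ?u x))))"
      by (intro sect_fscale sect_pull A(2) w[OF a] regf_const)
    then have "sect (A' \<inter> ?B) (\<lambda>x. fscale E (?u powi (-m)) (act b (inverse ?u) (s (lam b ?u x))))"
      by (rule sect_subset) auto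
    then have "sect (A' \<inter> ?B) t" by (rule sect_eq) (use t w(1)[OF a] in auto)
    then show "\<exists>B. zopen Y B \<and> a \<in> B \<and> sect (A' \<inter> B) t"
      using zopen_lam[OF A(1) w(1)[OF a], of b] a w[OF a] A'(1) by (intro exI[of _ ?B]) auto
  qed
  moreover have "t (lam b v a) = fscale E (v powi m) (act b v (t a))" if a: "a \<in> A'" and v: "v \<noteq> 0" for a v
  proof -
    have va: "lam b v a \<in> A'" using A'(3)[OF a v] .
    let ?u = "w (lam b v a)"
    note u = w[OF va]
    let ?c = "lam b (?u * v) a"
    have cA: "?c \<in> A" using u(2) by (simp add: lam_lam)
    have cY: "?c \<in> Y" using cA A(1) zopen_subset by blast
    have x: "s ?c \<in> fib ?c" using sect_fib[OF A(2) cA] .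
    have nz: "?u * v \<noteq> 0" "inverse (?u * v) \<noteq> 0" using u v by auto
    have aY: "a \<in> Y" using a A'(1) by auto
    have D: "act b (inverse (?u * v)) (s ?c) \<in> fib a"
      using act_fib[OF cY nz(2) x, of b] nz by (simp add: lam_lam mult_ac)
    have 1: "t (lam b v a) = fscale E (?u powi (-m)) (act b (inverse ?u) (s ?c))"
      using t[OF va u] by (simp only: lam_lam)
    have "t a = fscale E ((?u * v) powi (-m)) (act b (inverse (?u * v)) (s ?c))"
      using t[OF a nz(1) cA] .
    moreover have "v * inverse (?u * v) = inverse ?u" using u v by (simp add: field_simps)
    ultimately have "act b v (t a) = fscale E ((?u * v) powi (-m)) (act b (inverse ?u) (s ?c))"
      using act_fscale[OF aY v D, of b] act_act[OF x v nz(2), of b] by (simp only:)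
    then have "fscale E (v powi m) (act b v (t a)) = fscale E (v powi m * (?u * v) powi (-m)) (act b (inverse ?u) (s ?c))"
      using act_fib[OF cY _ x, of "inverse ?u" b] u
      by (simp only: fs_fs[of "lam b (inverse ?u) ?c"] lam_homog_coords cY inverse_nonzero_iff_nonzero not_False_eq_True)
    moreover have "v powi m * (?u * v) powi (-m) = ?u powi (-m)"
      using u v by (simp add: power_int_mult_distrib power_int_minus field_simps)
    ultimately show ?thesis using 1 by (simp only:)
  qed
  ultimately show ?thesis using t by blast
qed

text \<open>The domain is enlarged to all points whose limit \<open>lam b 0 a\<close> lies in
  \<open>A\<close>. Membership in \<open>A\<close> is an open condition on u that holds at u = 0,
  hence also for some nonzero u, and the sections extend along the orbit.\<close>

lemma ex_hframe:
  assumes z: "z \<in> Y" "lam b 0 z = z"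
  shows "\<exists>A s1 s2 m1 m2. hframe b A s1 s2 m1 m2 \<and> z \<in> A"
proof -
  from ex_local_homogeneous_frame[OF z] obtain A s1 s2 m1 m2 where A: "zopen Y A" "z \<in> A" "sect A s1" "sect A s2"
    and basis_at: "\<And>a. a \<in> A \<Longrightarrow> basis_at a (s1 a) (s2 a)"
    and hom: "\<And>a u. a \<in> A \<Longrightarrow> u \<noteq> 0 \<Longrightarrow> lam b u a \<in> A \<Longrightarrow> s1 (lam b u a) = fscale E (u powi m1) (act b u (s1 a))"
      "\<And>a u. a \<in> A \<Longrightarrow> u \<noteq> 0 \<Longrightarrow> lam b u a \<in> A \<Longrightarrow> s2 (lam b u a) = fscale E (u powi m2) (act b u (s2 a))"
    by blast
  define A' where "A' = {a\<in>Y. lam b 0 a \<in> A}"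
  have A'Y: "A' \<subseteq> Y" by (auto simp: A'_def)
  have AY: "A \<subseteq> Y" using A(1) zopen_subset by blast
  have zopA': "zopen Y A'"
  proof (rule zopen_glue[OF A'Y])
    fix a assume a: "a \<in> A'"
    then obtain G where G: "G \<in> polyfun" "G (lam b 0 a) \<noteq> 0" "\<And>x. x \<in> Y \<Longrightarrow> G x \<noteq> 0 \<Longrightarrow> x \<in> A"
      using zopE[OF A(1), of "lam b 0 a"] unfolding A'_def by blast
    have aY: "lam b 0 a \<in> Y" using a AY by (auto simp: A'_def)
    then obtain i where i: "lam b 0 a i \<noteq> 0" by (auto simp: homog_coords_def fun_eq_iff)
    \<comment> \<open>The first factor keeps the limit point away from the origin, which lies
      outside \<open>Y\<close>.\<close>
    have "(\<lambda>x. lam b 0 x i * G (lam b 0 x)) \<in> polyfun"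
      unfolding lam_def by (intro polyfun_intros polyfun_subst[OF G(1)])
    from zopen_nonvanishing_polyfun[OF this, of Y]
    have "zopen Y {x\<in>Y. lam b 0 x i * G (lam b 0 x) \<noteq> 0}" .
    moreover have "{x\<in>Y. lam b 0 x i * G (lam b 0 x) \<noteq> 0} \<subseteq> A'"
    proof
      fix x assume x: "x \<in> {x\<in>Y. lam b 0 x i * G (lam b 0 x) \<noteq> 0}"
      then have "lam b 0 x \<noteq> (\<lambda>_. 0)" by (metis (mono_tags, lifting) mem_Collect_eq mult_zero_left)
      then have "lam b 0 x \<in> Y" using x by (auto simp: homog_coords_def affine_space_def lam_def)
      with x G(3) show "x \<in> A'" by (auto simp: A'_def)
    qed
    ultimately show "\<exists>B. zopen Y B \<and> a \<in> B \<and> B \<subseteq> A'" using a i G(2) A'Y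
      by (intro exI[of _ "{x\<in>Y. lam b 0 x i * G (lam b 0 x) \<noteq> 0}"]) auto
  qed
  have ex: "\<exists>u. u \<noteq> 0 \<and> lam b u a \<in> A" if a: "a \<in> A'" for a
  proof -
    obtain G where G: "G \<in> polyfun" "G (lam b 0 a) \<noteq> 0" "\<And>x. x \<in> Y \<Longrightarrow> G x \<noteq> 0 \<Longrightarrow> x \<in> A"
      using zopE[OF A(1), of "lam b 0 a"] a unfolding A'_def by blast
    have l: "lam b u a = (\<lambda>i. (if (i = 0) = b then 0 else a i) + u * (if (i = 0) = b then a i else 0))" for u
      by (auto simp: lam_def)
    obtain p where p: "\<And>u. poly p u = G (lam b u a)"
      using polyfun_line[OF G(1), of "\<lambda>i. if (i = 0) = b then 0 else a i" "\<lambda>i. if (i = 0) = b then a i else 0"]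
      unfolding l by blast
    have "p \<noteq> 0" using p[of 0] G(2) by auto
    from poly_nonzero_ex[OF this, of "{0}"] obtain u where "u \<noteq> 0" "poly p u \<noteq> 0" by auto
    then show ?thesis using G(3)[of "lam b u a"] a by (auto simp: p A'_def intro: lam_homog_coords)
  qed
  have sat: "lam b u a \<in> A'" if "a \<in> A'" "u \<noteq> 0" for a u
    using that by (auto simp: A'_def lam_lam intro: lam_homog_coords)
  from extend_homogeneous_section[OF A(1,3) hom(1) A'Y ex sat]
  obtain t1 where t1: "sect A' t1" "\<And>a u. a \<in> A' \<Longrightarrow> u \<noteq> 0 \<Longrightarrow> t1 (lam b u a) = fscale E (u powi m1) (act b u (t1 a))"
    "\<And>a u. a \<in> A' \<Longrightarrow> u \<noteq> 0 \<Longrightarrow> lam b u a \<in> A \<Longrightarrow> t1 a = fscale E (u powi (-m1)) (act b (inverse u) (s1 (lam b u a)))"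
    by blast
  from extend_homogeneous_section[OF A(1,4) hom(2) A'Y ex sat]
  obtain t2 where t2: "sect A' t2" "\<And>a u. a \<in> A' \<Longrightarrow> u \<noteq> 0 \<Longrightarrow> t2 (lam b u a) = fscale E (u powi m2) (act b u (t2 a))"
    "\<And>a u. a \<in> A' \<Longrightarrow> u \<noteq> 0 \<Longrightarrow> lam b u a \<in> A \<Longrightarrow> t2 a = fscale E (u powi (-m2)) (act b (inverse u) (s2 (lam b u a)))"
    by blast
  have "basis_at a (t1 a) (t2 a)" if a: "a \<in> A'" for a
  proof -
    obtain u where u: "u \<noteq> 0" "lam b u a \<in> A" using ex[OF a] by blast
    have "basis_at (lam b (inverse u) (lam b u a)) (act b (inverse u) (s1 (lam b u a))) (act b (inverse u) (s2 (lam b u a)))"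
      using u by (intro basis_at_act basis_at) auto
    then show ?thesis using u unfolding t1(3)[OF a u] t2(3)[OF a u]
      by (intro basis_at_fs) (auto simp: lam_lam power_int_eq_0_iff)
  qed
  moreover have "z \<in> A'" using A(2) z by (simp add: A'_def)
  moreover have "lam b 0 a \<in> A'" if "a \<in> A'" for a using that AY by (auto simp: A'_def lam_lam)
  moreover have "a \<in> A'" if "a \<in> Y" "lam b 0 a \<in> A'" for a using that by (auto simp: A'_def lam_lam)
  ultimately show ?thesis unfolding hframe_def using zopA' t1(1,2) t2(1,2) by blast
qed

end

section \<open>Polynomials in three variables\<close>

text \<open>Division by a greatest common divisor. Coprimality of \<open>p\<close> and
  \<open>q\<close> appears in the form in which it is applied: every pair proportional to (p, q) is
  a multiple of it.\<close>

lemma ufd_coprime_part: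
  fixes a b :: "'a::ufd"
  assumes "a \<noteq> 0"
  shows "\<exists>D p q. a = D * p \<and> b = D * q \<and> (\<forall>p' q'. p' * q = q' * p \<longrightarrow> (\<exists>u. p' = p * u \<and> q' = q * u))"
proof -
  define D where "D = some_gcd a b"
  obtain p q where pq: "a = D * p" "b = D * q" using some_gcd.gcd_dvd1 some_gcd.gcd_dvd2 unfolding D_def by (metis dvdE)
  have nz: "D \<noteq> 0" "p \<noteq> 0" using assms pq by auto
  have "\<exists>u. p' = p * u \<and> q' = q * u" if eq: "p' * q = q' * p" for p' q'
  proof -
    have "b * p' = a * q'" using arg_cong[OF eq, of "\<lambda>x. D * x"] unfolding pq by (simp add: mult_ac)
    then have "a dvd b * p'" by simp
    then have "a dvd D * p'" unfolding D_def by (intro some_gcd.gcd_greatest_mult) auto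
    then have "D * p dvd D * p'" using pq(1) by simp
    then have "p dvd p'" using nz by simp
    then obtain u where u: "p' = p * u" by (rule dvdE)
    with eq have "p * (u * q) = p * q'" by (simp add: mult_ac)
    then have "q' = q * u" using nz by (simp add: mult_ac)
    with u show ?thesis by blast
  qed
  with pq show ?thesis by blast
qed

text \<open>Variables are nested, with x innermost, then y, and in \<open>ev3\<close> t outermost.
  The nested ring is a unique factorisation domain, and the resultant eliminates t.\<close>

definition ev2 :: "'k::field poly poly \<Rightarrow> 'k \<Rightarrow> 'k \<Rightarrow> 'k" where
  "ev2 c x y = poly (poly c [:y:]) x"

definition ev3 :: "'k::field poly poly poly \<Rightarrow> 'k \<Rightarrow> 'k \<Rightarrow> 'k \<Rightarrow> 'k" where
  "ev3 P x y t = poly (map_poly (\<lambda>c. ev2 c x y) P) t"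

lemma ev2_hom: "comm_ring_hom (\<lambda>c. ev2 c x y)"
  by unfold_locales (auto simp: ev2_def)

lemma ev2_pCons [simp]: "ev2 (pCons p c) x y = poly p x + y * ev2 c x y"
  by (simp add: ev2_def)

lemma ev2_simps [simp]: "ev2 0 x y = 0" "ev2 1 x y = 1" "ev2 (c + d) x y = ev2 c x y + ev2 d x y"
  "ev2 (c * d) x y = ev2 c x y * ev2 d x y" "ev2 (c - d) x y = ev2 c x y - ev2 d x y"
  by (auto simp: ev2_def)

lemma ev3_pCons [simp]: "ev3 (pCons c P) x y t = ev2 c x y + t * ev3 P x y t"
  by (cases "c = 0 \<and> P = 0") (auto simp: ev3_def map_poly_pCons)

lemma ev3_simps [simp]: "ev3 0 x y t = 0" "ev3 1 x y t = 1" "ev3 (P + Q) x y t = ev3 P x y t + ev3 Q x y t"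
  "ev3 (P * Q) x y t = ev3 P x y t * ev3 Q x y t" "ev3 (P - Q) x y t = ev3 P x y t - ev3 Q x y t"
proof -
  interpret h: comm_ring_hom "\<lambda>c. ev2 c x y" by (rule ev2_hom)
  interpret m: map_poly_comm_ring_hom "\<lambda>c. ev2 c x y" ..
  show "ev3 0 x y t = 0" "ev3 1 x y t = 1" "ev3 (P + Q) x y t = ev3 P x y t + ev3 Q x y t"
    "ev3 (P * Q) x y t = ev3 P x y t * ev3 Q x y t" "ev3 (P - Q) x y t = ev3 P x y t - ev3 Q x y t"
    by (simp_all add: ev3_def m.hom_add m.hom_mult m.hom_minus m.hom_one)
qed

lemma ev2_sum: "ev2 c x y = (\<Sum>i\<le>degree c. poly (coeff c i) x * y ^ i)"
  by (simp add: ev2_def poly_altdef[of c] poly_sum poly_mult poly_power)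

lemma ev3_sum: "ev3 P x y t = (\<Sum>i\<le>degree P. ev2 (coeff P i) x y * t ^ i)"
proof -
  have "ev3 P x y t = (\<Sum>i\<le>degree (map_poly (\<lambda>c. ev2 c x y) P). coeff (map_poly (\<lambda>c. ev2 c x y) P) i * t ^ i)"
    unfolding ev3_def by (rule poly_altdef)
  also have "\<dots> = (\<Sum>i\<le>degree P. coeff (map_poly (\<lambda>c. ev2 c x y) P) i * t ^ i)"
    by (rule sum.mono_neutral_left) (auto simp: coeff_eq_0 degree_map_poly_le intro: order_trans)
  finally show ?thesis by (simp add: coeff_map_poly)
qed

lemma ev2_polyfun: "(\<lambda>v::nat \<Rightarrow> 'k::field. ev2 c (v i) (v j)) \<in> polyfun"
  unfolding ev2_sum poly_altdef by (intro polyfun_intros)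

lemma ev3_polyfun: "(\<lambda>v::nat \<Rightarrow> 'k::field. ev3 P (v i) (v j) (v k)) \<in> polyfun"
  unfolding ev3_sum by (intro polyfun_intros ev2_polyfun)

lemma ev2_line:
  fixes c :: "'k::field poly poly"
  shows "\<exists>p. \<forall>s. poly p s = ev2 c (x + s * x') (y + s * y')"
  using polyfun_line[OF ev2_polyfun[of c 0 1], of "\<lambda>i. if i = 0 then x else y" "\<lambda>i. if i = 0 then x' else y'"] by simp

lemma ev3_line:
  fixes P :: "'k::field poly poly poly"
  shows "\<exists>p. \<forall>s. poly p s = ev3 P (x + s * x') (y + s * y') (t + s * t')"
  using polyfun_line[OF ev3_polyfun[of P 0 1 2], of "\<lambda>i. if i = 0 then x else if i = 1 then y else t"
    "\<lambda>i. if i = 0 then x' else if i = 1 then y' else t'"] by simp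

lemma ev2_zero:
  fixes c :: "'k::alg_closed_field poly poly"
  assumes "\<And>x y. ev2 c x y = 0"
  shows "c = 0"
proof (rule ccontr)
  assume "c \<noteq> 0"
  then have "finite {q. poly c q = 0}" by (rule poly_roots_finite)
  moreover have "poly c [:y:] = 0" for y
    by (rule poly_eqI_cofinite[of "{}"]) (use assms in \<open>auto simp: ev2_def\<close>)
  then have "range (\<lambda>y. [:y:]) \<subseteq> {q. poly c q = 0}" by auto
  ultimately have "finite (range (\<lambda>y::'k. [:y:]))" by (rule finite_subset[rotated])
  then have "finite (UNIV :: 'k set)" by (rule finite_imageD) (auto simp: inj_on_def)
  then show False using infinite_UNIV_alg_closed by blast
qed

lemma ev3_zero:
  fixes P :: "'k::alg_closed_field poly poly poly"
  assumes "\<And>x y t. ev3 P x y t = 0"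
  shows "P = 0"
proof (rule poly_eqI)
  fix j
  have "map_poly (\<lambda>c. ev2 c x y) P = 0" for x y
    by (rule poly_eqI_cofinite[of "{}"]) (use assms in \<open>auto simp: ev3_def\<close>)
  then have "ev2 (coeff P j) x y = 0" for x y
    by (metis coeff_0 coeff_map_poly ev2_simps(1))
  then have "coeff P j = 0" by (rule ev2_zero)
  then show "coeff P j = coeff 0 j" by simp
qed

text \<open>The difference times the last variable vanishes everywhere. Points with t nonzero lie
  off the origin, where the assumptions on a family of lines apply.\<close>

lemma ev3_eqI:
  fixes P Q :: "'k::alg_closed_field poly poly poly"
  assumes "\<And>x y t. t \<noteq> 0 \<Longrightarrow> ev3 P x y t = ev3 Q x y t"
  shows "P = Q"
proof -
  have "(P - Q) * [:0, 1:] = 0"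
  proof (rule ev3_zero)
    fix x y t :: 'k
    have "ev3 [:0, 1:] x y t = t" by (simp add: ev3_def map_poly_pCons)
    then show "ev3 ((P - Q) * [:0, 1:]) x y t = 0" using assms[of t x y]
      by (cases "t = 0") (simp_all only: ev3_simps, simp_all)
  qed
  then show ?thesis by (simp only: mult_eq_0_iff) simp
qed

lemma polyfun_ev3:
  fixes f :: "(nat \<Rightarrow> 'k::field) \<Rightarrow> 'k"
  assumes "f \<in> polyfun"
  shows "\<exists>P. \<forall>x y t. ev3 P x y t = f (\<lambda>i. x * a i + y * b i + t * c i)"
  using assms
proof induction
  case (const k)
  show ?case by (intro exI[of _ "[:[:[:k:]:]:]"]) simp
next
  case (coord i)
  show ?case by (intro exI[of _ "[:[:[:0, a i:], [:b i:]:], [:[:c i:]:]:]"]) simp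
next
  case (add f g)
  then obtain P Q where "\<forall>x y t. ev3 P x y t = f (\<lambda>i. x * a i + y * b i + t * c i)"
    "\<forall>x y t. ev3 Q x y t = g (\<lambda>i. x * a i + y * b i + t * c i)" by blast
  then show ?case by (intro exI[of _ "P + Q"]) simp
next
  case (mult f g)
  then obtain P Q where "\<forall>x y t. ev3 P x y t = f (\<lambda>i. x * a i + y * b i + t * c i)"
    "\<forall>x y t. ev3 Q x y t = g (\<lambda>i. x * a i + y * b i + t * c i)" by blast
  then show ?case by (intro exI[of _ "P * Q"]) simp
qed

lemma ev3_scale_ex:
  fixes P :: "'k::field poly poly poly"
  shows "\<exists>P'. \<forall>x y t. ev3 P' x y t = ev3 P (s * x) (s * y) (s * t)"
  using polyfun_ev3[OF ev3_polyfun[of P 0 1 2], of "\<lambda>i. if i = 0 then s else 0" "\<lambda>i. if i = 1 then s else 0"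
    "\<lambda>i. if i = 2 then s else 0"] by (simp add: mult.commute)

lemma ev3_unit:
  fixes U V :: "'k::alg_closed_field poly poly poly"
  assumes "U * V = 1"
  shows "\<exists>l. l \<noteq> 0 \<and> (\<forall>x y t. ev3 U x y t = l)"
proof -
  have "U dvd 1" using assms by (metis dvd_triv_left)
  then obtain c where c: "U = [:c:]" "c dvd 1" unfolding is_unit_poly_iff by blast
  from c(2) obtain d where d: "c = [:d:]" "d dvd 1" unfolding is_unit_poly_iff by blast
  from d(2) obtain l where l: "d = [:l:]" "l dvd 1" unfolding is_unit_poly_iff by blast
  then show ?thesis by (intro exI[of _ l]) (auto simp: c d)
qed

text \<open>The cofactor for \<open>s\<close> and the rescaled cofactor for the inverse of
  \<open>s\<close> have product 1. So the cofactor is a unit of the polynomial ring, that is, a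
  nonzero constant.\<close>

lemma ev3_semi_invariant:
  fixes P :: "'k::alg_closed_field poly poly poly"
  assumes P: "P \<noteq> 0" and dv: "\<And>s. s \<noteq> 0 \<Longrightarrow> \<exists>U. \<forall>x y t. ev3 P (s * x) (s * y) (s * t) = ev3 P x y t * ev3 U x y t"
    and s: "s \<noteq> 0"
  shows "\<exists>l. l \<noteq> 0 \<and> (\<forall>x y t. ev3 P (s * x) (s * y) (s * t) = l * ev3 P x y t)"
proof -
  obtain U where U: "\<And>x y t. ev3 P (s * x) (s * y) (s * t) = ev3 P x y t * ev3 U x y t" using dv[OF s] by blast
  obtain V where V: "\<And>x y t. ev3 P (inverse s * x) (inverse s * y) (inverse s * t) = ev3 P x y t * ev3 V x y t"
    using dv[of "inverse s"] s by auto
  obtain V' where V': "\<And>x y t. ev3 V' x y t = ev3 V (s * x) (s * y) (s * t)" using ev3_scale_ex by blast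
  have "P * (U * V' - 1) = 0"
  proof (rule ev3_zero)
    fix x y t
    have "ev3 P x y t = ev3 P (s * x) (s * y) (s * t) * ev3 V' x y t"
      using V[of "s * x" "s * y" "s * t"] s by (simp add: V' mult.assoc[symmetric])
    then show "ev3 (P * (U * V' - 1)) x y t = 0" by (simp add: U algebra_simps)
  qed
  then have "U * V' = 1" using P by simp
  from ev3_unit[OF this] obtain l where "l \<noteq> 0" "\<And>x y t. ev3 U x y t = l" by blast
  then show ?thesis using U by (intro exI[of _ l]) (simp add: mult.commute)
qed

text \<open>After removal of the largest power of the variable no root is left, so the remaining
  factor is constant.\<close>

lemma poly_only_zero_root:
  fixes p :: "'k::alg_closed_field poly"
  assumes "\<And>s. s \<noteq> 0 \<Longrightarrow> poly p s \<noteq> 0"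
  shows "\<exists>c m. c \<noteq> 0 \<and> p = monom c m"
proof -
  have "p \<noteq> 0" using assms[of 1] by auto
  obtain q where q: "p = [:- 0, 1:] ^ Polynomial.order 0 p * q" "\<not> [:- 0, 1:] dvd q"
    using order_decomp[OF \<open>p \<noteq> 0\<close>] by blast
  have "poly q s \<noteq> 0" for s
  proof (cases "s = 0")
    case True then show ?thesis using q(2) by (simp add: poly_eq_0_iff_dvd)
  next
    case False
    then show ?thesis using assms[OF False] q(1) by (metis mult_zero_right poly_mult)
  qed
  then have "degree q = 0" using alg_closed_imp_poly_has_root by blast
  then obtain c where "q = [:c:]" by (rule degree_eq_zeroE)
  moreover have "c \<noteq> 0" using q(1) \<open>p \<noteq> 0\<close> calculation by auto
  ultimately have "p = monom c (Polynomial.order 0 p)" using q(1) by (simp add: monom_altdef)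
  with \<open>c \<noteq> 0\<close> show ?thesis by blast
qed

lemma coeff_pcompose_scale:
  fixes p :: "'k::field poly"
  shows "coeff (pcompose p [:0, s:]) j = s ^ j * coeff p j"
proof -
  have "coeff (pcompose p [:0, s:]) j = fps_nth (fps_of_poly (pcompose p [:0, s:])) j" by simp
  then show ?thesis unfolding pcompose_scale_nth by simp
qed

text \<open>A semi-invariant polynomial is homogeneous, so its leading coefficient in the last variable is
  a constant unless the polynomial vanishes at \<open>(0, 0, 1)\<close>.\<close>

lemma ev3_homogeneous_lead:
  fixes P :: "'k::alg_closed_field poly poly poly"
  assumes P1: "ev3 P 0 0 1 \<noteq> 0"
    and hom: "\<And>s. s \<noteq> 0 \<Longrightarrow> \<exists>l. l \<noteq> 0 \<and> (\<forall>x y t. ev3 P (s * x) (s * y) (s * t) = l * ev3 P x y t)"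
  shows "\<exists>c. c \<noteq> 0 \<and> lead_coeff P = [:[:c:]:] \<and> (\<forall>t. ev3 P 0 0 t = c * t ^ degree P)"
proof -
  let ?h = "\<lambda>x y. map_poly (\<lambda>c. ev2 c x y) P"
  have "poly (?h 0 0) s \<noteq> 0" if s: "s \<noteq> 0" for s
  proof -
    obtain l where l: "l \<noteq> 0" "\<And>x y t. ev3 P (s * x) (s * y) (s * t) = l * ev3 P x y t" using hom[OF s] by blast
    then have "ev3 P 0 0 s \<noteq> 0" using P1 l(2)[of 0 0 1] by simp
    then show ?thesis by (simp add: ev3_def)
  qed
  \<comment> \<open>On the axis x = y = 0 the polynomial has no nonzero root and is therefore a
    monomial; its exponent \<open>m\<close> forces the scalar \<open>l\<close> belonging to
    \<open>s\<close> to be s^m.\<close>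
  then obtain c m where c: "c \<noteq> 0" "?h 0 0 = monom c m" using poly_only_zero_root by blast
  have ev0: "ev3 P 0 0 t = c * t ^ m" for t by (simp add: ev3_def c poly_monom)
  have hm: "ev3 P (s * x) (s * y) (s * t) = s ^ m * ev3 P x y t" if s: "s \<noteq> 0" for s x y t
  proof -
    obtain l where l: "\<And>x y t. ev3 P (s * x) (s * y) (s * t) = l * ev3 P x y t" using hom[OF s] by blast
    have "c * s ^ m = l * c" using l[of 0 0 1] by (simp add: ev0)
    then have "l = s ^ m" using c(1) by simp
    then show ?thesis using l by simp
  qed
  \<comment> \<open>Comparison of the coefficients of t^j. For j > m a positive power of s survives
    on the left, and s = 0 shows that the coefficient is zero; for j = m the powers cancel, and s =
    0 shows that it is constant.\<close>
  have co: "s ^ j * ev2 (coeff P j) (s * x) (s * y) = s ^ m * ev2 (coeff P j) x y" if s: "s \<noteq> 0" for s x y j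
  proof -
    have "pcompose (?h (s * x) (s * y)) [:0, s:] = smult (s ^ m) (?h x y)"
    proof (rule poly_eqI_cofinite[of "{}"])
      fix t show "poly (pcompose (?h (s * x) (s * y)) [:0, s:]) t = poly (smult (s ^ m) (?h x y)) t"
        using hm[OF s, of x y t] by (simp add: poly_pcompose ev3_def mult.commute)
    qed simp
    from arg_cong[OF this, of "\<lambda>p. coeff p j"] show ?thesis
      by (simp add: coeff_pcompose_scale coeff_map_poly)
  qed
  have "coeff P j = 0" if j: "j > m" for j
  proof (rule ev2_zero)
    fix x y
    obtain p where p: "\<And>s. poly p s = ev2 (coeff P j) (s * x) (s * y)" using ev2_line[of "coeff P j" 0 x 0 y] by auto
    have "[:0, 1:] ^ (j - m) * p = [:ev2 (coeff P j) x y:]"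
    proof (rule poly_eqI_cofinite[of "{0}"])
      fix s :: 'k assume "s \<notin> {0}"
      then have s: "s \<noteq> 0" by simp
      have "s ^ m * (s ^ (j - m) * ev2 (coeff P j) (s * x) (s * y)) = s ^ m * ev2 (coeff P j) x y"
        using co[OF s, of j x y] j by (simp flip: power_add mult.assoc)
      then have "s ^ (j - m) * ev2 (coeff P j) (s * x) (s * y) = ev2 (coeff P j) x y" using s by simp
      then show "poly ([:0, 1:] ^ (j - m) * p) s = poly [:ev2 (coeff P j) x y:] s" by (simp add: p)
    qed simp
    from arg_cong[OF this, of "\<lambda>p. poly p 0"] show "ev2 (coeff P j) x y = 0" using j by (simp add: zero_power)
  qed
  moreover have cm: "coeff P m - [:[:c:]:] = 0"
  proof (rule ev2_zero)
    fix x y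
    obtain p where p: "\<And>s. poly p s = ev2 (coeff P m) (s * x) (s * y)" using ev2_line[of "coeff P m" 0 x 0 y] by auto
    have "p = [:ev2 (coeff P m) x y:]"
    proof (rule poly_eqI_cofinite[of "{0}"])
      fix s :: 'k assume "s \<notin> {0}"
      then show "poly p s = poly [:ev2 (coeff P m) x y:] s" using co[of s m x y] by (simp add: p)
    qed simp
    from arg_cong[OF this, of "\<lambda>p. poly p 0"] have "ev2 (coeff P m) 0 0 = ev2 (coeff P m) x y" by (simp add: p)
    moreover have "ev2 (coeff P m) 0 0 = c"
      using arg_cong[OF c(2), of "\<lambda>p. coeff p m"] by (simp add: coeff_map_poly)
    ultimately show "ev2 (coeff P m - [:[:c:]:]) x y = 0" by (simp add: ev2_def)
  qed
  ultimately have "degree P = m" using c(1)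
    by (intro antisym degree_le le_degree) auto
  then show ?thesis using c(1) cm ev0 by (intro exI[of _ c]) simp
qed

section \<open>Resultants and common zeros\<close>

lemma bezout_no_common_root:
  fixes f g :: "'k::alg_closed_field poly"
  assumes "f \<noteq> 0" "\<And>x. \<not> (poly f x = 0 \<and> poly g x = 0)"
  shows "\<exists>u v. u * f + v * g = 1"
proof -
  define I where "I = {u * f + v * g |u v. True}"
  have "f \<in> I" "g \<in> I" unfolding I_def
    by (intro CollectI exI[of _ 1] exI[of _ 0]; simp) (intro CollectI exI[of _ 0] exI[of _ 1]; simp)
  define P where "P = (\<lambda>d. d \<in> I \<and> d \<noteq> 0)"
  have "P f" using \<open>f \<in> I\<close> assms(1) by (simp add: P_def)
  then obtain d where d: "P d" "\<And>e. P e \<Longrightarrow> degree d \<le> degree e"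
    using ex_has_least_nat[of P f degree] by blast
  then obtain u v where uv: "d = u * f + v * g" and d0: "d \<noteq> 0" unfolding P_def I_def by blast
  have dvd: "d dvd e" if e: "e \<in> I" for e
  proof (rule ccontr)
    assume "\<not> d dvd e"
    then have "e mod d \<noteq> 0" by (simp add: dvd_eq_mod_eq_0)
    obtain u' v' where e': "e = u' * f + v' * g" using e unfolding I_def by blast
    have "e mod d = e - e div d * d" by (simp add: minus_div_mult_eq_mod)
    also have "\<dots> = (u' - e div d * u) * f + (v' - e div d * v) * g"
      by (subst (1) e', subst (2) uv) (simp add: algebra_simps)
    finally have "e mod d \<in> I" unfolding I_def by auto
    with \<open>e mod d \<noteq> 0\<close> have "degree d \<le> degree (e mod d)" using d(2) by (simp add: P_def)
    moreover have "degree (e mod d) < degree d" using \<open>e mod d \<noteq> 0\<close> d0 degree_mod_less by blast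
    ultimately show False by simp
  qed
  have "degree d = 0"
  proof (rule ccontr)
    assume "degree d \<noteq> 0"
    then obtain x where "poly d x = 0" using alg_closed_imp_poly_has_root by blast
    then have "poly f x = 0 \<and> poly g x = 0" using dvd[OF \<open>f \<in> I\<close>] dvd[OF \<open>g \<in> I\<close>] by (auto elim!: dvdE)
    with assms(2) show False by blast
  qed
  then obtain c where c: "d = [:c:]" by (rule degree_eq_zeroE)
  with d0 have "c \<noteq> 0" by auto
  have "smult (inverse c) u * f + smult (inverse c) v * g = smult (inverse c) (u * f + v * g)"
    by (simp only: smult_add_right mult_smult_left)
  also have "\<dots> = 1" unfolding uv[symmetric] c using \<open>c \<noteq> 0\<close> by simp
  finally show ?thesis by (intro exI)
qed

text \<open>Without a common root, a Bezout identity over the field maps to the fraction field and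
  makes the gcd there constant. A common root gives a common linear factor, which survives the
  map.\<close>

lemma resultant_zero_iff_common_root:
  fixes f g :: "'k::alg_closed_field poly"
  assumes "f \<noteq> 0"
  shows "resultant f g = 0 \<longleftrightarrow> (\<exists>x. poly f x = 0 \<and> poly g x = 0)"
proof -
  have inj: "inj_comm_ring_hom (to_fract :: 'k \<Rightarrow> 'k fract)" by unfold_locales auto
  interpret h: comm_ring_hom "to_fract :: 'k \<Rightarrow> 'k fract" by unfold_locales
  interpret m: map_poly_comm_ring_hom "to_fract :: 'k \<Rightarrow> 'k fract" ..
  let ?m = "map_poly (to_fract :: 'k \<Rightarrow> 'k fract)"
  have "resultant f g = 0 \<longleftrightarrow> resultant (?m f) (?m g) = 0" by (simp add: inj_comm_ring_hom.resultant_hom[OF inj])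
  also have "\<dots> \<longleftrightarrow> degree (gcd (?m f) (?m g)) \<noteq> 0" by (rule resultant_0_gcd)
  also have "\<dots> \<longleftrightarrow> (\<exists>x. poly f x = 0 \<and> poly g x = 0)"
  proof
    assume deg: "degree (gcd (?m f) (?m g)) \<noteq> 0"
    show "\<exists>x. poly f x = 0 \<and> poly g x = 0"
    proof (rule ccontr)
      assume "\<nexists>x. poly f x = 0 \<and> poly g x = 0"
      then obtain u v where "u * f + v * g = 1" using bezout_no_common_root[OF assms] by blast
      then have "?m u * ?m f + ?m v * ?m g = 1" by (metis m.hom_add m.hom_mult m.hom_one)
      then have "gcd (?m f) (?m g) dvd 1"
        by (metis dvd_add dvd_mult gcd_dvd1 gcd_dvd2)
      then show False using deg by (auto simp: is_unit_iff_degree dest: dvd_imp_degree_le)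
    qed
  next
    assume "\<exists>x. poly f x = 0 \<and> poly g x = 0"
    then obtain x where x: "[:-x, 1:] dvd f" "[:-x, 1:] dvd g" using poly_eq_0_iff_dvd by blast
    have "?m p dvd ?m q" if "p dvd q" for p q
      using that by (elim dvdE) (simp only: m.hom_mult dvd_triv_left)
    with x have "?m [:-x, 1:] dvd ?m f" "?m [:-x, 1:] dvd ?m g" by blast+
    then have d: "?m [:-x, 1:] dvd gcd (?m f) (?m g)" by simp
    have "?m f \<noteq> 0" using assms by simp
    then have "gcd (?m f) (?m g) \<noteq> 0" by simp
    from dvd_imp_degree_le[OF d this] show "degree (gcd (?m f) (?m g)) \<noteq> 0" by simp
  qed
  finally show ?thesis .
qed

text \<open>Two polynomials in three variables that vanish at the origin have a second common zero, if their leading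
  coefficients in the last variable are constant: otherwise the resultant would vanish exactly at
  the origin of the plane.\<close>

lemma ev3_common_zero:
  fixes P Q :: "'k::alg_closed_field poly poly poly"
  assumes P: "lead_coeff P = [:[:c:]:]" "c \<noteq> 0" and Q: "lead_coeff Q = [:[:d:]:]" "d \<noteq> 0"
    and zero: "ev3 P 0 0 0 = 0" "ev3 Q 0 0 0 = 0"
  shows "\<exists>x y t. \<not> (x = 0 \<and> y = 0) \<and> ev3 P x y t = 0 \<and> ev3 Q x y t = 0"
proof (rule ccontr)
  assume no: "\<not> ?thesis"
  let ?h = "\<lambda>x y. map_poly (\<lambda>c. ev2 c x y)"
  define R where "R = resultant P Q"
  have ev2c: "ev2 [:[:c:]:] x y = c" for x y and c :: 'k by (simp add: ev2_def)
  \<comment> \<open>Constant leading coefficients preserve both degrees when x and y are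
    specialised, so the resultant specialises to the resultant.\<close>
  have degP: "degree (?h x y P) = degree P" for x y
    using P by (intro antisym degree_map_poly_le le_degree) (simp add: coeff_map_poly ev2c)
  have degQ: "degree (?h x y Q) = degree Q" for x y
    using Q by (intro antisym degree_map_poly_le le_degree) (simp add: coeff_map_poly ev2c)
  have "coeff (?h x y P) (degree P) \<noteq> 0" for x y using P by (simp add: coeff_map_poly ev2c)
  then have nz: "?h x y P \<noteq> 0" for x y by (metis coeff_0)
  have R: "ev2 R x y = 0 \<longleftrightarrow> (\<exists>t. ev3 P x y t = 0 \<and> ev3 Q x y t = 0)" for x y
  proof -
    have "resultant (?h x y P) (?h x y Q) = ev2 R x y"
      unfolding R_def by (rule comm_ring_hom.resultant_map_poly[OF ev2_hom degP degQ])
    with resultant_zero_iff_common_root[OF nz, of x y "?h x y Q"] show ?thesis by (simp add: ev3_def)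
  qed
  have R0: "ev2 R 0 0 = 0" using zero R by blast
  have Rn: "ev2 R x y \<noteq> 0" if "\<not> (x = 0 \<and> y = 0)" for x y using no that R by blast
  obtain p where p: "\<And>y. poly p y = ev2 R 1 y" using ev2_line[of R 1 0 0 1] by auto
  obtain q where q: "\<And>y. poly q y = ev2 R 0 y" using ev2_line[of R 0 0 0 1] by auto
  \<comment> \<open>For fixed nonzero y the resultant has no root as a polynomial in x, so it is
    constant in x and takes equal values at x = 0 and x = 1. This equality extends to y = 0, where
    one of the two values is zero and the other is not.\<close>
  have "p = q"
  proof (rule poly_eqI_cofinite[of "{0}"])
    fix y :: 'k assume y: "y \<notin> {0}"
    obtain r where r: "\<And>x. poly r x = ev2 R x y" using ev2_line[of R 0 1 y 0] by auto
    have "\<not> (\<exists>x. poly r x = 0)" using Rn y by (simp add: r)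
    then have "degree r = 0" using alg_closed_imp_poly_has_root by blast
    then obtain c where "r = [:c:]" by (rule degree_eq_zeroE)
    then show "poly p y = poly q y" using r[of 0] r[of 1] by (simp add: p q)
  qed simp
  then have "ev2 R 1 0 = 0" using p[of 0] q[of 0] R0 by simp
  with Rn[of 1 0] show False by simp
qed

text \<open>\<open>L\<close> is a map from the projective plane to the projective line, given by a family of lines in
  \<open>k\<^sup>2\<close>. Hitting both axes, it would give two homogeneous polynomials without a common zero.\<close>

lemma no_line_family:
  fixes L :: "'k::alg_closed_field \<Rightarrow> 'k \<Rightarrow> 'k \<Rightarrow> 'k \<Rightarrow> 'k \<Rightarrow> bool"
  assumes line: "\<And>x y t. \<not> (x = 0 \<and> y = 0 \<and> t = 0) \<Longrightarrow>
      \<exists>\<alpha>0 \<beta>0. (\<alpha>0 \<noteq> 0 \<or> \<beta>0 \<noteq> 0) \<and> (\<forall>\<alpha> \<beta>. L x y t \<alpha> \<beta> \<longleftrightarrow> \<alpha> * \<beta>0 = \<beta> * \<alpha>0)"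
    and loc: "\<And>x y t. \<not> (x = 0 \<and> y = 0 \<and> t = 0) \<Longrightarrow>
      \<exists>A B G. (ev3 A x y t \<noteq> 0 \<or> ev3 B x y t \<noteq> 0) \<and> ev3 G x y t \<noteq> 0 \<and>
        (\<forall>x y t. \<not> (x = 0 \<and> y = 0 \<and> t = 0) \<longrightarrow> ev3 G x y t \<noteq> 0 \<longrightarrow> L x y t (ev3 A x y t) (ev3 B x y t))"
    and scale: "\<And>x y t s \<alpha> \<beta>. \<not> (x = 0 \<and> y = 0 \<and> t = 0) \<Longrightarrow> s \<noteq> 0 \<Longrightarrow>
      L (s * x) (s * y) (s * t) \<alpha> \<beta> \<longleftrightarrow> L x y t \<alpha> (e s * \<beta>)"
    and e: "\<And>s. s \<noteq> 0 \<Longrightarrow> e s \<noteq> 0"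
    and special: "L 1 0 0 0 1" "L 0 1 0 1 0" "\<not> L 0 0 1 0 1" "\<not> L 0 0 1 1 0"
  shows False
proof -
  have same_line: "\<alpha> * \<beta>' = \<beta> * \<alpha>'" if "L x y t \<alpha> \<beta>" "L x y t \<alpha>' \<beta>'" "\<not> (x = 0 \<and> y = 0 \<and> t = 0)" for x y t \<alpha> \<beta> \<alpha>' \<beta>'
  proof -
    from line[OF that(3)] obtain \<alpha>0 \<beta>0 where l: "\<alpha>0 \<noteq> 0 \<or> \<beta>0 \<noteq> 0" "\<And>\<alpha> \<beta>. L x y t \<alpha> \<beta> \<longleftrightarrow> \<alpha> * \<beta>0 = \<beta> * \<alpha>0" by blast
    have 1: "\<alpha> * \<beta>0 = \<beta> * \<alpha>0" "\<alpha>' * \<beta>0 = \<beta>' * \<alpha>0" using that l(2) by auto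
    have "(\<alpha> * \<beta>' - \<beta> * \<alpha>') * \<alpha>0 = \<alpha> * (\<beta>' * \<alpha>0) - \<alpha>' * (\<beta> * \<alpha>0)" by (simp add: algebra_simps)
    also have "\<dots> = 0" unfolding 1[symmetric] by (simp add: algebra_simps)
    finally have a: "(\<alpha> * \<beta>' - \<beta> * \<alpha>') * \<alpha>0 = 0" .
    have "(\<alpha> * \<beta>' - \<beta> * \<alpha>') * \<beta>0 = \<beta>' * (\<alpha> * \<beta>0) - \<beta> * (\<alpha>' * \<beta>0)" by (simp add: algebra_simps)
    also have "\<dots> = 0" unfolding 1 by (simp add: algebra_simps)
    finally have "(\<alpha> * \<beta>' - \<beta> * \<alpha>') * \<beta>0 = 0" .
    with a l(1) show ?thesis by auto
  qed
  have smul: "L x y t (u * \<alpha>) (u * \<beta>) \<longleftrightarrow> L x y t \<alpha> \<beta>" if "u \<noteq> 0" "\<not> (x = 0 \<and> y = 0 \<and> t = 0)" for x y t u \<alpha> \<beta>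
    using line[OF that(2)] that(1) by (auto simp: mult.assoc)
  obtain A0 B0 G0 where 0: "ev3 A0 0 0 1 \<noteq> 0 \<or> ev3 B0 0 0 1 \<noteq> 0" "ev3 G0 0 0 1 \<noteq> 0"
    "\<And>x y t. \<not> (x = 0 \<and> y = 0 \<and> t = 0) \<Longrightarrow> ev3 G0 x y t \<noteq> 0 \<Longrightarrow> L x y t (ev3 A0 x y t) (ev3 B0 x y t)"
    using loc[of 0 0 1] by auto
  have L001: "L 0 0 1 (ev3 A0 0 0 1) (ev3 B0 0 0 1)" using 0(2,3) by simp
  have "ev3 A0 0 0 1 \<noteq> 0"
  proof
    assume "ev3 A0 0 0 1 = 0"
    with L001 0(1) have "L 0 0 1 (ev3 B0 0 0 1 * 0) (ev3 B0 0 0 1 * 1)" "ev3 B0 0 0 1 \<noteq> 0" by auto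
    then show False using smul[of "ev3 B0 0 0 1" 0 0 1 0 1] special by simp
  qed
  then have "A0 \<noteq> 0" by auto
  from ufd_coprime_part[OF this, of B0] obtain D P Q where DPQ: "A0 = D * P" "B0 = D * Q"
    "\<And>p' q'. p' * Q = q' * P \<Longrightarrow> \<exists>u. p' = P * u \<and> q' = Q * u" by blast
  have D0: "D \<noteq> 0" and P0: "P \<noteq> 0" using \<open>A0 \<noteq> 0\<close> DPQ by auto
  have G00: "G0 \<noteq> 0" using 0(2) by auto
  \<comment> \<open>Any local pair is proportional to (P, Q) on a dense set, hence identically,
    hence is a polynomial multiple of it by coprimality. So (P, Q) is nonzero and spans the line
    wherever a local pair does.\<close>
  have PQ: "(ev3 P x y t \<noteq> 0 \<or> ev3 Q x y t \<noteq> 0) \<and> L x y t (ev3 P x y t) (ev3 Q x y t)"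
    if v: "\<not> (x = 0 \<and> y = 0 \<and> t = 0)" for x y t
  proof -
    from loc[OF v] obtain A B G where G: "ev3 A x y t \<noteq> 0 \<or> ev3 B x y t \<noteq> 0" "ev3 G x y t \<noteq> 0"
      "\<And>x y t. \<not> (x = 0 \<and> y = 0 \<and> t = 0) \<Longrightarrow> ev3 G x y t \<noteq> 0 \<Longrightarrow> L x y t (ev3 A x y t) (ev3 B x y t)" by blast
    have "(A * Q - B * P) * (G * (G0 * D)) = 0"
    proof (rule ev3_eqI)
      fix x y t :: 'k assume t: "t \<noteq> 0"
      show "ev3 ((A * Q - B * P) * (G * (G0 * D))) x y t = ev3 0 x y t"
      proof (cases "ev3 G x y t = 0 \<or> ev3 G0 x y t = 0 \<or> ev3 D x y t = 0")
        case False
        then have "L x y t (ev3 A x y t) (ev3 B x y t)" "L x y t (ev3 A0 x y t) (ev3 B0 x y t)"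
          using G(3) 0(3) t by auto
        from same_line[OF this] t have "ev3 A x y t * ev3 B0 x y t = ev3 B x y t * ev3 A0 x y t" by blast
        then have "ev3 D x y t * (ev3 A x y t * ev3 Q x y t - ev3 B x y t * ev3 P x y t) = 0"
          by (simp add: DPQ algebra_simps)
        with False have "ev3 A x y t * ev3 Q x y t - ev3 B x y t * ev3 P x y t = 0" by simp
        then show ?thesis by simp
      qed auto
    qed
    moreover have "G \<noteq> 0" using G(2) by auto
    ultimately have "A * Q = B * P" using D0 G00 by (simp only: mult_eq_0_iff) simp
    from DPQ(3)[OF this] obtain u where u: "A = P * u" "B = Q * u" by blast
    have "ev3 u x y t \<noteq> 0" using G(1) unfolding u by auto
    moreover have "L x y t (ev3 u x y t * ev3 P x y t) (ev3 u x y t * ev3 Q x y t)"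
      using G(3)[OF v G(2)] by (simp add: u mult.commute)
    ultimately show ?thesis using smul[OF _ v] G(1) by (auto simp: u)
  qed
  have P100: "ev3 P 1 0 0 = 0" using same_line[OF _ special(1)] PQ[of 1 0 0] by auto
  have Q010: "ev3 Q 0 1 0 = 0" using same_line[OF _ special(2)] PQ[of 0 1 0] by auto
  have P001: "ev3 P 0 0 1 \<noteq> 0" using PQ[of 0 0 1] smul[of "ev3 Q 0 0 1" 0 0 1 0 1] special(3) by auto
  have Q001: "ev3 Q 0 0 1 \<noteq> 0" using PQ[of 0 0 1] smul[of "ev3 P 0 0 1" 0 0 1 1 0] special(4) by auto
  have Q0: "Q \<noteq> 0" using Q001 by auto
  \<comment> \<open>By \<open>scale\<close>, the pair formed by \<open>P\<close> and
    \<open>e s\<close> times \<open>Q\<close> at the scaled point lies on the line of the original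
    point. It is therefore a multiple of (P, Q), with one and the same factor for both
    entries.\<close>
  have mults: "\<exists>u. (\<forall>x y t. ev3 P (s * x) (s * y) (s * t) = ev3 P x y t * ev3 u x y t) \<and>
      (\<forall>x y t. e s * ev3 Q (s * x) (s * y) (s * t) = ev3 Q x y t * ev3 u x y t)" if s: "s \<noteq> 0" for s
  proof -
    obtain P' where P': "\<And>x y t. ev3 P' x y t = ev3 P (s * x) (s * y) (s * t)" using ev3_scale_ex by blast
    obtain Q' where Q': "\<And>x y t. ev3 Q' x y t = ev3 Q (s * x) (s * y) (s * t)" using ev3_scale_ex by blast
    have c: "ev3 [:[:[:e s:]:]:] x y t = e s" for x y t by simp
    have "P' * Q = ([:[:[:e s:]:]:] * Q') * P"
    proof (rule ev3_eqI)
      fix x y t :: 'k assume t: "t \<noteq> 0"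
      have "L (s * x) (s * y) (s * t) (ev3 P' x y t) (ev3 Q' x y t)"
        using PQ[of "s * x" "s * y" "s * t"] s t by (simp add: P' Q')
      then have "L x y t (ev3 P' x y t) (e s * ev3 Q' x y t)" using scale s t by blast
      moreover have "L x y t (ev3 P x y t) (ev3 Q x y t)" using PQ t by blast
      ultimately have "ev3 P' x y t * ev3 Q x y t = e s * ev3 Q' x y t * ev3 P x y t" using same_line t by blast
      then show "ev3 (P' * Q) x y t = ev3 ([:[:[:e s:]:]:] * Q' * P) x y t"
        by (simp only: ev3_simps c)
    qed
    from DPQ(3)[OF this] obtain u where u: "P' = P * u" "[:[:[:e s:]:]:] * Q' = Q * u" by blast
    have "ev3 ([:[:[:e s:]:]:] * Q') x y t = e s * ev3 Q' x y t" for x y t by (simp only: ev3_simps c)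
    then show ?thesis using u by (intro exI[of _ u]) (metis P' Q' ev3_simps(4))
  qed
  have "\<exists>u. \<forall>x y t. ev3 P (s * x) (s * y) (s * t) = ev3 P x y t * ev3 u x y t" if "s \<noteq> 0" for s
    using mults[OF that] by blast
  from ev3_semi_invariant[OF P0 this] have homP: "\<exists>l. l \<noteq> 0 \<and> (\<forall>x y t. ev3 P (s * x) (s * y) (s * t) = l * ev3 P x y t)" if "s \<noteq> 0" for s
    using that by blast
  have "\<exists>u. \<forall>x y t. ev3 Q (s * x) (s * y) (s * t) = ev3 Q x y t * ev3 u x y t" if s: "s \<noteq> 0" for s
  proof -
    obtain u where u: "\<And>x y t. e s * ev3 Q (s * x) (s * y) (s * t) = ev3 Q x y t * ev3 u x y t" using mults[OF s] by blast
    have c: "ev3 [:[:[:inverse (e s):]:]:] x y t = inverse (e s)" for x y t by simp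
    have "ev3 Q (s * x) (s * y) (s * t) = ev3 Q x y t * ev3 ([:[:[:inverse (e s):]:]:] * u) x y t" for x y t
      using u[of x y t] e[OF s] by (simp only: ev3_simps c) (simp add: field_simps)
    then show ?thesis by blast
  qed
  from ev3_semi_invariant[OF Q0 this] have homQ: "\<exists>l. l \<noteq> 0 \<and> (\<forall>x y t. ev3 Q (s * x) (s * y) (s * t) = l * ev3 Q x y t)" if "s \<noteq> 0" for s
    using that by blast
  \<comment> \<open>A semi-invariant polynomial with a zero vanishes along the line from the origin
    through it, except perhaps at the origin, and hence there too.\<close>
  have vanish: "ev3 F 0 0 0 = 0" if F: "ev3 F x y t = 0" and
    hom: "\<And>s. s \<noteq> 0 \<Longrightarrow> \<exists>l. l \<noteq> 0 \<and> (\<forall>x y t. ev3 F (s * x) (s * y) (s * t) = l * ev3 F x y t)" for F :: "'k poly poly poly" and x y t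
  proof -
    obtain p where p: "\<And>s. poly p s = ev3 F (s * x) (s * y) (s * t)" using ev3_line[of F 0 x 0 y 0 t] by auto
    have "p = 0"
    proof (rule poly_eqI_cofinite[of "{0}"])
      fix s :: 'k assume "s \<notin> {0}"
      then show "poly p s = poly 0 s" using hom[of s] F by (auto simp: p)
    qed simp
    then show ?thesis using p[of 0] by simp
  qed
  from ev3_homogeneous_lead[OF P001 homP] obtain c where c: "c \<noteq> 0" "lead_coeff P = [:[:c:]:]" by blast
  from ev3_homogeneous_lead[OF Q001 homQ] obtain d where d: "d \<noteq> 0" "lead_coeff Q = [:[:d:]:]" by blast
  from ev3_common_zero[OF c(2,1) d(2,1) vanish[OF P100 homP] vanish[OF Q010 homQ]] PQ show False by blast
qed

section \<open>The hyperplane at infinity\<close>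

definition hyperplane :: "nat \<Rightarrow> (nat \<Rightarrow> 'k::field) set" where
  "hyperplane n = {a \<in> homog_coords n. a 0 = 0}"

lemma irreducible_set_hyperplane: "irreducible_set (hyperplane n :: (nat \<Rightarrow> 'k::alg_closed_field) set)"
proof -
  have "irreducible_set ({a \<in> affine_space (Suc n). a 0 = 0} - {\<lambda>_. 0 :: 'k})"
    by (rule irreducible_set_nonzero_vectors) (auto simp: affine_space_def)
  also have "{a \<in> affine_space (Suc n). a 0 = 0} - {\<lambda>_. 0 :: 'k} = hyperplane n"
    by (auto simp: hyperplane_def homog_coords_def)
  finally show ?thesis .
qed

lemma irreducible_set_homog_coords: "irreducible_set (homog_coords n :: (nat \<Rightarrow> 'k::alg_closed_field) set)"
  unfolding homog_coords_def by (rule irreducible_set_nonzero_vectors) (auto simp: affine_space_def)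

definition axis_vec :: "nat \<Rightarrow> nat \<Rightarrow> 'k::field" where
  "axis_vec i = (\<lambda>j. if j = i then 1 else 0)"

lemma axis_vec_hyperplane: "0 < i \<Longrightarrow> i \<le> n \<Longrightarrow> axis_vec i \<in> hyperplane n"
  by (auto simp: axis_vec_def hyperplane_def homog_coords_def affine_space_def fun_eq_iff)

lemma hyperplane_scale: "a \<in> hyperplane n \<Longrightarrow> c \<noteq> 0 \<Longrightarrow> (\<lambda>i. c * a i) \<in> hyperplane n"
  using homog_coords_scale by (auto simp: hyperplane_def)

lemma polyfun_line_zero:
  fixes f :: "('i \<Rightarrow> 'k::alg_closed_field) \<Rightarrow> 'k"
  assumes "f \<in> polyfun" "finite B" "\<And>s. s \<notin> B \<Longrightarrow> f (\<lambda>i. w i + s * y i) = 0"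
  shows "f w = 0"
proof -
  obtain p where p: "\<And>s. poly p s = f (\<lambda>i. w i + s * y i)" using polyfun_line[OF assms(1)] by blast
  have "p = 0" by (rule poly_eqI_cofinite[OF assms(2)]) (simp add: p assms(3))
  then show ?thesis using p[of 0] by simp
qed

text \<open>Extension across codimension two: \<open>r\<close> has a polynomial numerator over a
  power of coordinate 1 and another over a power of coordinate 2. Comparing them shows that the
  first numerator is divisible by coordinate 1, and the exponent descends to 0.\<close>

lemma hartogs_hyperplane:
  fixes r :: "(nat \<Rightarrow> 'k::alg_closed_field) \<Rightarrow> 'k"
  assumes n: "n \<ge> 2" and r: "regf (hyperplane n) r"
  shows "\<exists>\<Phi>\<in>polyfun. \<forall>a\<in>hyperplane n. r a = \<Phi> a"
proof -
  define \<rho> where "\<rho> = (\<lambda>(w::nat \<Rightarrow> 'k) i. if 1 \<le> i \<and> i \<le> n then w i else 0)"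
  have \<rho>hyperplane: "\<rho> w \<in> hyperplane n" if "w i \<noteq> 0" "1 \<le> i" "i \<le> n" for w i
  proof -
    have "\<rho> w i \<noteq> 0" using that by (simp add: \<rho>_def)
    then have "\<rho> w \<noteq> (\<lambda>_. 0)" by auto
    then show ?thesis by (auto simp: \<rho>_def hyperplane_def homog_coords_def affine_space_def)
  qed
  have \<rho>id: "\<rho> a = a" if "a \<in> hyperplane n" for a
  proof
    fix i show "\<rho> a i = a i"
      using that by (cases "i = 0"; cases "i \<le> n") (auto simp: \<rho>_def hyperplane_def homog_coords_def affine_space_def)
  qed
  have "regf {w. w i \<noteq> 0} (\<lambda>w. r (\<rho> w))" if "1 \<le> i" "i \<le> n" for i
  proof (rule regf_comp[OF r])
    show "\<rho> w \<in> hyperplane n" if "w \<in> {w. w i \<noteq> 0}" for w using \<rho>hyperplane that \<open>1 \<le> i\<close> \<open>i \<le> n\<close> by auto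
    show "regf {w. w i \<noteq> 0} (\<lambda>w. \<rho> w j)" for j
      unfolding \<rho>_def by (intro regf_polyfun polyfun_intros)
  qed
  then have pr: "\<exists>\<Phi>\<in>polyfun. \<exists>M. \<forall>w. w i \<noteq> 0 \<longrightarrow> r (\<rho> w) * w i ^ M = \<Phi> w" if "1 \<le> i" "i \<le> n" for i
    using that by (intro regf_principal polyfun.coord) auto
  obtain \<Phi>2 M2 where \<Phi>2: "\<Phi>2 \<in> polyfun" "\<And>w. w 2 \<noteq> 0 \<Longrightarrow> r (\<rho> w) * w 2 ^ M2 = \<Phi>2 w" using pr[of 2] n by auto
  define T where "T = (\<lambda>M. \<exists>\<Phi>\<in>polyfun. \<forall>w. w 1 \<noteq> 0 \<longrightarrow> r (\<rho> w) * w 1 ^ M = \<Phi> w)"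
  have step: "T M" if "T (Suc M)" for M
  proof -
    from that obtain \<Phi> where \<Phi>: "\<Phi> \<in> polyfun" "\<And>w. w 1 \<noteq> 0 \<Longrightarrow> r (\<rho> w) * w 1 ^ Suc M = \<Phi> w"
      unfolding T_def by blast
    have eq: "w 2 ^ M2 * \<Phi> w - w 1 ^ Suc M * \<Phi>2 w = 0" for w
    proof (rule polyfun_line_zero[where f = "\<lambda>w. w 2 ^ M2 * \<Phi> w - w 1 ^ Suc M * \<Phi>2 w" and B = "{- w 1, - w 2}" and y = "\<lambda>_. 1"])
      show "(\<lambda>w. w 2 ^ M2 * \<Phi> w - w 1 ^ Suc M * \<Phi>2 w) \<in> polyfun" by (intro polyfun_intros \<Phi> \<Phi>2)
      fix s assume "s \<notin> {- w 1, - w 2}"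
      then have nz: "w 1 + s * 1 \<noteq> 0" "w 2 + s * 1 \<noteq> 0" by (auto simp: add_eq_0_iff)
      show "(w 2 + s * 1) ^ M2 * \<Phi> (\<lambda>i. w i + s * 1) - (w 1 + s * 1) ^ Suc M * \<Phi>2 (\<lambda>i. w i + s * 1) = 0"
        unfolding \<Phi>(2)[of "\<lambda>i. w i + s * 1", OF nz(1), symmetric] \<Phi>2(2)[of "\<lambda>i. w i + s * 1", OF nz(2), symmetric]
        by (simp only: mult_ac) simp
    qed simp
    \<comment> \<open>By \<open>eq\<close> the numerator vanishes where coordinate 1 is zero and
      coordinate 2 is not. Moving along axis 2 removes the second condition.\<close>
    have van: "\<Phi> w = 0" if w1: "w 1 = 0" for w
    proof (rule polyfun_line_zero[OF \<Phi>(1), where B = "{- w 2}" and y = "axis_vec 2"])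
      fix s assume "s \<notin> {- w 2}"
      then have "w 2 + s \<noteq> 0" by (auto simp: add_eq_0_iff)
      with eq[of "\<lambda>i. w i + s * axis_vec 2 i"] w1 show "\<Phi> (\<lambda>i. w i + s * axis_vec 2 i) = 0"
        by (simp add: axis_vec_def)
    qed simp
    define X where "X = (\<lambda>i (w::nat \<Rightarrow> 'k). if i = 1 then [:0, 1:] else [:w i:])"
    have X: "pfam (X i)" for i
      unfolding X_def by (cases "i = 1") (auto intro!: pfam_const pfam_pCons polyfun_intros)
    have X': "(\<lambda>i. poly (X i w) s) = w(1 := s)" for w s by (auto simp: X_def)
    from pfam_subst[where X = X, OF \<Phi>(1) X] obtain P where P: "pfam P" "\<And>w s. poly (P w) s = \<Phi> (w(1 := s))"
      unfolding X' by blast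
    have P0: "coeff (P w) 0 = 0" for w using P(2)[of w 0] van[of "w(1 := 0)"] by (simp add: poly_0_coeff_0)
    obtain D where D: "\<And>w. degree (P w) \<le> D" using P(1) by (auto simp: pfam_def)
    \<comment> \<open>Division by coordinate 1: \<open>\<Phi>\<close> is expanded in that
      coordinate, with constant coefficient zero by \<open>van\<close>.\<close>
    define \<Phi>' where "\<Phi>' = (\<lambda>w. \<Sum>j\<le>D. coeff (P w) (Suc j) * w 1 ^ j)"
    have "\<Phi> w = w 1 * \<Phi>' w" for w
    proof -
      have "\<Phi> w = poly (P w) (w 1)" by (simp add: P(2))
      also have "\<dots> = (\<Sum>j\<le>Suc D. coeff (P w) j * w 1 ^ j)" unfolding poly_altdef
        by (rule sum.mono_neutral_left) (use D[of w] in \<open>auto simp: coeff_eq_0 intro: le_SucI\<close>)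
      also have "\<dots> = (\<Sum>j\<le>D. coeff (P w) (Suc j) * w 1 ^ Suc j)"
        unfolding sum.atMost_Suc_shift by (simp add: P0)
      finally show ?thesis by (simp add: \<Phi>'_def sum_distrib_left mult_ac)
    qed
    moreover have "\<Phi>' \<in> polyfun" unfolding \<Phi>'_def using P(1) by (intro polyfun_intros) (simp add: pfam_def)
    ultimately show ?thesis unfolding T_def using \<Phi>(2) by (intro bexI[of _ \<Phi>']) (auto simp: mult_ac)
  qed
  have "T M \<Longrightarrow> T 0" for M by (induction M) (auto intro: step)
  moreover have "\<exists>M. T M" using pr[of 1] n unfolding T_def by auto
  ultimately have "T 0" by blast
  then obtain \<Phi> where \<Phi>: "\<Phi> \<in> polyfun" "\<And>w. w 1 \<noteq> 0 \<Longrightarrow> r (\<rho> w) = \<Phi> w" unfolding T_def by auto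
  have "r a = \<Phi> a" if "a \<in> hyperplane n" for a
  proof (rule regf_eq_dense[OF irreducible_set_hyperplane zopen_self r regf_polyfun[OF \<Phi>(1)] _ _ _ that])
    show "zopen (hyperplane n) {a\<in>hyperplane n. a 1 \<noteq> 0}" by (intro zopen_nonvanishing_polyfun polyfun.coord)
    show "{a\<in>hyperplane n. a 1 \<noteq> 0} \<noteq> ({} :: (nat \<Rightarrow> 'k) set)" using axis_vec_hyperplane[of 1 n] n by (auto simp: axis_vec_def)
    show "r a = \<Phi> a" if "a \<in> hyperplane n \<inter> {a\<in>hyperplane n. a 1 \<noteq> 0}" for a using \<Phi>(2)[of a] \<rho>id that by auto
  qed
  with \<Phi>(1) show ?thesis by blast
qed

section \<open>Families of lines in the plane over the hyperplane at infinity\<close>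

text \<open>In the application \<open>L\<close> consists of the lines spanned by the section of smaller weight along
  the hyperplane, in coordinates with respect to a frame on the affine space \<open>Y0\<close>; the twist \<open>e\<close>
  comes from the difference of the two weights of that frame.\<close>

locale line_family =
  fixes n :: nat and L :: "(nat \<Rightarrow> 'k::alg_closed_field) \<Rightarrow> 'k \<Rightarrow> 'k \<Rightarrow> bool" and e :: "'k \<Rightarrow> 'k"
  assumes n: "n \<ge> 3"
    and line: "\<And>a. a \<in> hyperplane n \<Longrightarrow> \<exists>\<alpha>0 \<beta>0. (\<alpha>0 \<noteq> 0 \<or> \<beta>0 \<noteq> 0) \<and> (\<forall>\<alpha> \<beta>. L a \<alpha> \<beta> \<longleftrightarrow> \<alpha> * \<beta>0 = \<beta> * \<alpha>0)"
    and loc: "\<And>a. a \<in> hyperplane n \<Longrightarrow> \<exists>A f g. zopen (hyperplane n) A \<and> a \<in> A \<and> regf A f \<and> regf A g \<and>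
       (\<forall>b\<in>A. (f b \<noteq> 0 \<or> g b \<noteq> 0) \<and> L b (f b) (g b))"
    and scale: "\<And>a c \<alpha> \<beta>. a \<in> hyperplane n \<Longrightarrow> c \<noteq> 0 \<Longrightarrow> L (\<lambda>i. c * a i) \<alpha> \<beta> \<longleftrightarrow> L a \<alpha> (e c * \<beta>)"
    and e: "\<And>c. c \<noteq> 0 \<Longrightarrow> e c \<noteq> 0"
begin

lemma line_iff:
  assumes a: "a \<in> hyperplane n" and fg: "f \<noteq> 0 \<or> g \<noteq> 0" "L a f g"
  shows "L a \<alpha> \<beta> \<longleftrightarrow> \<alpha> * g = \<beta> * f"
proof -
  from line[OF a] obtain \<alpha>0 \<beta>0 where l: "\<alpha>0 \<noteq> 0 \<or> \<beta>0 \<noteq> 0" "\<And>\<alpha> \<beta>. L a \<alpha> \<beta> \<longleftrightarrow> \<alpha> * \<beta>0 = \<beta> * \<alpha>0" by blast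
  have fg': "f * \<beta>0 = g * \<alpha>0" using l(2) fg by simp
  have "\<exists>u. u \<noteq> 0 \<and> f = u * \<alpha>0 \<and> g = u * \<beta>0"
  proof (cases "\<alpha>0 = 0")
    case True
    with l(1) fg' have "\<beta>0 \<noteq> 0" "f = 0" by auto
    with fg(1) True show ?thesis by (intro exI[of _ "g / \<beta>0"]) auto
  next
    case False
    then have "g = f * \<beta>0 / \<alpha>0" using fg' by (simp add: field_simps)
    with False fg(1) show ?thesis by (intro exI[of _ "f / \<alpha>0"]) auto
  qed
  then obtain u where "u \<noteq> 0" "f = u * \<alpha>0" "g = u * \<beta>0" by blast
  then show ?thesis using l(2) by (auto simp: mult.left_commute)
qed

text \<open>If both axes occur, at \<open>y1\<close> and \<open>y2\<close>, these vectors are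
  independent, since the line at a multiple of \<open>y1\<close> is the same axis as at
  \<open>y1\<close>. Irreducibility supplies a third vector \<open>w\<close>, independent of them
  and with a line different from both axes. The span of the three then contradicts
  \<open>no_line_family\<close>.\<close>

lemma no_mixed: "\<not> (\<exists>y1\<in>hyperplane n. \<exists>y2\<in>hyperplane n. L y1 0 1 \<and> L y2 1 0)"
proof
  assume "\<exists>y1\<in>hyperplane n. \<exists>y2\<in>hyperplane n. L y1 0 1 \<and> L y2 1 0"
  then obtain y1 y2 where y: "y1 \<in> hyperplane n" "y2 \<in> hyperplane n" "L y1 0 1" "L y2 1 0" by blast
  have y1iff: "L y1 \<alpha> \<beta> \<longleftrightarrow> \<alpha> = 0" for \<alpha> \<beta> using line_iff[OF y(1) _ y(3)] by simp
  have y2iff: "L y2 \<alpha> \<beta> \<longleftrightarrow> \<beta> = 0" for \<alpha> \<beta> using line_iff[OF y(2) _ y(4)] by simp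
  have "\<exists>i j. y1 i * y2 j - y1 j * y2 i \<noteq> 0"
  proof (rule ccontr)
    assume no: "\<not> ?thesis"
    obtain i where i: "y1 i \<noteq> 0" using y(1) by (auto simp: hyperplane_def homog_coords_def fun_eq_iff)
    define c where "c = y2 i / y1 i"
    have y2: "y2 = (\<lambda>j. c * y1 j)"
    proof
      fix j have "y1 i * y2 j = y1 j * y2 i" using no by auto
      then show "y2 j = c * y1 j" using i by (simp add: c_def field_simps)
    qed
    have "c \<noteq> 0" using y(2) by (auto simp: y2 hyperplane_def homog_coords_def)
    from scale[OF y(1) this, of 0 1] have "L y2 0 1" by (simp add: y2[symmetric] y1iff)
    then show False by (simp add: y2iff)
  qed
  then obtain i j where ij: "y1 i * y2 j - y1 j * y2 i \<noteq> 0" by blast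
  have "i \<noteq> j" using ij by auto
  \<comment> \<open>A third coordinate direction inside the hyperplane; it exists because n \<ge>
    3.\<close>
  have "\<exists>k\<in>{1, 2, 3}. k \<noteq> i \<and> k \<noteq> j" using \<open>i \<noteq> j\<close> by auto
  then obtain k where "k \<in> {1, 2, 3}" "k \<noteq> i" "k \<noteq> j" by blast
  then have k: "k \<noteq> i" "k \<noteq> j" "0 < k" "k \<le> n" using n by auto
  \<comment> \<open>The minor of the matrix with rows \<open>y1\<close>, \<open>y2\<close>, w in the
    columns i, j, k, expanded along the row w.\<close>
  define m where "m = (\<lambda>w. w k * (y1 i * y2 j - y1 j * y2 i) - w j * (y1 i * y2 k - y1 k * y2 i) + w i * (y1 j * y2 k - y1 k * y2 j))"
  have m: "m \<in> polyfun" unfolding m_def by (intro polyfun_intros)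
  let ?B1 = "{a\<in>hyperplane n. \<not> L a 0 1}" and ?B2 = "{a\<in>hyperplane n. \<not> L a 1 0}" and ?B3 = "{a\<in>hyperplane n. m a \<noteq> 0}"
  have B1: "zopen (hyperplane n) ?B1"
  proof (rule zopen_glue)
    fix a assume a: "a \<in> ?B1"
    then obtain A f g where A: "zopen (hyperplane n) A" "a \<in> A" "regf A f" "regf A g" "\<forall>b\<in>A. (f b \<noteq> 0 \<or> g b \<noteq> 0) \<and> L b (f b) (g b)"
      using loc by blast
    have "L b 0 1 \<longleftrightarrow> f b = 0" if "b \<in> A" for b
      using line_iff[of b "f b" "g b" 0 1] A(1,5) that zopen_subset by auto
    then have "{b\<in>A. f b \<noteq> 0} \<subseteq> ?B1" "a \<in> {b\<in>A. f b \<noteq> 0}" using a A(1,2) zopen_subset by auto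
    then show "\<exists>B. zopen (hyperplane n) B \<and> a \<in> B \<and> B \<subseteq> ?B1" using zopen_nonvanishing[OF A(1,3)] by blast
  qed auto
  have B2: "zopen (hyperplane n) ?B2"
  proof (rule zopen_glue)
    fix a assume a: "a \<in> ?B2"
    then obtain A f g where A: "zopen (hyperplane n) A" "a \<in> A" "regf A f" "regf A g" "\<forall>b\<in>A. (f b \<noteq> 0 \<or> g b \<noteq> 0) \<and> L b (f b) (g b)"
      using loc by blast
    have "L b 1 0 \<longleftrightarrow> g b = 0" if "b \<in> A" for b
      using line_iff[of b "f b" "g b" 1 0] A(1,5) that zopen_subset by auto
    then have "{b\<in>A. g b \<noteq> 0} \<subseteq> ?B2" "a \<in> {b\<in>A. g b \<noteq> 0}" using a A(1,2) zopen_subset by auto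
    then show "\<exists>B. zopen (hyperplane n) B \<and> a \<in> B \<and> B \<subseteq> ?B2" using zopen_nonvanishing[OF A(1,4)] by blast
  qed auto
  have B3: "zopen (hyperplane n) ?B3" by (rule zopen_nonvanishing_polyfun[OF m])
  have "y2 \<in> ?B1" "y1 \<in> ?B2" using y by (auto simp: y1iff y2iff)
  then have B12: "?B1 \<inter> ?B2 \<noteq> {}" using irreducible_set_zopen_meet[OF irreducible_set_hyperplane B1 B2] by blast
  have "axis_vec k \<in> ?B3" using ij k axis_vec_hyperplane[of k n] by (simp add: m_def axis_vec_def)
  then have "?B1 \<inter> ?B2 \<inter> ?B3 \<noteq> {}" using irreducible_set_zopen_meet[OF irreducible_set_hyperplane zopen_Int[OF B1 B2] B3 B12] by blast
  then obtain w where w: "w \<in> hyperplane n" "\<not> L w 0 1" "\<not> L w 1 0" "m w \<noteq> 0" by blast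
  let ?a = "\<lambda>x y t i. x * y1 i + y * y2 i + t * w i"
  have ind: "?a x y t \<in> hyperplane n" if v: "\<not> (x = 0 \<and> y = 0 \<and> t = 0)" for x y t
  proof -
    have "?a x y t \<noteq> (\<lambda>_. 0)"
    proof
      assume "?a x y t = (\<lambda>_. 0)"
      then have 0: "?a x y t l = 0" for l by (rule fun_cong)
      have "t * m w = m (?a x y t)" by (simp add: m_def algebra_simps)
      also have "\<dots> = 0" by (simp add: m_def 0)
      finally have t: "t = 0" using w(4) by simp
      have "x * (y1 i * y2 j - y1 j * y2 i) = y2 j * ?a x y t i - y2 i * ?a x y t j" by (simp add: t algebra_simps)
      then have x: "x = 0" using ij by (simp add: 0)
      have "y * (y1 i * y2 j - y1 j * y2 i) = y1 i * ?a x y t j - y1 j * ?a x y t i" by (simp add: t algebra_simps)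
      then have "y = 0" using ij by (simp add: 0)
      with t x v show False by simp
    qed
    then show ?thesis using y(1,2) w(1) by (auto simp: hyperplane_def homog_coords_def affine_space_def)
  qed
  show False
  proof (rule no_line_family[where L = "\<lambda>x y t. L (?a x y t)" and e = e])
    fix x y t :: 'k assume v: "\<not> (x = 0 \<and> y = 0 \<and> t = 0)"
    show "\<exists>\<alpha>0 \<beta>0. (\<alpha>0 \<noteq> 0 \<or> \<beta>0 \<noteq> 0) \<and> (\<forall>\<alpha> \<beta>. L (?a x y t) \<alpha> \<beta> \<longleftrightarrow> \<alpha> * \<beta>0 = \<beta> * \<alpha>0)"
      by (rule line[OF ind[OF v]])
    show "L (?a (s * x) (s * y) (s * t)) \<alpha> \<beta> \<longleftrightarrow> L (?a x y t) \<alpha> (e s * \<beta>)" if "s \<noteq> 0" for s \<alpha> \<beta>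
      using scale[OF ind[OF v] that] by (simp add: algebra_simps)
    from loc[OF ind[OF v]] obtain A f g where A: "zopen (hyperplane n) A" "?a x y t \<in> A" "regf A f" "regf A g"
      "\<And>b. b \<in> A \<Longrightarrow> (f b \<noteq> 0 \<or> g b \<noteq> 0) \<and> L b (f b) (g b)" by blast
    obtain F1 G1 where 1: "F1 \<in> polyfun" "G1 \<in> polyfun" "G1 (?a x y t) \<noteq> 0" "\<And>b. b \<in> A \<Longrightarrow> G1 b \<noteq> 0 \<Longrightarrow> f b * G1 b = F1 b"
      by (rule regfE[OF A(3,2)]) blast
    obtain F2 G2 where 2: "F2 \<in> polyfun" "G2 \<in> polyfun" "G2 (?a x y t) \<noteq> 0" "\<And>b. b \<in> A \<Longrightarrow> G2 b \<noteq> 0 \<Longrightarrow> g b * G2 b = F2 b"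
      by (rule regfE[OF A(4,2)]) blast
    obtain H where H: "H \<in> polyfun" "H (?a x y t) \<noteq> 0" "\<And>b. b \<in> hyperplane n \<Longrightarrow> H b \<noteq> 0 \<Longrightarrow> b \<in> A"
      by (rule zopE[OF A(1,2)]) blast
    obtain PA where PA: "\<And>x y t. ev3 PA x y t = F1 (?a x y t) * G2 (?a x y t)"
      using polyfun_ev3[OF polyfun.mult[OF 1(1) 2(2)], of y1 y2 w] by blast
    obtain PB where PB: "\<And>x y t. ev3 PB x y t = F2 (?a x y t) * G1 (?a x y t)"
      using polyfun_ev3[OF polyfun.mult[OF 2(1) 1(2)], of y1 y2 w] by blast
    obtain PG where PG: "\<And>x y t. ev3 PG x y t = G1 (?a x y t) * G2 (?a x y t) * H (?a x y t)"
      using polyfun_ev3[OF polyfun.mult[OF polyfun.mult[OF 1(2) 2(2)] H(1)], of y1 y2 w] by blast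
    have main: "(F1 b * G2 b \<noteq> 0 \<or> F2 b * G1 b \<noteq> 0) \<and> L b (F1 b * G2 b) (F2 b * G1 b)"
      if b: "b \<in> hyperplane n" "G1 b * G2 b * H b \<noteq> 0" for b
    proof -
      have bA: "b \<in> A" and nz: "G1 b \<noteq> 0" "G2 b \<noteq> 0" using H(3) b by auto
      have "F1 b = f b * G1 b" "F2 b = g b * G2 b" using 1(4) 2(4) bA nz by auto
      then show ?thesis using A(5)[OF bA] nz line_iff[OF b(1), of "f b" "g b"] by auto
    qed
    show "\<exists>A B G. (ev3 A x y t \<noteq> 0 \<or> ev3 B x y t \<noteq> 0) \<and> ev3 G x y t \<noteq> 0 \<and>
        (\<forall>x y t. \<not> (x = 0 \<and> y = 0 \<and> t = 0) \<longrightarrow> ev3 G x y t \<noteq> 0 \<longrightarrow> L (?a x y t) (ev3 A x y t) (ev3 B x y t))"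
    proof (rule exI[of _ PA], rule exI[of _ PB], rule exI[of _ PG], intro conjI allI impI)
      show G: "ev3 PG x y t \<noteq> 0" using 1(3) 2(3) H(2) by (simp add: PG)
      show "ev3 PA x y t \<noteq> 0 \<or> ev3 PB x y t \<noteq> 0"
        using main[OF ind[OF v] G[unfolded PG]] unfolding PA PB by blast
      fix x y t assume "\<not> (x = 0 \<and> y = 0 \<and> t = 0)" "ev3 PG x y t \<noteq> 0"
      then show "L (?a x y t) (ev3 PA x y t) (ev3 PB x y t)" using main[OF ind] unfolding PA PB PG by blast
    qed
  qed (use e y w in simp_all)
qed

text \<open>Lines that avoid one axis have a well-defined slope. It is a regular function on the
  cone over the hyperplane, so \<open>hartogs_hyperplane\<close> applies.\<close>

lemma ratio_polyfun:
  assumes "\<And>a. a \<in> hyperplane n \<Longrightarrow> \<not> L a 1 0"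
  shows "\<exists>r\<in>polyfun. \<forall>a\<in>hyperplane n. L a (r a) 1"
proof -
  have "\<exists>r. L a r 1" if a: "a \<in> hyperplane n" for a
  proof -
    obtain f g where fg: "f \<noteq> 0 \<or> g \<noteq> 0" "L a f g" using loc[OF a] by blast
    then have "g \<noteq> 0" using line_iff[OF a fg, of 1 0] assms[OF a] by auto
    then show ?thesis using line_iff[OF a fg, of "f / g" 1] by auto
  qed
  then obtain r where r: "\<And>a. a \<in> hyperplane n \<Longrightarrow> L a (r a) 1" by metis
  have "regf (hyperplane n) r"
  proof (rule regf_glue[where X = "hyperplane n"])
    fix a :: "nat \<Rightarrow> 'k" assume a: "a \<in> hyperplane n"
    from loc[OF a] obtain A f g where A: "zopen (hyperplane n) A" "a \<in> A" "regf A f" "regf A g"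
      "\<And>b. b \<in> A \<Longrightarrow> (f b \<noteq> 0 \<or> g b \<noteq> 0) \<and> L b (f b) (g b)" by blast
    have bh: "b \<in> hyperplane n" if "b \<in> A" for b using zopen_subset[OF A(1)] that by auto
    have g: "g b \<noteq> 0" if "b \<in> A" for b
      using line_iff[OF bh[OF that], of "f b" "g b" 1 0] A(5)[OF that] assms[OF bh[OF that]] by auto
    have "r b = f b / g b" if "b \<in> A" for b
      using line_iff[OF bh[OF that], of "f b" "g b" "r b" 1] A(5)[OF that] r[OF bh[OF that]] g[OF that]
      by (simp add: field_simps)
    moreover have "regf A (\<lambda>b. f b / g b)" by (intro regf_divide A g)
    ultimately have "regf A r" by (subst regf_cong) auto
    then show "\<exists>B. zopen (hyperplane n) B \<and> a \<in> B \<and> regf (hyperplane n \<inter> B) r"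
      using A(1,2) by (auto intro: regf_subset)
  qed simp
  from hartogs_hyperplane[OF _ this] n obtain \<Phi> where "\<Phi> \<in> polyfun" "\<And>a. a \<in> hyperplane n \<Longrightarrow> r a = \<Phi> a" by auto
  then show ?thesis using r by (intro bexI[of _ \<Phi>]) auto
qed

end

text \<open>By \<open>no_mixed\<close> at most one axis occurs. If the first one does, the
  coordinates are exchanged, which inverts the twist \<open>e\<close>.\<close>

lemma (in line_family) dichotomy:
  "(\<exists>r\<in>polyfun. \<forall>a\<in>hyperplane n. L a (r a) 1) \<or> (\<exists>r\<in>polyfun. \<forall>a\<in>hyperplane n. L a 1 (r a))"
proof (cases "\<exists>y2\<in>hyperplane n. L y2 1 0")
  case False
  then show ?thesis using ratio_polyfun by blast
next
  case True
  then have no: "\<not> L a 0 1" if "a \<in> hyperplane n" for a using no_mixed that by blast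
  interpret swap: line_family n "\<lambda>a \<alpha> \<beta>. L a \<beta> \<alpha>" "\<lambda>c. inverse (e c)"
  proof
    fix a :: "nat \<Rightarrow> 'k" assume a: "a \<in> hyperplane n"
    from line[OF a] obtain \<alpha>0 \<beta>0 where "\<alpha>0 \<noteq> 0 \<or> \<beta>0 \<noteq> 0" "\<And>\<alpha> \<beta>. L a \<alpha> \<beta> \<longleftrightarrow> \<alpha> * \<beta>0 = \<beta> * \<alpha>0" by blast
    then show "\<exists>\<alpha>0 \<beta>0. (\<alpha>0 \<noteq> 0 \<or> \<beta>0 \<noteq> 0) \<and> (\<forall>\<alpha> \<beta>. L a \<beta> \<alpha> \<longleftrightarrow> \<alpha> * \<beta>0 = \<beta> * \<alpha>0)"
      by (intro exI[of _ \<beta>0] exI[of _ \<alpha>0]) auto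
    from loc[OF a] show "\<exists>A f g. zopen (hyperplane n) A \<and> a \<in> A \<and> regf A f \<and> regf A g \<and>
       (\<forall>b\<in>A. (f b \<noteq> 0 \<or> g b \<noteq> 0) \<and> L b (g b) (f b))" by blast
    fix c :: 'k and \<alpha> \<beta> assume c: "c \<noteq> 0"
    obtain f g where fg: "f \<noteq> 0 \<or> g \<noteq> 0" "L a f g" using loc[OF a] by blast
    have "L (\<lambda>i. c * a i) \<beta> \<alpha> \<longleftrightarrow> \<beta> * g = e c * \<alpha> * f"
      using scale[OF a c, of \<beta> \<alpha>] line_iff[OF a fg] by simp
    also have "\<dots> \<longleftrightarrow> inverse (e c) * \<beta> * g = \<alpha> * f" using e[OF c] by (simp add: field_simps)
    also have "\<dots> \<longleftrightarrow> L a (inverse (e c) * \<beta>) \<alpha>" using line_iff[OF a fg] by simp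
    finally show "L (\<lambda>i. c * a i) \<beta> \<alpha> \<longleftrightarrow> L a (inverse (e c) * \<beta>) \<alpha>" .
  qed (use n e in auto)
  from swap.ratio_polyfun no show ?thesis by blast
qed

lemma powi_eq_1_imp_zero:
  fixes d :: int
  assumes "\<And>u::'k::alg_closed_field. u \<noteq> 0 \<Longrightarrow> u powi d = 1"
  shows "d = 0"
proof -
  define m where "m = nat \<bar>d\<bar>"
  have pow: "u ^ m = 1" if "u \<noteq> 0" for u :: 'k
  proof (cases "d \<ge> 0")
    case True then show ?thesis using assms[OF that] by (simp add: m_def power_int_def)
  next
    case False then show ?thesis using assms[OF that] by (simp add: m_def power_int_def power_inverse)
  qed
  have "monom (1::'k) m = 1"
    by (rule poly_eqI_cofinite[of "{0}"]) (auto simp: poly_monom pow)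
  then have "degree (monom (1::'k) m) = 0" by simp
  then have "m = 0" by (simp add: degree_monom_eq)
  then show ?thesis by (simp add: m_def)
qed

lemma zopen_hyperplane_restrict:
  assumes "zopen (homog_coords n) A"
  shows "zopen (hyperplane n) (A \<inter> hyperplane n)"
  unfolding zopen_def
proof (intro conjI ballI)
  fix a assume a: "a \<in> A \<inter> hyperplane n"
  obtain G where "G \<in> polyfun" "G a \<noteq> 0" "\<And>b. b \<in> homog_coords n \<Longrightarrow> G b \<noteq> 0 \<Longrightarrow> b \<in> A"
    using zopE[OF assms, of a] a by blast
  then show "\<exists>G\<in>polyfun. G a \<noteq> 0 \<and> (\<forall>b\<in>hyperplane n. G b \<noteq> 0 \<longrightarrow> b \<in> A \<inter> hyperplane n)"
    by (intro bexI[of _ G]) (auto simp: hyperplane_def)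
qed auto

text \<open>A regular function has no pole at the limit v = 0 of the orbit. With h = F/G near the
  limit and k = -m, the identity v^k F = C G along the orbit gives C = 0 at v = 0.\<close>

lemma regf_neg_hom_zero:
  fixes h :: "(nat \<Rightarrow> 'k::alg_closed_field) \<Rightarrow> 'k"
  assumes h: "regf A h" and x: "\<And>v. lam b v x \<in> A" and m: "m < (0::int)"
    and hom: "\<And>v. v \<noteq> 0 \<Longrightarrow> h (lam b v x) = v powi m * C"
  shows "C = 0"
proof -
  obtain F G where FG: "F \<in> polyfun" "G \<in> polyfun" "G (lam b 0 x) \<noteq> 0" "\<And>y. y \<in> A \<Longrightarrow> G y \<noteq> 0 \<Longrightarrow> h y * G y = F y"
    by (rule regfE[OF h x]) blast
  have l: "lam b u x = (\<lambda>i. (if (i = 0) = b then 0 else x i) + u * (if (i = 0) = b then x i else 0))" for u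
    by (auto simp: lam_def)
  obtain p where p: "\<And>v. poly p v = F (lam b v x)"
    using polyfun_line[OF FG(1), of "\<lambda>i. if (i = 0) = b then 0 else x i" "\<lambda>i. if (i = 0) = b then x i else 0"] unfolding l by blast
  obtain q where q: "\<And>v. poly q v = G (lam b v x)"
    using polyfun_line[OF FG(2), of "\<lambda>i. if (i = 0) = b then 0 else x i" "\<lambda>i. if (i = 0) = b then x i else 0"] unfolding l by blast
  define k where "k = nat (- m)"
  have "q \<noteq> 0" using q[of 0] FG(3) by auto
  then have fin: "finite ({0} \<union> {v. poly q v = 0})" using poly_roots_finite by blast
  have "smult C q = [:0, 1:] ^ k * p"
  proof (rule poly_eqI_cofinite[OF fin])
    fix v assume "v \<notin> {0} \<union> {v. poly q v = 0}"
    then have v: "v \<noteq> 0" "G (lam b v x) \<noteq> 0" by (auto simp: q)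
    have "v powi m = inverse (v ^ k)" using m by (simp add: k_def power_int_def power_inverse)
    then have k: "v ^ k * v powi m = 1" using v(1) by simp
    have "v ^ k * F (lam b v x) = (v ^ k * v powi m) * (C * G (lam b v x))"
      unfolding FG(4)[OF x v(2), symmetric] hom[OF v(1)] by (simp only: mult_ac)
    then have "v ^ k * F (lam b v x) = C * G (lam b v x)" unfolding k by simp
    then show "poly (smult C q) v = poly ([:0, 1:] ^ k * p) v" by (simp add: p q)
  qed
  from arg_cong[OF this, of "\<lambda>p. poly p 0"] have "C * G (lam b 0 x) = 0 ^ k * poly p 0" by (simp add: q)
  moreover have "k > 0" using m by (simp add: k_def)
  ultimately show "C = 0" using FG(3) by (simp add: zero_power)
qed

section \<open>Frames on the affine space and along the hyperplane\<close>

context equivariant_bundle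
begin

lemma basis_at_proj:
  assumes "basis_at b d e" "a \<in> Y" "proj_point a = proj_point b"
  shows "basis_at a d e"
  using assms unfolding basis_at_def fib_def cU_def by auto

lemma act_False_True: "act False (inverse u) d = act True u d"
  by (simp add: act_def)

definition Y0 :: "(nat \<Rightarrow> 'k) set" where "Y0 = {a \<in> Y. a 0 \<noteq> 0}"

lemma zopen_Y0: "zopen Y Y0"
  unfolding Y0_def by (rule zopen_nonvanishing_polyfun[OF polyfun.coord])

definition hom_sect :: "(nat \<Rightarrow> 'k) set \<Rightarrow> ((nat \<Rightarrow> 'k) \<Rightarrow> 'e) \<Rightarrow> int \<Rightarrow> bool" where
  "hom_sect A s m \<longleftrightarrow> (\<forall>a\<in>A. \<forall>u. u \<noteq> 0 \<longrightarrow> s (lam True u a) = fscale E (u powi m) (act True u (s a)))"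

text \<open>On \<open>Y0\<close> a vector can be normalised by its coordinate 0, so the sections may
  be required to be constant along the lines of the cone. They are then sections over the affine
  space itself.\<close>

definition eframe :: "((nat \<Rightarrow> 'k) \<Rightarrow> 'e) \<Rightarrow> ((nat \<Rightarrow> 'k) \<Rightarrow> 'e) \<Rightarrow> int \<Rightarrow> int \<Rightarrow> bool" where
  "eframe e1 e2 p1 p2 \<longleftrightarrow> sect Y0 e1 \<and> sect Y0 e2 \<and> (\<forall>a\<in>Y0. basis_at a (e1 a) (e2 a)) \<and>
     (\<forall>a\<in>Y0. \<forall>c. c \<noteq> 0 \<longrightarrow> e1 (\<lambda>i. c * a i) = e1 a \<and> e2 (\<lambda>i. c * a i) = e2 a) \<and>
     hom_sect Y0 e1 p1 \<and> hom_sect Y0 e2 p2"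

text \<open>The affine space is the attracting set of [1:0:...:0], so one frame there covers it
  after normalisation of coordinate 0. Normalisation turns \<open>lam True u\<close> into
  \<open>lam False\<close> with the inverse parameter, whence the signs of the weights.\<close>

lemma ex_eframe: "\<exists>e1 e2 p1 p2. eframe e1 e2 p1 p2"
proof -
  let ?z = "axis_vec 0 :: nat \<Rightarrow> 'k"
  have z: "?z \<in> Y" "lam False 0 ?z = ?z"
    by (auto simp: axis_vec_def homog_coords_def affine_space_def lam_def fun_eq_iff)
  from ex_hframe[OF z] obtain A s1 s2 m1 m2 where hf: "hframe False A s1 s2 m1 m2" and zA: "?z \<in> A" by blast
  define \<rho> where "\<rho> = (\<lambda>(a::nat \<Rightarrow> 'k) i. inverse (a 0) * a i)"
  have \<rho>Y: "\<rho> a \<in> Y" if "a \<in> Y0" for a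
    using that homog_coords_scale[of a n "inverse (a 0)"] by (simp add: \<rho>_def Y0_def)
  have \<rho>A: "\<rho> a \<in> A" if a: "a \<in> Y0" for a
  proof -
    have "lam False 0 (\<rho> a) = ?z" using a by (auto simp: \<rho>_def lam_def axis_vec_def Y0_def)
    then show ?thesis using hf zA \<rho>Y[OF a] unfolding hframe_def by metis
  qed
  have \<rho>p: "proj_point (\<rho> a) = proj_point a" if "a \<in> Y0" for a
    using that proj_point_scale[of "inverse (a 0)" a] by (simp add: \<rho>_def Y0_def)
  have \<rho>s: "\<rho> (\<lambda>i. c * a i) = \<rho> a" if "c \<noteq> 0" for a c
    using that by (auto simp: \<rho>_def)
  have \<rho>l: "\<rho> (lam True u a) = lam False (inverse u) (\<rho> a)" if "u \<noteq> 0" "a \<in> Y0" for u a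
    using that by (auto simp: \<rho>_def lam_def Y0_def fun_eq_iff field_simps)
  have Y0Y: "Y0 \<subseteq> Y" by (auto simp: Y0_def)
  have reg: "regf Y0 (\<lambda>a. \<rho> a i)" for i
    unfolding \<rho>_def by (intro regf_mult regf_inverse regf_coord) (simp add: Y0_def)
  have s: "sect A s1" "sect A s2" and basis_at: "\<And>a. a \<in> A \<Longrightarrow> basis_at a (s1 a) (s2 a)"
    and hom: "\<And>a u. a \<in> A \<Longrightarrow> u \<noteq> 0 \<Longrightarrow> s1 (lam False u a) = fscale E (u powi m1) (act False u (s1 a))"
      "\<And>a u. a \<in> A \<Longrightarrow> u \<noteq> 0 \<Longrightarrow> s2 (lam False u a) = fscale E (u powi m2) (act False u (s2 a))"
    using hf unfolding hframe_def by auto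
  have pw: "inverse u powi m = u powi (- m)" for u :: 'k and m
    by (simp add: power_int_inverse power_int_minus)
  have "eframe (\<lambda>a. s1 (\<rho> a)) (\<lambda>a. s2 (\<rho> a)) (- m1) (- m2)"
    unfolding eframe_def hom_sect_def
    using sect_comp[OF s(1) Y0Y \<rho>A reg \<rho>p] sect_comp[OF s(2) Y0Y \<rho>A reg \<rho>p]
      basis_at_proj[OF basis_at[OF \<rho>A] _ \<rho>p[symmetric]] Y0Y hom[OF \<rho>A]
    by (auto simp: \<rho>s \<rho>l pw act_False_True)
  then show ?thesis by blast
qed

lemma hframe_True:
  assumes "hframe True A f1 f2 b1 b2"
  shows "zopen Y A" "sect A f1" "sect A f2" "\<And>a. a \<in> A \<Longrightarrow> basis_at a (f1 a) (f2 a)"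
    "hom_sect A f1 b1" "hom_sect A f2 b2"
    "\<And>a. a \<in> A \<Longrightarrow> lam True 0 a \<in> A" "\<And>a. a \<in> Y \<Longrightarrow> lam True 0 a \<in> A \<Longrightarrow> a \<in> A"
    "\<And>a u. a \<in> A \<Longrightarrow> u \<noteq> 0 \<Longrightarrow> lam True u a \<in> A"
proof -
  show "zopen Y A" "sect A f1" "sect A f2" "\<And>a. a \<in> A \<Longrightarrow> basis_at a (f1 a) (f2 a)"
    "hom_sect A f1 b1" "hom_sect A f2 b2"
    "\<And>a. a \<in> A \<Longrightarrow> lam True 0 a \<in> A" "\<And>a. a \<in> Y \<Longrightarrow> lam True 0 a \<in> A \<Longrightarrow> a \<in> A"
    using assms unfolding hframe_def hom_sect_def by auto
  then show "\<And>a u. a \<in> A \<Longrightarrow> u \<noteq> 0 \<Longrightarrow> lam True u a \<in> A"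
    using sect_Y[of A f1] by (metis lam_homog_coords lam_lam mult_zero_left)
qed

lemma hframe_swap: "hframe True A f1 f2 b1 b2 \<Longrightarrow> hframe True A f2 f1 b2 b1"
  using basis_at_swap unfolding hframe_def by auto

text \<open>The expansion of \<open>s a\<close>, transported along the orbit, is compared with the
  one at the translated point in the transported basis. A coefficient scales by the weight of the
  section minus that of the basis element.\<close>

lemma coef_hom:
  assumes s: "hom_sect A s m" "hom_sect A t1 q1" "hom_sect A t2 q2"
    and basis_at: "basis_at a (t1 a) (t2 a)" and a: "a \<in> A" and u: "u \<noteq> 0"
    and eq: "s a = lc g1 g2 (t1 a) (t2 a)" "s (lam True u a) = lc g1' g2' (t1 (lam True u a)) (t2 (lam True u a))"
  shows "g1' = u powi (m - q1) * g1" "g2' = u powi (m - q2) * g2"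
proof -
  have Y: "a \<in> Y" and f: "t1 a \<in> fib a" "t2 a \<in> fib a" using basis_at by (auto simp: basis_at_def)
  have Y': "lam True u a \<in> Y" and f': "act True u (t1 a) \<in> fib (lam True u a)" "act True u (t2 a) \<in> fib (lam True u a)"
    using Y f u by (auto intro: lam_homog_coords act_fib)
  have "lc (u powi m * g1) (u powi m * g2) (act True u (t1 a)) (act True u (t2 a)) = s (lam True u a)"
    using s(1) a u by (simp add: hom_sect_def eq(1) act_lc[OF Y u f] fs_lc[OF Y' f'])
  also have "\<dots> = lc (g1' * u powi q1) (g2' * u powi q2) (act True u (t1 a)) (act True u (t2 a))"
    using s(2,3) a u by (simp add: hom_sect_def eq(2) lc_fs[OF Y' f'])
  finally have "u powi m * g1 = g1' * u powi q1 \<and> u powi m * g2 = g2' * u powi q2"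
    by (rule basis_at_uniq[OF basis_at_act[OF basis_at u]])
  then show "g1' = u powi (m - q1) * g1" "g2' = u powi (m - q2) * g2"
    using u by (simp_all add: power_int_diff field_simps)
qed

text \<open>At the fixed point \<open>z\<close> the weights are those of the representation of the
  group on the fibre. A nonzero entry of the matrix between the frames forces two weights to agree,
  and an invertible matrix has a nonzero product along one of its two diagonals.\<close>

lemma hframe_weights:
  assumes hf: "hframe True A f1 f2 b1 b2" "hframe True A' f1' f2' b1' b2'"
    and z: "z \<in> A" "z \<in> A'" "z \<in> hyperplane n"
  shows "(b1' = b1 \<and> b2' = b2) \<or> (b1' = b2 \<and> b2' = b1)"
proof -
  note 1 = hframe_True[OF hf(1)] and 2 = hframe_True[OF hf(2)]
  have lz: "lam True u z = z" for u using z(3) by (auto simp: lam_def hyperplane_def)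
  obtain p q where pq: "f1' z = lc p q (f1 z) (f2 z)" using basis_at_ex[OF 1(4)[OF z(1)] sect_fib[OF 2(2) z(2)]] by blast
  obtain r s where rs: "f2' z = lc r s (f1 z) (f2 z)" using basis_at_ex[OF 1(4)[OF z(1)] sect_fib[OF 2(3) z(2)]] by blast
  have H: "hom_sect {z} f1 b1" "hom_sect {z} f2 b2" "hom_sect {z} f1' b1'" "hom_sect {z} f2' b2'"
    using 1(5,6) 2(5,6) z by (auto simp: hom_sect_def)
  have w: "m = k" if "c \<noteq> 0" "\<And>u. u \<noteq> 0 \<Longrightarrow> c = u powi (m - k) * c" for c :: 'k and m k
  proof -
    have "u powi (m - k) = 1" if "u \<noteq> 0" for u :: 'k
      using \<open>c \<noteq> 0\<close> \<open>\<And>u. u \<noteq> 0 \<Longrightarrow> c = u powi (m - k) * c\<close>[OF that] by simp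
    from powi_eq_1_imp_zero[OF this] show ?thesis by simp
  qed
  have pw: "p \<noteq> 0 \<Longrightarrow> b1' = b1" "q \<noteq> 0 \<Longrightarrow> b1' = b2"
    using coef_hom[OF H(3,1,2) 1(4)[OF z(1)] _ _ pq, unfolded lz, OF _ _ pq] w by blast+
  have rw: "r \<noteq> 0 \<Longrightarrow> b2' = b1" "s \<noteq> 0 \<Longrightarrow> b2' = b2"
    using coef_hom[OF H(4,1,2) 1(4)[OF z(1)] _ _ rs, unfolded lz, OF _ _ rs] w by blast+
  have "p * s - q * r \<noteq> 0"
    using 2(4)[OF z(2)] basis_at_lc_iff[OF 1(4)[OF z(1)]] by (simp add: pq rs)
  then have "(p \<noteq> 0 \<and> s \<noteq> 0) \<or> (q \<noteq> 0 \<and> r \<noteq> 0)" by auto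
  then show ?thesis using pw rw by blast
qed

text \<open>Domains of frames around different points meet inside the hyperplane by irreducibility.
  The weights agree there up to order, and b1 \<ge> b2 fixes the order.\<close>

lemma ex_hframes:
  "\<exists>b1 b2. b1 \<ge> b2 \<and> (\<forall>z\<in>hyperplane n. \<exists>A f1 f2. hframe True A f1 f2 b1 b2 \<and> z \<in> A)"
proof -
  have ex: "\<exists>A f1 f2 b1 b2. hframe True A f1 f2 b1 b2 \<and> z \<in> A \<and> b1 \<ge> b2" if z: "z \<in> hyperplane n" for z
  proof -
    have "z \<in> Y" "lam True 0 z = z" using z by (auto simp: hyperplane_def lam_def)
    from ex_hframe[OF this] obtain A f1 f2 b1 b2 where "hframe True A f1 f2 b1 b2" "z \<in> A" by blast
    then show ?thesis using hframe_swap by (cases "b1 \<ge> b2") (blast, meson linear)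
  qed
  have z0: "axis_vec 1 \<in> hyperplane n" using axis_vec_hyperplane[of 1 n] n3 by simp
  from ex[OF this] obtain A0 g1 g2 b1 b2 where 0: "hframe True A0 g1 g2 b1 b2" "axis_vec 1 \<in> A0" "b1 \<ge> b2" by blast
  have "\<exists>A f1 f2. hframe True A f1 f2 b1 b2 \<and> z \<in> A" if z: "z \<in> hyperplane n" for z
  proof -
    from ex[OF z] obtain A f1 f2 c1 c2 where 1: "hframe True A f1 f2 c1 c2" "z \<in> A" "c1 \<ge> c2" by blast
    have "A0 \<inter> hyperplane n \<inter> (A \<inter> hyperplane n) \<noteq> {}"
      by (rule irreducible_set_zopen_meet[OF irreducible_set_hyperplane zopen_hyperplane_restrict[OF hframe_True(1)[OF 0(1)]] zopen_hyperplane_restrict[OF hframe_True(1)[OF 1(1)]]])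
        (use 0(2) z0 1(2) z in auto)
    then obtain w where w: "w \<in> A0" "w \<in> A" "w \<in> hyperplane n" by blast
    from hframe_weights[OF 0(1) 1(1) w] 0(3) 1(3) have "c1 = b1 \<and> c2 = b2" by auto
    with 1 show ?thesis by blast
  qed
  with 0(3) show ?thesis by blast
qed

text \<open>The last clause says that the lines spanned by \<open>e1\<close> and \<open>e2\<close>
  extend across the hyperplane as complementary line subbundles: \<open>t1\<close> and
  \<open>t2\<close> generate the extensions locally and coincide with \<open>e1\<close> and
  \<open>e2\<close> up to nonzero scalars on \<open>Y0\<close>.\<close>

definition split_frame :: "((nat \<Rightarrow> 'k) \<Rightarrow> 'e) \<Rightarrow> ((nat \<Rightarrow> 'k) \<Rightarrow> 'e) \<Rightarrow> bool" where
  "split_frame e1 e2 \<longleftrightarrow> sect Y0 e1 \<and> sect Y0 e2 \<and> (\<forall>a\<in>Y0. basis_at a (e1 a) (e2 a)) \<and>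
     (\<forall>a\<in>Y0. \<forall>c. c \<noteq> 0 \<longrightarrow> e1 (\<lambda>i. c * a i) = e1 a \<and> e2 (\<lambda>i. c * a i) = e2 a) \<and>
     (\<forall>z\<in>hyperplane n. \<exists>A t1 t2. zopen Y A \<and> z \<in> A \<and> sect A t1 \<and> sect A t2 \<and> (\<forall>a\<in>A. basis_at a (t1 a) (t2 a)) \<and>
        (\<forall>a\<in>A \<inter> Y0. (\<exists>c. c \<noteq> 0 \<and> t1 a = fscale E c (e1 a)) \<and> (\<exists>c. c \<noteq> 0 \<and> t2 a = fscale E c (e2 a))))"

text \<open>On \<open>Y0\<close> this is the point with coordinate 0 equal to 1 on the orbit of
  \<open>a\<close> under \<open>lam True\<close>. It also makes sense on the hyperplane, where
  \<open>a\<close> is the limit of the orbit of \<open>at1 a\<close>.\<close>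

abbreviation at1 :: "(nat \<Rightarrow> 'k) \<Rightarrow> nat \<Rightarrow> 'k" where "at1 a \<equiv> a(0 := 1)"

lemma at1_Y0: "a \<in> Y \<Longrightarrow> at1 a \<in> Y0"
  by (auto simp: Y0_def homog_coords_def affine_space_def fun_eq_iff)

lemma lam_at1: "lam True v (at1 a) = a(0 := v)"
  by (auto simp: lam_def)

lemma lam_True_0: "lam True 0 a = a(0 := 0)"
  by (auto simp: lam_def)

lemma at1_hframe:
  assumes hf: "hframe True A f1 f2 b1 b2" and a: "a \<in> A"
  shows "at1 a \<in> A" "at1 a \<in> Y0"
proof -
  have "a \<in> Y" using a hframe_True(1)[OF hf] zopen_subset by blast
  then show 1: "at1 a \<in> Y0" by (rule at1_Y0)
  have "lam True 0 (at1 a) = lam True 0 a" by (simp add: lam_True_0)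
  then show "at1 a \<in> A" using hframe_True(7,8)[OF hf] a 1 by (auto simp: Y0_def)
qed

text \<open>The function is frozen at a_0 = 1 and so becomes constant along orbits. This is how
  coefficients known on \<open>Y0\<close> are continued across the hyperplane.\<close>

lemma regf_at1:
  assumes hf: "hframe True A f1 f2 b1 b2" and "regf (A \<inter> Y0) g"
  shows "regf A (\<lambda>a. g (at1 a))"
proof (rule regf_comp[OF assms(2)])
  show "regf A (\<lambda>a. at1 a i)" for i by (cases "i = 0") (auto intro: regf_intros)
qed (use at1_hframe[OF hf] in auto)

text \<open>Both coefficients of \<open>e1\<close> in a frame with equal weights b have weight p1 -
  b. Freezing them at a_0 = 1 thus multiplies \<open>e1\<close> by a single power of a_0, and the
  result extends to the hyperplane; likewise for \<open>e2\<close>.\<close>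

lemma split_frame_equal_weights:
  assumes ef: "eframe e1 e2 p1 p2" and hfs: "\<And>z. z \<in> hyperplane n \<Longrightarrow> \<exists>A f1 f2. hframe True A f1 f2 b b \<and> z \<in> A"
  shows "split_frame e1 e2"
proof -
  have e: "sect Y0 e1" "sect Y0 e2" "\<And>a. a \<in> Y0 \<Longrightarrow> basis_at a (e1 a) (e2 a)" "hom_sect Y0 e1 p1" "hom_sect Y0 e2 p2"
    using ef by (auto simp: eframe_def)
  have "\<exists>A t1 t2. zopen Y A \<and> z \<in> A \<and> sect A t1 \<and> sect A t2 \<and> (\<forall>a\<in>A. basis_at a (t1 a) (t2 a)) \<and>
        (\<forall>a\<in>A \<inter> Y0. (\<exists>c. c \<noteq> 0 \<and> t1 a = fscale E c (e1 a)) \<and> (\<exists>c. c \<noteq> 0 \<and> t2 a = fscale E c (e2 a)))"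
    if z: "z \<in> hyperplane n" for z
  proof -
    from hfs[OF z] obtain A f1 f2 where hf: "hframe True A f1 f2 b b" and zA: "z \<in> A" by blast
    note f = hframe_True[OF hf]
    have sub: "sect (A \<inter> Y0) f1" "sect (A \<inter> Y0) f2" "sect (A \<inter> Y0) e1" "sect (A \<inter> Y0) e2"
      using f(2,3) e(1,2) by (auto intro: sect_subset)
    have fb: "\<And>a. a \<in> A \<inter> Y0 \<Longrightarrow> basis_at a (f1 a) (f2 a)" using f(4) by auto
    obtain k11 k12 where k1: "regf (A \<inter> Y0) k11" "regf (A \<inter> Y0) k12"
      "\<And>a. a \<in> A \<inter> Y0 \<Longrightarrow> e1 a = lc (k11 a) (k12 a) (f1 a) (f2 a)" using sect_cof[OF sub(1,2,3) fb] by blast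
    obtain k21 k22 where k2: "regf (A \<inter> Y0) k21" "regf (A \<inter> Y0) k22"
      "\<And>a. a \<in> A \<inter> Y0 \<Longrightarrow> e2 a = lc (k21 a) (k22 a) (f1 a) (f2 a)" using sect_cof[OF sub(1,2,4) fb] by blast
    define t1 where "t1 = (\<lambda>a. lc (k11 (at1 a)) (k12 (at1 a)) (f1 a) (f2 a))"
    define t2 where "t2 = (\<lambda>a. lc (k21 (at1 a)) (k22 (at1 a)) (f1 a) (f2 a))"
    have "sect A t1" "sect A t2" unfolding t1_def t2_def
      by (intro sect_lc f regf_at1[OF hf] k1 k2)+
    moreover have "basis_at a (t1 a) (t2 a)" if a: "a \<in> A" for a
    proof -
      have x: "at1 a \<in> A \<inter> Y0" using at1_hframe[OF hf a] by blast
      then have "basis_at (at1 a) (e1 (at1 a)) (e2 (at1 a))" using e(3) by blast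
      then have "k11 (at1 a) * k22 (at1 a) - k12 (at1 a) * k21 (at1 a) \<noteq> 0"
        using basis_at_lc_iff[OF fb[OF x]] by (simp add: k1(3)[OF x] k2(3)[OF x])
      then show ?thesis unfolding t1_def t2_def using basis_at_lc_iff[OF f(4)[OF a]] by blast
    qed
    moreover have "(\<exists>c. c \<noteq> 0 \<and> t1 a = fscale E c (e1 a)) \<and> (\<exists>c. c \<noteq> 0 \<and> t2 a = fscale E c (e2 a))"
      if a: "a \<in> A \<inter> Y0" for a
    proof -
      have x: "at1 a \<in> A \<inter> Y0" using at1_hframe[OF hf] a by blast
      have a0: "a 0 \<noteq> 0" and aY: "a \<in> Y" using a by (auto simp: Y0_def)
      have la: "lam True (a 0) (at1 a) = a" by (simp add: lam_at1)
      have H: "hom_sect (A \<inter> Y0) e1 p1" "hom_sect (A \<inter> Y0) e2 p2" "hom_sect (A \<inter> Y0) f1 b" "hom_sect (A \<inter> Y0) f2 b"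
        using e(4,5) f(5,6) by (auto simp: hom_sect_def)
      have ff: "f1 a \<in> fib a" "f2 a \<in> fib a" using sect_fib sub a by blast+
      have K1: "k11 a = a 0 powi (p1 - b) * k11 (at1 a)" "k12 a = a 0 powi (p1 - b) * k12 (at1 a)"
        using coef_hom[OF H(1,3,4) fb[OF x] x a0 k1(3)[OF x], unfolded la, OF k1(3)[OF a]] by auto
      have K2: "k21 a = a 0 powi (p2 - b) * k21 (at1 a)" "k22 a = a 0 powi (p2 - b) * k22 (at1 a)"
        using coef_hom[OF H(2,3,4) fb[OF x] x a0 k2(3)[OF x], unfolded la, OF k2(3)[OF a]] by auto
      have c: "a 0 powi (b - p) * (a 0 powi (p - b) * y) = y" for p y
        using a0 by (simp add: power_int_diff field_simps)
      have "t1 a = fscale E (a 0 powi (b - p1)) (e1 a)" "t2 a = fscale E (a 0 powi (b - p2)) (e2 a)"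
        unfolding k1(3)[OF a] k2(3)[OF a] fs_lc[OF aY ff] by (simp_all add: K1 K2 c t1_def t2_def)
      then show ?thesis using a0 by (metis power_int_not_zero)
    qed
    ultimately show ?thesis using f(1) zA
      by (rule_tac exI[of _ A], rule_tac exI[of _ t1], rule_tac exI[of _ t2]) simp
  qed
  then show ?thesis using ef unfolding split_frame_def eframe_def by simp
qed

text \<open>Homotheties commute with \<open>lam True\<close>, so composition with one gives a frame
  of the same weights. This allows the lines at \<open>a\<close> and at a multiple of
  \<open>a\<close> to be compared.\<close>

lemma hframe_scale:
  assumes hf: "hframe True A f1 f2 b1 b2" and c: "c \<noteq> 0"
  shows "hframe True {a\<in>Y. (\<lambda>i. c * a i) \<in> A} (\<lambda>a. f1 (\<lambda>i. c * a i)) (\<lambda>a. f2 (\<lambda>i. c * a i)) b1 b2"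
proof -
  note f = hframe_True[OF hf]
  let ?B = "{a\<in>Y. (\<lambda>i. c * a i) \<in> A}"
  have zB: "zopen Y ?B"
    by (rule zopen_preimage[OF f(1) zopen_self]) (use c in \<open>auto intro: homog_coords_scale regf_intros\<close>)
  have pp: "proj_point (\<lambda>i. c * a i) = proj_point a" for a :: "nat \<Rightarrow> 'k" using c by (rule proj_point_scale)
  have reg: "regf ?B (\<lambda>b. c * b i)" for i by (intro regf_intros)
  have sB: "sect ?B (\<lambda>a. f1 (\<lambda>i. c * a i))" "sect ?B (\<lambda>a. f2 (\<lambda>i. c * a i))"
    by (rule sect_comp[OF f(2) _ _ reg pp]; simp) (rule sect_comp[OF f(3) _ _ reg pp]; simp)
  have bB: "basis_at a (f1 (\<lambda>i. c * a i)) (f2 (\<lambda>i. c * a i))" if "a \<in> ?B" for a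
    by (rule basis_at_proj[OF f(4) _ pp[symmetric]]) (use that in simp_all)
  have l0: "lam True 0 a \<in> ?B" if "a \<in> ?B" for a
  proof -
    have "(\<lambda>i. c * lam True 0 a i) \<in> A" using f(7)[of "\<lambda>i. c * a i"] that by (simp add: lam_scale)
    moreover from this have "(\<lambda>i. c * lam True 0 a i) \<in> Y" using zopen_subset[OF f(1)] by blast
    from homog_coords_scale[OF this, of "inverse c"] c have "(\<lambda>i. inverse c * (c * lam True 0 a i)) \<in> Y" by simp
    moreover have "(\<lambda>i. inverse c * (c * lam True 0 a i)) = lam True 0 a" using c by (simp add: mult.assoc[symmetric])
    ultimately show ?thesis by simp
  qed
  have l1: "a \<in> ?B" if "a \<in> Y" "lam True 0 a \<in> ?B" for a
    using that f(8)[of "\<lambda>i. c * a i"] homog_coords_scale[OF that(1) c] by (simp add: lam_scale)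
  have hm: "f1 (\<lambda>i. c * lam True u a i) = fscale E (u powi b1) (act True u (f1 (\<lambda>i. c * a i)))"
    "f2 (\<lambda>i. c * lam True u a i) = fscale E (u powi b2) (act True u (f2 (\<lambda>i. c * a i)))"
    if "a \<in> ?B" "u \<noteq> 0" for a u
    using f(5,6) that by (auto simp: hom_sect_def lam_scale[symmetric])
  show ?thesis unfolding hframe_def
    by (intro conjI ballI allI impI) (rule zB sB | erule (1) hm l1 | erule bB l0)+
qed

text \<open>The coefficient of \<open>f1\<close> in \<open>f2'\<close> has the negative weight b2 -
  b1 along an orbit whose limit lies in the common domain, so \<open>regf_neg_hom_zero\<close> kills
  it. The coefficient of \<open>f2\<close> is then nonzero, since \<open>f2'\<close> belongs to a
  basis.\<close>

lemma hframe_second_unique: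
  assumes hf: "hframe True A f1 f2 b1 b2" "hframe True A' f1' f2' b1 b2" and b: "b1 > b2"
    and a: "a \<in> A" "a \<in> A'"
  shows "\<exists>c. c \<noteq> 0 \<and> f2' (at1 a) = fscale E c (f2 (at1 a))"
proof -
  note 1 = hframe_True[OF hf(1)] and 2 = hframe_True[OF hf(2)]
  let ?B = "A \<inter> A'"
  let ?x = "at1 a"
  have x: "?x \<in> ?B" using at1_hframe[OF hf(1) a(1)] at1_hframe[OF hf(2) a(2)] by blast
  have s: "sect ?B f1" "sect ?B f2" "sect ?B f2'" using 1(2,3) 2(3) by (auto intro: sect_subset)
  have bb: "\<And>a. a \<in> ?B \<Longrightarrow> basis_at a (f1 a) (f2 a)" using 1(4) by auto
  obtain h k where hk: "regf ?B h" "regf ?B k" "\<And>a. a \<in> ?B \<Longrightarrow> f2' a = lc (h a) (k a) (f1 a) (f2 a)"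
    using sect_cof[OF s bb] by blast
  have xl: "lam True v ?x \<in> ?B" for v
    using 1(7,9) 2(7,9) x by (cases "v = 0") auto
  have H: "hom_sect ?B f1 b1" "hom_sect ?B f2 b2" "hom_sect ?B f2' b2" using 1(5,6) 2(6) by (auto simp: hom_sect_def)
  have hv: "h (lam True v ?x) = v powi (b2 - b1) * h ?x" if v: "v \<noteq> 0" for v
    using coef_hom(1)[OF H(3,1,2) bb[OF x] x v hk(3)[OF x] hk(3)[OF xl]] .
  have h0: "h ?x = 0"
    by (rule regf_neg_hom_zero[where b = True and x = ?x and m = "b2 - b1", OF hk(1) xl _ hv]) (use b in auto)
  have xf: "?x \<in> Y" "f1 ?x \<in> fib ?x" "f2 ?x \<in> fib ?x" using bb[OF x] by (auto simp: basis_at_def)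
  have eq: "f2' ?x = fscale E (k ?x) (f2 ?x)" using hk(3)[OF x] by (simp add: h0 lc_0x[OF xf])
  have "k ?x \<noteq> 0"
  proof
    assume "k ?x = 0"
    then have "f2' ?x = lc 0 0 (f1 ?x) (f2 ?x)" using hk(3)[OF x] h0 by simp
    moreover obtain p q where "f1' ?x = lc p q (f1 ?x) (f2 ?x)" using basis_at_ex[OF bb[OF x] sect_fib[OF 2(2)]] x by blast
    ultimately have "basis_at ?x (lc p q (f1 ?x) (f2 ?x)) (lc 0 0 (f1 ?x) (f2 ?x))" using 2(4)[of ?x] x by simp
    then show False using basis_at_lc_iff[OF bb[OF x]] by simp
  qed
  with eq show ?thesis by blast
qed

text \<open>The section \<open>e2'\<close> is \<open>e2\<close> plus the multiple of
  \<open>e1\<close> dictated by the polynomial \<open>r\<close>, so that near the hyperplane it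
  becomes proportional to \<open>f2\<close>. A generator for the line of \<open>e1\<close> is
  obtained from \<open>f1\<close> by adding a multiple of \<open>f2\<close> that cancels the
  \<open>e2\<close>-component.\<close>

lemma split_frame_unequal_weights:
  assumes ef: "eframe e1 e2 p1 p2" and b: "b1 > b2"
    and hfs: "\<And>z. z \<in> hyperplane n \<Longrightarrow> \<exists>A f1 f2. hframe True A f1 f2 b1 b2 \<and> z \<in> A"
    and r: "r \<in> polyfun" "\<And>a c. a \<in> hyperplane n \<Longrightarrow> c \<noteq> 0 \<Longrightarrow> r (\<lambda>i. c * a i) = c powi (p1 - p2) * r a"
    and L: "\<And>a A f1 f2 c1 c2. a \<in> hyperplane n \<Longrightarrow> a \<in> A \<Longrightarrow> hframe True A f1 f2 b1 b2 \<Longrightarrow>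
       f2 (at1 a) = lc c1 c2 (e1 (at1 a)) (e2 (at1 a)) \<Longrightarrow> r a * c2 = c1"
  shows "\<exists>e2'. split_frame e1 e2'"
proof -
  have e: "sect Y0 e1" "sect Y0 e2" "\<And>a. a \<in> Y0 \<Longrightarrow> basis_at a (e1 a) (e2 a)" "hom_sect Y0 e1 p1" "hom_sect Y0 e2 p2"
    "\<And>a c. a \<in> Y0 \<Longrightarrow> c \<noteq> 0 \<Longrightarrow> e1 (\<lambda>i. c * a i) = e1 a \<and> e2 (\<lambda>i. c * a i) = e2 a"
    using ef by (auto simp: eframe_def)
  \<comment> \<open>The hyperplane coordinates of a / a_0; dividing by a_0 makes \<open>e2'\<close>
    constant along the lines of the cone.\<close>
  define \<rho> where "\<rho> = (\<lambda>(a::nat \<Rightarrow> 'k) i. if i = 0 then 0 else inverse (a 0) * a i)"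
  have \<rho>s: "\<rho> (\<lambda>i. c * a i) = \<rho> a" if "c \<noteq> 0" for a c
    using that by (auto simp: \<rho>_def)
  define e2' where "e2' = (\<lambda>a. lc (r (\<rho> a)) 1 (e1 a) (e2 a))"
  have ef': "e1 a \<in> fib a" "e2 a \<in> fib a" "a \<in> Y" if "a \<in> Y0" for a using e(3)[OF that] by (auto simp: basis_at_def)
  have "regf Y0 (\<lambda>a. \<rho> a i)" for i
    unfolding \<rho>_def by (cases "i = 0") (auto simp: Y0_def intro!: regf_mult regf_inverse regf_intros)
  then have "sect Y0 e2'" unfolding e2'_def by (intro sect_lc e regf_const regf_polyfun_subst[OF r(1)])
  moreover have "basis_at a (e1 a) (e2' a)" if a: "a \<in> Y0" for a
  proof -
    have "e1 a = lc 1 0 (e1 a) (e2 a)" using ef'[OF a] by (simp add: lc_x0 fs_1)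
    then show ?thesis unfolding e2'_def using basis_at_lc_iff[OF e(3)[OF a], of 1 0 "r (\<rho> a)" 1] by simp
  qed
  moreover have "e2' (\<lambda>i. c * a i) = e2' a" if "a \<in> Y0" "c \<noteq> 0" for a c
    using e(6)[OF that] by (simp add: e2'_def \<rho>s that)
  moreover have "\<exists>A t1 t2. zopen Y A \<and> z \<in> A \<and> sect A t1 \<and> sect A t2 \<and> (\<forall>a\<in>A. basis_at a (t1 a) (t2 a)) \<and>
        (\<forall>a\<in>A \<inter> Y0. (\<exists>c. c \<noteq> 0 \<and> t1 a = fscale E c (e1 a)) \<and> (\<exists>c. c \<noteq> 0 \<and> t2 a = fscale E c (e2' a)))"
    if z: "z \<in> hyperplane n" for z
  proof -
    from hfs[OF z] obtain A f1 f2 where hf: "hframe True A f1 f2 b1 b2" and zA: "z \<in> A" by blast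
    note f = hframe_True[OF hf]
    have sub: "sect (A \<inter> Y0) f1" "sect (A \<inter> Y0) f2" "sect (A \<inter> Y0) e1" "sect (A \<inter> Y0) e2"
      using f(2,3) e(1,2) by (auto intro: sect_subset)
    have eb: "\<And>a. a \<in> A \<inter> Y0 \<Longrightarrow> basis_at a (e1 a) (e2 a)" using e(3) by auto
    obtain g11 g21 where g1: "regf (A \<inter> Y0) g11" "regf (A \<inter> Y0) g21"
      "\<And>a. a \<in> A \<inter> Y0 \<Longrightarrow> f1 a = lc (g11 a) (g21 a) (e1 a) (e2 a)" using sect_cof[OF sub(3,4,1) eb] by blast
    obtain g12 g22 where g2: "regf (A \<inter> Y0) g12" "regf (A \<inter> Y0) g22"
      "\<And>a. a \<in> A \<inter> Y0 \<Longrightarrow> f2 a = lc (g12 a) (g22 a) (e1 a) (e2 a)" using sect_cof[OF sub(3,4,2) eb] by blast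
    have det: "g11 (at1 a) * g22 (at1 a) - g21 (at1 a) * g12 (at1 a) \<noteq> 0" if a: "a \<in> A" for a
    proof -
      have x: "at1 a \<in> A \<inter> Y0" using at1_hframe[OF hf a] by blast
      then have "basis_at (at1 a) (f1 (at1 a)) (f2 (at1 a))" using f(4) by blast
      then show ?thesis using basis_at_lc_iff[OF eb[OF x]] by (simp add: g1(3)[OF x] g2(3)[OF x])
    qed
    have rel: "r (a(0 := 0)) * g22 (at1 a) = g12 (at1 a)" if a: "a \<in> A" for a
    proof -
      have "a(0 := 0) \<in> A" using f(7)[OF a] by (simp add: lam_True_0)
      moreover from this have "a(0 := 0) \<in> hyperplane n" using f(1) zopen_subset by (auto simp: hyperplane_def)
      ultimately show ?thesis using L[OF _ _ hf, of "a(0 := 0)"] g2(3)[of "at1 a"] at1_hframe[OF hf a] by simp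
    qed
    \<comment> \<open>By \<open>rel\<close> the coefficient \<open>g12\<close> is a multiple of
      \<open>g22\<close>, so \<open>g22 = 0\<close> would make the determinant vanish.\<close>
    have g22: "g22 (at1 a) \<noteq> 0" if a: "a \<in> A" for a
      using det[OF a] rel[OF a] by auto
    define k where "k = nat (b1 - b2)"
    \<comment> \<open>The solution of g21 + q g22 = 0. The quotient g21 / g22 has weight b1 - b2, so
      it is its value at \<open>at1 a\<close> times that power of a_0. The power is nonnegative
      because b1 > b2, and therefore \<open>q\<close> is regular on the hyperplane too.\<close>
    define q where "q = (\<lambda>a. - (g21 (at1 a) / g22 (at1 a)) * a 0 ^ k)"
    have "regf A q" unfolding q_def
      by (intro regf_mult regf_uminus regf_divide regf_at1[OF hf] g1 g2 g22 regf_intros)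
    define t1 where "t1 = (\<lambda>a. lc 1 (q a) (f1 a) (f2 a))"
    have "sect A t1" unfolding t1_def by (intro sect_lc f regf_const \<open>regf A q\<close>)
    moreover have "basis_at a (t1 a) (f2 a)" if a: "a \<in> A" for a
    proof -
      have fa: "a \<in> Y" "f1 a \<in> fib a" "f2 a \<in> fib a" using f(4)[OF a] by (auto simp: basis_at_def)
      then have "f2 a = lc 0 1 (f1 a) (f2 a)" by (simp add: lc_0x[OF fa] fs_1[OF fa(1,3)])
      then show ?thesis unfolding t1_def using basis_at_lc_iff[OF f(4)[OF a], of 1 "q a" 0 1] by simp
    qed
    moreover have "(\<exists>c. c \<noteq> 0 \<and> t1 a = fscale E c (e1 a)) \<and> (\<exists>c. c \<noteq> 0 \<and> f2 a = fscale E c (e2' a))"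
      if a: "a \<in> A \<inter> Y0" for a
    proof -
      have aA: "a \<in> A" and x: "at1 a \<in> A \<inter> Y0" using at1_hframe[OF hf] a by blast+
      have a0: "a 0 \<noteq> 0" and aY: "a \<in> Y" using a by (auto simp: Y0_def)
      have la: "lam True (a 0) (at1 a) = a" by (simp add: lam_at1)
      have H: "hom_sect (A \<inter> Y0) e1 p1" "hom_sect (A \<inter> Y0) e2 p2" "hom_sect (A \<inter> Y0) f1 b1" "hom_sect (A \<inter> Y0) f2 b2"
        using e(4,5) f(5,6) by (auto simp: hom_sect_def)
      have ee: "e1 a \<in> fib a" "e2 a \<in> fib a" using sect_fib sub a by blast+
      let ?w = "\<lambda>m. a 0 powi m"
      have G1: "g11 a = ?w (b1 - p1) * g11 (at1 a)" "g21 a = ?w (b1 - p2) * g21 (at1 a)"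
        using coef_hom[OF H(3,1,2) eb[OF x] x a0 g1(3)[OF x], unfolded la, OF g1(3)[OF a]] by auto
      have G2: "g12 a = ?w (b2 - p1) * g12 (at1 a)" "g22 a = ?w (b2 - p2) * g22 (at1 a)"
        using coef_hom[OF H(4,1,2) eb[OF x] x a0 g2(3)[OF x], unfolded la, OF g2(3)[OF a]] by auto
      have "a(0 := 0) \<in> A" using f(7)[OF aA] by (simp add: lam_True_0)
      then have hy: "a(0 := 0) \<in> hyperplane n" using f(1) zopen_subset by (auto simp: hyperplane_def)
      \<comment> \<open>Homogeneity of \<open>r\<close> converts its value at a / a_0 into its value
        at the limit point \<open>a(0 := 0)\<close>; the power of a_0 that appears is the one by
        which the weights p1 and p2 differ.\<close>
      have "\<rho> a = (\<lambda>i. inverse (a 0) * (a(0 := 0)) i)" by (auto simp: \<rho>_def)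
      then have "r (\<rho> a) = inverse (a 0) powi (p1 - p2) * r (a(0 := 0))" using r(2)[OF hy] a0 by simp
      also have "inverse (a 0) powi (p1 - p2) = ?w (p2 - p1)"
        using a0 by (simp add: power_int_inverse power_int_diff field_simps)
      finally have r\<rho>: "r (\<rho> a) = ?w (p2 - p1) * r (a(0 := 0))" .
      have kk: "a 0 ^ k = ?w (b1 - b2)" using b by (simp add: k_def power_int_def)
      have "f2 a = fscale E (?w (b2 - p2) * g22 (at1 a)) (e2' a)"
      proof -
        have "g12 a = ?w (b2 - p2) * g22 (at1 a) * r (\<rho> a)"
          using a0 by (simp add: G2 r\<rho> rel[OF aA, symmetric] power_int_diff field_simps)
        then show ?thesis unfolding g2(3)[OF a] e2'_def fs_lc[OF aY ee] by (simp add: G2)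
      qed
      moreover have "t1 a = fscale E (?w (b1 - p1) * (g11 (at1 a) * g22 (at1 a) - g21 (at1 a) * g12 (at1 a)) / g22 (at1 a)) (e1 a)"
      proof -
        have "t1 a = lc (g11 a + q a * g12 a) (g21 a + q a * g22 a) (e1 a) (e2 a)"
          unfolding t1_def g1(3)[OF a] g2(3)[OF a] lc_lc[OF aY ee] by simp
        also have "g21 a + q a * g22 a = 0"
          using a0 g22[OF aA] by (simp add: q_def kk G1 G2 power_int_diff field_simps)
        also have "g11 a + q a * g12 a = ?w (b1 - p1) * (g11 (at1 a) * g22 (at1 a) - g21 (at1 a) * g12 (at1 a)) / g22 (at1 a)"
          using a0 g22[OF aA] by (simp add: q_def kk G1 G2 power_int_diff field_simps)
        finally show ?thesis by (simp add: lc_x0[OF aY ee])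
      qed
      moreover have "?w (b2 - p2) * g22 (at1 a) \<noteq> 0" using a0 g22[OF aA] by simp
      moreover have "?w (b1 - p1) * (g11 (at1 a) * g22 (at1 a) - g21 (at1 a) * g12 (at1 a)) / g22 (at1 a) \<noteq> 0"
        using a0 g22[OF aA] det[OF aA] by simp
      ultimately show ?thesis by blast
    qed
    ultimately show ?thesis using f(1,3) zA
      by (rule_tac exI[of _ A], rule_tac exI[of _ t1], rule_tac exI[of _ f2]) simp
  qed
  ultimately show ?thesis using e unfolding split_frame_def by (intro exI[of _ e2']) simp
qed

lemma eframe_swap: "eframe e1 e2 p1 p2 \<Longrightarrow> eframe e2 e1 p2 p1"
  using basis_at_swap unfolding eframe_def by auto

lemma lc_swap: "a \<in> Y \<Longrightarrow> d \<in> fib a \<Longrightarrow> e \<in> fib a \<Longrightarrow> lc x y d e = lc y x e d"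
proof -
  assume a: "a \<in> Y" "d \<in> fib a" "e \<in> fib a"
  obtain U \<phi> where U: "(U, \<phi>) \<in> charts E" "a \<in> cU U" by (rule chart_ex[OF a(1)])
  show ?thesis by (rule ch_eqI[OF U]) (simp_all add: fib_lc a ch_lc[OF U])
qed

lemma ex_split_frame: "\<exists>e1 e2. split_frame e1 e2"
proof -
  obtain e1 e2 p1 p2 where ef: "eframe e1 e2 p1 p2" using ex_eframe by blast
  obtain b1 b2 where b: "b1 \<ge> b2" "\<And>z. z \<in> hyperplane n \<Longrightarrow> \<exists>A f1 f2. hframe True A f1 f2 b1 b2 \<and> z \<in> A"
    using ex_hframes by blast
  show ?thesis
  proof (cases "b1 = b2")
    case True
    then show ?thesis using split_frame_equal_weights[OF ef] b(2) by blast
  next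
    case False
    with b(1) have b': "b1 > b2" by simp
    have e: "sect Y0 e1" "sect Y0 e2" "\<And>a. a \<in> Y0 \<Longrightarrow> basis_at a (e1 a) (e2 a)" "hom_sect Y0 e1 p1" "hom_sect Y0 e2 p2"
      "\<And>a c. a \<in> Y0 \<Longrightarrow> c \<noteq> 0 \<Longrightarrow> e1 (\<lambda>i. c * a i) = e1 a \<and> e2 (\<lambda>i. c * a i) = e2 a"
      using ef by (auto simp: eframe_def)
    \<comment> \<open>The frame \<open>e1\<close>, \<open>e2\<close> does not reach the hyperplane,
      so the line at \<open>a\<close> is read off at \<open>at1 a\<close>. By
      \<open>hframe_second_unique\<close> it is the same for all choices of
      \<open>f2\<close>.\<close>
    define L where "L = (\<lambda>a \<alpha> \<beta>. \<exists>A f1 f2 c1 c2. hframe True A f1 f2 b1 b2 \<and> a \<in> A \<and>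
       f2 (at1 a) = lc c1 c2 (e1 (at1 a)) (e2 (at1 a)) \<and> \<alpha> * c2 = \<beta> * c1)"
    have L_iff: "L a \<alpha> \<beta> \<longleftrightarrow> \<alpha> * c2 = \<beta> * c1"
      if hf: "hframe True A f1 f2 b1 b2" "a \<in> A" "f2 (at1 a) = lc c1 c2 (e1 (at1 a)) (e2 (at1 a))" for a A f1 f2 c1 c2 \<alpha> \<beta>
    proof
      assume "L a \<alpha> \<beta>"
      then obtain A' f1' f2' c1' c2' where hf': "hframe True A' f1' f2' b1 b2" "a \<in> A'"
        "f2' (at1 a) = lc c1' c2' (e1 (at1 a)) (e2 (at1 a))" "\<alpha> * c2' = \<beta> * c1'" unfolding L_def by blast
      obtain c where c: "c \<noteq> 0" "f2 (at1 a) = fscale E c (f2' (at1 a))"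
        using hframe_second_unique[OF hf'(1) hf(1) b' hf'(2) hf(2)] by blast
      have x: "at1 a \<in> Y0" using at1_hframe[OF hf(1,2)] by blast
      have bx: "at1 a \<in> Y" "e1 (at1 a) \<in> fib (at1 a)" "e2 (at1 a) \<in> fib (at1 a)" using e(3)[OF x] by (auto simp: basis_at_def)
      have "lc c1 c2 (e1 (at1 a)) (e2 (at1 a)) = lc (c * c1') (c * c2') (e1 (at1 a)) (e2 (at1 a))"
        using c(2) hf(3) hf'(3) fs_lc[OF bx] by simp
      from basis_at_uniq[OF e(3)[OF x] this] hf'(4) show "\<alpha> * c2 = \<beta> * c1" by (simp add: mult.left_commute)
    next
      assume "\<alpha> * c2 = \<beta> * c1" with hf show "L a \<alpha> \<beta>" unfolding L_def by blast
    qed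
    have coefs: "\<exists>c1 c2. f2 (at1 a) = lc c1 c2 (e1 (at1 a)) (e2 (at1 a)) \<and> (c1 \<noteq> 0 \<or> c2 \<noteq> 0)"
      if hf: "hframe True A f1 f2 b1 b2" "a \<in> A" for a A f1 f2
    proof -
      note f = hframe_True[OF hf(1)]
      have x: "at1 a \<in> Y0" "at1 a \<in> A" using at1_hframe[OF hf] by blast+
      obtain c1 c2 where c: "f2 (at1 a) = lc c1 c2 (e1 (at1 a)) (e2 (at1 a))"
        using basis_at_ex[OF e(3)[OF x(1)] sect_fib[OF f(3) x(2)]] by blast
      obtain d1 d2 where d: "f1 (at1 a) = lc d1 d2 (e1 (at1 a)) (e2 (at1 a))"
        using basis_at_ex[OF e(3)[OF x(1)] sect_fib[OF f(2) x(2)]] by blast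
      have "d1 * c2 - d2 * c1 \<noteq> 0" using f(4)[OF x(2)] basis_at_lc_iff[OF e(3)[OF x(1)]] by (simp add: c d)
      then have "c1 \<noteq> 0 \<or> c2 \<noteq> 0" by auto
      with c show ?thesis by blast
    qed
    interpret lf: line_family n L "\<lambda>c. c powi (p1 - p2)"
    proof
      show "n \<ge> 3" by (rule n3)
      fix a :: "nat \<Rightarrow> 'k" assume a: "a \<in> hyperplane n"
      then obtain A f1 f2 where hf: "hframe True A f1 f2 b1 b2" "a \<in> A" using b(2) by blast
      note f = hframe_True[OF hf(1)]
      from coefs[OF hf] obtain c1 c2 where "f2 (at1 a) = lc c1 c2 (e1 (at1 a)) (e2 (at1 a))" "c1 \<noteq> 0 \<or> c2 \<noteq> 0" by blast
      then show "\<exists>\<alpha>0 \<beta>0. (\<alpha>0 \<noteq> 0 \<or> \<beta>0 \<noteq> 0) \<and> (\<forall>\<alpha> \<beta>. L a \<alpha> \<beta> \<longleftrightarrow> \<alpha> * \<beta>0 = \<beta> * \<alpha>0)"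
        using L_iff[OF hf] by blast
      have sub: "sect (A \<inter> Y0) e1" "sect (A \<inter> Y0) e2" "sect (A \<inter> Y0) f2"
        using f(3) e(1,2) by (auto intro: sect_subset)
      have eb: "\<And>a. a \<in> A \<inter> Y0 \<Longrightarrow> basis_at a (e1 a) (e2 a)" using e(3) by auto
      obtain g1 g2 where g: "regf (A \<inter> Y0) g1" "regf (A \<inter> Y0) g2"
        "\<And>a. a \<in> A \<inter> Y0 \<Longrightarrow> f2 a = lc (g1 a) (g2 a) (e1 a) (e2 a)" using sect_cof[OF sub eb] by blast
      have "(g1 (at1 x) \<noteq> 0 \<or> g2 (at1 x) \<noteq> 0) \<and> L x (g1 (at1 x)) (g2 (at1 x))" if x: "x \<in> A \<inter> hyperplane n" for x
      proof -
        have xA: "x \<in> A" and x1: "at1 x \<in> A \<inter> Y0" using at1_hframe[OF hf(1)] x by blast+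
        from coefs[OF hf(1) xA] obtain c1 c2 where c: "f2 (at1 x) = lc c1 c2 (e1 (at1 x)) (e2 (at1 x))" "c1 \<noteq> 0 \<or> c2 \<noteq> 0" by blast
        from basis_at_uniq[OF eb[OF x1], of c1 c2 "g1 (at1 x)" "g2 (at1 x)"] c(1) g(3)[OF x1]
        have "c1 = g1 (at1 x)" "c2 = g2 (at1 x)" by auto
        then show ?thesis using c(2) L_iff[OF hf(1) xA g(3)[OF x1]] by (auto simp: mult.commute)
      qed
      moreover have "zopen (hyperplane n) (A \<inter> hyperplane n)" by (rule zopen_hyperplane_restrict[OF f(1)])
      moreover have "regf (A \<inter> hyperplane n) (\<lambda>x. g1 (at1 x))" "regf (A \<inter> hyperplane n) (\<lambda>x. g2 (at1 x))"
        by (rule regf_subset[OF regf_at1[OF hf(1) g(1)]], simp) (rule regf_subset[OF regf_at1[OF hf(1) g(2)]], simp)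
      ultimately show "\<exists>A f g. zopen (hyperplane n) A \<and> a \<in> A \<and> regf A f \<and> regf A g \<and> (\<forall>b\<in>A. (f b \<noteq> 0 \<or> g b \<noteq> 0) \<and> L b (f b) (g b))"
        using a hf(2)
        by (rule_tac exI[of _ "A \<inter> hyperplane n"], rule_tac exI[of _ "\<lambda>x. g1 (at1 x)"], rule_tac exI[of _ "\<lambda>x. g2 (at1 x)"]) simp
    next
      fix a :: "nat \<Rightarrow> 'k" and c \<alpha> \<beta> :: 'k assume a: "a \<in> hyperplane n" and c: "c \<noteq> 0"
      let ?ca = "\<lambda>i. c * a i"
      have "?ca \<in> hyperplane n" by (rule hyperplane_scale[OF a c])
      then obtain A f1 f2 where hf: "hframe True A f1 f2 b1 b2" "?ca \<in> A" using b(2) by blast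
      note f = hframe_True[OF hf(1)]
      from coefs[OF hf] obtain c1 c2 where c12: "f2 (at1 ?ca) = lc c1 c2 (e1 (at1 ?ca)) (e2 (at1 ?ca))" by blast
      let ?x = "at1 ?ca"
      have x: "?x \<in> A" "?x \<in> Y0" using at1_hframe[OF hf] by blast+
      have bx: "?x \<in> Y" "e1 ?x \<in> fib ?x" "e2 ?x \<in> fib ?x" using e(3)[OF x(2)] by (auto simp: basis_at_def)
      have aY: "a \<in> Y" using a by (simp add: hyperplane_def)
      \<comment> \<open>Scaling and passing to \<open>at1\<close> differ by a move along the orbit.
        The move multiplies the coordinates with respect to \<open>e1\<close> and \<open>e2\<close>
        by powers of c whose exponents differ by p1 - p2, which is the origin of the twist.\<close>
      have ca: "(\<lambda>i. c * at1 a i) = lam True c ?x" by (auto simp: lam_def)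
      have a1: "at1 a \<in> Y0" using at1_Y0[OF aY] .
      let ?y = "lam True c ?x"
      have yY: "?y \<in> Y" by (rule lam_homog_coords[OF c bx(1)])
      have sf: "act True c (e1 ?x) \<in> fib ?y" "act True c (e2 ?x) \<in> fib ?y" using act_fib[OF bx(1) c] bx by auto
      have e1: "e1 (at1 a) = fscale E (c powi p1) (act True c (e1 ?x))" and e2: "e2 (at1 a) = fscale E (c powi p2) (act True c (e2 ?x))"
        using e(6)[OF a1 c] e(4,5) x(2) c unfolding ca hom_sect_def by auto
      have "f2 ?y = fscale E (c powi b2) (act True c (f2 ?x))" using f(6) x(1) c by (simp add: hom_sect_def)
      also have "\<dots> = lc (c powi b2 * c1) (c powi b2 * c2) (act True c (e1 ?x)) (act True c (e2 ?x))"
        by (simp add: c12 act_lc[OF bx(1) c bx(2,3)] fs_lc[OF yY sf])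
      also have "\<dots> = lc (c powi (b2 - p1) * c1) (c powi (b2 - p2) * c2) (e1 (at1 a)) (e2 (at1 a))"
        unfolding e1 e2 lc_fs[OF yY sf] using c by (simp add: power_int_diff field_simps)
      finally have f2y: "f2 (\<lambda>i. c * at1 a i) = lc (c powi (b2 - p1) * c1) (c powi (b2 - p2) * c2) (e1 (at1 a)) (e2 (at1 a))"
        unfolding ca .
      \<comment> \<open>The frame around the multiple of \<open>a\<close>, composed with the
        homothety, is a frame around \<open>a\<close>, so \<open>f2y\<close> determines the line at
        \<open>a\<close>.\<close>
      have "a \<in> {a\<in>Y. (\<lambda>i. c * a i) \<in> A}" using aY hf(2) by simp
      from L_iff[OF hframe_scale[OF hf(1) c] this f2y, of \<alpha> "c powi (p1 - p2) * \<beta>"]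
      have "L a \<alpha> (c powi (p1 - p2) * \<beta>) \<longleftrightarrow> \<alpha> * c2 = \<beta> * c1"
        using c by (simp add: power_int_diff field_simps)
      then show "L ?ca \<alpha> \<beta> \<longleftrightarrow> L a \<alpha> (c powi (p1 - p2) * \<beta>)" using L_iff[OF hf c12] by simp
    qed simp
    from lf.dichotomy show ?thesis
    proof (elim disjE bexE)
      fix r assume r: "r \<in> polyfun" "\<forall>a\<in>hyperplane n. L a (r a) 1"
      have "r (\<lambda>i. c * a i) = c powi (p1 - p2) * r a" if a: "a \<in> hyperplane n" and c: "c \<noteq> 0" for a c
      proof -
        have "L (\<lambda>i. c * a i) (r (\<lambda>i. c * a i)) 1" using r(2) hyperplane_scale[OF a c] by blast
        then have "L a (r (\<lambda>i. c * a i)) (c powi (p1 - p2))" using lf.scale[OF a c] by simp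
        moreover have "L a (r a) 1" using r(2) a by blast
        ultimately show ?thesis using lf.line_iff[OF a, of "r a" 1 "r (\<lambda>i. c * a i)" "c powi (p1 - p2)"] by simp
      qed
      moreover have "r a * c2 = c1" if "a \<in> hyperplane n" "a \<in> A" "hframe True A f1 f2 b1 b2"
        "f2 (at1 a) = lc c1 c2 (e1 (at1 a)) (e2 (at1 a))" for a A f1 f2 c1 c2
        using L_iff[OF that(3,2,4), of "r a" 1] r(2) that(1) by simp
      ultimately show ?thesis using split_frame_unequal_weights[OF ef b' b(2) r(1)] by blast
    next
      fix r assume r: "r \<in> polyfun" "\<forall>a\<in>hyperplane n. L a 1 (r a)"
      have "r (\<lambda>i. c * a i) = c powi (p2 - p1) * r a" if a: "a \<in> hyperplane n" and c: "c \<noteq> 0" for a c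
      proof -
        have "L (\<lambda>i. c * a i) 1 (r (\<lambda>i. c * a i))" using r(2) hyperplane_scale[OF a c] by blast
        then have "L a 1 (c powi (p1 - p2) * r (\<lambda>i. c * a i))" using lf.scale[OF a c] by simp
        moreover have "L a 1 (r a)" using r(2) a by blast
        ultimately have "r a = c powi (p1 - p2) * r (\<lambda>i. c * a i)"
          using lf.line_iff[OF a, of 1 "r a" 1 "c powi (p1 - p2) * r (\<lambda>i. c * a i)"] by simp
        then show ?thesis using c by (simp add: power_int_diff field_simps)
      qed
      moreover have "r a * c2 = c1" if a: "a \<in> hyperplane n" "a \<in> A" and hf: "hframe True A f1 f2 b1 b2"
        and eq: "f2 (at1 a) = lc c1 c2 (e2 (at1 a)) (e1 (at1 a))" for a A f1 f2 c1 c2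
      proof -
        have x: "at1 a \<in> Y0" using at1_hframe[OF hf a(2)] by blast
        then have "at1 a \<in> Y" "e1 (at1 a) \<in> fib (at1 a)" "e2 (at1 a) \<in> fib (at1 a)" using e(3)[OF x] by (auto simp: basis_at_def)
        then have "f2 (at1 a) = lc c2 c1 (e1 (at1 a)) (e2 (at1 a))" using eq lc_swap by metis
        from L_iff[OF hf a(2) this, of 1 "r a"] r(2) a(1) show ?thesis by simp
      qed
      ultimately show ?thesis using split_frame_unequal_weights[OF eframe_swap[OF ef] b' b(2) r(1)] by blast
    qed
  qed
qed

end

section \<open>Splitting the bundle\<close>

definition over :: "nat \<Rightarrow> (nat \<Rightarrow> 'k::field) set \<Rightarrow> (nat \<Rightarrow> 'k) set set \<Rightarrow> (nat + nat \<Rightarrow> 'k) set" where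
  "over m A W = {case_sum b v |b v. b \<in> A \<and> proj_point b \<in> W \<and> v \<in> affine_space m}"

text \<open>Regularity is checked on the cone and locally in the base: near each representative a
  formula in homogeneous coordinates is enough.\<close>

lemma regular_on_local:
  fixes W :: "(nat \<Rightarrow> 'k::alg_closed_field) set set"
  assumes W: "zopen (homog_coords n) {a\<in>homog_coords n. proj_point a \<in> W}" "W \<subseteq> proj_space n"
    and loc: "\<And>a. a \<in> homog_coords n \<Longrightarrow> proj_point a \<in> W \<Longrightarrow> \<exists>A G. zopen (homog_coords n) A \<and> a \<in> A \<and>
      regf (over m A W) G \<and>
      (\<forall>b v. b \<in> A \<longrightarrow> proj_point b \<in> W \<longrightarrow> v \<in> affine_space m \<longrightarrow> F (proj_point b, v) = G (case_sum b v))"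
  shows "regular_on n m (W \<times> affine_space m) F"
proof (rule regf_imp_regular_on)
  show "zopen (prodpts n m) (cone n m (W \<times> affine_space m))" by (rule zopen_cone_times[OF W(1)])
  show "W \<times> affine_space m \<subseteq> proj_space n \<times> affine_space m" using W(2) by auto
  show "regf (cone n m (W \<times> affine_space m)) (\<lambda>w. F (proj_point (\<lambda>i. w (Inl i)), \<lambda>j. w (Inr j)))"
  proof (rule regf_glue[OF cone_subset])
    fix w assume "w \<in> cone n m (W \<times> affine_space m)"
    then obtain a v where w: "w = case_sum a v" "a \<in> homog_coords n" "v \<in> affine_space m" "proj_point a \<in> W"
      by (auto simp: cone_def)
    from loc[OF w(2,4)] obtain A G where A: "zopen (homog_coords n) A" "a \<in> A" "regf (over m A W) G"
      "\<And>b v. b \<in> A \<Longrightarrow> proj_point b \<in> W \<Longrightarrow> v \<in> affine_space m \<Longrightarrow> F (proj_point b, v) = G (case_sum b v)" by blast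
    let ?B = "{w\<in>prodpts n m. (\<lambda>i. w (Inl i)) \<in> A}"
    have "zopen (prodpts n m) ?B"
      by (rule zopen_preimage[OF A(1) zopen_self]) (auto simp: prodpts_def intro: regf_intros)
    moreover have "w \<in> ?B" using w A(2) by (auto simp: prodpts_iff)
    moreover have "regf (cone n m (W \<times> affine_space m) \<inter> ?B) (\<lambda>w. F (proj_point (\<lambda>i. w (Inl i)), \<lambda>j. w (Inr j)))"
    proof -
      have sub: "cone n m (W \<times> affine_space m) \<inter> ?B \<subseteq> over m A W"
        by (auto simp: cone_def over_def case_sum_eq_iff)
      have "F (proj_point (\<lambda>i. x (Inl i)), \<lambda>j. x (Inr j)) = G x" if "x \<in> cone n m (W \<times> affine_space m) \<inter> ?B" for x
        using that A(4) by (auto simp: cone_def)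
      then show ?thesis using regf_subset[OF A(3) sub] by (subst regf_cong) auto
    qed
    ultimately show "\<exists>B. zopen (prodpts n m) B \<and> w \<in> B \<and>
        regf (cone n m (W \<times> affine_space m) \<inter> B) (\<lambda>w. F (proj_point (\<lambda>i. w (Inl i)), \<lambda>j. w (Inr j)))" by blast
  qed
qed

lemma regf_over:
  assumes "regf B f" "\<And>b. b \<in> A \<Longrightarrow> proj_point b \<in> W \<Longrightarrow> b \<in> B"
  shows "regf (over m A W) (\<lambda>w. f (\<lambda>i. w (Inl i)))"
  by (rule regf_comp[OF assms(1)]) (use assms(2) in \<open>auto simp: over_def intro: regf_intros\<close>)

context equivariant_bundle
begin

lemma fadd_fs:
  assumes a: "a \<in> Y" "d \<in> fib a"
  shows "fadd E (fscale E c d) (fscale E c' d) = fscale E (c + c') d"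
proof -
  obtain U \<phi> where U: "(U, \<phi>) \<in> charts E" "a \<in> cU U" by (rule chart_ex[OF a(1)])
  show ?thesis by (rule ch_eqI[OF U]) (simp_all add: fib_scale fib_add a ch_add[OF U] ch_scale[OF U] algebra_simps)
qed

lemma lc_add:
  assumes a: "a \<in> Y" "d \<in> fib a" "e \<in> fib a"
  shows "fadd E (lc p q d e) (lc r s d e) = lc (p + r) (q + s) d e"
proof -
  obtain U \<phi> where U: "(U, \<phi>) \<in> charts E" "a \<in> cU U" by (rule chart_ex[OF a(1)])
  show ?thesis by (rule ch_eqI[OF U]) (simp_all add: fib_lc fib_add a ch_add[OF U] ch_lc[OF U] algebra_simps)
qed

lemma chart_subset: "(U, \<phi>) \<in> charts E \<Longrightarrow> U \<subseteq> proj_space n"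
  using charts_cover by auto

text \<open>The line subbundle that extends the span of a section \<open>e\<close> over the affine space \<open>Y0\<close>.\<close>

definition sub :: "((nat \<Rightarrow> 'k) \<Rightarrow> 'e) \<Rightarrow> 'e set" where
  "sub e = {d. \<exists>a A s. zopen Y A \<and> a \<in> A \<and> sect A s \<and> s a = d \<and> (\<forall>b\<in>A \<inter> Y0. \<exists>c. s b = fscale E c (e b))}"

text \<open>Coordinate \<open>j\<close> of a chart of the bundle is a chart of the line wherever it
  does not vanish on the whole fibre. Since the line is nonzero, j = 0 and j = 1 together cover the
  domain of the chart.\<close>

definition line_sub :: "((nat \<Rightarrow> 'k) \<Rightarrow> 'e) \<Rightarrow> ('e, 'k) vbundle" where
  "line_sub e = \<lparr> total_space = sub e, bproj = bproj E, fadd = fadd E, fscale = fscale E,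
     charts = {({x\<in>U. \<exists>d\<in>sub e. bproj E d = x \<and> \<phi> d j \<noteq> 0}, \<lambda>d i. if i = 0 then \<phi> d j else 0) |U \<phi> j.
        (U, \<phi>) \<in> charts E \<and> j < (2::nat)} \<rparr>"

text \<open>Over \<open>A\<close> the subbundle is spanned by \<open>t\<close>, and \<open>t'\<close> spans a complement.\<close>

definition line_data :: "((nat \<Rightarrow> 'k) \<Rightarrow> 'e) \<Rightarrow> (nat \<Rightarrow> 'k) set \<Rightarrow> ((nat \<Rightarrow> 'k) \<Rightarrow> 'e) \<Rightarrow> ((nat \<Rightarrow> 'k) \<Rightarrow> 'e) \<Rightarrow> bool" where
  "line_data e A t t' \<longleftrightarrow> zopen Y A \<and> sect A t \<and> sect A t' \<and> (\<forall>b\<in>A. basis_at b (t b) (t' b)) \<and>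
     (\<forall>b\<in>A \<inter> Y0. \<exists>c. c \<noteq> 0 \<and> t b = fscale E c (e b)) \<and>
     sect Y0 e \<and> (\<forall>b\<in>Y0. \<forall>c. c \<noteq> 0 \<longrightarrow> e (\<lambda>i. c * b i) = e b)"

lemma line_data_D:
  assumes "line_data e A t t'"
  shows "zopen Y A" "sect A t" "sect A t'" "\<And>b. b \<in> A \<Longrightarrow> basis_at b (t b) (t' b)"
    "\<And>b. b \<in> A \<Longrightarrow> b \<in> Y0 \<Longrightarrow> \<exists>c. c \<noteq> 0 \<and> t b = fscale E c (e b)" "sect Y0 e"
    "\<And>b c. b \<in> Y0 \<Longrightarrow> c \<noteq> 0 \<Longrightarrow> e (\<lambda>i. c * b i) = e b"
    "\<And>b. b \<in> A \<Longrightarrow> b \<in> Y" "\<And>b. b \<in> A \<Longrightarrow> t b \<in> fib b" "\<And>b. b \<in> A \<Longrightarrow> t' b \<in> fib b"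
proof -
  show zA: "zopen Y A" and t: "sect A t" and t': "sect A t'" and "\<And>b. b \<in> A \<Longrightarrow> basis_at b (t b) (t' b)"
    "\<And>b. b \<in> A \<Longrightarrow> b \<in> Y0 \<Longrightarrow> \<exists>c. c \<noteq> 0 \<and> t b = fscale E c (e b)" "sect Y0 e"
    "\<And>b c. b \<in> Y0 \<Longrightarrow> c \<noteq> 0 \<Longrightarrow> e (\<lambda>i. c * b i) = e b"
    using assms unfolding line_data_def by simp_all
  show "\<And>b. b \<in> A \<Longrightarrow> b \<in> Y" using zopen_subset[OF zA] by blast
  show "\<And>b. b \<in> A \<Longrightarrow> t b \<in> fib b" "\<And>b. b \<in> A \<Longrightarrow> t' b \<in> fib b"
    using sect_fib[OF t] sect_fib[OF t'] by simp_all
qed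

lemma sub_total: "sub e \<subseteq> total_space E"
  unfolding sub_def using sect_fib fib_total by blast

lemma fib_bproj: "d \<in> fib a \<Longrightarrow> bproj E d = proj_point a"
  by (simp add: fib_def fibre_def)

text \<open>A witness for membership lives near some representative of the point, possibly not
  \<open>b\<close>; a homothety moves it to \<open>b\<close>. In the expansion with respect to
  \<open>t\<close> and \<open>t'\<close>, its \<open>t'\<close>-coefficient is zero on the dense set
  \<open>Y0\<close>, hence at \<open>b\<close>.\<close>

lemma sub_iff:
  assumes line_data: "line_data e A t t'" and b: "b \<in> A" and d: "d \<in> fib b"
  shows "d \<in> sub e \<longleftrightarrow> (\<exists>c. d = fscale E c (t b))"
proof
  note L = line_data_D[OF line_data]
  assume "\<exists>c. d = fscale E c (t b)"
  then obtain c where c: "d = fscale E c (t b)" by blast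
  have "sect A (\<lambda>x. fscale E c (t x))" by (intro sect_fscale L regf_const)
  moreover have "\<exists>k. fscale E c (t x) = fscale E k (e x)" if x: "x \<in> A" "x \<in> Y0" for x
  proof -
    obtain k where "t x = fscale E k (e x)" using L(5)[OF x] by blast
    then show ?thesis using fs_fs[OF L(8)[OF x(1)] sect_fib[OF L(6) x(2)]] by auto
  qed
  ultimately show "d \<in> sub e" unfolding sub_def using L(1) b c by blast
next
  note L = line_data_D[OF line_data]
  assume "d \<in> sub e"
  then obtain a A' s where s: "zopen Y A'" "a \<in> A'" "sect A' s" "s a = d" "\<And>b. b \<in> A' \<Longrightarrow> b \<in> Y0 \<Longrightarrow> \<exists>c. s b = fscale E c (e b)"
    unfolding sub_def by blast
  have "proj_point a = proj_point b" using fib_bproj[OF d] fib_bproj[OF sect_fib[OF s(3,2)]] s(4) by simp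
  then obtain c where c: "c \<noteq> 0" "a = (\<lambda>i. c * b i)" by (rule proj_point_eqD)
  define B where "B = {x\<in>A. (\<lambda>i. c * x i) \<in> A'}"
  have BA: "B \<subseteq> A" by (auto simp: B_def)
  have zB: "zopen Y B" unfolding B_def
    by (rule zopen_preimage[OF s(1) L(1)]) (use c L(8) in \<open>auto intro: homog_coords_scale regf_intros\<close>)
  have bB: "b \<in> B" using b s(2) c by (simp add: B_def)
  define s' where "s' = (\<lambda>x. s (\<lambda>i. c * x i))"
  have s': "sect B s'" unfolding s'_def
    by (rule sect_comp[OF s(3)]) (use c(1) BA L(8) in \<open>auto simp: B_def proj_point_scale intro: regf_intros\<close>)
  have tB: "sect B t" "sect B t'" "\<And>x. x \<in> B \<Longrightarrow> basis_at x (t x) (t' x)" using L(2,3,4) BA by (auto intro: sect_subset)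
  obtain f g where fg: "regf B f" "regf B g" "\<And>x. x \<in> B \<Longrightarrow> s' x = lc (f x) (g x) (t x) (t' x)"
    using sect_cof[OF tB(1,2) s' tB(3)] by blast
  have g0: "g x = 0" if x: "x \<in> B \<inter> Y0" for x
  proof -
    have xA: "x \<in> A" and xY0: "x \<in> Y0" using x BA by auto
    have "(\<lambda>i. c * x i) \<in> Y0" using xY0 c(1) homog_coords_scale by (auto simp: Y0_def)
    moreover have "(\<lambda>i. c * x i) \<in> A'" using x by (auto simp: B_def)
    ultimately obtain k where k: "s' x = fscale E k (e x)" using s(5) L(7)[OF xY0 c(1)] unfolding s'_def by metis
    obtain l where l: "l \<noteq> 0" "t x = fscale E l (e x)" using L(5)[OF xA xY0] by blast
    have "s' x = fscale E (k / l) (t x)"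
      using l k fs_fs[OF L(8)[OF xA] sect_fib[OF L(6) xY0], of "k / l" l] by simp
    also have "\<dots> = lc (k / l) 0 (t x) (t' x)" using lc_x0[OF L(8)[OF xA] L(9)[OF xA] L(10)[OF xA]] by simp
    finally show ?thesis using basis_at_uniq[OF tB(3), of x "f x" "g x" "k / l" 0] fg(3)[of x] x by auto
  qed
  have "Y0 \<noteq> {}"
  proof -
    have "(axis_vec 0 :: nat \<Rightarrow> 'k) \<in> Y0" by (auto simp: axis_vec_def Y0_def homog_coords_def affine_space_def fun_eq_iff)
    then show ?thesis by blast
  qed
  from regf_eq_dense[OF irreducible_set_homog_coords zB fg(2) regf_const zopen_Y0 this g0 bB] have "g b = 0" by simp
  then have "s' b = fscale E (f b) (t b)"
    using fg(3)[OF bB] lc_x0[OF L(8)[OF b] L(9)[OF b] L(10)[OF b]] by simp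
  moreover have "s' b = d" using s(4) c by (simp add: s'_def)
  ultimately show "\<exists>c. d = fscale E c (t b)" by blast
qed

lemma fibre_line_sub: "fibre (line_sub e) (proj_point b) = sub e \<inter> fib b"
  using sub_total by (auto simp: fibre_def line_sub_def fib_def)

section \<open>Charts of the line subbundle\<close>

context
  fixes e
  assumes cover: "\<forall>a\<in>Y. \<exists>A t t'. line_data e A t t' \<and> a \<in> A"
begin

definition Uj :: "(nat \<Rightarrow> 'k) set set \<Rightarrow> ('e \<Rightarrow> nat \<Rightarrow> 'k) \<Rightarrow> nat \<Rightarrow> (nat \<Rightarrow> 'k) set set" where
  "Uj U \<phi> j = {x\<in>U. \<exists>d\<in>sub e. bproj E d = x \<and> \<phi> d j \<noteq> 0}"

lemma Uj_iff:
  assumes line_data: "line_data e A t t'" and U: "(U, \<phi>) \<in> charts E" and b: "b \<in> A"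
  shows "proj_point b \<in> Uj U \<phi> j \<longleftrightarrow> b \<in> cU U \<and> \<phi> (t b) j \<noteq> 0"
proof
  note L = line_data_D[OF line_data]
  assume "proj_point b \<in> Uj U \<phi> j"
  then obtain d where d: "proj_point b \<in> U" "d \<in> sub e" "bproj E d = proj_point b" "\<phi> d j \<noteq> 0" by (auto simp: Uj_def)
  have bU: "b \<in> cU U" using d(1) L(8)[OF b] by (simp add: cU_def)
  have df: "d \<in> fib b" using d(2,3) sub_total by (auto simp: fib_def fibre_def)
  then obtain c where "d = fscale E c (t b)" using sub_iff[OF line_data b] d(2) by blast
  then show "b \<in> cU U \<and> \<phi> (t b) j \<noteq> 0" using d(4) bU ch_scale[OF U bU L(9)[OF b]] by auto
next
  note L = line_data_D[OF line_data]
  assume *: "b \<in> cU U \<and> \<phi> (t b) j \<noteq> 0"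
  have "t b = fscale E 1 (t b)" using fs_1[OF L(8,9)] b by simp
  then have "t b \<in> sub e" using sub_iff[OF line_data b L(9)[OF b]] by blast
  then show "proj_point b \<in> Uj U \<phi> j" using * fib_bproj[OF L(9)[OF b]] by (auto simp: Uj_def cU_def)
qed

lemma zopen_Uj:
  assumes U: "(U, \<phi>) \<in> charts E" and j: "j < 2"
  shows "zopen Y {a\<in>Y. proj_point a \<in> Uj U \<phi> j}"
proof (rule zopen_glue)
  fix a assume a: "a \<in> {a\<in>Y. proj_point a \<in> Uj U \<phi> j}"
  then obtain A t t' where line_data: "line_data e A t t'" "a \<in> A" using cover by blast
  note L = line_data_D[OF line_data(1)]
  let ?B = "{b\<in>A \<inter> cU U. \<phi> (t b) j \<noteq> 0}"
  have "zopen Y ?B" by (rule zopen_nonvanishing[OF zopen_Int[OF L(1) zopen_cU[OF U]] sect_chart[OF L(2) U j]])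
  moreover have "a \<in> ?B" using a line_data(2) Uj_iff[OF line_data(1) U line_data(2)] by simp
  moreover have "?B \<subseteq> {a\<in>Y. proj_point a \<in> Uj U \<phi> j}" using Uj_iff[OF line_data(1) U] L(8) by auto
  ultimately show "\<exists>B. zopen Y B \<and> a \<in> B \<and> B \<subseteq> {a\<in>Y. proj_point a \<in> Uj U \<phi> j}" by blast
qed auto

lemma charts_line_sub: "charts (line_sub e) = {(Uj U \<phi> j, \<lambda>d i. if i = 0 then \<phi> d j else 0) |U \<phi> j. (U, \<phi>) \<in> charts E \<and> j < 2}"
  by (simp add: line_sub_def Uj_def)

lemma Uj_proj: "(U, \<phi>) \<in> charts E \<Longrightarrow> Uj U \<phi> j \<subseteq> proj_space n"
  using chart_subset by (auto simp: Uj_def)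

lemma fibre_line_sub_eq:
  assumes "line_data e A t t'" "b \<in> A"
  shows "fibre (line_sub e) (proj_point b) = range (\<lambda>c. fscale E c (t b))"
  unfolding fibre_line_sub using sub_iff[OF assms] fib_scale line_data_D(8,9)[OF assms(1) assms(2)] by auto

lemma line_sub_ops [simp]: "fadd (line_sub e) = fadd E" "fscale (line_sub e) = fscale E" "bproj (line_sub e) = bproj E" "total_space (line_sub e) = sub e"
  by (simp_all add: line_sub_def)

lemma affine_1: "v \<in> affine_space 1 \<longleftrightarrow> v = (\<lambda>i. if i = 0 then v 0 else 0)"
  by (auto simp: affine_space_def fun_eq_iff)

lemma line_sub_trivial:
  assumes U: "(U, \<phi>) \<in> charts E" and j: "j < 2"
  shows "local_trivialisation n 1 (line_sub e) (Uj U \<phi> j) (\<lambda>d i. if i = 0 then \<phi> d j else 0)" (is "local_trivialisation n 1 _ _ ?\<chi>")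
proof -
  have "bij_betw ?\<chi> (fibre (line_sub e) x) (affine_space 1) \<and>
        (\<forall>d\<in>fibre (line_sub e) x. \<forall>d'\<in>fibre (line_sub e) x. ?\<chi> (fadd (line_sub e) d d') = (\<lambda>i. ?\<chi> d i + ?\<chi> d' i)) \<and>
        (\<forall>c. \<forall>d\<in>fibre (line_sub e) x. ?\<chi> (fscale (line_sub e) c d) = (\<lambda>i. c * ?\<chi> d i))" if x: "x \<in> Uj U \<phi> j" for x
  proof -
    have "x \<in> proj_space n" using x Uj_proj[OF U] by blast
    then obtain b where b: "b \<in> Y" "x = proj_point b" by (auto simp: proj_space_def)
    obtain A t t' where line_data: "line_data e A t t'" "b \<in> A" using bspec[OF cover b(1)] by blast
    note L = line_data_D[OF line_data(1)]
    have bU: "b \<in> cU U" and nz: "\<phi> (t b) j \<noteq> 0" using x Uj_iff[OF line_data(1) U line_data(2)] by (auto simp: b)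
    note tb = L(9)[OF line_data(2)]
    have fE: "fibre (line_sub e) x = range (\<lambda>c. fscale E c (t b))" unfolding b using fibre_line_sub_eq[OF line_data] .
    have sc: "\<phi> (fscale E c (t b)) j = c * \<phi> (t b) j" for c by (rule ch_scale[OF U bU tb])
    have "bij_betw ?\<chi> (fibre (line_sub e) x) (affine_space 1)"
    proof (rule bij_betw_imageI)
      show "inj_on ?\<chi> (fibre (line_sub e) x)"
      proof (rule inj_onI)
        fix d d' assume "d \<in> fibre (line_sub e) x" "d' \<in> fibre (line_sub e) x" and eq: "?\<chi> d = ?\<chi> d'"
        then obtain c c' where c: "d = fscale E c (t b)" "d' = fscale E c' (t b)" unfolding fE by blast
        from fun_cong[OF eq, of 0] have "c = c'" using nz by (simp add: c sc)
        then show "d = d'" by (simp add: c)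
      qed
      show "?\<chi> ` fibre (line_sub e) x = affine_space 1"
      proof (intro equalityI subsetI)
        fix v assume "v \<in> ?\<chi> ` fibre (line_sub e) x" then show "v \<in> affine_space 1" by (auto simp: affine_space_def)
      next
        fix v :: "nat \<Rightarrow> 'k" assume "v \<in> affine_space 1"
        then have v: "v = (\<lambda>i. if i = 0 then v 0 else 0)" by (simp only: affine_1)
        have "?\<chi> (fscale E (v 0 / \<phi> (t b) j) (t b)) = (\<lambda>i. if i = 0 then v 0 else 0)"
          using nz by (auto simp: sc)
        then have "v = ?\<chi> (fscale E (v 0 / \<phi> (t b) j) (t b))" using v by simp
        then show "v \<in> ?\<chi> ` fibre (line_sub e) x" unfolding fE by blast
      qed
    qed
    moreover have "?\<chi> (fadd (line_sub e) d d') = (\<lambda>i. ?\<chi> d i + ?\<chi> d' i)" if "d \<in> fibre (line_sub e) x" "d' \<in> fibre (line_sub e) x" for d d'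
      using that ch_add[OF U bU] unfolding b fibre_line_sub by (auto simp: fun_eq_iff)
    moreover have "?\<chi> (fscale (line_sub e) c d) = (\<lambda>i. c * ?\<chi> d i)" if "d \<in> fibre (line_sub e) x" for c d
      using that ch_scale[OF U bU] unfolding b fibre_line_sub by (auto simp: fun_eq_iff)
    ultimately show ?thesis by blast
  qed
  moreover have "proj_open n (Uj U \<phi> j)" by (rule zopen_imp_proj_open[OF zopen_Uj[OF assms] Uj_proj[OF U]])
  ultimately show ?thesis unfolding local_trivialisation_def by blast
qed

lemma chart_inv_line_sub:
  assumes line_data: "line_data e A t t'" "b \<in> A" and U: "(U, \<phi>) \<in> charts E" and j: "j < 2" and bU: "proj_point b \<in> Uj U \<phi> j"
  shows "chart_inv (line_sub e) (\<lambda>d i. if i = 0 then \<phi> d j else 0) (proj_point b) (\<lambda>i. if i = 0 then c else 0) = fscale E (c / \<phi> (t b) j) (t b)"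
  unfolding chart_inv_def
proof (rule inv_into_f_eq)
  note L = line_data_D[OF line_data(1)]
  have U': "b \<in> cU U" and nz: "\<phi> (t b) j \<noteq> 0" using bU Uj_iff[OF line_data(1) U line_data(2)] by auto
  show "inj_on (\<lambda>d (i::nat). if i = 0 then \<phi> d j else 0) (fibre (line_sub e) (proj_point b))"
  proof -
    have "local_trivialisation n 1 (line_sub e) (Uj U \<phi> j) (\<lambda>d i. if i = 0 then \<phi> d j else 0)" by (rule line_sub_trivial[OF U j])
    then have "\<forall>x\<in>Uj U \<phi> j. bij_betw (\<lambda>d i. if i = 0 then \<phi> d j else 0) (fibre (line_sub e) x) (affine_space 1)"
      unfolding local_trivialisation_def by blast
    from bspec[OF this bU] show ?thesis by (rule bij_betw_imp_inj_on)
  qed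
  show "fscale E (c / \<phi> (t b) j) (t b) \<in> fibre (line_sub e) (proj_point b)" unfolding fibre_line_sub_eq[OF line_data] by blast
  show "(\<lambda>i. if i = 0 then \<phi> (fscale E (c / \<phi> (t b) j) (t b)) j else 0) = (\<lambda>i. if i = 0 then c else 0)"
    using nz ch_scale[OF U U' L(9)[OF line_data(2)]] by (auto simp: fun_eq_iff)
qed

lemma line_bundle_line_sub: "line_bundle n (line_sub e)"
  unfolding vector_bundle_def
proof (intro conjI)
  show "bproj (line_sub e) ` total_space (line_sub e) \<subseteq> proj_space n"
    using bproj_proj_space sub_total by (simp add: line_sub_def) blast
  have ex: "\<exists>A t t' b. line_data e A t t' \<and> b \<in> A \<and> x = proj_point b" if "x \<in> proj_space n" for x :: "(nat \<Rightarrow> 'k) set"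
    using that cover unfolding proj_space_def by blast
  show "\<forall>x\<in>proj_space n. \<forall>d\<in>fibre (line_sub e) x. \<forall>d'\<in>fibre (line_sub e) x. fadd (line_sub e) d d' \<in> fibre (line_sub e) x"
  proof (intro ballI)
    fix x :: "(nat \<Rightarrow> 'k) set" and d d' assume x: "x \<in> proj_space n" and d: "d \<in> fibre (line_sub e) x" "d' \<in> fibre (line_sub e) x"
    from ex[OF x] obtain A t t' b where line_data: "line_data e A t t'" "b \<in> A" and b: "x = proj_point b" by blast
    note L = line_data_D[OF line_data(1)]
    show "fadd (line_sub e) d d' \<in> fibre (line_sub e) x"
      using d fadd_fs[OF L(8)[OF line_data(2)] L(9)[OF line_data(2)]] unfolding b fibre_line_sub_eq[OF line_data] by auto
  qed
  show "\<forall>x\<in>proj_space n. \<forall>c. \<forall>d\<in>fibre (line_sub e) x. fscale (line_sub e) c d \<in> fibre (line_sub e) x"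
  proof (intro ballI allI)
    fix x :: "(nat \<Rightarrow> 'k) set" and c d assume x: "x \<in> proj_space n" and d: "d \<in> fibre (line_sub e) x"
    from ex[OF x] obtain A t t' b where line_data: "line_data e A t t'" "b \<in> A" and b: "x = proj_point b" by blast
    note L = line_data_D[OF line_data(1)]
    show "fscale (line_sub e) c d \<in> fibre (line_sub e) x"
      using d fs_fs[OF L(8)[OF line_data(2)] L(9)[OF line_data(2)]] unfolding b fibre_line_sub_eq[OF line_data] by auto
  qed
  show "(\<Union>(U, \<phi>)\<in>charts (line_sub e). U) = proj_space n"
  proof (intro equalityI subsetI)
    fix x assume "x \<in> (\<Union>(U, \<phi>)\<in>charts (line_sub e). U)"
    then show "x \<in> proj_space n" using Uj_proj unfolding charts_line_sub by blast
  next
    fix x :: "(nat \<Rightarrow> 'k) set" assume x: "x \<in> proj_space n"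
    from ex[OF x] obtain A t t' b where line_data: "line_data e A t t'" "b \<in> A" and b: "x = proj_point b" by blast
    note L = line_data_D[OF line_data(1)]
    obtain U \<phi> where U: "(U, \<phi>) \<in> charts E" "b \<in> cU U" using chart_ex[OF L(8)[OF line_data(2)]] by blast
    have "chart_det \<phi> (t b) (t' b) \<noteq> 0" by (rule basis_at_chart[OF L(4)[OF line_data(2)] U])
    then have "\<phi> (t b) 0 \<noteq> 0 \<or> \<phi> (t b) 1 \<noteq> 0" by (auto simp: chart_det_def)
    then obtain j where j: "j < 2" "\<phi> (t b) j \<noteq> 0" by (metis one_less_numeral_iff semiring_norm(76) zero_less_numeral)
    then have "x \<in> Uj U \<phi> j" using Uj_iff[OF line_data(1) U(1) line_data(2)] U(2) b by simp
    then show "x \<in> (\<Union>(U, \<phi>)\<in>charts (line_sub e). U)" unfolding charts_line_sub using U(1) j(1) by blast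
  qed
  show "\<forall>(U, \<phi>)\<in>charts (line_sub e). local_trivialisation n 1 (line_sub e) U \<phi>"
    unfolding charts_line_sub using line_sub_trivial by auto
  show "\<forall>(U, \<phi>)\<in>charts (line_sub e). \<forall>(V, \<psi>)\<in>charts (line_sub e). \<forall>i<1.
     regular_on n 1 ((U \<inter> V) \<times> affine_space 1) (\<lambda>(x, v). \<psi> (chart_inv (line_sub e) \<phi> x v) i)"
  proof -
    have "regular_on n 1 ((Uj U \<phi> j \<inter> Uj V \<psi> k) \<times> affine_space 1)
       (\<lambda>(x, v). \<psi> (chart_inv (line_sub e) (\<lambda>d i. if i = 0 then \<phi> d j else 0) x v) k)"
      if U: "(U, \<phi>) \<in> charts E" and j: "j < 2" and V: "(V, \<psi>) \<in> charts E" and k: "k < 2" for U \<phi> j V \<psi> k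
    proof (rule regular_on_local)
      have "{a \<in> Y. proj_point a \<in> Uj U \<phi> j \<inter> Uj V \<psi> k} = {a \<in> Y. proj_point a \<in> Uj U \<phi> j} \<inter> {a \<in> Y. proj_point a \<in> Uj V \<psi> k}" by auto
      then show "zopen Y {a \<in> Y. proj_point a \<in> Uj U \<phi> j \<inter> Uj V \<psi> k}"
        using zopen_Int[OF zopen_Uj[OF U j] zopen_Uj[OF V k]] by simp
      show "Uj U \<phi> j \<inter> Uj V \<psi> k \<subseteq> proj_space n" using Uj_proj[OF U] by blast
      fix a assume a: "a \<in> Y" "proj_point a \<in> Uj U \<phi> j \<inter> Uj V \<psi> k"
      obtain A t t' where line_data: "line_data e A t t'" "a \<in> A" using bspec[OF cover a(1)] by blast
      note L = line_data_D[OF line_data(1)]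
      let ?W = "Uj U \<phi> j \<inter> Uj V \<psi> k"
      \<comment> \<open>The transition function between two such charts is the ratio of the
        coordinates of the generator \<open>t\<close>.\<close>
      let ?G = "\<lambda>w. w (Inr 0) / \<phi> (t (\<lambda>i. w (Inl i))) j * \<psi> (t (\<lambda>i. w (Inl i))) k"
      have in': "b \<in> A \<inter> cU U" "b \<in> A \<inter> cU V" "\<phi> (t b) j \<noteq> 0" if "b \<in> A" "proj_point b \<in> ?W" for b
        using that Uj_iff[OF line_data(1) U] Uj_iff[OF line_data(1) V] by auto
      have "regf (over 1 A ?W) ?G"
        by (intro regf_mult regf_divide regf_coord regf_over[OF sect_chart[OF L(2) U j]] regf_over[OF sect_chart[OF L(2) V k]])
          (use in' in \<open>auto simp: over_def\<close>)
      moreover have "\<psi> (chart_inv (line_sub e) (\<lambda>d i. if i = 0 then \<phi> d j else 0) (proj_point b) v) k = ?G (case_sum b v)"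
        if b: "b \<in> A" "proj_point b \<in> ?W" and v: "v \<in> affine_space 1" for b v
      proof -
        have "v = (\<lambda>i. if i = 0 then v 0 else 0)" using v by (simp only: affine_1)
        then have "chart_inv (line_sub e) (\<lambda>d i. if i = 0 then \<phi> d j else 0) (proj_point b) v = fscale E (v 0 / \<phi> (t b) j) (t b)"
          using chart_inv_line_sub[OF line_data(1) b(1) U j, of "v 0"] b(2) by simp
        moreover have "b \<in> cU V" using in'[OF b] by blast
        ultimately show ?thesis using ch_scale[OF V _ L(9)[OF b(1)]] by simp
      qed
      ultimately show "\<exists>A G. zopen Y A \<and> a \<in> A \<and> regf (over 1 A ?W) G \<and> (\<forall>b v. b \<in> A \<longrightarrow> proj_point b \<in> ?W \<longrightarrow> v \<in> affine_space 1 \<longrightarrow>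
         (case (proj_point b, v) of (x, v) \<Rightarrow> \<psi> (chart_inv (line_sub e) (\<lambda>d i. if i = 0 then \<phi> d j else 0) x v) k) = G (case_sum b v))"
        using L(1) line_data(2) by (intro exI[of _ A] exI[of _ ?G]) simp
    qed
    then show ?thesis unfolding charts_line_sub by auto
  qed
qed

end

text \<open>Over \<open>Y0\<close> the frame itself generates both lines; near the hyperplane the
  generators come from \<open>split_frame\<close>. Each generator serves as the complement for the
  other line.\<close>

lemma split_frame_line_data:
  assumes sf: "split_frame e1 e2" and a: "a \<in> Y"
  shows "\<exists>A t1 t2. line_data e1 A t1 t2 \<and> line_data e2 A t2 t1 \<and> a \<in> A"
proof -
  have e: "sect Y0 e1" "sect Y0 e2" "\<And>a. a \<in> Y0 \<Longrightarrow> basis_at a (e1 a) (e2 a)"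
    "\<And>a c. a \<in> Y0 \<Longrightarrow> c \<noteq> 0 \<Longrightarrow> e1 (\<lambda>i. c * a i) = e1 a \<and> e2 (\<lambda>i. c * a i) = e2 a"
    using sf by (auto simp: split_frame_def)
  show ?thesis
  proof (cases "a 0 = 0")
    case True
    with a have "a \<in> hyperplane n" by (simp add: hyperplane_def)
    then obtain A t1 t2 where t: "zopen Y A" "a \<in> A" "sect A t1" "sect A t2" "\<forall>a\<in>A. basis_at a (t1 a) (t2 a)"
      "\<forall>a\<in>A \<inter> Y0. (\<exists>c. c \<noteq> 0 \<and> t1 a = fscale E c (e1 a)) \<and> (\<exists>c. c \<noteq> 0 \<and> t2 a = fscale E c (e2 a))"
      using sf unfolding split_frame_def by blast
    have "line_data e1 A t1 t2" "line_data e2 A t2 t1" using t e basis_at_swap unfolding line_data_def by simp_all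
    with t(2) show ?thesis by blast
  next
    case False
    with a have aY: "a \<in> Y0" by (simp add: Y0_def)
    have "\<exists>c. c \<noteq> 0 \<and> e1 b = fscale E c (e1 b)" "\<exists>c. c \<noteq> 0 \<and> e2 b = fscale E c (e2 b)" if b: "b \<in> Y0" for b
    proof -
      have "b \<in> Y" "e1 b \<in> fib b" "e2 b \<in> fib b" using e(3)[OF b] by (auto simp: basis_at_def)
      then show "\<exists>c. c \<noteq> 0 \<and> e1 b = fscale E c (e1 b)" "\<exists>c. c \<noteq> 0 \<and> e2 b = fscale E c (e2 b)"
        using fs_1 by (metis zero_neq_one)+
    qed
    then have "line_data e1 Y0 e1 e2" "line_data e2 Y0 e2 e1" using e zopen_Y0 basis_at_swap unfolding line_data_def by simp_all
    with aY show ?thesis by blast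
  qed
qed

section \<open>The isomorphism with the direct sum\<close>

context
  fixes e1 e2
  assumes sf: "split_frame e1 e2"
begin

abbreviation DS :: "('e \<times> 'e, 'k) vbundle" where "DS \<equiv> direct_sum 1 (line_sub e1) (line_sub e2)"

lemma cov1: "\<forall>a\<in>Y. \<exists>A t t'. line_data e1 A t t' \<and> a \<in> A"
  using split_frame_line_data[OF sf] by blast

lemma cov2: "\<forall>a\<in>Y. \<exists>A t t'. line_data e2 A t t' \<and> a \<in> A"
  using split_frame_line_data[OF sf] by blast

lemma DS_ops: "fadd DS (d, d') (g, g') = (fadd E d g, fadd E d' g')" "fscale DS c (d, d') = (fscale E c d, fscale E c d')"
  "bproj DS (d, d') = bproj E d"
  by (simp_all add: direct_sum_def line_sub_def)

lemma fibre_DS: "fibre DS (proj_point b) = (sub e1 \<inter> fib b) \<times> (sub e2 \<inter> fib b)"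
  using sub_total by (auto simp: fibre_def direct_sum_def line_sub_def fib_def)

lemma charts_DS: "charts DS = {(Uj e1 U \<phi> j \<inter> Uj e2 V \<psi> k, \<lambda>(d, d') i. if i < 1 then (if i = 0 then \<phi> d j else 0) else (if i - 1 = 0 then \<psi> d' k else 0))
   |U \<phi> j V \<psi> k. (U, \<phi>) \<in> charts E \<and> j < 2 \<and> (V, \<psi>) \<in> charts E \<and> k < 2}" (is "_ = ?C")
proof (intro equalityI subsetI)
  fix p assume "p \<in> charts DS"
  then obtain U1 \<phi>1 U2 \<phi>2 where 1: "(U1, \<phi>1) \<in> charts (line_sub e1)" "(U2, \<phi>2) \<in> charts (line_sub e2)"
    and p: "p = (U1 \<inter> U2, \<lambda>(d, d') i. if i < 1 then \<phi>1 d i else \<phi>2 d' (i - 1))"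
    unfolding direct_sum_def by auto
  from 1(1) obtain U \<phi> j where U: "U1 = Uj e1 U \<phi> j" "\<phi>1 = (\<lambda>d i. if i = 0 then \<phi> d j else 0)" "(U, \<phi>) \<in> charts E" "j < 2"
    unfolding charts_line_sub[OF cov1] mem_Collect_eq prod.inject by (elim exE conjE) (rule that)
  from 1(2) obtain V \<psi> k where V: "U2 = Uj e2 V \<psi> k" "\<phi>2 = (\<lambda>d i. if i = 0 then \<psi> d k else 0)" "(V, \<psi>) \<in> charts E" "k < 2"
    unfolding charts_line_sub[OF cov2] mem_Collect_eq prod.inject by (elim exE conjE) (rule that)
  show "p \<in> ?C" unfolding mem_Collect_eq p U(1,2) V(1,2) using U(3,4) V(3,4)
    by (intro exI conjI) (rule refl | assumption)+
next
  fix p assume "p \<in> ?C"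
  then obtain U \<phi> j V \<psi> k where UV: "(U, \<phi>) \<in> charts E" "j < 2" "(V, \<psi>) \<in> charts E" "k < 2"
    and p: "p = (Uj e1 U \<phi> j \<inter> Uj e2 V \<psi> k, \<lambda>(d, d') i. if i < 1 then (if i = 0 then \<phi> d j else 0) else (if i - 1 = 0 then \<psi> d' k else 0))"
    unfolding mem_Collect_eq by (elim exE conjE)
  have 1: "(Uj e1 U \<phi> j, \<lambda>d i. if i = 0 then \<phi> d j else 0) \<in> charts (line_sub e1)"
    unfolding charts_line_sub[OF cov1] mem_Collect_eq using UV by blast
  have 2: "(Uj e2 V \<psi> k, \<lambda>d i. if i = 0 then \<psi> d k else 0) \<in> charts (line_sub e2)"
    unfolding charts_line_sub[OF cov2] mem_Collect_eq using UV by blast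
  show "p \<in> charts DS" unfolding direct_sum_def vbundle.simps mem_Collect_eq p
    by (intro exI conjI) (rule refl 1 2)+
qed

lemma DS_chartE:
  assumes "(W, \<chi>) \<in> charts DS"
  obtains U \<phi> j V \<psi> k where "(U, \<phi>) \<in> charts E" "j < 2" "(V, \<psi>) \<in> charts E" "k < 2" "W = Uj e1 U \<phi> j \<inter> Uj e2 V \<psi> k"
    "\<chi> = (\<lambda>(d, d') i. if i < 1 then (if i = 0 then \<phi> d j else 0) else (if i - 1 = 0 then \<psi> d' k else 0))"
  using assms unfolding charts_DS mem_Collect_eq by (elim exE conjE Pair_inject)

text \<open>The pair is unique on every fibre because the two lines are complementary;
  \<open>decompose_lc\<close> computes it in terms of local generators.\<close>

definition decompose :: "'e \<Rightarrow> 'e \<times> 'e" where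
  "decompose x = (SOME p. fst p \<in> sub e1 \<and> snd p \<in> sub e2 \<and> bproj E (fst p) = bproj E x \<and> bproj E (snd p) = bproj E x \<and> x = fadd E (fst p) (snd p))"

context
  fixes A t1 t2 b
  assumes L1: "line_data e1 A t1 t2" and L2: "line_data e2 A t2 t1" and b: "b \<in> A"
begin

lemma LDb: "b \<in> Y" "t1 b \<in> fib b" "t2 b \<in> fib b" "basis_at b (t1 b) (t2 b)"
  using line_data_D(4,8,9,10)[OF L1 b] by blast+

lemma sub1_fib: "sub e1 \<inter> fib b = range (\<lambda>c. fscale E c (t1 b))"
  using sub_iff[OF L1 b] fib_scale LDb by auto

lemma sub2_fib: "sub e2 \<inter> fib b = range (\<lambda>c. fscale E c (t2 b))"
  using sub_iff[OF L2 b] fib_scale LDb by auto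

lemma lc_fadd: "fadd E (fscale E p (t1 b)) (fscale E q (t2 b)) = lc p q (t1 b) (t2 b)"
  by (simp add: lc_def)

lemma decompose_lc: "decompose (lc p q (t1 b) (t2 b)) = (fscale E p (t1 b), fscale E q (t2 b))"
  unfolding decompose_def
proof (rule some_equality)
  let ?x = "lc p q (t1 b) (t2 b)"
  have x: "bproj E ?x = proj_point b" by (rule fib_bproj[OF fib_lc[OF LDb(1-3)]])
  have "fscale E p (t1 b) \<in> sub e1 \<inter> fib b" "fscale E q (t2 b) \<in> sub e2 \<inter> fib b"
    unfolding sub1_fib sub2_fib by blast+
  then show "fst (fscale E p (t1 b), fscale E q (t2 b)) \<in> sub e1 \<and> snd (fscale E p (t1 b), fscale E q (t2 b)) \<in> sub e2 \<and>
    bproj E (fst (fscale E p (t1 b), fscale E q (t2 b))) = bproj E ?x \<and> bproj E (snd (fscale E p (t1 b), fscale E q (t2 b))) = bproj E ?x \<and>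
    ?x = fadd E (fst (fscale E p (t1 b), fscale E q (t2 b))) (snd (fscale E p (t1 b), fscale E q (t2 b)))"
    using fib_bproj unfolding x by (simp add: lc_fadd)
  fix pr assume pr: "fst pr \<in> sub e1 \<and> snd pr \<in> sub e2 \<and> bproj E (fst pr) = bproj E ?x \<and> bproj E (snd pr) = bproj E ?x \<and> ?x = fadd E (fst pr) (snd pr)"
  then have "fst pr \<in> sub e1 \<inter> fib b" "snd pr \<in> sub e2 \<inter> fib b"
    using sub_total unfolding x by (auto simp: fib_def fibre_def)
  then obtain p' q' where pq: "fst pr = fscale E p' (t1 b)" "snd pr = fscale E q' (t2 b)"
    unfolding sub1_fib sub2_fib by blast
  then have "lc p q (t1 b) (t2 b) = lc p' q' (t1 b) (t2 b)" using pr by (simp add: lc_fadd)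
  from basis_at_uniq[OF LDb(4) this] pq show "pr = (fscale E p (t1 b), fscale E q (t2 b))"
    by (metis prod.collapse)
qed

lemma fib_lcE: assumes "x \<in> fib b" obtains p q where "x = lc p q (t1 b) (t2 b)"
  using basis_at_ex[OF LDb(4) assms] by blast

lemma fibre_DS_eq: "fibre DS (proj_point b) = {(fscale E p (t1 b), fscale E q (t2 b)) |p q. True}"
  unfolding fibre_DS sub1_fib sub2_fib by auto

end

lemma ex_line_data: "x \<in> proj_space n \<Longrightarrow> \<exists>A t1 t2 b. line_data e1 A t1 t2 \<and> line_data e2 A t2 t1 \<and> b \<in> A \<and> x = proj_point b"
  using split_frame_line_data[OF sf] unfolding proj_space_def by blast

lemma zopen_cUW: "zopen Y {a\<in>Y. proj_point a \<in> U} \<Longrightarrow> zopen Y {a\<in>Y. proj_point a \<in> V} \<Longrightarrow> zopen Y {a\<in>Y. proj_point a \<in> U \<inter> V}"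
proof -
  assume "zopen Y {a\<in>Y. proj_point a \<in> U}" "zopen Y {a\<in>Y. proj_point a \<in> V}"
  then have "zopen Y ({a\<in>Y. proj_point a \<in> U} \<inter> {a\<in>Y. proj_point a \<in> V})" by (rule zopen_Int)
  also have "{a\<in>Y. proj_point a \<in> U} \<inter> {a\<in>Y. proj_point a \<in> V} = {a\<in>Y. proj_point a \<in> U \<inter> V}" by auto
  finally show ?thesis .
qed

lemma hom_decompose: "bundle_hom n 2 2 E DS decompose"
  unfolding bundle_hom_def
proof (intro conjI)
  show "\<forall>x\<in>proj_space n. decompose ` fibre E x \<subseteq> fibre DS x \<and>
        (\<forall>d\<in>fibre E x. \<forall>e\<in>fibre E x. decompose (fadd E d e) = fadd DS (decompose d) (decompose e)) \<and>
        (\<forall>c. \<forall>e\<in>fibre E x. decompose (fscale E c e) = fscale DS c (decompose e))"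
  proof
    fix x :: "(nat \<Rightarrow> 'k) set" assume "x \<in> proj_space n"
    then obtain A t1 t2 b where L: "line_data e1 A t1 t2" "line_data e2 A t2 t1" "b \<in> A" and x: "x = proj_point b" using ex_line_data by blast
    note B = LDb[OF L]
    have F: "fibre E x = fib b" by (simp add: fib_def x)
    have 1: "decompose d \<in> fibre DS x" if d: "d \<in> fib b" for d
    proof -
      obtain p q where "d = lc p q (t1 b) (t2 b)" using fib_lcE[OF L d] .
      then show ?thesis unfolding x fibre_DS_eq[OF L] using decompose_lc[OF L] by blast
    qed
    have 2: "decompose (fadd E d d') = fadd DS (decompose d) (decompose d')" if d: "d \<in> fib b" "d' \<in> fib b" for d d'
    proof -
      obtain p q where "d = lc p q (t1 b) (t2 b)" using fib_lcE[OF L d(1)] .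
      moreover obtain p' q' where "d' = lc p' q' (t1 b) (t2 b)" using fib_lcE[OF L d(2)] .
      ultimately show ?thesis by (simp add: lc_add[OF B(1-3)] decompose_lc[OF L] DS_ops fadd_fs[OF B(1)] B(2,3) del: One_nat_def)
    qed
    have 3: "decompose (fscale E c d) = fscale DS c (decompose d)" if d: "d \<in> fib b" for c d
    proof -
      obtain p q where "d = lc p q (t1 b) (t2 b)" using fib_lcE[OF L d] .
      then show ?thesis by (simp add: fs_lc[OF B(1-3)] decompose_lc[OF L] DS_ops fs_fs[OF B(1)] B(2,3) del: One_nat_def)
    qed
    from 1 2 3 show "decompose ` fibre E x \<subseteq> fibre DS x \<and>
        (\<forall>d\<in>fibre E x. \<forall>e\<in>fibre E x. decompose (fadd E d e) = fadd DS (decompose d) (decompose e)) \<and>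
        (\<forall>c. \<forall>e\<in>fibre E x. decompose (fscale E c e) = fscale DS c (decompose e))" unfolding F by auto
  qed
  have "regular_on n 2 ((U0 \<inter> (Uj e1 U \<phi> j \<inter> Uj e2 V \<psi> k)) \<times> affine_space 2)
     (\<lambda>(x, v). (\<lambda>(d, d') i. if i < 1 then (if i = 0 then \<phi> d j else 0) else (if i - 1 = 0 then \<psi> d' k else 0)) (decompose (chart_inv E \<phi>0 x v)) i)"
    if U0: "(U0, \<phi>0) \<in> charts E" and U: "(U, \<phi>) \<in> charts E" and j: "j < 2" and V: "(V, \<psi>) \<in> charts E" and k: "k < 2" and i: "i < (2::nat)"
    for U0 \<phi>0 U \<phi> j V \<psi> k i
  proof (rule regular_on_local)
    let ?W = "U0 \<inter> (Uj e1 U \<phi> j \<inter> Uj e2 V \<psi> k)"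
    show "zopen Y {a \<in> Y. proj_point a \<in> ?W}"
      using zopen_cU[OF U0] unfolding cU_def
      by (intro zopen_cUW zopen_Uj[OF cov1 U j] zopen_Uj[OF cov2 V k])
    show "?W \<subseteq> proj_space n" using chart_subset[OF U0] by blast
    fix a assume a: "a \<in> Y" "proj_point a \<in> ?W"
    obtain A t1 t2 where L: "line_data e1 A t1 t2" "line_data e2 A t2 t1" and aA: "a \<in> A" using split_frame_line_data[OF sf a(1)] by blast
    note D = line_data_D[OF L(1)]
    let ?p = "\<lambda>w::nat + nat \<Rightarrow> 'k. (\<lambda>i. w (Inl i))"
    \<comment> \<open>By Cramer's rule, \<open>?c1\<close> and \<open>?c2\<close> are the
      coefficients with respect to \<open>t1\<close> and \<open>t2\<close> of the vector with
      coordinates v 0 and v 1 in the chart \<open>\<phi>0\<close>.\<close>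
    let ?c1 = "\<lambda>w. (w (Inr 0) * \<phi>0 (t2 (?p w)) 1 - w (Inr 1) * \<phi>0 (t2 (?p w)) 0) / chart_det \<phi>0 (t1 (?p w)) (t2 (?p w))"
    let ?c2 = "\<lambda>w. (\<phi>0 (t1 (?p w)) 0 * w (Inr 1) - \<phi>0 (t1 (?p w)) 1 * w (Inr 0)) / chart_det \<phi>0 (t1 (?p w)) (t2 (?p w))"
    let ?G = "\<lambda>w. if i = 0 then ?c1 w * \<phi> (t1 (?p w)) j else ?c2 w * \<psi> (t2 (?p w)) k"
    have in': "b \<in> A \<inter> cU U0" "b \<in> A \<inter> cU U" "b \<in> A \<inter> cU V" if "b \<in> A" "proj_point b \<in> ?W" for b
      using that Uj_iff[OF cov1 L(1) U] Uj_iff[OF cov2 L(2) V] D(8) by (auto simp: cU_def)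
    have dnz: "chart_det \<phi>0 (t1 b) (t2 b) \<noteq> 0" if "b \<in> A" "proj_point b \<in> ?W" for b
      using basis_at_chart[OF D(4) U0] in'(1)[OF that] that by auto
    have r: "regf (over 2 A ?W) (\<lambda>w. \<phi>0 (t1 (?p w)) i)" "regf (over 2 A ?W) (\<lambda>w. \<phi>0 (t2 (?p w)) i)" if "i < 2" for i
      by (rule regf_over[OF sect_chart[OF D(2) U0 that]], use in' in blast) (rule regf_over[OF sect_chart[OF D(3) U0 that]], use in' in blast)
    have r': "regf (over 2 A ?W) (\<lambda>w. \<phi> (t1 (?p w)) j)" "regf (over 2 A ?W) (\<lambda>w. \<psi> (t2 (?p w)) k)"
      by (rule regf_over[OF sect_chart[OF D(2) U j]], use in' in blast) (rule regf_over[OF sect_chart[OF D(3) V k]], use in' in blast)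
    have rd: "regf (over 2 A ?W) (\<lambda>w. chart_det \<phi>0 (t1 (?p w)) (t2 (?p w)))"
      unfolding chart_det_def by (intro regf_diff regf_mult r) simp_all
    have rc: "regf (over 2 A ?W) ?c1" "regf (over 2 A ?W) ?c2"
      by (intro regf_divide rd regf_diff regf_mult r regf_coord; use dnz in \<open>auto simp: over_def\<close>)+
    have "regf (over 2 A ?W) ?G"
      using regf_mult[OF rc(1) r'(1)] regf_mult[OF rc(2) r'(2)] by (cases "i = 0") (simp_all only: simp_thms if_True if_False)
    moreover have "(\<lambda>(d, d') i. if i < 1 then (if i = 0 then \<phi> d j else 0) else (if i - 1 = 0 then \<psi> d' k else 0)) (decompose (chart_inv E \<phi>0 (proj_point b) v)) i = ?G (case_sum b v)"
      if b: "b \<in> A" "proj_point b \<in> ?W" and v: "v \<in> affine_space 2" for b v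
    proof -
      have bU: "b \<in> cU U0" "b \<in> cU U" "b \<in> cU V" using in'[OF b] by auto
      let ?x = "tr \<phi>0 b (v 0) (v 1)"
      have x: "chart_inv E \<phi>0 (proj_point b) v = ?x" by (simp only: tr_def affine2_vec[OF v])
      have xf: "?x \<in> fib b" by (rule tr_fib[OF U0 bU(1)])
      note xx = basis_at_cramer[OF U0 bU(1) D(9)[OF b(1)] D(10)[OF b(1)] dnz[OF b] xf]
      have v01: "\<phi>0 ?x 0 = v 0" "\<phi>0 ?x 1 = v 1" by (simp_all add: ch_tr[OF U0 bU(1)] vec2_def del: One_nat_def)
      have 1: "chart_det \<phi>0 ?x (t2 b) / chart_det \<phi>0 (t1 b) (t2 b) = ?c1 (case_sum b v)" "chart_det \<phi>0 (t1 b) ?x / chart_det \<phi>0 (t1 b) (t2 b) = ?c2 (case_sum b v)"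
        unfolding chart_det_def v01 by (simp_all del: One_nat_def)
      have "decompose ?x = (fscale E (?c1 (case_sum b v)) (t1 b), fscale E (?c2 (case_sum b v)) (t2 b))"
        by (subst xx, subst decompose_lc[OF L b(1)]) (simp only: 1)
      then show ?thesis unfolding x using i ch_scale[OF U bU(2) D(9)[OF b(1)]] ch_scale[OF V bU(3) D(10)[OF b(1)]] by auto
    qed
    ultimately show "\<exists>A G. zopen Y A \<and> a \<in> A \<and> regf (over 2 A ?W) G \<and> (\<forall>b v. b \<in> A \<longrightarrow> proj_point b \<in> ?W \<longrightarrow> v \<in> affine_space 2 \<longrightarrow>
      (case (proj_point b, v) of (x, v) \<Rightarrow> (\<lambda>(d, d') i. if i < 1 then (if i = 0 then \<phi> d j else 0) else (if i - 1 = 0 then \<psi> d' k else 0)) (decompose (chart_inv E \<phi>0 x v)) i) = G (case_sum b v))"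
      using D(1) aA by (intro exI[of _ A] exI[of _ ?G]) (simp only: prod.case, simp)
  qed
  note reg = this
  show "\<forall>(U, \<phi>)\<in>charts E. \<forall>(V, \<psi>)\<in>charts DS. \<forall>i<2.
     regular_on n 2 ((U \<inter> V) \<times> affine_space 2) (\<lambda>(x, v). \<psi> (decompose (chart_inv E \<phi> x v)) i)"
  proof (clarsimp simp del: One_nat_def)
    fix U0 \<phi>0 W \<chi> i assume U0: "(U0, \<phi>0) \<in> charts E" and W: "(W, \<chi>) \<in> charts DS" and i: "i < (2::nat)"
    from W show "regular_on n 2 ((U0 \<inter> W) \<times> affine_space 2) (\<lambda>(x, v). \<chi> (decompose (chart_inv E \<phi>0 x v)) i)"
      by (rule DS_chartE) (simp only:, rule reg[OF U0 _ _ _ _ i], assumption+)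
  qed
qed

definition add_summands :: "'e \<times> 'e \<Rightarrow> 'e" where "add_summands p = fadd E (fst p) (snd p)"

lemma hom_add_summands: "bundle_hom n 2 2 DS E add_summands"
  unfolding bundle_hom_def
proof (intro conjI)
  show "\<forall>x\<in>proj_space n. add_summands ` fibre DS x \<subseteq> fibre E x \<and>
        (\<forall>d\<in>fibre DS x. \<forall>e\<in>fibre DS x. add_summands (fadd DS d e) = fadd E (add_summands d) (add_summands e)) \<and>
        (\<forall>c. \<forall>e\<in>fibre DS x. add_summands (fscale DS c e) = fscale E c (add_summands e))"
  proof
    fix x :: "(nat \<Rightarrow> 'k) set" assume "x \<in> proj_space n"
    then obtain A t1 t2 b where L: "line_data e1 A t1 t2" "line_data e2 A t2 t1" "b \<in> A" and x: "x = proj_point b" using ex_line_data by blast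
    note B = LDb[OF L]
    have 1: "add_summands d \<in> fibre E x" if "d \<in> fibre DS x" for d
      using that fib_add[OF B(1)] unfolding x fibre_DS by (auto simp: add_summands_def fib_def)
    have 2: "add_summands (fadd DS d d') = fadd E (add_summands d) (add_summands d')" if "d \<in> fibre DS x" "d' \<in> fibre DS x" for d d'
      using that unfolding x fibre_DS_eq[OF L]
      by (auto simp: add_summands_def DS_ops fadd_fs[OF B(1)] B(2,3) lc_fadd[OF L] lc_add[OF B(1-3)] simp del: One_nat_def)
    have 3: "add_summands (fscale DS c d) = fscale E c (add_summands d)" if "d \<in> fibre DS x" for c d
      using that unfolding x fibre_DS_eq[OF L]
      by (auto simp: add_summands_def DS_ops fs_fs[OF B(1)] B(2,3) lc_fadd[OF L] fs_lc[OF B(1-3)] simp del: One_nat_def)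
    from 1 2 3 show "add_summands ` fibre DS x \<subseteq> fibre E x \<and>
        (\<forall>d\<in>fibre DS x. \<forall>e\<in>fibre DS x. add_summands (fadd DS d e) = fadd E (add_summands d) (add_summands e)) \<and>
        (\<forall>c. \<forall>e\<in>fibre DS x. add_summands (fscale DS c e) = fscale E c (add_summands e))" by auto
  qed
  let ?ch = "\<lambda>\<phi> j \<psi> k. (\<lambda>(d, d') i. if i < (1::nat) then (if i = 0 then \<phi> d j else 0) else (if i - 1 = 0 then \<psi> d' k else 0))"
  have "regular_on n 2 ((Uj e1 U \<phi> j \<inter> Uj e2 V \<psi> k \<inter> U0) \<times> affine_space 2)
     (\<lambda>(x, v). \<phi>0 (add_summands (chart_inv DS (?ch \<phi> j \<psi> k) x v)) i)"
    if U0: "(U0, \<phi>0) \<in> charts E" and U: "(U, \<phi>) \<in> charts E" and j: "j < 2" and V: "(V, \<psi>) \<in> charts E" and k: "k < 2" and i: "i < (2::nat)"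
    for U0 \<phi>0 U \<phi> j V \<psi> k i
  proof (rule regular_on_local)
    let ?W = "Uj e1 U \<phi> j \<inter> Uj e2 V \<psi> k \<inter> U0"
    show "zopen Y {a \<in> Y. proj_point a \<in> ?W}"
      using zopen_cU[OF U0] unfolding cU_def
      by (intro zopen_cUW zopen_Uj[OF cov1 U j] zopen_Uj[OF cov2 V k])
    show "?W \<subseteq> proj_space n" using chart_subset[OF U0] by blast
    fix a assume a: "a \<in> Y" "proj_point a \<in> ?W"
    obtain A t1 t2 where L: "line_data e1 A t1 t2" "line_data e2 A t2 t1" and aA: "a \<in> A" using split_frame_line_data[OF sf a(1)] by blast
    note D = line_data_D[OF L(1)]
    let ?p = "\<lambda>w::nat + nat \<Rightarrow> 'k. (\<lambda>i. w (Inl i))"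
    \<comment> \<open>A chart of the sum is inverted one summand at a time: the coordinate v 0
      determines the multiple of \<open>t1\<close> and v 1 that of \<open>t2\<close>. The sum of
      both is then read in the chart \<open>\<phi>0\<close>.\<close>
    let ?G = "\<lambda>w. w (Inr 0) / \<phi> (t1 (?p w)) j * \<phi>0 (t1 (?p w)) i + w (Inr 1) / \<psi> (t2 (?p w)) k * \<phi>0 (t2 (?p w)) i"
    have in': "b \<in> A \<inter> cU U0" "b \<in> A \<inter> cU U" "b \<in> A \<inter> cU V" "\<phi> (t1 b) j \<noteq> 0" "\<psi> (t2 b) k \<noteq> 0"
      if "b \<in> A" "proj_point b \<in> ?W" for b
      using that Uj_iff[OF cov1 L(1) U] Uj_iff[OF cov2 L(2) V] D(8) by (auto simp: cU_def)
    have r: "regf (over 2 A ?W) (\<lambda>w. \<phi>0 (t1 (?p w)) i)" "regf (over 2 A ?W) (\<lambda>w. \<phi>0 (t2 (?p w)) i)"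
      by (rule regf_over[OF sect_chart[OF D(2) U0 i]], use in' in blast) (rule regf_over[OF sect_chart[OF D(3) U0 i]], use in' in blast)
    have r': "regf (over 2 A ?W) (\<lambda>w. \<phi> (t1 (?p w)) j)" "regf (over 2 A ?W) (\<lambda>w. \<psi> (t2 (?p w)) k)"
      by (rule regf_over[OF sect_chart[OF D(2) U j]], use in' in blast) (rule regf_over[OF sect_chart[OF D(3) V k]], use in' in blast)
    have "regf (over 2 A ?W) ?G"
      by (intro regf_add regf_mult regf_divide regf_coord r r') (use in' in \<open>auto simp: over_def\<close>)
    moreover have "\<phi>0 (add_summands (chart_inv DS (?ch \<phi> j \<psi> k) (proj_point b) v)) i = ?G (case_sum b v)"
      if b: "b \<in> A" "proj_point b \<in> ?W" and v: "v \<in> affine_space 2" for b v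
    proof -
      have bU: "b \<in> cU U0" "b \<in> cU U" "b \<in> cU V" using in'[OF b] by auto
      note nz = in'(4,5)[OF b]
      note B = LDb[OF L b(1)]
      let ?q = "(fscale E (v 0 / \<phi> (t1 b) j) (t1 b), fscale E (v 1 / \<psi> (t2 b) k) (t2 b))"
      have sc: "\<phi> (fscale E c (t1 b)) j = c * \<phi> (t1 b) j" "\<psi> (fscale E c (t2 b)) k = c * \<psi> (t2 b) k" for c
        using ch_scale[OF U bU(2) B(2)] ch_scale[OF V bU(3) B(3)] by auto
      have "chart_inv DS (?ch \<phi> j \<psi> k) (proj_point b) v = ?q"
        unfolding chart_inv_def
      proof (rule inv_into_f_eq)
        show "inj_on (?ch \<phi> j \<psi> k) (fibre DS (proj_point b))"
        proof (rule inj_onI)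
          fix y z assume "y \<in> fibre DS (proj_point b)" "z \<in> fibre DS (proj_point b)" and eq: "?ch \<phi> j \<psi> k y = ?ch \<phi> j \<psi> k z"
          then obtain p q p' q' where yz: "y = (fscale E p (t1 b), fscale E q (t2 b))" "z = (fscale E p' (t1 b), fscale E q' (t2 b))"
            unfolding fibre_DS_eq[OF L b(1)] by blast
          from fun_cong[OF eq, of 0] fun_cong[OF eq, of 1] nz show "y = z" by (simp add: yz sc)
        qed
        show "?q \<in> fibre DS (proj_point b)" unfolding fibre_DS_eq[OF L b(1)] by blast
        have "?ch \<phi> j \<psi> k ?q = vec2 (v 0) (v 1)" using nz by (auto simp: sc vec2_def fun_eq_iff)
        then show "?ch \<phi> j \<psi> k ?q = v" using affine2_vec[OF v] by simp
      qed
      then show ?thesis by (simp add: add_summands_def lc_fadd[OF L b(1)] ch_lc[OF U0 bU(1) B(2,3)])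
    qed
    ultimately show "\<exists>A G. zopen Y A \<and> a \<in> A \<and> regf (over 2 A ?W) G \<and> (\<forall>b v. b \<in> A \<longrightarrow> proj_point b \<in> ?W \<longrightarrow> v \<in> affine_space 2 \<longrightarrow>
      (case (proj_point b, v) of (x, v) \<Rightarrow> \<phi>0 (add_summands (chart_inv DS (?ch \<phi> j \<psi> k) x v)) i) = G (case_sum b v))"
      using D(1) aA by (intro exI[of _ A] exI[of _ ?G]) (simp only: prod.case, simp)
  qed
  note reg = this
  show "\<forall>(U, \<phi>)\<in>charts DS. \<forall>(V, \<psi>)\<in>charts E. \<forall>i<2.
     regular_on n 2 ((U \<inter> V) \<times> affine_space 2) (\<lambda>(x, v). \<psi> (add_summands (chart_inv DS \<phi> x v)) i)"
  proof (clarsimp simp del: One_nat_def)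
    fix U0 \<phi>0 W \<chi> i assume U0: "(U0, \<phi>0) \<in> charts E" and W: "(W, \<chi>) \<in> charts DS" and i: "i < (2::nat)"
    from W show "regular_on n 2 ((W \<inter> U0) \<times> affine_space 2) (\<lambda>(x, v). \<phi>0 (add_summands (chart_inv DS \<chi> x v)) i)"
      by (rule DS_chartE) (simp only:, rule reg[OF U0 _ _ _ _ i], assumption+)
  qed
qed

lemma isomorphic_DS: "bundle_isomorphic n 2 E DS"
  unfolding bundle_isomorphic_def
proof (rule exI[of _ decompose], rule exI[of _ add_summands], intro conjI hom_decompose hom_add_summands ballI)
  fix x assume x: "x \<in> total_space E"
  then have "bproj E x \<in> proj_space n" using bproj_proj_space by blast
  then obtain A t1 t2 b where L: "line_data e1 A t1 t2" "line_data e2 A t2 t1" "b \<in> A" and p: "bproj E x = proj_point b" using ex_line_data by blast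
  have "x \<in> fib b" using x p by (simp add: fib_def fibre_def)
  then obtain p q where "x = lc p q (t1 b) (t2 b)" using fib_lcE[OF L] by blast
  then show "add_summands (decompose x) = x" by (simp add: decompose_lc[OF L] add_summands_def lc_fadd[OF L])
next
  fix y assume y: "y \<in> total_space DS"
  then have 1: "fst y \<in> total_space E" "bproj DS y = bproj E (fst y)"
    using subsetD[OF sub_total] by (auto simp: direct_sum_def line_sub_def)
  then have "bproj E (fst y) \<in> proj_space n" using bproj_proj_space by blast
  then obtain A t1 t2 b where L: "line_data e1 A t1 t2" "line_data e2 A t2 t1" "b \<in> A" and "bproj E (fst y) = proj_point b" using ex_line_data by blast
  with 1(2) have p: "bproj DS y = proj_point b" by simp
  have "y \<in> fibre DS (proj_point b)" using y p by (simp add: fibre_def)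
  then obtain p q where "y = (fscale E p (t1 b), fscale E q (t2 b))" unfolding fibre_DS_eq[OF L] by blast
  then show "decompose (add_summands y) = y" by (simp add: add_summands_def lc_fadd[OF L] decompose_lc[OF L])
qed

end

end

theorem mainTheorem1:
  fixes n :: nat
    and E :: "('e, 'k::alg_closed_field) vbundle"
    and \<sigma> :: "'k \<Rightarrow> 'e \<Rightarrow> 'e"
  assumes "n \<ge> 3"
    and "vector_bundle n 2 E"
    and "gm_linearisation n 2 E \<sigma>"
  shows "\<exists>(L1 :: ('e, 'k) vbundle) (L2 :: ('e, 'k) vbundle).
           line_bundle n L1 \<and> line_bundle n L2 \<and>
           bundle_isomorphic n 2 E (direct_sum 1 L1 L2)"
proof -
  interpret equivariant_bundle n E \<sigma> using assms by unfold_locales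
  obtain e1 e2 where sf: "split_frame e1 e2" using ex_split_frame by blast
  have "line_bundle n (line_sub e1)" by (rule line_bundle_line_sub[OF cov1[OF sf]])
  moreover have "line_bundle n (line_sub e2)" by (rule line_bundle_line_sub[OF cov2[OF sf]])
  ultimately show ?thesis using isomorphic_DS[OF sf] by blast
qed

end
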